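(* Let $R$ be a skew-invertible Hecke symmetry over $\mathbb{C}[[h]]$, $\overline R(x)$ the associated $R$-matrix with multiplicative spectral parameter and $\mathbf{Y}^+(\overline R)$ the associated algebra with unit $1$ (all defined in the context). For any $c\in\mathbb{C}$ there exists a unique formal power series $\overline L^-(x)$ in $\mathrm{End}\,\mathbb{C}^N\otimes\mathrm{Hom}(\mathbf{Y}^+(\overline R),\mathbf{Y}^+(\overline R)[x^{-1}]_h)$ satisfying $\overline L^-(x)1=I\otimes1$ and such that for all integers $n\geqslant1$ and variables $y=(y_1,\dots,y_n)$ \begin{align*} &\overline L^{-}_0(x)\,(RP)_{01}\cdots(RP)_{0n}\,\overline L_{[n]}^{+}(y)=\overline R_{10}(y_1e^{hc/a}/x)\cdots\overline R_{n0}(y_ne^{hc/a}/x)\\ &\qquad\times\overline L_{[n]}^{+}(y)\,(RP)_{10}\cdots(RP)_{n0}\,\overline R_{0n}(y_ne^{-hc/a}/x)^{-1}\cdots\overline R_{01}(y_1e^{-hc/a}/x)^{-1}. \end{align*} The series $\overline L^-(x)$ is invertible in $\mathrm{End}\,\mathbb{C}^N\otimes\mathrm{Hom}(\mathbf{Y}^+(\overline R),\mathbf{Y}^+(\overline R)[x^{-1}]_h)$ and it satisfies the following identities for operators on $\mathbf{Y}^+(\overline R)$: \begin{align*} \overline R_{12}(x/y)\,\overline L_1^-(x)\,(RP)_{12}\,\overline L_2^-(y)&=\overline L_2^-(y)\,(RP)_{21}\,\overline L_1^-(x)\,\overline R_{21}(x/y),\\ \overline L_1^-(x)\,(RP)_{12}\,\overline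 L_2^+(y)\,\overline R_{12}(ye^{-hc/a}/x)&=\overline R_{21}(ye^{hc/a}/x)\,\overline L_2^+(y)\,(RP)_{21}\,\overline L_1^-(x). \end{align*}
   Context: Hecke symmetries. $N\geqslant 2$ is an integer, $h$ a formal parameter, $P=\sum_{i,j}e_{ij}\otimes e_{ji}$ and $I$ (identity) on $\mathbb{C}^N\otimes\mathbb{C}^N$ ($I$ also denotes the identity matrix in $\mathrm{End}\,\mathbb{C}^N$). For $A\in(\mathrm{End}\,\mathbb{C}^N)^{\otimes 2}$ (with any coefficients), $A_{rs}$ denotes $A$ acting on tensor factors $r$ and $s$ (first leg in factor $r$, second leg in factor $s$); e.g. $A_{21}=PA_{12}P$. A Hecke symmetry is $R\in(\mathrm{End}\,\mathbb{C}^N)^{\otimes 2}[[h]]$ with $R_{12}R_{23}R_{12}=R_{23}R_{12}R_{23}$ and $(R-e^hI)(R+e^{-h}I)=0$; it is skew-invertible if there is $\Psi\in(\mathrm{End}\,\mathbb{C}^N)^{\otimes 2}[[h]]$ with $\mathrm{tr}_2R_{12}\Psi_{23}=P_{13}=\mathrm{tr}_2\Psi_{12}R_{23}$. Multiplicative $R$-matrix. Fix an integer $M>0$ and $0\ne a\in\mathbb{C}$. Let $\overline g(x)\in 1+x\mathbb{C}[[x,h]]$ be the unique series with $\prod_{k=0}^{M-1}\overline g(xe^{-2kh})=\frac{1-xe^{-2(M-1)h}}{1-x}$, let $\overline f(x)=\frac{1-x}{1-xe^{-2h}}\,\overline g(x)$, and $\overline R(x)=\overline f(x)\big(PR+\frac{(e^h-e^{-h})x}{1-x}P\big)\in(\mathrm{End}\,\mathbb{C}^N)^{\otimes2}[[x,h]]$;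 all expansions are in nonnegative powers of $x$, so $\overline R(x/y)$ is a series in nonnegative powers of $x/y$, etc. Modules. For a $\mathbb{C}[[h]]$-module $V$, $V[x^{-1}]_h$ is the set of $\sum_{r\leqslant0}a_rx^r$, $a_r\in V$, with $a_r\to0$ $h$-adically as $r\to-\infty$. Tensor products of $\mathbb{C}[[h]]$-modules are $h$-adically completed. Algebra. $\mathbf{Y}^+(\overline R)$ is the topologically free associative unital $\mathbb{C}[[h]]$-algebra generated by $\overline l_{ij}^{(-r)}$ ($1\leqslant i,j\leqslant N$, $r\geqslant1$) subject to $\overline R_{12}(x/y)\overline L_1^+(x)(RP)_{12}\overline L_2^+(y)=\overline L_2^+(y)(RP)_{21}\overline L_1^+(x)\overline R_{21}(x/y)$, where $\overline L^+(x)=\sum_{i,j}e_{ij}\otimes\overline l^+_{ij}(x)$, $\overline l^+_{ij}(x)=\delta_{ij}-\sum_{r\geqslant1}\overline l_{ij}^{(-r)}x^{r-1}$, and a subscript $k$ indicates that the matrix part sits in the $k$-th copy of $\mathrm{End}\,\mathbb{C}^N$. (Topologically free: the quotient of the $h$-adically completed free algebra by the smallest $h$-adically closed two-sided ideal $J$ containing the relations and such that $ha\in J$ implies $a\in J$.) Notation. $\overline L_{[n]}^+(y)=\prod_{i=1}^{n}\overline L_i^+(y_i)(RP)_{i\,i+1}\cdots(RP)_{i\,n}$, the factors for $i=1,\dots,n$ ordered from left to right. In the formula defining $\overline L^-$, copies of $\mathrm{End}\,\mathbb{C}^N$ are labelled $0,1,\dots,n$ and $\overline L^+_{[n]}(y)$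 (in copies $1,\dots,n$) is regarded as a series of elements of $\mathbf{Y}^+(\overline R)$; in the operator identities $\overline L^+$ acts by left multiplication. *)

theory Defs
  imports
    "HOL-Analysis.Analysis"
    "HOL-Algebra.QuotRing"
    "HOL-Algebra.Module"
    "HOL-Computational_Algebra.Formal_Power_Series"
    "HOL-Library.Poly_Mapping"
begin

section \<open>Matrices on several tensor legs with formal series entries\<close>

text \<open>
  The ring \<open>\<complex>[[h]]\<close> is \<^typ>\<open>complex fps\<close>, so that \<open>h\<close> is \<^const>\<open>fps_X\<close> and \<open>e\<^bsup>zh\<^esup>\<close> is
  \<open>fps_exp z\<close>; \<open>\<complex>[[x,h]] = \<complex>[[h]][[x]]\<close> is \<^typ>\<open>complex fps fps\<close>.  The index type \<open>'n\<close> has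
  \<open>N\<close> elements, and for \<open>A\<close> in \<open>(End \<complex>\<^sup>N)\<^bsup>\<otimes>2\<^esup>\<close> the entry \<open>A $ (i,k) $ (j,l)\<close> is the coefficient
  of \<open>e\<^sub>i\<^sub>j \<otimes> e\<^sub>k\<^sub>l\<close>.

  An element of \<open>(End \<complex>\<^sup>N)\<^bsup>\<otimes>S\<^esup> \<otimes> K\<close>, for a finite set \<open>S\<close> of tensor leg labels and a
  (noncommutative) \<open>\<complex>[[h]]\<close>-algebra \<open>K\<close>, with entries formal series in variables \<open>x\<^sub>0, x\<^sub>1, \<dots>\<close>,
  is a family \<open>A I J \<gamma>\<close>: row multi-index \<open>I\<close>, column multi-index \<open>J\<close>, and the exponents
  \<open>\<gamma> v\<close> of the \<open>x\<^sub>v\<close>.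
\<close>

type_synonym ('n, 'k) tmat = "(nat \<Rightarrow> 'n) \<Rightarrow> (nat \<Rightarrow> 'n) \<Rightarrow> (nat \<Rightarrow> int) \<Rightarrow> 'k"

definition idx :: "nat set \<Rightarrow> (nat \<Rightarrow> 'n) set" where
  "idx S = S \<rightarrow>\<^sub>E UNIV"

definition teq :: "nat set \<Rightarrow> ('n, 'k) tmat \<Rightarrow> ('n, 'k) tmat \<Rightarrow> bool" where
  "teq S A B \<longleftrightarrow> (\<forall>I\<in>idx S. \<forall>J\<in>idx S. \<forall>\<gamma>. A I J \<gamma> = B I J \<gamma>)"

text \<open>
  The sum runs over the nonzero contributions only.  It is finite for every product formed below:
  there the exponents of the factors are bounded from one side in such a way that each monomial
  arises in finitely many ways.  (\<^const>\<open>finsum\<close> over an infinite set would be \<open>0\<close>.)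
\<close>

definition tmult ::
  "(complex fps, 'k) module \<Rightarrow> nat set \<Rightarrow> ('n, 'k) tmat \<Rightarrow> ('n, 'k) tmat \<Rightarrow> ('n, 'k) tmat" where
  "tmult K S A B = (\<lambda>I J \<gamma>.
     finsum K (\<lambda>(T, \<alpha>). A I T \<alpha> \<otimes>\<^bsub>K\<^esub> B T J (\<lambda>v. \<gamma> v - \<alpha> v))
       {(T, \<alpha>). T \<in> idx S \<and> A I T \<alpha> \<noteq> \<zero>\<^bsub>K\<^esub> \<and> B T J (\<lambda>v. \<gamma> v - \<alpha> v) \<noteq> \<zero>\<^bsub>K\<^esub>})"

definition tone :: "(complex fps, 'k) module \<Rightarrow> ('n, 'k) tmat" where
  "tone K = (\<lambda>I J \<gamma>. if I = J \<and> \<gamma> = (\<lambda>_. 0) then \<one>\<^bsub>K\<^esub> else \<zero>\<^bsub>K\<^esub>)"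

definition tprod ::
  "(complex fps, 'k) module \<Rightarrow> nat set \<Rightarrow> ('n, 'k) tmat list \<Rightarrow> ('n, 'k) tmat" where
  "tprod K S As = foldr (tmult K S) As (tone K)"

definition ptrace :: "(complex fps, 'k) module \<Rightarrow> nat \<Rightarrow> ('n::finite, 'k) tmat \<Rightarrow> ('n, 'k) tmat" where
  "ptrace K t A = (\<lambda>I J \<gamma>. finsum K (\<lambda>m. A (I(t := m)) (J(t := m)) \<gamma>) UNIV)"

definition leg1 ::
  "(complex fps, 'k) module \<Rightarrow> nat set \<Rightarrow> nat \<Rightarrow> ('n \<Rightarrow> 'n \<Rightarrow> (nat \<Rightarrow> int) \<Rightarrow> 'k) \<Rightarrow> ('n, 'k) tmat"
where
  "leg1 K S r A = (\<lambda>I J \<gamma>.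
     if \<forall>t\<in>S - {r}. I t = J t then A (I r) (J r) \<gamma> else \<zero>\<^bsub>K\<^esub>)"

definition leg2 ::
  "(complex fps, 'k) module \<Rightarrow> nat set \<Rightarrow> nat \<Rightarrow> nat \<Rightarrow>
     ('n \<times> 'n \<Rightarrow> 'n \<times> 'n \<Rightarrow> (nat \<Rightarrow> int) \<Rightarrow> 'k) \<Rightarrow> ('n, 'k) tmat" where
  "leg2 K S r s A = (\<lambda>I J \<gamma>.
     if \<forall>t\<in>S - {r, s}. I t = J t then A (I r, I s) (J r, J s) \<gamma> else \<zero>\<^bsub>K\<^esub>)"

text \<open>\<open>A\<^sub>r\<^sub>s\<close> for a matrix \<open>A\<close> over \<open>\<complex>[[h]]\<close>.\<close>

definition cleg ::
  "(complex fps, 'k) module \<Rightarrow> nat set \<Rightarrow> nat \<Rightarrow> nat \<Rightarrow>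
     complex fps ^ ('n::finite \<times> 'n) ^ ('n \<times> 'n) \<Rightarrow> ('n, 'k) tmat" where
  "cleg K S r s A = leg2 K S r s (\<lambda>p q \<gamma>.
     if \<gamma> = (\<lambda>_. 0) then (A $ p $ q) \<odot>\<^bsub>K\<^esub> \<one>\<^bsub>K\<^esub> else \<zero>\<^bsub>K\<^esub>)"

text \<open>\<open>A\<^sub>r\<^sub>s(b x\<^sub>u / x\<^sub>v)\<close> for a matrix \<open>A(x)\<close> over \<open>\<complex>[[x,h]]\<close>, \<open>b \<in> \<complex>[[h]]\<close> and \<open>u \<noteq> v\<close>.\<close>

definition sleg ::
  "(complex fps, 'k) module \<Rightarrow> nat set \<Rightarrow> nat \<Rightarrow> nat \<Rightarrow>
     complex fps fps ^ ('n::finite \<times> 'n) ^ ('n \<times> 'n) \<Rightarrow> complex fps \<Rightarrow> nat \<Rightarrow> nat \<Rightarrow> ('n, 'k) tmat"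
where
  "sleg K S r s A b u v = leg2 K S r s (\<lambda>p q \<gamma>.
     if \<gamma> u \<ge> 0 \<and> \<gamma> = (\<lambda>_. 0)(u := \<gamma> u, v := - \<gamma> u)
     then (b ^ nat (\<gamma> u) * fps_nth (A $ p $ q) (nat (\<gamma> u))) \<odot>\<^bsub>K\<^esub> \<one>\<^bsub>K\<^esub> else \<zero>\<^bsub>K\<^esub>)"

section \<open>Hecke symmetries\<close>

definition ch_alg :: "(complex fps, complex fps) module" where
  "ch_alg = \<lparr>carrier = UNIV, mult = (*), one = 1, zero = 0, add = (+), smult = (*)\<rparr>"

definition Pmat :: "complex fps ^ ('n::finite \<times> 'n) ^ ('n \<times> 'n)" where
  "Pmat = (\<chi> p q. if fst p = snd q \<and> snd p = fst q then 1 else 0)"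

definition hecke_symmetry :: "complex fps ^ ('n::finite \<times> 'n) ^ ('n \<times> 'n) \<Rightarrow> bool" where
  "hecke_symmetry R \<longleftrightarrow>
     (let S = {1, 2, 3}; R12 = cleg ch_alg S 1 2 R; R23 = cleg ch_alg S 2 3 R in
       teq S (tprod ch_alg S [R12, R23, R12]) (tprod ch_alg S [R23, R12, R23])) \<and>
     (R - mat (fps_exp 1)) ** (R + mat (fps_exp (- 1))) = 0"

definition skew_invertible :: "complex fps ^ ('n::finite \<times> 'n) ^ ('n \<times> 'n) \<Rightarrow> bool" where
  "skew_invertible R \<longleftrightarrow> (\<exists>\<Psi> :: complex fps ^ ('n \<times> 'n) ^ ('n \<times> 'n).
     let S = {1, 2, 3}; P13 = cleg ch_alg {1, 3} 1 3 Pmat in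
       teq {1, 3} (ptrace ch_alg 2 (tprod ch_alg S [cleg ch_alg S 1 2 R, cleg ch_alg S 2 3 \<Psi>])) P13 \<and>
       teq {1, 3} (ptrace ch_alg 2 (tprod ch_alg S [cleg ch_alg S 1 2 \<Psi>, cleg ch_alg S 2 3 R])) P13)"

section \<open>The multiplicative R-matrix\<close>

definition gbar :: "nat \<Rightarrow> complex fps fps" where
  "gbar M = (THE g. fps_nth g 0 = 1 \<and>
     (\<Prod>k<M. g oo (fps_const (fps_exp (- 2 * of_nat k)) * fps_X)) =
     (1 - fps_const (fps_exp (- 2 * (of_nat M - 1))) * fps_X) / (1 - fps_X))"

definition fbar :: "nat \<Rightarrow> complex fps fps" where
  "fbar M = (1 - fps_X) / (1 - fps_const (fps_exp (- 2)) * fps_X) * gbar M"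

definition Rbar ::
  "nat \<Rightarrow> complex fps ^ ('n::finite \<times> 'n) ^ ('n \<times> 'n) \<Rightarrow> complex fps fps ^ ('n \<times> 'n) ^ ('n \<times> 'n)"
where
  "Rbar M R = (\<chi> p q. fbar M *
     (fps_const ((Pmat ** R) $ p $ q) +
      fps_const (fps_exp 1 - fps_exp (- 1)) * fps_X / (1 - fps_X) * fps_const (Pmat $ p $ q)))"

section \<open>The algebra \<open>Y\<^sup>+\<close>\<close>

text \<open>The free monoid, written additively as \<^type>\<open>poly_mapping\<close> requires.\<close>

datatype 'a fmon = FMon "'a list"

instantiation fmon :: (type) monoid_add
begin

definition zero_fmon :: "'a fmon" where "zero_fmon = FMon []"

fun plus_fmon :: "'a fmon \<Rightarrow> 'a fmon \<Rightarrow> 'a fmon" where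
  "plus_fmon (FMon u) (FMon w) = FMon (u @ w)"

instance
proof
  fix a b c :: "'a fmon"
  show "a + b + c = a + (b + c)" by (cases a; cases b; cases c) simp
  show "0 + a = a" by (cases a) (simp add: zero_fmon_def)
  show "a + 0 = a" by (cases a) (simp add: zero_fmon_def)
qed

end

text \<open>\<open>(i, j, r)\<close> stands for the generator \<open>l\<^sub>i\<^sub>j\<^bsup>(-(r+1))\<^esup>\<close>, which goes with \<open>x\<^sup>r\<close>.\<close>

type_synonym 'n gen = "'n \<times> 'n \<times> nat"

text \<open>
  The \<open>h\<close>-adically completed free \<open>\<complex>[[h]]\<close>-algebra consists of the power series in \<open>h\<close> over the
  free \<open>\<complex>\<close>-algebra.  The library topology on \<^type>\<open>fps\<close> is the \<open>h\<close>-adic one.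
\<close>

type_synonym 'n falg = "('n gen fmon \<Rightarrow>\<^sub>0 complex) fps"

definition falg_const :: "complex fps \<Rightarrow> 'n falg" where
  "falg_const s = Abs_fps (\<lambda>m. Poly_Mapping.single 0 (fps_nth s m))"

definition falg_gen :: "'n gen \<Rightarrow> 'n falg" where
  "falg_gen g = fps_const (Poly_Mapping.single (FMon [g]) 1)"

definition free_alg :: "(complex fps, 'n falg) module" where
  "free_alg = \<lparr>carrier = UNIV, mult = (*), one = 1, zero = 0, add = (+),
     smult = (\<lambda>s a. falg_const s * a)\<rparr>"

text \<open>The coefficient of \<open>x\<^sup>r\<close> in \<open>l\<^sup>+\<^sub>i\<^sub>j(x)\<close>.\<close>

definition lplus :: "'n \<Rightarrow> 'n \<Rightarrow> nat \<Rightarrow> 'n falg" where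
  "lplus i j r = (if i = j \<and> r = 0 then 1 else 0) - falg_gen (i, j, r)"

text \<open>\<open>L\<^sup>+\<^sub>k(x\<^sub>k)\<close>, its coefficients being mapped to \<open>K\<close> by \<open>\<rho>\<close>.\<close>

definition Lp ::
  "(complex fps, 'k) module \<Rightarrow> ('n falg \<Rightarrow> 'k) \<Rightarrow> nat set \<Rightarrow> nat \<Rightarrow> ('n, 'k) tmat" where
  "Lp K \<rho> S k = leg1 K S k (\<lambda>i j \<gamma>.
     if \<gamma> k \<ge> 0 \<and> \<gamma> = (\<lambda>_. 0)(k := \<gamma> k) then \<rho> (lplus i j (nat (\<gamma> k))) else \<zero>\<^bsub>K\<^esub>)"

definition Y_relations ::
  "nat \<Rightarrow> complex fps ^ ('n::finite \<times> 'n) ^ ('n \<times> 'n) \<Rightarrow> 'n falg set" where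
  "Y_relations M R =
    (let S = {1, 2}; K = free_alg; L = Lp K (\<lambda>a. a) S;
         lhs = tprod K S [sleg K S 1 2 (Rbar M R) 1 1 2, L 1, cleg K S 1 2 (R ** Pmat), L 2];
         rhs = tprod K S [L 2, cleg K S 2 1 (R ** Pmat), L 1, sleg K S 2 1 (Rbar M R) 1 1 2]
     in {lhs I J \<gamma> - rhs I J \<gamma> | I J \<gamma>. I \<in> idx S \<and> J \<in> idx S})"

definition Y_ideal :: "nat \<Rightarrow> complex fps ^ ('n::finite \<times> 'n) ^ ('n \<times> 'n) \<Rightarrow> 'n falg set" where
  "Y_ideal M R = \<Inter>{I. ideal I free_alg \<and> Y_relations M R \<subseteq> I \<and> closed I \<and>
     (\<forall>a. fps_X * a \<in> I \<longrightarrow> a \<in> I)}"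

definition Y_class ::
  "nat \<Rightarrow> complex fps ^ ('n::finite \<times> 'n) ^ ('n \<times> 'n) \<Rightarrow> 'n falg \<Rightarrow> 'n falg set" where
  "Y_class M R a = Y_ideal M R +>\<^bsub>free_alg\<^esub> a"

definition Yplus ::
  "nat \<Rightarrow> complex fps ^ ('n::finite \<times> 'n) ^ ('n \<times> 'n) \<Rightarrow> (complex fps, 'n falg set) module" where
  "Yplus M R = (let Q = free_alg Quot Y_ideal M R in
     \<lparr>carrier = carrier Q, mult = mult Q, one = one Q, zero = zero Q, add = add Q,
      smult = (\<lambda>s v. Y_class M R (falg_const s) \<otimes>\<^bsub>Q\<^esub> v)\<rparr>)"

section \<open>Operators\<close>

text \<open>
  Homomorphisms of \<open>\<complex>[[h]]\<close>-modules.  They are taken to be undefined outside the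
  carrier, so that equality of homomorphisms is equality of functions.
\<close>

definition Hom :: "(complex fps, 'a) module \<Rightarrow> (complex fps, 'b) module \<Rightarrow> ('a \<Rightarrow> 'b) set" where
  "Hom V W = {f \<in> carrier V \<rightarrow>\<^sub>E carrier W.
     (\<forall>v\<in>carrier V. \<forall>w\<in>carrier V. f (v \<oplus>\<^bsub>V\<^esub> w) = f v \<oplus>\<^bsub>W\<^esub> f w) \<and>
     (\<forall>s. \<forall>v\<in>carrier V. f (s \<odot>\<^bsub>V\<^esub> v) = s \<odot>\<^bsub>W\<^esub> f v)}"

definition End_alg :: "(complex fps, 'a) module \<Rightarrow> (complex fps, 'a \<Rightarrow> 'a) module" where
  "End_alg V = \<lparr>carrier = Hom V V,
     mult = (\<lambda>f g. \<lambda>v\<in>carrier V. f (g v)),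
     one = (\<lambda>v\<in>carrier V. v),
     zero = (\<lambda>v\<in>carrier V. \<zero>\<^bsub>V\<^esub>),
     add = (\<lambda>f g. \<lambda>v\<in>carrier V. f v \<oplus>\<^bsub>V\<^esub> g v),
     smult = (\<lambda>s f. \<lambda>v\<in>carrier V. s \<odot>\<^bsub>V\<^esub> f v)\<rparr>"

text \<open>
  The module \<open>V[x\<^bsup>-1\<^esup>]\<^sub>h\<close>, where \<open>u r\<close> is the coefficient of \<open>x\<^bsup>-r\<^esup>\<close>.  Only its module structure
  is used, so the ring multiplication of the record is left undefined.
\<close>

definition xinv_h :: "(complex fps, 'a) module \<Rightarrow> (complex fps, nat \<Rightarrow> 'a) module" where
  "xinv_h V = \<lparr>carrier = {u. (\<forall>r. u r \<in> carrier V) \<and>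
       (\<forall>k. \<exists>r0. \<forall>r\<ge>r0. \<exists>w\<in>carrier V. u r = (fps_X ^ k) \<odot>\<^bsub>V\<^esub> w)},
     mult = undefined, one = undefined,
     zero = (\<lambda>_. \<zero>\<^bsub>V\<^esub>),
     add = (\<lambda>u w r. u r \<oplus>\<^bsub>V\<^esub> w r),
     smult = (\<lambda>s u r. s \<odot>\<^bsub>V\<^esub> u r)\<rparr>"

abbreviation YEnd ::
  "nat \<Rightarrow> complex fps ^ ('n::finite \<times> 'n) ^ ('n \<times> 'n) \<Rightarrow>
     (complex fps, 'n falg set \<Rightarrow> 'n falg set) module" where
  "YEnd M R \<equiv> End_alg (Yplus M R)"

text \<open>\<open>L\<^sup>+\<^sub>k(x\<^sub>k)\<close> acting by left multiplication.\<close>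

definition LpY ::
  "nat \<Rightarrow> complex fps ^ ('n::finite \<times> 'n) ^ ('n \<times> 'n) \<Rightarrow> nat set \<Rightarrow> nat \<Rightarrow>
     ('n, 'n falg set \<Rightarrow> 'n falg set) tmat" where
  "LpY M R = Lp (YEnd M R) (\<lambda>a. \<lambda>v\<in>carrier (Yplus M R). Y_class M R a \<otimes>\<^bsub>Yplus M R\<^esub> v)"

text \<open>A matrix over \<open>Hom(Y\<^sup>+, Y\<^sup>+[x\<^bsup>-1\<^esup>]\<^sub>h)\<close>.\<close>

type_synonym 'n Lop = "'n \<Rightarrow> 'n \<Rightarrow> 'n falg set \<Rightarrow> nat \<Rightarrow> 'n falg set"

definition Lops :: "nat \<Rightarrow> complex fps ^ ('n::finite \<times> 'n) ^ ('n \<times> 'n) \<Rightarrow> 'n Lop set" where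
  "Lops M R = {L. \<forall>i j. L i j \<in> Hom (Yplus M R) (xinv_h (Yplus M R))}"

text \<open>\<open>L\<^sub>k(x\<^sub>k)\<close> for such a matrix \<open>L\<close>.\<close>

definition LmY ::
  "nat \<Rightarrow> complex fps ^ ('n::finite \<times> 'n) ^ ('n \<times> 'n) \<Rightarrow> 'n Lop \<Rightarrow> nat set \<Rightarrow> nat \<Rightarrow>
     ('n, 'n falg set \<Rightarrow> 'n falg set) tmat" where
  "LmY M R L S k = leg1 (YEnd M R) S k (\<lambda>i j \<gamma>.
     if \<gamma> k \<le> 0 \<and> \<gamma> = (\<lambda>_. 0)(k := \<gamma> k)
     then (\<lambda>v\<in>carrier (Yplus M R). L i j v (nat (- \<gamma> k))) else \<zero>\<^bsub>YEnd M R\<^esub>)"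

definition Lop_invertible ::
  "nat \<Rightarrow> complex fps ^ ('n::finite \<times> 'n) ^ ('n \<times> 'n) \<Rightarrow> 'n Lop \<Rightarrow> bool" where
  "Lop_invertible M R L \<longleftrightarrow> (\<exists>L'\<in>Lops M R.
     teq {0} (tprod (YEnd M R) {0} [LmY M R L {0} 0, LmY M R L' {0} 0]) (tone (YEnd M R)) \<and>
     teq {0} (tprod (YEnd M R) {0} [LmY M R L' {0} 0, LmY M R L {0} 0]) (tone (YEnd M R)))"

text \<open>The list of factors of \<open>L\<^sup>+\<^bsub>[n]\<^esub>(x\<^sub>1, \<dots>, x\<^sub>n)\<close>.\<close>

definition Lp_bracket ::
  "nat \<Rightarrow> complex fps ^ ('n::finite \<times> 'n) ^ ('n \<times> 'n) \<Rightarrow> nat set \<Rightarrow> nat \<Rightarrow>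
     ('n, 'n falg set \<Rightarrow> 'n falg set) tmat list" where
  "Lp_bracket M R S n = concat (map (\<lambda>i. LpY M R S i #
     map (\<lambda>j. cleg (YEnd M R) S i j (R ** Pmat)) [Suc i..<Suc n]) [1..<Suc n])"

text \<open>
  The defining identity of \<open>L\<^sup>-(x)\<close>, with \<open>x = x\<^sub>0\<close>, \<open>y\<^sub>i = x\<^sub>i\<close> and \<open>\<kappa> = c/a\<close>.  Both sides are
  series of elements of \<open>Y\<^sup>+\<close>; they are obtained by letting elements act by left multiplication
  and applying the resulting operators to \<open>1\<close>.
\<close>

definition Lminus_identity ::
  "nat \<Rightarrow> complex fps ^ ('n::finite \<times> 'n) ^ ('n \<times> 'n) \<Rightarrow> complex \<Rightarrow> 'n Lop \<Rightarrow> nat \<Rightarrow> bool" where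
  "Lminus_identity M R \<kappa> L n \<longleftrightarrow>
    (let S = {0..n}; K = YEnd M R; ns = [1..<Suc n];
         RP = (\<lambda>r s. cleg K S r s (R ** Pmat));
         lhs = tprod K S
           ([LmY M R L S 0] @ map (\<lambda>i. RP 0 i) ns @ Lp_bracket M R S n);
         rhs = tprod K S
           (map (\<lambda>i. sleg K S i 0 (Rbar M R) (fps_exp \<kappa>) i 0) ns @ Lp_bracket M R S n @
            map (\<lambda>i. RP i 0) ns @
            map (\<lambda>i. sleg K S 0 i (matrix_inv (Rbar M R)) (fps_exp (- \<kappa>)) i 0) (rev ns))
     in \<forall>I\<in>idx S. \<forall>J\<in>idx S. \<forall>\<gamma>. lhs I J \<gamma> \<one>\<^bsub>Yplus M R\<^esub> = rhs I J \<gamma> \<one>\<^bsub>Yplus M R\<^esub>)"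

definition is_Lminus ::
  "nat \<Rightarrow> complex fps ^ ('n::finite \<times> 'n) ^ ('n \<times> 'n) \<Rightarrow> complex \<Rightarrow> 'n Lop \<Rightarrow> bool" where
  "is_Lminus M R \<kappa> L \<longleftrightarrow> L \<in> Lops M R \<and>
     (\<forall>i j r. L i j \<one>\<^bsub>Yplus M R\<^esub> r = (if i = j \<and> r = 0 then \<one>\<^bsub>Yplus M R\<^esub> else \<zero>\<^bsub>Yplus M R\<^esub>)) \<and>
     (\<forall>n\<ge>1. Lminus_identity M R \<kappa> L n)"

end

theory Submission
  imports Defs "HOL-Library.Function_Algebras"
begin

text \<open>
  Everything takes place on the completed free algebra \<open>F\<close>.  Removing the factor \<open>(RP)\<^sub>0\<^sub>1\<close> by skew
  invertibility turns the exchange relation of \<open>L\<^sup>-\<close> with \<open>L\<^sup>+\<close> into a recursion which defines a matrix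
  \<open>T(x)\<close> of operators on \<open>F\<close> with \<open>T(x) 1 = I\<close>.  That relation, moved through the bracket with the
  Yang--Baxter equation, is the defining identity of \<open>L\<^sup>-\<close>.  The quadratic relation for \<open>T\<close> follows by
  induction on words, since both of its sides obey the same exchange relation with \<open>L\<^sup>+\<close> and agree
  on \<open>1\<close>.  Modulo \<open>h\<close> the matrix \<open>T\<close> is the identity, so it has an inverse given by an \<open>h\<close>-adically
  convergent geometric series.

  The relations of \<open>Y\<^sup>+\<close> enter only once: by the Yang--Baxter equation \<open>T\<close> carries them to
  combinations of themselves, hence preserves the ideal and descends to \<open>Y\<^sup>+\<close>.  For uniqueness, two
  solutions are lifted to \<open>F\<close>; stripping all factors \<open>RP\<close> from the identity shows that their
  difference sends every product of entries of \<open>L\<^sup>+\<close> into the ideal.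
\<close>

text \<open>Two obstacles shape the proof. In the quotient the entries of L^+ satisfy relations, so
  a recursion on their products might be inconsistent there; on the free algebra words form a
  topological basis and any recursion on them is allowed. Moreover the identities mix powers of y
  with powers of 1/x. For each of them there are monomials, such as 1/x and x/y, in which all
  exponents are natural numbers; a matrix of series is then an operator on coefficient families, and
  every infinite sum becomes finite coefficientwise. T is the identity modulo h for the following
  reason. There the shifts e^{hc/a} and e^{-hc/a} become 1 and e^h - e^{-h} becomes 0, so R-bar_21
  reduces to a scalar series s times (RP)_12, and R-bar_12 to s times (RP)_21. With T = 1 the right
  side of the exchange relation is then s (RP)_12 L (RP)_21 (RP)_21^{-1} s^{-1}, which is the left
  side. The condition that ha in J implies a in J makes (1 - T)/h preserve the ideal; so the inverse
  of T descends to the quotient as well.\<close>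

section \<open>Additive endomorphisms of an abelian group as a ring\<close>

typedef (overloaded) ('a::ab_group_add) addop = "{f::'a \<Rightarrow> 'a. \<forall>x y. f (x + y) = f x + f y}"
  morphisms app Addop
  by (rule exI[of _ id]) simp

setup_lifting type_definition_addop

text \<open>Operators get a type of their own so that operator identities are computations in a
  noncommutative ring. The same type serves the free algebra, series over it and tensor-indexed
  vectors of series.\<close>

instantiation addop :: (ab_group_add) ring
begin
lift_definition zero_addop :: "'a addop" is "\<lambda>x. 0" by simp
lift_definition plus_addop :: "'a addop \<Rightarrow> 'a addop \<Rightarrow> 'a addop" is "\<lambda>f g x. f x + g x"
  by (simp add: algebra_simps)
lift_definition uminus_addop :: "'a addop \<Rightarrow> 'a addop" is "\<lambda>f x. - f x" by simp
lift_definition minus_addop :: "'a addop \<Rightarrow> 'a addop \<Rightarrow> 'a addop" is "\<lambda>f g x. f x - g x"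
  by simp
lift_definition times_addop :: "'a addop \<Rightarrow> 'a addop \<Rightarrow> 'a addop" is "\<lambda>f g x. f (g x)" by simp
instance
  by standard (transfer; auto simp: algebra_simps fun_eq_iff)+
end

text \<open>The class \<open>ring_1\<close> contains 0 \<noteq> 1, which fails for the trivial
  group; hence the sort \<open>{ring,monoid_mult}\<close> below.\<close>

instantiation addop :: (ab_group_add) monoid_mult
begin
lift_definition one_addop :: "'a addop" is "\<lambda>x. x" by simp
instance
  by standard (transfer; simp)+
end

lemma app_add: "app f (x + y) = app f x + app f y"
  by transfer simp

lemma app_0 [simp]: "app f 0 = 0"
  using app_add[of f 0 0] by simp

lemma app_minus: "app f (- x) = - app f x"
  using app_add[of f x "- x"] by (simp add: eq_neg_iff_add_eq_0 add.commute)

lemma app_diff: "app f (x - y) = app f x - app f y"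
  using app_add[of f x "- y"] app_minus[of f y] by simp

lemma app_sum: "app f (sum g A) = (\<Sum>x\<in>A. app f (g x))"
  by (induction A rule: infinite_finite_induct) (simp_all add: app_add)

lemma app_simps [simp]:
  "app (f + g) x = app f x + app g x" "app (f - g) x = app f x - app g x"
  "app (- f) x = - app f x" "app (f * g) x = app f (app g x)" "app 1 x = x" "app 0 x = 0"
  by (transfer; simp)+

lemma app_sum_left: "app (sum f A) x = (\<Sum>i\<in>A. app (f i) x)"
  by (induction A rule: infinite_finite_induct) simp_all

lemma addop_eqI: "(\<And>x. app f x = app g x) \<Longrightarrow> f = g"
  by transfer (simp add: fun_eq_iff)

lemma app_Addop: "(\<And>x y. f (x + y) = f x + f y) \<Longrightarrow> app (Addop f) = f"
  by (simp add: Addop_inverse)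

lemma sum_fun_apply: "(sum f A) x = (\<Sum>i\<in>A. f i x)"
  by (induction A rule: infinite_finite_induct) simp_all

section \<open>The completed free algebra\<close>

lemma single_zero_commute:
  fixes p :: "'a::monoid_add \<Rightarrow>\<^sub>0 'b::comm_semiring_1"
  shows "Poly_Mapping.single 0 c * p = p * Poly_Mapping.single 0 c"
proof (rule poly_mapping_eqI)
  fix k :: 'a
  have "Sum_any (\<lambda>aa. c when aa = 0 \<and> k = a + aa) = (c when k = a)" for a
  proof -
    have "(\<lambda>aa. c when aa = 0 \<and> k = a + aa) = (\<lambda>aa. (c when k = a) when aa = 0)"
      by (auto simp: fun_eq_iff when_def)
    then show ?thesis by (simp only: Sum_any_when_equal)
  qed
  then show "poly_mapping.lookup (Poly_Mapping.single 0 c * p) k = poly_mapping.lookup (p * Poly_Mapping.single 0 c) k"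
    by (simp add: lookup_mult lookup_single when_mult mult_when when_when
        Sum_any_when_dependent_prod_left mult.commute
        flip: Sum_any_right_distrib Sum_any_left_distrib)
qed

lemma fps_nth_falg_const [simp]: "fps_nth (falg_const s) n = Poly_Mapping.single 0 (fps_nth s n)"
  by (simp add: falg_const_def)

lemma falg_const_fps_const: "falg_const (fps_const c) = fps_const (Poly_Mapping.single 0 c)"
  by (simp add: fps_eq_iff)

lemma falg_const_0 [simp]: "falg_const 0 = 0"
  by (simp add: fps_eq_iff)

lemma falg_const_1 [simp]: "falg_const 1 = 1"
  by (simp add: fps_eq_iff)

lemma falg_const_X [simp]: "falg_const fps_X = fps_X"
  by (simp add: fps_eq_iff fps_X_def)

lemma falg_const_add: "falg_const (s + t) = falg_const s + falg_const t"
  by (simp add: fps_eq_iff single_add)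

lemma falg_const_minus: "falg_const (- s) = - falg_const s"
  by (simp add: fps_eq_iff single_uminus)

lemma falg_const_sum: "falg_const (sum f A) = (\<Sum>x\<in>A. falg_const (f x))"
  by (induction A rule: infinite_finite_induct) (simp_all add: falg_const_add)

lemma single_sum: "Poly_Mapping.single k (sum f A) = (\<Sum>x\<in>A. Poly_Mapping.single k (f x))"
  by (induction A rule: infinite_finite_induct) (simp_all add: single_add)

lemma falg_const_mult: "falg_const (s * t) = falg_const s * falg_const t"
  by (simp add: fps_eq_iff fps_mult_nth single_sum mult_single)

text \<open>It makes left multiplication by any element linear over \<complex>[[h]]
  (\<open>linop_lmul\<close>), although the algebra is not commutative.\<close>

lemma falg_const_commute: "falg_const s * a = a * falg_const s"
proof (rule fps_ext)
  fix n
  have "fps_nth (falg_const s * a) n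
      = (\<Sum>i=0..n. Poly_Mapping.single 0 (fps_nth s i) * fps_nth a (n - i))"
    by (simp add: fps_mult_nth)
  also have "\<dots> = (\<Sum>i=0..n. fps_nth a (n - i) * Poly_Mapping.single 0 (fps_nth s i))"
    by (simp add: single_zero_commute)
  also have "\<dots> = (\<Sum>i=0..n. fps_nth a i * Poly_Mapping.single 0 (fps_nth s (n - i)))"
    by (rule sum.reindex_bij_witness[of _ "\<lambda>i. n - i" "\<lambda>i. n - i"]) auto
  also have "\<dots> = fps_nth (a * falg_const s) n"
    by (simp add: fps_mult_nth)
  finally show "fps_nth (falg_const s * a) n = fps_nth (a * falg_const s) n" .
qed

lemma inj_falg_const: "falg_const s = falg_const t \<Longrightarrow> s = t"
  by (simp add: fps_eq_iff)
     (metis inj_single injD)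

section \<open>Closed submodules\<close>

definition submod :: "'n falg set \<Rightarrow> bool" where
  "submod U \<longleftrightarrow> 0 \<in> U \<and> (\<forall>a\<in>U. \<forall>b\<in>U. a + b \<in> U) \<and> (\<forall>s. \<forall>a\<in>U. falg_const s * a \<in> U)"

text \<open>An h-adically closed submodule: the second condition says that b is congruent to an
  element of U modulo every power of h. This form passes through linear maps without any topology;
  \<open>closed_iff_csub\<close> compares it with \<open>closed\<close>.\<close>

definition csub :: "'n falg set \<Rightarrow> bool" where
  "csub U \<longleftrightarrow> submod U \<and> (\<forall>b. (\<forall>m. \<exists>c. b - fps_X ^ m * c \<in> U) \<longrightarrow> b \<in> U)"

lemma submodD:
  assumes "submod U"
  shows "0 \<in> U" "a \<in> U \<Longrightarrow> b \<in> U \<Longrightarrow> a + b \<in> U" "a \<in> U \<Longrightarrow> falg_const s * a \<in> U"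
  using assms by (auto simp: submod_def)

lemma submod_uminus: "submod U \<Longrightarrow> a \<in> U \<Longrightarrow> - a \<in> U"
  using submodD(3)[of U a "-1"] by (simp add: falg_const_minus)

lemma submod_diff: "submod U \<Longrightarrow> a \<in> U \<Longrightarrow> b \<in> U \<Longrightarrow> a - b \<in> U"
  using submodD(2)[of U a "- b"] submod_uminus by force

lemma submod_sum: "submod U \<Longrightarrow> (\<And>i. i \<in> A \<Longrightarrow> f i \<in> U) \<Longrightarrow> sum f A \<in> U"
  by (induction A rule: infinite_finite_induct) (auto intro: submodD)

lemma csub_submod: "csub U \<Longrightarrow> submod U"
  by (simp add: csub_def)

lemma csub_lim: "csub U \<Longrightarrow> (\<And>m. \<exists>c. b - fps_X ^ m * c \<in> U) \<Longrightarrow> b \<in> U"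
  by (auto simp: csub_def)

lemma fps_truncate:
  fixes b :: "'a::ring_1 fps"
  shows "\<exists>c. b - fps_X ^ m * c = (\<Sum>k<m. fps_X ^ k * fps_const (fps_nth b k))"
proof (intro exI)
  show "b - fps_X ^ m * Abs_fps (\<lambda>n. fps_nth b (n + m)) = (\<Sum>k<m. fps_X ^ k * fps_const (fps_nth b k))"
    by (auto simp: fps_eq_iff fps_sum_nth fps_X_power_mult_nth if_distrib[of "\<lambda>x. x * _"]
        intro!: sum.neutral cong: if_cong)
qed

lemma fps_nth_eq_0_imp_X_power:
  fixes b :: "'a::ring_1 fps"
  assumes "\<And>k. k < m \<Longrightarrow> fps_nth b k = 0"
  shows "\<exists>c. b = fps_X ^ m * c"
  using fps_truncate[of b m] assms by (auto simp: )

lemma falg_const_X_power: "falg_const (fps_X ^ m) = fps_X ^ m"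
  by (induction m) (simp_all add: falg_const_mult)

lemma falg_gen_eq: "falg_gen (i, j, r) = (if i = j \<and> r = 0 then 1 else 0) - lplus i j r"
  by (simp add: lplus_def)

lemma poly_mapping_sum_singles:
  "p = (\<Sum>k\<in>Poly_Mapping.keys p. Poly_Mapping.single k (poly_mapping.lookup p k))"
  by (rule poly_mapping_eqI) (simp add: lookup_sum lookup_single when_def in_keys_iff)

abbreviation word :: "'n gen list \<Rightarrow> 'n falg" where
  "word w \<equiv> fps_const (Poly_Mapping.single (FMon w) 1)"

lemma word_Nil: "word [] = 1"
  by (simp flip: zero_fmon_def)

lemma word_Cons: "word (g # w) = falg_gen g * word w"
  by (simp add: falg_gen_def mult_single)

text \<open>Words span a dense submodule: modulo h^m an element is a finite combination of words
  with coefficients in \<complex>[h].\<close>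

lemma csub_eq_UNIV_word:
  fixes U :: "'n falg set"
  assumes U: "csub U" and word: "\<And>w. word w \<in> U"
  shows "b \<in> U"
proof -
  note sub = csub_submod[OF U]
  have const: "fps_const p \<in> U" for p
  proof -
    have "fps_const p = (\<Sum>k\<in>Poly_Mapping.keys p. falg_const (fps_const (poly_mapping.lookup p k)) * fps_const (Poly_Mapping.single k 1))"
      by (subst poly_mapping_sum_singles)
         (simp add: fps_eq_iff fps_sum_nth falg_const_fps_const mult_single)
    also have "\<dots> \<in> U"
    proof (intro submod_sum[OF sub] submodD(3)[OF sub])
      fix k show "fps_const (Poly_Mapping.single k 1) \<in> U" using word by (cases k) auto
    qed
    finally show ?thesis .
  qed
  show ?thesis
  proof (rule csub_lim[OF U])
    fix m
    obtain c where c: "b - fps_X ^ m * c = (\<Sum>k<m. fps_X ^ k * fps_const (fps_nth b k))"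
      using fps_truncate by blast
    have "(\<Sum>k<m. fps_X ^ k * fps_const (fps_nth b k)) \<in> U"
      using const submodD(3)[OF sub, of _ "fps_X ^ _"]
      by (intro submod_sum[OF sub]) (simp add: falg_const_X_power)
    then show "\<exists>c. b - fps_X ^ m * c \<in> U" by (intro exI[of _ c]) (simp only: c)
  qed
qed

text \<open>The induction principle on the free algebra. A generator is 0 or 1 minus an entry of
  L^+, so letters can be traded for the entries \<open>lplus\<close>, in which the exchange
  relations are expressed.\<close>

lemma csub_eq_UNIV:
  fixes U :: "'n falg set"
  assumes U: "csub U" and one: "1 \<in> U"
    and step: "\<And>i j r b. b \<in> U \<Longrightarrow> lplus i j r * b \<in> U"
  shows "b \<in> U"
proof (rule csub_eq_UNIV_word[OF U])
  note sub = csub_submod[OF U]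
  show "word w \<in> U" for w
  proof (induction w)
    case Nil
    then show ?case using one by (simp only: word_Nil)
  next
    case (Cons g w)
    obtain i j r where g: "g = (i, j, r)" by (cases g) auto
    have "word (g # w) = (if i = j \<and> r = 0 then 1 else 0) * word w - lplus i j r * word w"
      unfolding word_Cons g falg_gen_eq by (simp only: left_diff_distrib)
    also have "\<dots> \<in> U"
      using Cons.IH step[OF Cons.IH] submodD(1)[OF sub] by (intro submod_diff[OF sub]) auto
    finally show ?case .
  qed
qed

section \<open>Linear operators on the free algebra\<close>

definition linop :: "'n falg addop \<Rightarrow> bool" where
  "linop f \<longleftrightarrow> (\<forall>s b. app f (falg_const s * b) = falg_const s * app f b)"

lemma linopD: "linop f \<Longrightarrow> app f (falg_const s * b) = falg_const s * app f b"
  by (simp add: linop_def)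

lemma linop_X: "linop f \<Longrightarrow> app f (fps_X ^ m * b) = fps_X ^ m * app f b"
  using linopD[of f "fps_X ^ m"] by (simp add: falg_const_X_power)

lemma submod_vimage: "linop f \<Longrightarrow> submod U \<Longrightarrow> submod {b. app f b \<in> U}"
  by (auto simp: submod_def app_add linop_def)

text \<open>Linearity includes continuity: a linear map takes h^m c to h^m times its value at c, so
  approximations modulo h^m are carried along.\<close>

lemma csub_vimage: "linop f \<Longrightarrow> csub U \<Longrightarrow> csub {b. app f b \<in> U}"
  unfolding csub_def
  by (auto simp: submod_vimage app_diff linop_X) blast

lemma csub_Inter: "(\<And>x. x \<in> A \<Longrightarrow> csub (U x)) \<Longrightarrow> csub {b. \<forall>x\<in>A. b \<in> U x}"
  unfolding csub_def submod_def by (auto; meson)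

lemma X_power_dvd_all_imp_0:
  fixes b :: "'a::ring_1 fps"
  assumes "\<And>m. \<exists>c. b = fps_X ^ m * c"
  shows "b = 0"
proof (rule fps_ext)
  fix n
  obtain c where "b = fps_X ^ Suc n * c" using assms by blast
  then show "fps_nth b n = fps_nth 0 n" by (simp add: fps_X_power_mult_nth del: power_Suc)
qed

text \<open>The algebra is h-adically separated. An equality is therefore membership in a closed
  submodule, and inductions for equalities, for congruences modulo h and for the ideal take one
  form.\<close>

lemma csub_0: "csub {0}"
  unfolding csub_def submod_def using X_power_dvd_all_imp_0 by fastforce

definition smul :: "complex fps \<Rightarrow> 'n falg addop" where
  "smul s = Addop (\<lambda>b. falg_const s * b)"

definition lmul :: "'n falg \<Rightarrow> 'n falg addop" where
  "lmul a = Addop (\<lambda>b. a * b)"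

lemma app_smul [simp]: "app (smul s) b = falg_const s * b"
  by (simp add: smul_def app_Addop algebra_simps)

lemma app_lmul [simp]: "app (lmul a) b = a * b"
  by (simp add: lmul_def app_Addop algebra_simps)

lemma linop_smul [simp]: "linop (smul s)"
  by (simp add: linop_def flip: mult.assoc falg_const_mult) (simp add: mult.commute)

lemma linop_lmul [simp]: "linop (lmul a)"
  by (simp add: linop_def) (metis falg_const_commute mult.assoc)

text \<open>Read as commutation with scalars, linearity lets scalar series slide past series of
  linear operators by the general rule \<open>comm_gser\<close>.\<close>

lemma linop_iff_commute: "linop f \<longleftrightarrow> (\<forall>s. f * smul s = smul s * f)"
  unfolding linop_def by (metis (no_types) addop_eqI app_simps(4) app_smul)

lemma linop_ring [intro]:
  "linop f \<Longrightarrow> linop g \<Longrightarrow> linop (f + g)" "linop f \<Longrightarrow> linop g \<Longrightarrow> linop (f - g)"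
  "linop f \<Longrightarrow> linop g \<Longrightarrow> linop (f * g)" "linop 0" "linop 1"
  by (simp_all add: linop_def algebra_simps)

lemma smul_mult: "smul (s * t) = smul s * smul t"
  by (rule addop_eqI) (simp add: falg_const_mult mult.assoc)

lemma smul_add: "smul (s + t) = smul s + smul t"
  by (rule addop_eqI) (simp add: falg_const_add algebra_simps)

lemma smul_0 [simp]: "smul 0 = 0" by (rule addop_eqI) simp

lemma smul_1 [simp]: "smul 1 = 1" by (rule addop_eqI) simp

lemma smul_sum: "smul (sum f A) = (\<Sum>x\<in>A. smul (f x))"
  by (induction A rule: infinite_finite_induct) (simp_all add: smul_add)

lemma linop_eq_word:
  fixes f g :: "'n falg addop"
  assumes "linop f" "linop g" and "\<And>w. app f (word w) = app g (word w)"
  shows "f = g"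
proof (rule addop_eqI)
  fix b
  have "csub {b. app (f - g) b \<in> {0}}"
    by (intro csub_vimage csub_0 linop_ring assms)
  then have "b \<in> {b. app (f - g) b \<in> {0}}"
    by (rule csub_eq_UNIV_word) (use assms in simp)
  then show "app f b = app g b" by simp
qed

section \<open>Linear extension from words\<close>

definition ext0 :: "('n gen fmon \<Rightarrow> 'n falg) \<Rightarrow> ('n gen fmon \<Rightarrow>\<^sub>0 complex) \<Rightarrow> 'n falg" where
  "ext0 t p = (\<Sum>w\<in>Poly_Mapping.keys p. falg_const (fps_const (poly_mapping.lookup p w)) * t w)"

lemma ext0_superset:
  "finite W \<Longrightarrow> Poly_Mapping.keys p \<subseteq> W \<Longrightarrow> ext0 t p = (\<Sum>w\<in>W. falg_const (fps_const (poly_mapping.lookup p w)) * t w)"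
  unfolding ext0_def by (rule sum.mono_neutral_left) (auto simp: in_keys_iff)

lemma ext0_add: "ext0 t (p + q) = ext0 t p + ext0 t q"
proof -
  let ?W = "Poly_Mapping.keys p \<union> Poly_Mapping.keys q"
  have "Poly_Mapping.keys (p + q) \<subseteq> ?W" by (rule Poly_Mapping.keys_add)
  then show ?thesis
    by (simp add: ext0_superset[of ?W] lookup_add falg_const_add ring_distribs sum.distrib
        flip: fps_const_add)
qed

lemma ext0_scale: "ext0 t (Poly_Mapping.single 0 c * p) = falg_const (fps_const c) * ext0 t p"
proof -
  have "Poly_Mapping.keys (Poly_Mapping.single 0 c * p) \<subseteq> Poly_Mapping.keys p"
    using keys_mult[of "Poly_Mapping.single 0 c" p] by (auto split: if_splits)
  moreover have "poly_mapping.lookup (Poly_Mapping.single 0 c * p) w = c * poly_mapping.lookup p w" for w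
    by (simp flip: mult_map_scale_conv_mult add: Poly_Mapping.map.rep_eq when_def)
  ultimately show ?thesis
    by (simp add: ext0_superset[of "Poly_Mapping.keys p"] sum_distrib_left falg_const_mult mult.assoc
        flip: fps_const_mult)
qed

lemma ext0_0 [simp]: "ext0 t 0 = 0" by (simp add: ext0_def)

text \<open>Each h-coefficient of b is a finite combination of words, which \<open>ext0\<close>
  sends to a power series. The m-th of these is shifted by h^m, and the sum over m \<le> n collects
  the coefficient of h^n.\<close>

definition ext :: "('n gen fmon \<Rightarrow> 'n falg) \<Rightarrow> 'n falg addop" where
  "ext t = Addop (\<lambda>b. Abs_fps (\<lambda>n. \<Sum>m\<le>n. fps_nth (ext0 t (fps_nth b m)) (n - m)))"

lemma app_ext_nth: "fps_nth (app (ext t) b) n = (\<Sum>m\<le>n. fps_nth (ext0 t (fps_nth b m)) (n - m))"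
  by (simp add: ext_def app_Addop fps_eq_iff ext0_add sum.distrib)

lemma ext_X: "app (ext t) (fps_X * b) = fps_X * app (ext t) b"
proof (rule fps_ext)
  fix n
  show "fps_nth (app (ext t) (fps_X * b)) n = fps_nth (fps_X * app (ext t) b) n"
    by (cases n) (simp_all add: app_ext_nth sum.atMost_Suc_shift del: sum.atMost_Suc)
qed

lemma ext_X_power: "app (ext t) (fps_X ^ m * b) = fps_X ^ m * app (ext t) b"
  by (induction m) (simp_all add: ext_X mult.assoc)

lemma ext_scale: "app (ext t) (falg_const (fps_const c) * b) = falg_const (fps_const c) * app (ext t) b"
proof (rule fps_ext)
  fix n
  have "fps_nth (app (ext t) (falg_const (fps_const c) * b)) n
    = (\<Sum>m\<le>n. fps_nth (ext0 t (Poly_Mapping.single 0 c * fps_nth b m)) (n - m))"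
    by (simp add: app_ext_nth falg_const_fps_const)
  also have "\<dots> = fps_nth (falg_const (fps_const c) * app (ext t) b) n"
    unfolding ext0_scale by (simp add: app_ext_nth falg_const_fps_const sum_distrib_left)
  finally show "fps_nth (app (ext t) (falg_const (fps_const c) * b)) n
    = fps_nth (falg_const (fps_const c) * app (ext t) b) n" .
qed

text \<open>Linearity over \<complex>[h] is contained in \<open>ext_X_power\<close> and
  \<open>ext_scale\<close>. Splitting s into a polynomial and a multiple of h^m shows that the
  defect is divisible by every power of h.\<close>

lemma linop_ext: "linop (ext t)"
  unfolding linop_def
proof (intro allI)
  fix s b
  let ?d = "app (ext t) (falg_const s * b) - falg_const s * app (ext t) b"
  have "?d = 0"
  proof (rule X_power_dvd_all_imp_0)
    fix m
    obtain c where c: "s - fps_X ^ m * c = (\<Sum>k<m. fps_X ^ k * fps_const (fps_nth s k))"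
      using fps_truncate by blast
    then have s: "s = (\<Sum>k<m. fps_X ^ k * fps_const (fps_nth s k)) + fps_X ^ m * c"
      by (simp add: algebra_simps)
    have "?d = fps_X ^ m * (app (ext t) (falg_const c * b) - falg_const c * app (ext t) b)"
      apply (subst s, subst (2) s)
      by (simp add: falg_const_add falg_const_mult falg_const_sum falg_const_X_power app_add app_sum
          ring_distribs sum_distrib_right mult.assoc ext_X_power ext_scale)
    then show "\<exists>c. ?d = fps_X ^ m * c" by blast
  qed
  then show "app (ext t) (falg_const s * b) = falg_const s * app (ext t) b" by simp
qed

lemma ext_word: "app (ext t) (fps_const (Poly_Mapping.single w 1)) = t w"
proof (rule fps_ext)
  fix n
  have "fps_nth (app (ext t) (fps_const (Poly_Mapping.single w 1))) n
    = (\<Sum>m\<le>n. if m = 0 then fps_nth (t w) n else 0)"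
    unfolding app_ext_nth by (rule sum.cong) (auto simp: ext0_def)
  then show "fps_nth (app (ext t) (fps_const (Poly_Mapping.single w 1))) n = fps_nth (t w) n"
    by simp
qed

section \<open>Series operators\<close>

text \<open>All coefficient families, with exponents of countably many variables and no condition on
  the support; finiteness is required of the operators instead.\<close>

type_synonym 'n ser = "(nat \<Rightarrow> nat) \<Rightarrow> 'n falg"

definition fin :: "('x \<Rightarrow> nat \<Rightarrow> nat) \<Rightarrow> bool" where
  "fin w \<longleftrightarrow> (\<forall>e. finite {x. w x \<le> e})"

text \<open>The formal series of the terms \<open>g x\<close> times the monomial with exponent
  \<open>w x\<close>, acting by multiplication. Under \<open>fin w\<close> finitely many terms reach
  a given exponent. Otherwise sums over infinite sets give 0, which is why the product rules ask for
  \<open>fin\<close>.\<close>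

definition gser :: "('x \<Rightarrow> nat \<Rightarrow> nat) \<Rightarrow> ('x \<Rightarrow> 'n falg addop) \<Rightarrow> 'n ser addop" where
  "gser w g = Addop (\<lambda>\<phi> e. \<Sum>x | w x \<le> e. app (g x) (\<phi> (e - w x)))"

lemma app_gser: "app (gser w g) \<phi> e = (\<Sum>x | w x \<le> e. app (g x) (\<phi> (e - w x)))"
  by (simp add: gser_def app_Addop fun_eq_iff app_add sum.distrib)

lemma finD: "fin w \<Longrightarrow> finite {x. w x \<le> e}"
  by (simp add: fin_def)

lemma le_diff_conv_fun: "(a::nat \<Rightarrow> nat) \<le> e \<Longrightarrow> b \<le> e - a \<longleftrightarrow> a + b \<le> e"
  by (simp add: le_fun_def) (metis add.commute le_diff_conv2)

lemma add_le_imp_le_fun: "(a::nat \<Rightarrow> nat) + b \<le> e \<Longrightarrow> a \<le> e" "(a::nat \<Rightarrow> nat) + b \<le> e \<Longrightarrow> b \<le> e"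
  by (auto simp: le_fun_def intro: add_leD1 add_leD2)

lemma diff_diff_fun: "(e::nat \<Rightarrow> nat) - a - b = e - (a + b)"
  by (simp add: fun_eq_iff)

lemma fin_prod:
  assumes "fin w" "fin w'"
  shows "fin (\<lambda>(x, y). w x + w' y)"
  unfolding fin_def
proof
  fix e
  have "{p. (case p of (x, y) \<Rightarrow> w x + w' y) \<le> e} \<subseteq> {x. w x \<le> e} \<times> {y. w' y \<le> e}"
    by (auto dest: add_le_imp_le_fun)
  then show "finite {p. (case p of (x, y) \<Rightarrow> w x + w' y) \<le> e}"
    using finD[OF assms(1)] finD[OF assms(2)] finite_subset by blast
qed

lemma gser_mult:
  assumes "fin w" "fin w'"
  shows "gser w f * gser w' g = gser (\<lambda>(x, y). w x + w' y) (\<lambda>(x, y). f x * g y)"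
proof (rule addop_eqI, rule ext)
  fix \<phi> e
  have "app (gser w f * gser w' g) \<phi> e
    = (\<Sum>x | w x \<le> e. \<Sum>y | w x + w' y \<le> e. app (f x * g y) (\<phi> (e - (w x + w' y))))"
    unfolding app_simps(4) app_gser[of w] app_gser[of w']
    by (intro sum.cong refl) (auto simp: app_sum diff_diff_fun le_diff_conv_fun intro!: sum.cong)
  also have "\<dots> = (\<Sum>(x, y)\<in>(SIGMA x:{x. w x \<le> e}. {y. w x + w' y \<le> e}).
      app (f x * g y) (\<phi> (e - (w x + w' y))))"
  proof (rule sum.Sigma)
    show "finite {x. w x \<le> e}" using finD assms by blast
    show "\<forall>x\<in>{x. w x \<le> e}. finite {y. w x + w' y \<le> e}"
      by (intro ballI finite_subset[OF _ finD[OF assms(2)]]) (auto dest: add_le_imp_le_fun)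
  qed
  also have "\<dots> = (\<Sum>p | (case p of (x, y) \<Rightarrow> w x + w' y) \<le> e.
      app (case p of (x, y) \<Rightarrow> f x * g y) (\<phi> (e - (case p of (x, y) \<Rightarrow> w x + w' y))))"
    by (rule sum.cong) (auto dest: add_le_imp_le_fun)
  finally show "app (gser w f * gser w' g) \<phi> e
    = app (gser (\<lambda>(x, y). w x + w' y) (\<lambda>(x, y). f x * g y)) \<phi> e"
    by (simp add: app_gser)
qed

text \<open>Terms with the same monomial may be collected as long as each collection is finite.
  Commuting factors (\<open>comm_gser\<close>), Cauchy products (\<open>cser_mult\<close>) and the
  recursion for T (\<open>mult_recursion\<close>) differ only in the map p.\<close>

lemma gser_regroup:
  assumes fin: "fin w'" and w: "\<And>x. w x = w' (p x)"
    and fib: "\<And>y. finite {x. p x = y}" and g: "\<And>y. g' y = (\<Sum>x | p x = y. g x)"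
  shows "gser w g = gser w' g'"
proof (rule addop_eqI, rule ext)
  fix \<phi> e
  have fy: "finite {y. w' y \<le> e}" using finD fin by blast
  have eq: "{x. w x \<le> e} = (\<Union>y\<in>{y. w' y \<le> e}. {x. p x = y})" using w by auto
  then have fx: "finite {x. w x \<le> e}" using fy fib by simp
  have "app (gser w g) \<phi> e = (\<Sum>y | w' y \<le> e. \<Sum>x | x \<in> {x. w x \<le> e} \<and> p x = y.
      app (g x) (\<phi> (e - w x)))"
    unfolding app_gser by (rule sum.group[symmetric]) (use fx fy w in auto)
  also have "\<dots> = (\<Sum>y | w' y \<le> e. \<Sum>x | p x = y. app (g x) (\<phi> (e - w' y)))"
  proof (rule sum.cong[OF refl])
    fix y assume y: "y \<in> {y. w' y \<le> e}"
    then show "(\<Sum>x | x \<in> {x. w x \<le> e} \<and> p x = y. app (g x) (\<phi> (e - w x)))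
      = (\<Sum>x | p x = y. app (g x) (\<phi> (e - w' y)))"
      by (intro sum.cong) (auto simp: w)
  qed
  finally show "app (gser w g) \<phi> e = app (gser w' g') \<phi> e"
    by (simp add: app_gser g app_sum_left)
qed

lemma gser_add: "gser w (\<lambda>x. f x + g x) = gser w f + gser w g"
  by (rule addop_eqI) (simp add: fun_eq_iff app_gser sum.distrib)

lemma gser_diff: "gser w (\<lambda>x. f x - g x) = gser w f - gser w g"
  by (rule addop_eqI) (simp add: fun_eq_iff app_gser sum_subtractf)

lemma gser_0: "gser w (\<lambda>x. 0) = 0"
  by (rule addop_eqI) (simp add: fun_eq_iff app_gser)

lemma gser_sum: "gser w (\<lambda>x. \<Sum>i\<in>A. f i x) = (\<Sum>i\<in>A. gser w (f i))"
  by (induction A rule: infinite_finite_induct) (simp_all add: gser_0 gser_add)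

text \<open>A predicate instead of an equation: commutation goals are then decomposed by
  introduction rules, where rewriting with the equations would loop.\<close>

definition comm :: "'a::times \<Rightarrow> 'a \<Rightarrow> bool" where
  "comm x y \<longleftrightarrow> x * y = y * x"

lemma comm_sym: "comm x y \<Longrightarrow> comm y x"
  by (simp add: comm_def)

lemma comm_ring:
  fixes x y z :: "'a::{ring,monoid_mult}"
  shows "comm x 0" "comm 0 x" "comm x 1" "comm 1 x"
    "comm x y \<Longrightarrow> comm x z \<Longrightarrow> comm x (y + z)" "comm x y \<Longrightarrow> comm x z \<Longrightarrow> comm x (y - z)"
    "comm x y \<Longrightarrow> comm x z \<Longrightarrow> comm x (y * z)"
    "comm y x \<Longrightarrow> comm z x \<Longrightarrow> comm (y + z) x" "comm y x \<Longrightarrow> comm z x \<Longrightarrow> comm (y - z) x"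
    "comm y x \<Longrightarrow> comm z x \<Longrightarrow> comm (y * z) x"
proof -
  show "comm x y \<Longrightarrow> comm x z \<Longrightarrow> comm x (y * z)" "comm y x \<Longrightarrow> comm z x \<Longrightarrow> comm (y * z) x"
    unfolding comm_def by (metis mult.assoc)+
qed (simp_all add: comm_def ring_distribs)

lemma comm_sum:
  fixes x :: "'a::ring"
  shows "(\<And>i. i \<in> A \<Longrightarrow> comm x (f i)) \<Longrightarrow> comm x (sum f A)"
    "(\<And>i. i \<in> A \<Longrightarrow> comm (f i) x) \<Longrightarrow> comm (sum f A) x"
  by (simp_all add: comm_def sum_distrib_left sum_distrib_right)

lemma comm_prod_list:
  fixes x :: "'a::{ring,monoid_mult}"
  shows "(\<And>y. y \<in> set ys \<Longrightarrow> comm x y) \<Longrightarrow> comm x (prod_list ys)"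
  by (induction ys) (auto intro: comm_ring)

lemma comm_gser:
  assumes "fin w" "fin w'" "\<And>x y. comm (f x) (g y)"
  shows "comm (gser w f) (gser w' g)"
proof -
  have "gser (\<lambda>(x, y). w x + w' y) (\<lambda>(x, y). f x * g y) = gser (\<lambda>(x, y). w' x + w y) (\<lambda>(x, y). g x * f y)"
  proof (rule gser_regroup[where p = prod.swap])
    show "fin (\<lambda>(x, y). w' x + w y)" by (intro fin_prod assms)
    fix y :: "'b \<times> 'a"
    have eq: "{x. prod.swap x = y} = {prod.swap y}" by auto
    show "finite {x. prod.swap x = y}" unfolding eq by simp
    show "(case y of (x, y) \<Rightarrow> g x * f y) = (\<Sum>x | prod.swap x = y. case x of (x, y) \<Rightarrow> f x * g y)"
      unfolding eq using assms(3) by (cases y) (simp add: comm_def)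
  qed (auto simp: add.commute)
  then show ?thesis by (simp add: comm_def gser_mult assms)
qed

section \<open>Series in one monomial\<close>

abbreviation mexp :: "nat \<Rightarrow> (nat \<Rightarrow> nat) \<Rightarrow> nat \<Rightarrow> nat" where
  "mexp r \<delta> \<equiv> (\<lambda>v. r * \<delta> v)"

text \<open>A series in the monomial with exponent \<delta>. Since \<delta> is a parameter, the same
  operator can stand for a series in a variable, in its inverse or in a quotient of two variables,
  depending on how exponents are interpreted at the end.\<close>

abbreviation cser :: "(nat \<Rightarrow> nat) \<Rightarrow> (nat \<Rightarrow> 'n falg addop) \<Rightarrow> 'n ser addop" where
  "cser \<delta> \<equiv> gser (\<lambda>r. mexp r \<delta>)"

lemma fin_mexp: "\<delta> \<noteq> 0 \<Longrightarrow> fin (\<lambda>r. mexp r \<delta>)"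
  unfolding fin_def
proof
  fix e assume "\<delta> \<noteq> 0"
  then obtain v where v: "\<delta> v > 0" by (auto simp: fun_eq_iff)
  have "{r. mexp r \<delta> \<le> e} \<subseteq> {..e v}"
  proof
    fix r assume "r \<in> {r. mexp r \<delta> \<le> e}"
    then have "r * \<delta> v \<le> e v" by (auto simp: le_fun_def)
    then show "r \<in> {..e v}" using v by simp (metis le_trans mult.right_neutral mult_le_mono2 Suc_leI One_nat_def)
  qed
  then show "finite {r. mexp r \<delta> \<le> e}" using finite_subset by blast
qed

definition sser :: "(nat \<Rightarrow> nat) \<Rightarrow> complex fps fps \<Rightarrow> 'n ser addop" where
  "sser \<delta> f = cser \<delta> (\<lambda>r. smul (fps_nth f r))"

lemma comm_smul: "linop f \<Longrightarrow> comm (smul s) f"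
  by (simp add: linop_iff_commute comm_def)

lemma comm_sser: "\<delta> \<noteq> 0 \<Longrightarrow> fin w \<Longrightarrow> (\<And>x. linop (g x)) \<Longrightarrow> comm (sser \<delta> f) (gser w g)"
  unfolding sser_def by (intro comm_gser fin_mexp comm_smul)

lemma comm_sser_sser: "\<delta> \<noteq> 0 \<Longrightarrow> \<epsilon> \<noteq> 0 \<Longrightarrow> comm (sser \<delta> f) (sser \<epsilon> g)"
  unfolding sser_def[of \<epsilon>] by (intro comm_sser fin_mexp linop_smul)

lemma sser_add: "sser \<delta> (f + g) = sser \<delta> f + sser \<delta> g"
  by (simp add: sser_def smul_add gser_add)

lemma sser_0 [simp]: "sser \<delta> 0 = 0"
  by (simp add: sser_def gser_0)

lemma sser_sum: "sser \<delta> (sum f A) = (\<Sum>x\<in>A. sser \<delta> (f x))"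
  by (induction A rule: infinite_finite_induct) (simp_all add: sser_add)

lemma cser_mult:
  assumes "\<delta> \<noteq> 0"
  shows "cser \<delta> f * cser \<delta> g = cser \<delta> (\<lambda>e. \<Sum>r=0..e. f r * g (e - r))"
proof -
  have "gser (\<lambda>(x, y). mexp x \<delta> + mexp y \<delta>) (\<lambda>(x, y). f x * g y) = cser \<delta> (\<lambda>e. \<Sum>r=0..e. f r * g (e - r))"
  proof (rule gser_regroup[where p = "\<lambda>(x, y). x + y"])
    fix y :: nat
    have eq: "{x. (case x of (x, y) \<Rightarrow> x + y) = y} = (\<lambda>i. (i, y - i)) ` {0..y}"
      by (auto simp: image_iff)
    show "finite {x. (case x of (x, y) \<Rightarrow> x + y) = y}" unfolding eq by simp
    show "(\<Sum>r=0..y. f r * g (y - r)) = (\<Sum>x | (case x of (x, y) \<Rightarrow> x + y) = y. case x of (x, y) \<Rightarrow> f x * g y)"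
      unfolding eq by (subst sum.reindex) (auto simp: inj_on_def)
  qed (use fin_mexp[OF assms] in \<open>auto simp: fun_eq_iff plus_fun_apply algebra_simps\<close>)
  then show ?thesis by (simp only: gser_mult[OF fin_mexp[OF assms] fin_mexp[OF assms]])
qed

lemma sser_mult:
  assumes "\<delta> \<noteq> 0"
  shows "sser \<delta> (f * g) = (sser \<delta> f * sser \<delta> g :: 'n ser addop)"
  unfolding sser_def cser_mult[OF assms] by (simp add: fps_mult_nth smul_sum smul_mult)

text \<open>A constant, written as a series with a single term of exponent 0; \<open>sser\<close>
  with \<delta> = 0 would be an infinite sum instead.\<close>

definition spt :: "complex fps \<Rightarrow> 'n ser addop" where
  "spt s = gser (\<lambda>_::unit. 0) (\<lambda>_. smul s)"

lemma fin_const: "fin (\<lambda>_::unit. a)"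
  by (simp add: fin_def)

lemma app_spt: "app (spt s) \<phi> e = falg_const s * \<phi> e"
proof -
  have "{x::unit. 0 \<le> e} = {()}" by (auto simp: le_fun_def)
  moreover have "e - 0 = e" by (simp add: fun_eq_iff)
  ultimately show ?thesis by (simp add: spt_def app_gser)
qed

lemma comm_spt: "fin w \<Longrightarrow> (\<And>x. linop (g x)) \<Longrightarrow> comm (spt s) (gser w g)"
  unfolding spt_def by (intro comm_gser fin_const comm_smul)

lemma comm_spt_sser: "\<delta> \<noteq> 0 \<Longrightarrow> comm (spt s) (sser \<delta> f)"
  unfolding sser_def by (intro comm_spt fin_mexp linop_smul)

lemma spt_mult: "spt (s * t) = spt s * spt t"
  by (rule addop_eqI) (simp add: fun_eq_iff app_spt falg_const_mult mult.assoc)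

lemma comm_spt_spt: "comm (spt s) (spt t)"
  by (simp add: comm_def mult.commute flip: spt_mult)

lemma spt_add: "spt (s + t) = spt s + spt t"
  by (rule addop_eqI) (simp add: fun_eq_iff app_spt falg_const_add algebra_simps)

lemma spt_0 [simp]: "spt 0 = 0" and spt_1 [simp]: "spt 1 = 1"
  by (rule addop_eqI; simp add: fun_eq_iff app_spt)+

lemma spt_sum: "spt (sum f A) = (\<Sum>x\<in>A. spt (f x))"
  by (induction A rule: infinite_finite_induct) (simp_all add: spt_add)

lemma sser_const:
  assumes "\<delta> \<noteq> 0"
  shows "sser \<delta> (fps_const s) = spt s"
proof (rule addop_eqI, rule ext)
  fix \<phi> e
  have "app (sser \<delta> (fps_const s)) \<phi> e = (\<Sum>r\<in>{0}. app (smul (fps_nth (fps_const s) r)) (\<phi> (e - mexp r \<delta>)))"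
    unfolding sser_def app_gser
    by (rule sum.mono_neutral_right) (use finD[OF fin_mexp[OF assms]] in \<open>auto simp: le_fun_def\<close>)
  moreover have "e - (\<lambda>v. 0) = e" by (simp add: fun_eq_iff)
  ultimately show "app (sser \<delta> (fps_const s)) \<phi> e = app (spt s) \<phi> e"
    by (simp add: app_spt)
qed

lemma sser_1: "\<delta> \<noteq> 0 \<Longrightarrow> sser \<delta> 1 = 1"
  using sser_const[of \<delta> 1] by simp

text \<open>Spectral parameters multiply: this is how x_1/x_2 times x_2/x_3 becomes x_1/x_3 in the
  Yang--Baxter equation.\<close>

lemma sser_X_mult:
  assumes "\<delta> \<noteq> 0" "\<epsilon> \<noteq> 0"
  shows "sser \<delta> (fps_const s * fps_X) * sser \<epsilon> (fps_const t * fps_X) = sser (\<delta> + \<epsilon>) (fps_const (s * t) * fps_X)"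
proof -
  have *: "app (sser \<delta> (fps_const s * fps_X)) \<phi> e = (if \<delta> \<le> e then falg_const s * \<phi> (e - \<delta>) else 0)"
    if "\<delta> \<noteq> 0" for \<delta> s and \<phi> :: "'a ser" and e
  proof -
    have "app (sser \<delta> (fps_const s * fps_X)) \<phi> e
      = (\<Sum>r\<in>{1} \<inter> {r. mexp r \<delta> \<le> e}. app (smul (fps_nth (fps_const s * fps_X) r)) (\<phi> (e - mexp r \<delta>)))"
      unfolding sser_def app_gser
      by (rule sum.mono_neutral_right) (use finD[OF fin_mexp[OF that]] in \<open>auto simp: fps_X_def\<close>)
    then show ?thesis by (auto simp: Int_insert_left)
  qed
  have "\<delta> + \<epsilon> \<noteq> 0" using assms by (auto simp: fun_eq_iff)
  show ?thesis
  proof (rule addop_eqI, rule ext)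
    fix \<phi> :: "'a ser" and e
    have "\<delta> \<le> e \<and> \<epsilon> \<le> e - \<delta> \<longleftrightarrow> \<delta> + \<epsilon> \<le> e"
      using le_diff_conv_fun add_le_imp_le_fun(1) by blast
    then show "app (sser \<delta> (fps_const s * fps_X) * sser \<epsilon> (fps_const t * fps_X)) \<phi> e
      = app (sser (\<delta> + \<epsilon>) (fps_const (s * t) * fps_X)) \<phi> e"
      using *[OF assms(1)] *[OF assms(2)] *[OF \<open>\<delta> + \<epsilon> \<noteq> 0\<close>]
      by (simp only: app_simps(4)) (auto simp: diff_diff_fun falg_const_mult mult.assoc)
  qed
qed

text \<open>The substitution \<open>x \<mapsto> b x\<close>.\<close>

definition rescale :: "complex fps \<Rightarrow> complex fps fps \<Rightarrow> complex fps fps" where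
  "rescale b f = Abs_fps (\<lambda>r. b ^ r * fps_nth f r)"

lemma fps_nth_rescale [simp]: "fps_nth (rescale b f) r = b ^ r * fps_nth f r"
  by (simp add: rescale_def)

lemma rescale_add: "rescale b (f + g) = rescale b f + rescale b g"
  by (simp add: fps_eq_iff algebra_simps)

lemma rescale_0 [simp]: "rescale b 0 = 0"
  by (simp add: fps_eq_iff)

lemma rescale_sum: "rescale b (sum f A) = (\<Sum>x\<in>A. rescale b (f x))"
  by (induction A rule: infinite_finite_induct) (simp_all add: rescale_add)

lemma rescale_mult: "rescale b (f * g) = rescale b f * rescale b g"
proof (rule fps_ext)
  fix n
  have "b ^ n * (fps_nth f i * fps_nth g (n - i)) = b ^ i * fps_nth f i * (b ^ (n - i) * fps_nth g (n - i))"
    if "i \<le> n" for i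
  proof -
    have "b ^ n = b ^ i * b ^ (n - i)" using that by (simp flip: power_add)
    then show ?thesis by (simp add: algebra_simps)
  qed
  then show "fps_nth (rescale b (f * g)) n = fps_nth (rescale b f * rescale b g) n"
    unfolding fps_nth_rescale fps_mult_nth sum_distrib_left by (intro sum.cong) auto
qed

lemma rescale_const [simp]: "rescale b (fps_const s) = fps_const s"
  by (simp add: fps_eq_iff)

lemma rescale_1 [simp]: "rescale b 1 = 1"
  using rescale_const[of b 1] by (simp del: rescale_const)

lemma rescale_X: "rescale b fps_X = fps_const b * fps_X"
  by (simp add: fps_eq_iff fps_X_def)

lemma rescale_by_1 [simp]: "rescale 1 f = f"
  by (simp add: fps_eq_iff)

section \<open>Locality and monomials\<close>

definition mon :: "(nat \<Rightarrow> nat) \<Rightarrow> 'n ser addop" where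
  "mon a = gser (\<lambda>_::unit. a) (\<lambda>_. 1)"

lemma app_mon: "app (mon a) \<phi> e = (if a \<le> e then \<phi> (e - a) else 0)"
  by (simp add: mon_def app_gser)

lemma comm_mon_gser: "fin w \<Longrightarrow> comm (mon a) (gser w g)"
  unfolding mon_def by (intro comm_gser fin_const comm_ring)

definition sing :: "(nat \<Rightarrow> nat) \<Rightarrow> 'n falg \<Rightarrow> 'n ser" where
  "sing a v = (\<lambda>e. if e = a then v else 0)"

lemma mon_sing: "app (mon a) (sing 0 v) = sing a v"
proof
  fix e
  have "a \<le> e \<Longrightarrow> e - a = 0 \<longleftrightarrow> e = a"
    by (auto simp: fun_eq_iff le_fun_def intro: antisym)
  then show "app (mon a) (sing 0 v) e = sing a v e"
    by (auto simp: app_mon sing_def)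
qed

text \<open>Each coefficient of the result depends on finitely many coefficients of the argument.
  This replaces continuity when an argument is cut down to finite support.\<close>

definition loc :: "'n ser addop \<Rightarrow> bool" where
  "loc c \<longleftrightarrow> (\<forall>e. \<exists>X. finite X \<and> (\<forall>\<phi>. (\<forall>e'\<in>X. \<phi> e' = 0) \<longrightarrow> app c \<phi> e = 0))"

lemma loc_gser:
  assumes "fin w" shows "loc (gser w g)"
  unfolding loc_def
proof
  fix e
  show "\<exists>X. finite X \<and> (\<forall>\<phi>. (\<forall>e'\<in>X. \<phi> e' = 0) \<longrightarrow> app (gser w g) \<phi> e = 0)"
    by (rule exI[of _ "(\<lambda>x. e - w x) ` {x. w x \<le> e}"]) (use finD[OF assms] in \<open>auto simp: app_gser\<close>)
qed

lemma loc_mult: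
  assumes "loc c" "loc d" shows "loc (c * d)"
  unfolding loc_def
proof
  fix e
  obtain X where X: "finite X" "\<And>\<phi>. (\<forall>e'\<in>X. \<phi> e' = 0) \<Longrightarrow> app c \<phi> e = 0"
    using assms(1) unfolding loc_def by blast
  obtain Z where Z: "\<And>e. finite (Z e)" "\<And>e \<phi>. (\<forall>e'\<in>Z e. \<phi> e' = 0) \<Longrightarrow> app d \<phi> e = 0"
    using assms(2) unfolding loc_def by metis
  show "\<exists>X. finite X \<and> (\<forall>\<phi>. (\<forall>e'\<in>X. \<phi> e' = 0) \<longrightarrow> app (c * d) \<phi> e = 0)"
    by (rule exI[of _ "\<Union>(Z ` X)"]) (use X Z in auto)
qed

lemma loc_add: "loc c \<Longrightarrow> loc d \<Longrightarrow> loc (c + d)" and loc_diff: "loc c \<Longrightarrow> loc d \<Longrightarrow> loc (c - d)"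
  and loc_0: "loc 0"
proof -
  assume c: "loc c" and d: "loc d"
  have "\<exists>X. finite X \<and> (\<forall>\<phi>. (\<forall>e'\<in>X. \<phi> e' = 0) \<longrightarrow> app c \<phi> e = 0 \<and> app d \<phi> e = 0)" for e
  proof -
    obtain X Z where "finite X" "\<And>\<phi>. (\<forall>e'\<in>X. \<phi> e' = 0) \<Longrightarrow> app c \<phi> e = 0"
      "finite Z" "\<And>\<phi>. (\<forall>e'\<in>Z. \<phi> e' = 0) \<Longrightarrow> app d \<phi> e = 0"
      using c d unfolding loc_def by metis
    then show ?thesis by (intro exI[of _ "X \<union> Z"]) auto
  qed
  then show "loc (c + d)" "loc (c - d)" unfolding loc_def
    by (metis (no_types, lifting) add.right_neutral app_simps(1) plus_fun_apply,
        metis (no_types, lifting) diff_0_right app_simps(2) minus_apply)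
qed (auto simp: loc_def)

lemma loc_sum: "(\<And>i. i \<in> A \<Longrightarrow> loc (f i)) \<Longrightarrow> loc (sum f A)"
  by (induction A rule: infinite_finite_induct) (auto intro: loc_0 loc_add)

text \<open>Locality replaces the argument by a finite sum of one-term series, and each of these is
  a monomial times a series concentrated in exponent 0, which c lets pass.\<close>

lemma loc_mem:
  assumes c: "loc c" and U: "submod U" and mon: "\<And>a. comm (mon a) c"
    and sing: "\<And>v e. app c (sing 0 v) e \<in> U"
  shows "app c \<phi> e \<in> U"
proof -
  obtain X where X: "finite X" "\<And>\<phi>. (\<forall>e'\<in>X. \<phi> e' = 0) \<Longrightarrow> app c \<phi> e = 0"
    using c unfolding loc_def by blast
  define \<psi> where "\<psi> = (\<Sum>a\<in>X. sing a (\<phi> a))"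
  have "app c (\<phi> - \<psi>) e = 0"
    by (rule X(2)) (use X(1) in \<open>auto simp: \<psi>_def sum_fun_apply sing_def\<close>)
  then have "app c \<phi> e = app c \<psi> e" by (simp add: app_diff)
  also have "\<dots> = (\<Sum>a\<in>X. app c (sing a (\<phi> a)) e)"
    by (simp add: \<psi>_def app_sum sum_fun_apply)
  also have "\<dots> \<in> U"
  proof (rule submod_sum[OF U])
    fix a
    have "app c (sing a (\<phi> a)) = app (c * mon a) (sing 0 (\<phi> a))" by (simp add: mon_sing)
    also have "c * mon a = mon a * c" using mon[of a] by (simp add: comm_def)
    finally have "app c (sing a (\<phi> a)) = app (mon a) (app c (sing 0 (\<phi> a)))" by (simp only: app_simps(4))
    then show "app c (sing a (\<phi> a)) e \<in> U" using sing submodD(1)[OF U] by (simp add: app_mon)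
  qed
  finally show ?thesis .
qed

text \<open>The term of degree k in \<open>h c\<close> takes k from both exponents at once. So the
  truncated convolution in \<open>rec\<close> says that \<open>h c\<close> is evaluated at the
  product of the two monomials.\<close>

lemma mult_recursion:
  assumes \<delta>: "\<delta> \<noteq> 0" and \<epsilon>: "\<epsilon> \<noteq> 0"
    and rec: "\<And>r s. T r * l s = (\<Sum>c\<in>C. \<Sum>k\<le>min r s.
      smul (fps_nth (h c) k) * (l' c (s - k) * T' c (r - k)))"
  shows "cser \<delta> T * cser \<epsilon> l = (\<Sum>c\<in>C. sser (\<delta> + \<epsilon>) (h c) * (cser \<epsilon> (l' c) * cser \<delta> (T' c)))"
proof -
  note fm = fin_mexp[OF \<delta>] fin_mexp[OF \<epsilon>]
  have nz: "\<delta> + \<epsilon> \<noteq> 0" using \<delta> by (auto simp: fun_eq_iff)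
  let ?w = "\<lambda>(r, s). mexp r \<delta> + mexp s \<epsilon>"
  have "sser (\<delta> + \<epsilon>) (h c) * (cser \<epsilon> (l' c) * cser \<delta> (T' c))
    = gser ?w (\<lambda>(r, s). \<Sum>k\<le>min r s. smul (fps_nth (h c) k) * (l' c (s - k) * T' c (r - k)))" for c
  proof -
    have "sser (\<delta> + \<epsilon>) (h c) * (cser \<epsilon> (l' c) * cser \<delta> (T' c))
      = gser (\<lambda>(k, p). mexp k (\<delta> + \<epsilon>) + (case p of (s, r) \<Rightarrow> mexp s \<epsilon> + mexp r \<delta>))
          (\<lambda>(k, p). smul (fps_nth (h c) k) * (case p of (s, r) \<Rightarrow> l' c s * T' c r))"
      unfolding sser_def by (simp only: gser_mult fm fin_mexp[OF nz] fin_prod)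
    also have "\<dots> = gser ?w (\<lambda>(r, s). \<Sum>k\<le>min r s. smul (fps_nth (h c) k) * (l' c (s - k) * T' c (r - k)))"
    proof (rule gser_regroup[where p = "\<lambda>(k, s, r). (k + r, k + s)"])
      show "fin ?w" by (intro fin_prod fm)
      fix y :: "nat \<times> nat"
      obtain r s where y: "y = (r, s)" by (cases y)
      have eq: "{x. (case x of (k, s, r) \<Rightarrow> (k + r, k + s)) = y} = (\<lambda>k. (k, s - k, r - k)) ` {..min r s}"
        unfolding y by (auto simp: image_iff)
      show "finite {x. (case x of (k, s, r) \<Rightarrow> (k + r, k + s)) = y}" unfolding eq by simp
      show "(case y of (r, s) \<Rightarrow> \<Sum>k\<le>min r s. smul (fps_nth (h c) k) * (l' c (s - k) * T' c (r - k)))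
        = (\<Sum>x | (case x of (k, s, r) \<Rightarrow> (k + r, k + s)) = y.
            case x of (k, p) \<Rightarrow> smul (fps_nth (h c) k) * (case p of (s, r) \<Rightarrow> l' c s * T' c r))"
        unfolding eq by (subst sum.reindex) (auto simp: inj_on_def y)
    qed (auto simp: fun_eq_iff algebra_simps)
    finally show ?thesis .
  qed
  moreover have "(\<Sum>c\<in>C. gser ?w (\<lambda>(r, s). \<Sum>k\<le>min r s. smul (fps_nth (h c) k) * (l' c (s - k) * T' c (r - k))))
    = gser ?w (\<lambda>(r, s). T r * l s)"
    by (subst gser_sum[symmetric]) (simp add: rec split_def)
  ultimately show ?thesis by (simp add: gser_mult fm)
qed

section \<open>Tensor legs\<close>

text \<open>Vectors with one tensor leg for every natural number. Each operator below touches one or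
  two legs, so no set of legs has to be carried along.\<close>

type_synonym 'n mvec = "(nat \<Rightarrow> 'n) \<Rightarrow> 'n ser"

definition lift :: "'n ser addop \<Rightarrow> 'n mvec addop" where
  "lift c = Addop (\<lambda>\<Phi> I. app c (\<Phi> I))"

text \<open>The matrix unit e_ab on leg k.\<close>

definition E :: "nat \<Rightarrow> 'n \<Rightarrow> 'n \<Rightarrow> 'n mvec addop" where
  "E k a b = Addop (\<lambda>\<Phi> I. if I k = a then \<Phi> (I(k := b)) else 0)"

lemma app_lift: "app (lift c) \<Phi> I = app c (\<Phi> I)"
  by (simp add: lift_def app_Addop fun_eq_iff app_add)

lemma app_E: "app (E k a b) \<Phi> I = (if I k = a then \<Phi> (I(k := b)) else 0)"
  by (simp add: E_def app_Addop fun_eq_iff)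

lemma mvec_eqI: "(\<And>\<Phi> I. app f \<Phi> I = app g \<Phi> I) \<Longrightarrow> f = g"
  for f g :: "'n mvec addop"
  by (intro addop_eqI ext) simp

lemma app_sum_apply: "app (sum f A) \<Phi> I = (\<Sum>i\<in>A. app (f i) \<Phi> I)"
  for f :: "'x \<Rightarrow> 'n mvec addop"
  by (simp add: app_sum_left sum_fun_apply)

lemma lift_ring:
  "lift (c + d) = lift c + lift d" "lift (c - d) = lift c - lift d" "lift (c * d) = lift c * lift d"
  "lift 0 = 0" "lift 1 = 1"
  by (rule mvec_eqI; simp add: app_lift)+

lemma lift_sum: "lift (sum f A) = (\<Sum>x\<in>A. lift (f x))"
  by (induction A rule: infinite_finite_induct) (simp_all add: lift_ring)

lemma comm_lift: "comm c d \<Longrightarrow> comm (lift c) (lift d)"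
  by (simp add: comm_def flip: lift_ring)

lemma comm_lift_E: "comm (lift c) (E k a b)" "comm (E k a b) (lift c)"
  unfolding comm_def by (rule mvec_eqI; simp add: app_lift app_E)+

lemma E_mult: "E k a b * E k c d = (if b = c then E k a d else 0)"
  by (rule mvec_eqI) (simp add: app_E)

lemma sum_E: "(\<Sum>a\<in>UNIV. E k a (a::'n::finite)) = 1"
  by (rule mvec_eqI) (simp add: app_sum_left sum_fun_apply app_E)

lemma comm_E: "k \<noteq> l \<Longrightarrow> comm (E k a b) (E l c d)"
  unfolding comm_def by (rule mvec_eqI) (auto simp: app_E fun_upd_twist)

definition leg1m :: "nat \<Rightarrow> ('n::finite \<Rightarrow> 'n \<Rightarrow> 'n ser addop) \<Rightarrow> 'n mvec addop" where
  "leg1m k C = (\<Sum>a\<in>UNIV. \<Sum>b\<in>UNIV. lift (C a b) * E k a b)"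

definition leg2m :: "nat \<Rightarrow> nat \<Rightarrow> ('n::finite \<times> 'n \<Rightarrow> 'n \<times> 'n \<Rightarrow> 'n ser addop) \<Rightarrow> 'n mvec addop" where
  "leg2m i j C = (\<Sum>p\<in>UNIV. \<Sum>q\<in>UNIV. lift (C p q) * (E i (fst p) (fst q) * E j (snd p) (snd q)))"

lemma app_leg1m: "app (leg1m k C) \<Phi> I = (\<Sum>b\<in>UNIV. app (C (I k) b) (\<Phi> (I(k := b))))"
proof -
  have "app (leg1m k C) \<Phi> I = (\<Sum>a\<in>UNIV. \<Sum>b\<in>UNIV. if I k = a then app (C a b) (\<Phi> (I(k := b))) else 0)"
    unfolding leg1m_def app_sum_apply
    by (intro sum.cong refl) (simp add: app_lift app_E)
  also have "\<dots> = (\<Sum>a\<in>UNIV. if I k = a then \<Sum>b\<in>UNIV. app (C a b) (\<Phi> (I(k := b))) else 0)"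
    by (intro sum.cong) auto
  finally show ?thesis by simp
qed

lemma app_leg2m:
  assumes "i \<noteq> j"
  shows "app (leg2m i j C) \<Phi> I = (\<Sum>q\<in>UNIV. app (C (I i, I j) q) (\<Phi> (I(i := fst q, j := snd q))))"
proof -
  have "app (leg2m i j C) \<Phi> I
    = (\<Sum>p\<in>UNIV. \<Sum>q\<in>UNIV. if p = (I i, I j) then app (C p q) (\<Phi> (I(i := fst q, j := snd q))) else 0)"
    unfolding leg2m_def app_sum_apply
    using assms by (intro sum.cong refl) (auto simp: app_lift app_E prod_eq_iff)
  also have "\<dots> = (\<Sum>p\<in>UNIV. if p = (I i, I j) then \<Sum>q\<in>UNIV. app (C p q) (\<Phi> (I(i := fst q, j := snd q))) else 0)"
    by (intro sum.cong) auto
  finally show ?thesis by simp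
qed

lemma UNIV_prod_sum:
  "(\<Sum>q\<in>(UNIV :: ('a::finite \<times> 'b::finite) set). f q) = (\<Sum>a\<in>UNIV. \<Sum>b\<in>UNIV. f (a, b))"
  unfolding UNIV_Times_UNIV[symmetric] by (simp add: sum.cartesian_product)

lemma leg2m_mult:
  assumes "i \<noteq> j"
  shows "leg2m i j C * leg2m i j D = leg2m i j (\<lambda>p q. \<Sum>t\<in>UNIV. C p t * D t q)"
proof (rule mvec_eqI)
  fix \<Phi> :: "'a mvec" and I
  have "app (leg2m i j C * leg2m i j D) \<Phi> I
    = (\<Sum>t\<in>UNIV. \<Sum>q\<in>UNIV. app (C (I i, I j) t) (app (D t q) (\<Phi> (I(i := fst q, j := snd q)))))"
    using assms by (simp add: app_leg2m app_sum fun_upd_twist)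
  also have "\<dots> = app (leg2m i j (\<lambda>p q. \<Sum>t\<in>UNIV. C p t * D t q)) \<Phi> I"
    using assms by (subst sum.swap) (simp add: app_leg2m app_sum_left)
  finally show "app (leg2m i j C * leg2m i j D) \<Phi> I = app (leg2m i j (\<lambda>p q. \<Sum>t\<in>UNIV. C p t * D t q)) \<Phi> I" .
qed

lemma leg2m_swap:
  assumes "i \<noteq> j"
  shows "leg2m j i C = leg2m i j (\<lambda>p q. C (prod.swap p) (prod.swap q))"
proof (rule mvec_eqI)
  fix \<Phi> :: "'a mvec" and I
  have "app (leg2m j i C) \<Phi> I = (\<Sum>q\<in>UNIV. app (C (I j, I i) q) (\<Phi> (I(j := fst q, i := snd q))))"
    using assms by (simp add: app_leg2m)
  also have "\<dots> = (\<Sum>q\<in>UNIV. app (C (I j, I i) (prod.swap q)) (\<Phi> (I(i := fst q, j := snd q))))"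
    by (rule sum.reindex_bij_witness[of _ prod.swap prod.swap]) (use assms in \<open>auto simp: fun_upd_twist\<close>)
  finally show "app (leg2m j i C) \<Phi> I = app (leg2m i j (\<lambda>p q. C (prod.swap p) (prod.swap q))) \<Phi> I"
    using assms by (simp add: app_leg2m)
qed

lemma leg1m_first: 
  assumes "i \<noteq> j"
  shows "leg1m i C = leg2m i j (\<lambda>p q. if snd p = snd q then C (fst p) (fst q) else 0)"
  by (rule mvec_eqI)
     (use assms in \<open>simp add: app_leg1m app_leg2m UNIV_prod_sum if_distrib[of "\<lambda>x. app x _"] fun_upd_idem cong: if_cong\<close>)

lemma leg1m_second:
  assumes "i \<noteq> j"
  shows "leg1m j C = leg2m i j (\<lambda>p q. if fst p = fst q then C (snd p) (snd q) else 0)"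
proof -
  have *: "(if I i = a then f a else 0) = (if a = I i then f a else 0)" for f :: "'a \<Rightarrow> 'a ser" and I and a
    by auto
  show ?thesis
    by (rule mvec_eqI)
     (use assms in \<open>simp add: app_leg1m app_leg2m UNIV_prod_sum if_distrib[of "\<lambda>x. app x _"] fun_upd_idem sum.swap[of _ UNIV UNIV] cong: if_cong\<close>)
qed

lemma leg1m_leg2m_first:
  assumes "i \<noteq> j"
  shows "leg1m i C * leg2m i j D = leg2m i j (\<lambda>p q. \<Sum>t\<in>UNIV. C (fst p) t * D (t, snd p) q)"
proof (rule mvec_eqI)
  fix \<Phi> :: "'a mvec" and I
  show "app (leg1m i C * leg2m i j D) \<Phi> I = app (leg2m i j (\<lambda>p q. \<Sum>t\<in>UNIV. C (fst p) t * D (t, snd p) q)) \<Phi> I"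
    using assms by (simp add: app_leg2m app_leg1m app_sum app_sum_left fun_upd_twist)
      (rule sum.swap)
qed

lemma leg1m_leg2m_second:
  assumes "i \<noteq> j"
  shows "leg1m j C * leg2m i j D = leg2m i j (\<lambda>p q. \<Sum>t\<in>UNIV. C (snd p) t * D (fst p, t) q)"
proof (rule mvec_eqI)
  fix \<Phi> :: "'a mvec" and I
  show "app (leg1m j C * leg2m i j D) \<Phi> I = app (leg2m i j (\<lambda>p q. \<Sum>t\<in>UNIV. C (snd p) t * D (fst p, t) q)) \<Phi> I"
    using assms by (simp add: app_leg2m app_leg1m app_sum app_sum_left fun_upd_twist)
      (rule sum.swap)
qed

lemma leg2m_leg1m_second:
  assumes "i \<noteq> j"
  shows "leg2m i j D * leg1m j C = leg2m i j (\<lambda>p q. \<Sum>t\<in>UNIV. D p (fst q, t) * C t (snd q))"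
proof (rule mvec_eqI)
  fix \<Phi> :: "'a mvec" and I
  have "app (leg2m i j D * leg1m j C) \<Phi> I = (\<Sum>x\<in>UNIV. \<Sum>t\<in>UNIV. \<Sum>y\<in>UNIV. 
       app (D (I i, I j) (x, t)) (app (C t y) (\<Phi> (I(i := x, j := y)))))"
    using assms by (simp add: app_leg2m app_leg1m app_sum UNIV_prod_sum)
  also have "\<dots> = (\<Sum>x\<in>UNIV. \<Sum>y\<in>UNIV. \<Sum>t\<in>UNIV.
       app (D (I i, I j) (x, t)) (app (C t y) (\<Phi> (I(i := x, j := y)))))"
    by (intro sum.cong refl sum.swap)
  finally show "app (leg2m i j D * leg1m j C) \<Phi> I
     = app (leg2m i j (\<lambda>p q. \<Sum>t\<in>UNIV. D p (fst q, t) * C t (snd q))) \<Phi> I"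
    using assms by (simp add: app_leg2m app_leg1m app_sum_left UNIV_prod_sum)
qed

lemma leg2m_add: "leg2m i j (\<lambda>p q. C p q + D p q) = leg2m i j C + leg2m i j D"
  by (simp add: leg2m_def lift_ring sum.distrib algebra_simps)

lemma leg2m_diff: "leg2m i j (\<lambda>p q. C p q - D p q) = leg2m i j C - leg2m i j D"
  by (simp add: leg2m_def lift_ring sum_subtractf algebra_simps)

lemma leg2m_scale: "leg2m i j (\<lambda>p q. c * C p q) = lift c * leg2m i j C"
  by (simp add: leg2m_def lift_ring sum_distrib_left mult.assoc)

lemma leg2m_one:
  assumes "i \<noteq> j" shows "leg2m i j (\<lambda>p q. if p = q then 1 else 0) = 1"
proof -
  have "leg2m i j (\<lambda>p q. if p = q then 1 else 0)
    = (\<Sum>p\<in>UNIV. E i (fst p) (fst p) * E j (snd p) (snd p :: 'a))"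
    unfolding leg2m_def 
    by (intro sum.cong refl) (simp add: if_distrib[of lift] lift_ring if_distrib[of "\<lambda>x. x * _"] cong: if_cong)
  also have "\<dots> = (\<Sum>a\<in>UNIV. E i a (a::'a)) * (\<Sum>a\<in>UNIV. E j a a)"
    by (simp add: UNIV_prod_sum sum_product)
  finally show ?thesis by (simp add: sum_E)
qed

lemma comm_leg1m: "(\<And>a b. comm x (lift (C a b))) \<Longrightarrow> (\<And>a b. comm x (E k a b)) \<Longrightarrow> comm x (leg1m k C)"
  unfolding leg1m_def by (intro comm_sum comm_ring)

lemma comm_leg2m: "(\<And>p q. comm x (lift (C p q))) \<Longrightarrow> (\<And>a b. comm x (E i a b)) \<Longrightarrow>
   (\<And>a b. comm x (E j a b)) \<Longrightarrow> comm x (leg2m i j C)"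
  unfolding leg2m_def by (intro comm_sum comm_ring)

lemma comm_E_leg1m: "k \<noteq> l \<Longrightarrow> comm (E k a b) (leg1m l C)"
  by (intro comm_leg1m comm_lift_E comm_E)

lemma comm_E_leg2m: "k \<noteq> i \<Longrightarrow> k \<noteq> j \<Longrightarrow> comm (E k a b) (leg2m i j C)"
  by (intro comm_leg2m comm_lift_E comm_E)

lemma comm_lift_leg1m: "(\<And>a b. comm c (C a b)) \<Longrightarrow> comm (lift c) (leg1m l C)"
  by (intro comm_leg1m comm_lift_E comm_lift)

lemma comm_lift_leg2m: "(\<And>p q. comm c (C p q)) \<Longrightarrow> comm (lift c) (leg2m i j C)"
  by (intro comm_leg2m comm_lift_E comm_lift)

lemma comm_leg2m_leg1m: "(\<And>p q a b. comm (C p q) (D a b)) \<Longrightarrow> k \<noteq> i \<Longrightarrow> k \<noteq> j \<Longrightarrow> comm (leg2m i j C) (leg1m k D)"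
  by (rule comm_sym) (intro comm_leg2m comm_sym[OF comm_lift_leg1m] comm_sym[OF comm_E_leg1m]; auto)

lemma comm_leg2m_leg2m: "(\<And>p q p' q'. comm (C p q) (D p' q')) \<Longrightarrow> {i, j} \<inter> {k, l} = {} \<Longrightarrow> comm (leg2m i j C) (leg2m k l D)"
  by (rule comm_sym) (intro comm_leg2m comm_sym[OF comm_lift_leg2m] comm_sym[OF comm_E_leg2m]; auto)

section \<open>Pointwise submodules\<close>

definition pw :: "'n falg set \<Rightarrow> 'n mvec set" where
  "pw U = {\<Phi>. \<forall>I e. \<Phi> I e \<in> U}"

definition stab :: "'n falg set \<Rightarrow> 'n mvec addop \<Rightarrow> bool" where
  "stab U x \<longleftrightarrow> (\<forall>\<Phi>\<in>pw U. app x \<Phi> \<in> pw U)"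

lemma stabD: "stab U x \<Longrightarrow> \<Phi> \<in> pw U \<Longrightarrow> app x \<Phi> \<in> pw U"
  by (simp add: stab_def)

lemma stab_mult: "stab U x \<Longrightarrow> stab U y \<Longrightarrow> stab U (x * y)"
  by (simp add: stab_def)

lemma pw_add: "submod U \<Longrightarrow> \<Phi> \<in> pw U \<Longrightarrow> \<Psi> \<in> pw U \<Longrightarrow> \<Phi> + \<Psi> \<in> pw U"
  by (auto simp: pw_def intro: submodD)

lemma pw_diff: "submod U \<Longrightarrow> \<Phi> \<in> pw U \<Longrightarrow> \<Psi> \<in> pw U \<Longrightarrow> \<Phi> - \<Psi> \<in> pw U"
  by (auto simp: pw_def intro: submod_diff)

lemma pw_0: "submod U \<Longrightarrow> 0 \<in> pw U"
  by (auto simp: pw_def intro: submodD)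

lemma pw_sum: "submod U \<Longrightarrow> (\<And>i. i \<in> A \<Longrightarrow> f i \<in> pw U) \<Longrightarrow> sum f A \<in> pw U"
  by (induction A rule: infinite_finite_induct) (auto intro: pw_0 pw_add)

lemma stab_sum: "submod U \<Longrightarrow> (\<And>i. i \<in> A \<Longrightarrow> stab U (f i)) \<Longrightarrow> stab U (sum f A)"
  by (auto simp: stab_def app_sum_left intro: pw_sum)

lemma stab_E: "submod U \<Longrightarrow> stab U (E k a b)"
  by (auto simp: stab_def pw_def app_E intro: submodD)

lemma stab_gser: "submod U \<Longrightarrow> (\<And>x b. b \<in> U \<Longrightarrow> app (g x) b \<in> U) \<Longrightarrow> stab U (lift (gser w g))"
  by (auto simp: stab_def pw_def app_lift app_gser intro!: submod_sum)

lemma stab_leg1m: "submod U \<Longrightarrow> (\<And>a b. stab U (lift (C a b))) \<Longrightarrow> stab U (leg1m k C)"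
  unfolding leg1m_def by (intro stab_sum stab_mult stab_E)

lemma stab_leg2m: "submod U \<Longrightarrow> (\<And>p q. stab U (lift (C p q))) \<Longrightarrow> stab U (leg2m i j C)"
  unfolding leg2m_def by (intro stab_sum stab_mult stab_E)

lemma stab_sser: "submod U \<Longrightarrow> stab U (lift (sser \<delta> f))"
  unfolding sser_def by (rule stab_gser) (auto intro: submodD)

lemma stab_spt: "submod U \<Longrightarrow> stab U (lift (spt s))"
  unfolding spt_def by (rule stab_gser) (auto intro: submodD)

text \<open>Vectors in \<open>pw (spn b)\<close> have all coefficients proportional to one element
  b; an induction over b thereby becomes a statement about vectors that all matrices of scalars
  preserve.\<close>

definition spn :: "'n falg \<Rightarrow> 'n falg set" where
  "spn b = {falg_const s * b |s. True}"

lemma submod_spn: "submod (spn b)"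
  unfolding submod_def spn_def
  apply (auto simp: mult.assoc[symmetric] simp flip: falg_const_mult)
   apply (metis falg_const_0 mult_zero_left)
  by (metis falg_const_add distrib_right)

section \<open>Extracting coefficients\<close>

definition unit_exp :: "nat \<Rightarrow> nat \<Rightarrow> nat" where
  "unit_exp k v = (if v = k then 1 else 0)"

lemma unit_exp_simps [simp]: "unit_exp k k = 1" "v \<noteq> k \<Longrightarrow> unit_exp k v = 0"
  by (simp_all add: unit_exp_def)

lemma unit_exp_nz [simp]: "unit_exp k \<noteq> 0"
  by (auto simp: fun_eq_iff unit_exp_def)

text \<open>Freezes the exponent of the k-th variable at r. An operator not involving that variable
  commutes with it, so coefficients of the variable can be compared on both sides of an
  operator.\<close>

definition slice :: "nat \<Rightarrow> nat \<Rightarrow> 'n mvec addop" where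
  "slice k r = Addop (\<lambda>\<Phi> I e. \<Phi> I (e(k := r)))"

lemma app_slice: "app (slice k r) \<Phi> I e = \<Phi> I (e(k := r))"
  by (simp add: slice_def app_Addop fun_eq_iff)

lemma comm_slice_E: "comm (slice k r) (E l a b)"
  unfolding comm_def by (rule mvec_eqI) (auto simp: fun_eq_iff app_E app_slice)

lemma comm_slice_gser:
  assumes "\<And>x. w x k = 0"
  shows "comm (slice k r) (lift (gser w g))"
  unfolding comm_def
proof (rule mvec_eqI, rule ext)
  fix \<Phi> :: "'b mvec" and I e
  have "w x \<le> e(k := r) \<longleftrightarrow> w x \<le> e" for x
    using assms[of x] by (simp add: le_fun_def) (metis le0)
  moreover have "e(k := r) - w x = (e - w x)(k := r)" for x
    using assms[of x] by (auto simp: fun_eq_iff)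
  ultimately show "app (slice k r * lift (gser w g)) \<Phi> I e = app (lift (gser w g) * slice k r) \<Phi> I e"
    by (simp add: app_slice app_lift app_gser)
qed

lemma comm_slice_sser: "\<delta> k = 0 \<Longrightarrow> comm (slice k r) (lift (sser \<delta> f))"
  unfolding sser_def by (rule comm_slice_gser) simp

lemma comm_slice_spt: "comm (slice k r) (lift (spt s))"
  unfolding spt_def by (rule comm_slice_gser) simp

text \<open>D does not involve the k-th variable, so knowing D times a series in that variable
  amounts to knowing D on each coefficient of the series.\<close>

lemma extract_coeff:
  assumes D: "\<And>r. comm (slice k r) D" and
    step: "\<And>\<Phi>. \<Phi> \<in> pw (spn b) \<Longrightarrow> app (D * lift (cser (unit_exp k) (\<lambda>r. lmul (a r)))) \<Phi> \<in> pw U"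
    and \<Phi>: "\<Phi> \<in> pw (spn (a r * b))"
  shows "app D \<Phi> \<in> pw U"
  unfolding pw_def
proof (intro CollectI allI)
  fix I and e0 :: "nat \<Rightarrow> nat"
  have "\<exists>s. \<Phi> I e = falg_const s * (a r * b)" for I e using \<Phi> by (auto simp: pw_def spn_def)
  then obtain u where u: "\<Phi> I e = falg_const (u I e) * (a r * b)" for I e by metis
  define m where "m = e0 k"
  \<comment> \<open>The slice of \<Phi> at m, with \<open>a r\<close> removed, is placed in degree 0
    of the k-th variable. Multiplication by the series puts \<open>a r\<close> back in degree r, so
    the slice at r of the product is the slice at m of \<Phi>.\<close>
  define \<Phi>0 where "\<Phi>0 = (\<lambda>I e. if e k = 0 then falg_const (u I (e(k := m))) * b else 0)"
  have *: "app (lift (cser (unit_exp k) (\<lambda>r. lmul (a r)))) \<Phi>0 I e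
      = a (e k) * (falg_const (u I (e(k := m))) * b)" for I e
  proof -
    have "app (lift (cser (unit_exp k) (\<lambda>r. lmul (a r)))) \<Phi>0 I e
      = (\<Sum>r\<in>{e k}. app (lmul (a r)) (\<Phi>0 I (e - mexp r (unit_exp k))))"
      unfolding app_lift app_gser
      by (rule sum.mono_neutral_right) 
        (use finD[OF fin_mexp[OF unit_exp_nz]] in \<open>auto simp: le_fun_def \<Phi>0_def unit_exp_def\<close>)
    moreover have "(e - mexp (e k) (unit_exp k)) = e(k := 0)" by (auto simp: fun_eq_iff unit_exp_def)
    ultimately show ?thesis by (simp add: \<Phi>0_def)
  qed
  have "slice_eq": "app (slice k m) \<Phi> = app (slice k r) (app (lift (cser (unit_exp k) (\<lambda>r. lmul (a r)))) \<Phi>0)"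
    by (intro ext) (simp add: app_slice * u, metis falg_const_commute mult.assoc)
  have "\<Phi>0 \<in> pw (spn b)"
    unfolding pw_def \<Phi>0_def using submodD(1)[OF submod_spn] by (auto simp: spn_def)
  from step[OF this] have mem: "app (D * lift (cser (unit_exp k) (\<lambda>r. lmul (a r)))) \<Phi>0 \<in> pw U" .
  have "app D \<Phi> I e0 = app (slice k m * D) \<Phi> I e0"
    by (simp add: app_slice m_def)
  also have "\<dots> = app (D * slice k m) \<Phi> I e0" using D[of m] by (simp add: comm_def)
  also have "\<dots> = app (D * slice k r) (app (lift (cser (unit_exp k) (\<lambda>r. lmul (a r)))) \<Phi>0) I e0"
    by (simp add: slice_eq)
  also have "\<dots> = app (slice k r * D) (app (lift (cser (unit_exp k) (\<lambda>r. lmul (a r)))) \<Phi>0) I e0"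
    using D[of r] by (simp add: comm_def)
  also have "\<dots> \<in> U" using mem by (simp add: app_slice pw_def)
  finally show "app D \<Phi> I e0 \<in> U" .
qed

section \<open>Stripping a sandwiched matrix\<close>

definition cm :: "nat \<Rightarrow> nat \<Rightarrow> complex fps ^ ('n::finite \<times> 'n) ^ ('n \<times> 'n) \<Rightarrow> 'n mvec addop" where
  "cm i j A = leg2m i j (\<lambda>p q. spt (A $ p $ q))"

text \<open>D does not act on leg j and G does not act on leg i, so matrix units on leg j from the
  left and on leg i from the right reach the matrix between them. The hypothesis \<open>inv\<close>
  says that B inverts the partial transpose of A in leg j, so that contraction with B removes
  A.\<close>

lemma strip:
  fixes D G :: "'n::finite mvec addop"
  assumes ij: "i \<noteq> j"
    and inv: "\<And>a b a' b'. (\<Sum>k\<in>UNIV. \<Sum>l\<in>UNIV. A $ (a, k) $ (l, b) * B k l a' b') = (if a = a' \<and> b = b' then 1 else 0)"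
    and DE: "\<And>a b. comm D (E j a b)" and GE: "\<And>a b. comm G (E i a b)"
    and Ds: "\<And>s. comm D (lift (spt s))" and Gs: "\<And>s. comm G (lift (spt s))"
  shows "D * G = (\<Sum>k\<in>UNIV. \<Sum>l\<in>UNIV. \<Sum>a\<in>UNIV. \<Sum>b\<in>UNIV.
    lift (spt (B k l a b)) * (E j b k * ((D * (cm i j A * G)) * E i l a)))"
proof -
  \<comment> \<open>The matrix units fix the row index k on leg j and the column index l on leg i;
    the other two indices of A stay free.\<close>
  have EE: "E j b k * cm i j A * E i l a = (\<Sum>a'\<in>UNIV. \<Sum>b'\<in>UNIV. lift (spt (A $ (a', k) $ (l, b'))) * (E i a' a * E j b b'))"
    for b k l a :: 'n
  proof (rule mvec_eqI)
    fix \<Phi> :: "'n mvec" and I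
    show "app (E j b k * cm i j A * E i l a) \<Phi> I = app (\<Sum>a'\<in>UNIV. \<Sum>b'\<in>UNIV. lift (spt (A $ (a', k) $ (l, b'))) * (E i a' a * E j b b')) \<Phi> I"
    proof -
      define f where "f y = app (spt (A $ (I i, k) $ (l, y))) (\<Phi> (I(i := a, j := y)))" for y
      have "app (E j b k * cm i j A * E i l a) \<Phi> I
        = (if I j = b then \<Sum>x\<in>UNIV. \<Sum>y\<in>UNIV. if x = l then f y else 0 else 0)"
        unfolding f_def cm_def using ij
        by (auto simp: app_E app_leg2m UNIV_prod_sum fun_upd_twist intro!: sum.cong)
      also have "\<dots> = (if I j = b then \<Sum>y\<in>UNIV. f y else 0)"
        by (subst sum.swap) simp
      also have "\<dots> = (\<Sum>a'\<in>UNIV. if a' = I i then if I j = b then \<Sum>y\<in>UNIV. f y else 0 else 0)"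
        by simp
      also have "\<dots> = app (\<Sum>a'\<in>UNIV. \<Sum>b'\<in>UNIV. lift (spt (A $ (a', k) $ (l, b'))) * (E i a' a * E j b b')) \<Phi> I"
        unfolding app_sum_apply f_def using ij by (intro sum.cong) (auto simp: app_lift app_E)
      finally show ?thesis .
    qed
  qed
  have "lift (spt (B k l a b)) * (E j b k * ((D * (cm i j A * G)) * E i l a))
    = (\<Sum>a'\<in>UNIV. \<Sum>b'\<in>UNIV. D * (lift (spt (A $ (a', k) $ (l, b') * B k l a b)) * (E i a' a * E j b b')) * G)"
    for k l a b
  proof -
    have 1: "E j b k * D = D * E j b k" "G * E i l a = E i l a * G"
      "lift (spt (B k l a b)) * D = D * lift (spt (B k l a b))"
      using DE GE Ds by (auto simp: comm_def)
    have "lift (spt (B k l a b)) * (E j b k * ((D * (cm i j A * G)) * E i l a))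
      = lift (spt (B k l a b)) * ((E j b k * D) * (cm i j A * (G * E i l a)))"
      by (simp only: mult.assoc)
    also have "\<dots> = lift (spt (B k l a b)) * D * (E j b k * cm i j A * E i l a) * G"
      unfolding 1(1,2) by (simp only: mult.assoc)
    also have "\<dots> = D * (lift (spt (B k l a b)) * (E j b k * cm i j A * E i l a)) * G"
      by (simp only: 1 mult.assoc[symmetric])
    also have "\<dots> = (\<Sum>a'\<in>UNIV. \<Sum>b'\<in>UNIV. D * (lift (spt (B k l a b)) * (lift (spt (A $ (a', k) $ (l, b'))) * (E i a' a * E j b b'))) * G)"
      unfolding EE by (simp only: sum_distrib_left sum_distrib_right)
    finally show ?thesis by (simp add: spt_mult lift_ring mult.assoc mult.commute[of "A $ _ $ _"])
  qed
  then have "(\<Sum>k\<in>UNIV. \<Sum>l\<in>UNIV. \<Sum>a\<in>UNIV. \<Sum>b\<in>UNIV.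
    lift (spt (B k l a b)) * (E j b k * ((D * (cm i j A * G)) * E i l a)))
    = (\<Sum>k\<in>UNIV. \<Sum>l\<in>UNIV. \<Sum>a\<in>UNIV. \<Sum>b\<in>UNIV. \<Sum>a'\<in>UNIV. \<Sum>b'\<in>UNIV. D * (lift (spt (A $ (a', k) $ (l, b') * B k l a b)) * (E i a' a * E j b b')) * G)"
    by simp
  also have "\<dots> = (\<Sum>a\<in>UNIV. \<Sum>b\<in>UNIV. \<Sum>a'\<in>UNIV. \<Sum>b'\<in>UNIV. \<Sum>k\<in>UNIV. \<Sum>l\<in>UNIV.
      D * (lift (spt (A $ (a', k) $ (l, b') * B k l a b)) * (E i a' a * E j b b')) * G)"
    unfolding sum.cartesian_product
    by (rule sum.reindex_bij_witness[of _ "\<lambda>(a, b, a', b', k, l). (k, l, a, b, a', b')" "\<lambda>(k, l, a, b, a', b'). (a, b, a', b', k, l)"]) auto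
  also have "\<dots> = (\<Sum>a\<in>UNIV. \<Sum>b\<in>UNIV. \<Sum>a'\<in>UNIV. \<Sum>b'\<in>UNIV. 
      D * (lift (spt (\<Sum>k\<in>UNIV. \<Sum>l\<in>UNIV. A $ (a', k) $ (l, b') * B k l a b)) * (E i a' a * E j b b')) * G)"
    by (simp add: spt_sum lift_sum sum_distrib_left sum_distrib_right)
  also have "\<dots> = (\<Sum>a\<in>UNIV. \<Sum>b\<in>UNIV. D * (E i a a * E j b b) * G)"
    unfolding inv
  proof (intro sum.cong refl)
    fix a b :: 'n
    have "(\<Sum>a'\<in>UNIV. \<Sum>b'\<in>UNIV.
        D * (lift (spt (if a' = a \<and> b' = b then 1 else 0)) * (E i a' a * E j b b')) * G)
      = (\<Sum>a'\<in>UNIV. \<Sum>b'\<in>UNIV. if a' = a then if b' = b then D * (E i a a * E j b b) * G else 0 else 0)"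
      by (intro sum.cong) (auto simp: lift_ring)
    also have "\<dots> = (\<Sum>a'\<in>UNIV. if a' = a then \<Sum>b'\<in>UNIV. if b' = b then D * (E i a a * E j b b) * G else 0 else 0)"
      by (intro sum.cong) auto
    finally show "(\<Sum>a'\<in>UNIV. \<Sum>b'\<in>UNIV.
        D * (lift (spt (if a' = a \<and> b' = b then 1 else 0)) * (E i a' a * E j b b')) * G)
      = D * (E i a a * E j b b) * G" by simp
  qed
  also have "\<dots> = D * ((\<Sum>a\<in>UNIV. E i a a) * (\<Sum>b\<in>UNIV. E j b b)) * G"
    by (simp only: sum_product) (simp only: sum_distrib_left sum_distrib_right)
  finally show ?thesis by (simp add: sum_E)
qed

section \<open>The scalar factors and the inverse of the R-matrix\<close>

text \<open>The coefficient ring \<complex>[[h]] is not a field, so the quotient has to be computed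
  from \<open>unit_factor\<close> and \<open>subdegree\<close>.\<close>

lemma fps_fps_divide_mult:
  fixes f g :: "complex fps fps"
  assumes "fps_nth g 0 = 1"
  shows "f / g * g = f"
proof -
  have nz: "g \<noteq> 0" and sd: "subdegree g = 0" using assms by (auto simp: subdegree_eq_0_iff)
  have "unit_factor g = g" by (simp add: fps_unit_factor_def sd)
  then have "f / g = f * inverse g" by (simp add: fps_divide_def nz sd)
  moreover have "g * inverse g = 1"
    unfolding fps_inverse_def using assms by (intro fps_right_inverse) (simp add: fps_inverse_one')
  ultimately show ?thesis by (simp add: mult.assoc mult.commute[of "inverse g"])
qed

lemma fps_unit:
  fixes f :: "'a::comm_ring_1 fps"
  assumes "fps_nth f 0 * y = 1"
  shows "\<exists>g. f * g = 1"
  using fps_right_inverse[OF assms] by blast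

definition dilprod :: "nat \<Rightarrow> complex fps fps \<Rightarrow> complex fps fps" where
  "dilprod M g = (\<Prod>k<M. g oo (fps_const (fps_exp (- 2 * of_nat k)) * fps_X))"

lemma dilprod_0: "fps_nth g 0 = 1 \<Longrightarrow> fps_nth (dilprod M g) 0 = 1"
  by (induction M) (simp_all add: dilprod_def)

text \<open>First-order perturbation: a change of g in degree n enters the product once through each
  factor, there multiplied by e^{-2kh} to the power n, while all other factors contribute their
  constant term 1.\<close>

lemma dilprod_diff:
  assumes "fps_nth f 0 = 1" "fps_nth g 0 = 1" "n > 0" "\<And>i. i < n \<Longrightarrow> fps_nth f i = fps_nth g i"
  shows "(\<forall>i<n. fps_nth (dilprod M f) i = fps_nth (dilprod M g) i) \<and>
    fps_nth (dilprod M f) n - fps_nth (dilprod M g) n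
      = (fps_nth f n - fps_nth g n) * (\<Sum>k<M. fps_exp (- 2 * of_nat k) ^ n)"
proof (induction M)
  case 0
  then show ?case by (simp add: dilprod_def)
next
  case (Suc M)
  let ?c = "fps_exp (- 2 * of_nat M) :: complex fps"
  let ?f = "f oo (fps_const ?c * fps_X)" and ?g = "g oo (fps_const ?c * fps_X)"
  have S: "dilprod (Suc M) h = dilprod M h * (h oo (fps_const ?c * fps_X))" for h
    by (simp add: dilprod_def)
  have low: "fps_nth (dilprod (Suc M) f) i = fps_nth (dilprod (Suc M) g) i" if "i < n" for i
    unfolding S fps_mult_nth using Suc assms(4) that by (intro sum.cong) auto
  have split: "fps_nth (a * b) n = fps_nth a 0 * fps_nth b n + (\<Sum>i=1..<n. fps_nth a i * fps_nth b (n - i)) + fps_nth a n * fps_nth b 0"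
    for a b :: "complex fps fps"
  proof -
    have "{0..n} = insert 0 (insert n {1..<n})" using \<open>n > 0\<close> by auto
    then show ?thesis using \<open>n > 0\<close> by (simp add: fps_mult_nth)
  qed
  have mid: "(\<Sum>i=1..<n. fps_nth (dilprod M f) i * fps_nth ?f (n - i))
    = (\<Sum>i=1..<n. fps_nth (dilprod M g) i * fps_nth ?g (n - i))"
    using Suc assms(4) by (intro sum.cong) auto
  have "fps_nth (dilprod (Suc M) f) n - fps_nth (dilprod (Suc M) g) n
    = (?c ^ n * fps_nth f n - ?c ^ n * fps_nth g n) + (fps_nth (dilprod M f) n - fps_nth (dilprod M g) n)"
    unfolding S split mid using assms(1,2) by (simp add: dilprod_0)
  also have "fps_nth (dilprod M f) n - fps_nth (dilprod M g) n
    = (fps_nth f n - fps_nth g n) * (\<Sum>k<M. fps_exp (- 2 * of_nat k) ^ n)" using Suc by simp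
  finally show ?case using low by (simp add: algebra_simps)
qed

text \<open>Modulo h every summand is 1, so the constant term is M, a unit of \<complex>.\<close>

lemma dil_sum_unit:
  assumes "M > 0"
  shows "\<exists>y. (\<Sum>k<M. fps_exp (- 2 * of_nat k) ^ n) * y = (1 :: complex fps)"
proof (rule fps_unit)
  have "fps_nth ((\<Sum>k<M. fps_exp (- 2 * of_nat k) ^ n) :: complex fps) 0 = of_nat M"
    by (simp add: fps_sum_nth fps_exp_power_mult)
  then show "fps_nth ((\<Sum>k<M. fps_exp (- 2 * of_nat k) ^ n) :: complex fps) 0 * (1 / of_nat M) = 1"
    using assms by simp
qed

text \<open>Degree by degree the equation is linear in the new coefficient with an invertible
  factor. This gives the \<open>THE\<close> in \<open>gbar\<close> its meaning.\<close>

lemma dilprod_ex1: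
  assumes M: "M > 0" and rhs: "fps_nth r 0 = 1"
  shows "\<exists>!g. fps_nth g 0 = 1 \<and> dilprod M g = r"
proof (rule ex_ex1I)
  obtain y where y: "(\<Sum>k<M. fps_exp (- 2 * of_nat k) ^ n) * y n = (1 :: complex fps)" for n
    using dil_sum_unit[OF M] by metis
  \<comment> \<open>The correction in degree n + 1 removes the defect of the product in that degree;
    \<open>y\<close> inverts the factor from \<open>dilprod_diff\<close>, and lower degrees are not
    changed.\<close>
  define G where "G = rec_nat 1 (\<lambda>n g. g + fps_const (y (Suc n) * (fps_nth r (Suc n) - fps_nth (dilprod M g) (Suc n))) * fps_X ^ Suc n)"
  have G0: "G 0 = 1" and GS: "G (Suc n) = G n + fps_const (y (Suc n) * (fps_nth r (Suc n) - fps_nth (dilprod M (G n)) (Suc n))) * fps_X ^ Suc n" for n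
    by (simp_all add: G_def)
  have low: "fps_nth (G (n + m)) i = fps_nth (G n) i" if "i \<le> n" for n m i
    by (induction m) (use that in \<open>simp_all add: GS fps_X_power_nth del: power_Suc\<close>)
  have one: "fps_nth (G n) 0 = 1" for n using low[of 0 0 n] by (simp add: G0)
  have prod: "fps_nth (dilprod M (G n)) n = fps_nth r n" for n
  proof (cases n)
    case 0
    then show ?thesis by (simp add: dilprod_0 one rhs)
  next
    case (Suc k)
    let ?t = "y (Suc k) * (fps_nth r (Suc k) - fps_nth (dilprod M (G k)) (Suc k))"
    have "fps_nth (dilprod M (G (Suc k))) (Suc k) - fps_nth (dilprod M (G k)) (Suc k)
      = (fps_nth (G (Suc k)) (Suc k) - fps_nth (G k) (Suc k)) * (\<Sum>k'<M. fps_exp (- 2 * of_nat k') ^ Suc k)"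
      by (rule dilprod_diff[THEN conjunct2]) (use one low[of _ k 1] in auto)
    also have "fps_nth (G (Suc k)) (Suc k) - fps_nth (G k) (Suc k) = ?t"
      by (simp add: GS fps_X_power_nth del: power_Suc)
    also have "?t * (\<Sum>k'<M. fps_exp (- 2 * of_nat k') ^ Suc k)
      = (fps_nth r (Suc k) - fps_nth (dilprod M (G k)) (Suc k)) * ((\<Sum>k'<M. fps_exp (- 2 * of_nat k') ^ Suc k) * y (Suc k))"
      by (simp only: mult_ac)
    finally show ?thesis using y[of "Suc k"] Suc by simp
  qed
  define g where "g = Abs_fps (\<lambda>n. fps_nth (G n) n)"
  have "fps_nth (dilprod M g) n = fps_nth r n" for n
  proof -
    have agree: "fps_nth g i = fps_nth (G (Suc n)) i" if "i < Suc n" for i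
      using low[of i i "Suc n - i"] that by (simp add: g_def)
    have "fps_nth (dilprod M g) n = fps_nth (dilprod M (G (Suc n))) n"
      using dilprod_diff[of g "G (Suc n)" "Suc n" M] agree one by (auto simp: g_def)
    also have "\<dots> = fps_nth (dilprod M (G n)) n"
      using dilprod_diff[of "G (Suc n)" "G n" "Suc n" M] one low[of _ n 1] by auto
    finally show ?thesis by (simp add: prod)
  qed
  then have "dilprod M g = r" by (simp add: fps_eq_iff)
  then show "\<exists>g. fps_nth g 0 = 1 \<and> dilprod M g = r"
    by (intro exI[of _ g]) (simp add: g_def one)
next
  fix f g assume f: "fps_nth f 0 = 1 \<and> dilprod M f = r" and g: "fps_nth g 0 = 1 \<and> dilprod M g = r"
  have "fps_nth f n = fps_nth g n" for n
  proof (induction n rule: less_induct)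
    case (less n)
    obtain y where y: "(\<Sum>k<M. fps_exp (- 2 * of_nat k) ^ n) * y = (1 :: complex fps)"
      using dil_sum_unit[OF M] by blast
    show ?case
    proof (cases "n = 0")
      case False
      then have "(fps_nth f n - fps_nth g n) * (\<Sum>k<M. fps_exp (- 2 * of_nat k) ^ n) = 0"
        using dilprod_diff[of f g n M] f g less by auto
      then have "(fps_nth f n - fps_nth g n) * ((\<Sum>k<M. fps_exp (- 2 * of_nat k) ^ n) * y) = 0"
        by (simp only: mult.assoc[symmetric]) simp
      then show ?thesis unfolding y by simp
    qed (use f g in simp)
  qed
  then show "f = g" by (simp add: fps_eq_iff)
qed

lemma fbar_0:
  assumes "M > 0"
  shows "fps_nth (fbar M) 0 = 1"
proof -
  have div0: "fps_nth (a / b) 0 = fps_nth a 0" if "fps_nth b 0 = 1" for a b :: "complex fps fps"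
    using arg_cong[OF fps_fps_divide_mult[OF that, of a], of "\<lambda>f. fps_nth f 0"] that by simp
  have "\<exists>!g. fps_nth g 0 = 1 \<and> dilprod M g =
     (1 - fps_const (fps_exp (- 2 * (of_nat M - 1))) * fps_X) / (1 - fps_X)"
    by (rule dilprod_ex1[OF assms]) (simp add: div0)
  from theI'[OF this] have "fps_nth (gbar M) 0 = 1" by (simp add: gbar_def dilprod_def)
  then show ?thesis by (simp add: fbar_def div0)
qed

definition nu :: "complex fps" where "nu = fps_exp 1 - fps_exp (- 1)"

definition cmat :: "'a::zero ^ 'k ^ 'l \<Rightarrow> 'a fps ^ 'k ^ 'l" where
  "cmat A = (\<chi> p q. fps_const (A $ p $ q))"

lemma cmat_mult: "cmat (A ** B) = cmat A ** cmat (B :: 'a::comm_ring_1 ^ 'k ^ 'l)"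
  by (simp add: cmat_def matrix_matrix_mult_def vec_eq_iff)
     (simp add: fps_eq_iff fps_sum_nth)

lemma cmat_add: "cmat (A + B) = cmat A + cmat (B :: 'a::comm_ring_1 ^ 'k ^ 'l)"
  by (simp add: cmat_def vec_eq_iff)

lemma cmat_mat: "cmat (mat s) = (mat (fps_const s) :: 'a::comm_ring_1 fps ^ 'k ^ 'k)"
  by (simp add: cmat_def mat_def vec_eq_iff)

lemma mat_mult_nth: "(mat c ** A) $ p $ q = c * (A $ p $ q)" for c :: "'a::comm_ring_1"
  by (simp add: mat_def matrix_matrix_mult_def if_distrib[of "\<lambda>x. x * _"] cong: if_cong)

lemma mult_mat_nth: "(A ** mat c) $ p $ q = c * (A $ p $ q)" for c :: "'a::comm_ring_1"
  by (simp add: mat_def matrix_matrix_mult_def if_distrib[of "\<lambda>x. _ * x"] mult.commute cong: if_cong)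

lemma mat_comm: "A ** mat c = mat c ** A" for c :: "'a::comm_ring_1"
  by (simp add: vec_eq_iff mat_mult_nth mult_mat_nth)

lemma mat_mult_mat: "mat c ** mat d = (mat (c * d) :: 'a::comm_ring_1 ^ 'k ^ 'k)"
  by (simp add: vec_eq_iff mat_mult_nth) (simp add: mat_def)

lemma Pmat_nth: "Pmat $ p $ q = (if q = prod.swap p then 1 else 0)"
  by (auto simp: Pmat_def prod_eq_iff)

lemma Pmat_mult_Pmat: "Pmat ** Pmat = mat 1"
  unfolding vec_eq_iff matrix_matrix_mult_def mat_def Pmat_nth
  by (auto simp: Pmat_nth if_distrib[of "\<lambda>x. x * _"] cong: if_cong)

lemma matrix_ring_distribs:
  fixes A B C :: "'a::comm_ring_1 ^ 'k ^ 'k"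
  shows "(A + B) ** C = A ** C + B ** C" "(A - B) ** C = A ** C - B ** C"
    "A ** (B + C) = A ** B + A ** C" "A ** (B - C) = A ** B - A ** C"
  by (simp_all add: vec_eq_iff matrix_matrix_mult_def algebra_simps sum.distrib sum_subtractf)

text \<open>The geometric series 1/(1 - x).\<close>

definition kser :: "complex fps fps" where "kser = Abs_fps (\<lambda>_. 1)"

lemma kser: "(1 - fps_X) * kser = 1"
  by (auto simp: fps_eq_iff kser_def left_diff_distrib)

lemma divide_one_minus_X: "(f :: complex fps fps) / (1 - fps_X) = f * kser"
proof -
  have "f / (1 - fps_X) = f / (1 - fps_X) * (1 - fps_X) * kser" by (simp add: mult.assoc kser)
  also have "\<dots> = f * kser" by (subst fps_fps_divide_mult) simp_all
  finally show ?thesis .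
qed

definition phi :: "nat \<Rightarrow> complex fps fps" where "phi M = fbar M * kser"

text \<open>With 1/(1 - x) absorbed into the scalar factor, what remains is linear in x; the
  Yang--Baxter equation becomes a polynomial identity.\<close>

lemma Rbar_nth:
  "Rbar M R $ p $ q = phi M * ((1 - fps_X) * fps_const ((Pmat ** R) $ p $ q)
     + fps_const nu * fps_X * fps_const (Pmat $ p $ q))"
proof -
  have "phi M * ((1 - fps_X) * a + b) = fbar M * ((1 - fps_X) * kser * a + b * kser)" for a b
    by (simp add: phi_def algebra_simps)
  then have *: "phi M * ((1 - fps_X) * a + b) = fbar M * (a + b * kser)" for a b by (simp add: kser)
  show ?thesis unfolding * Rbar_def nu_def by (simp add: divide_one_minus_X mult_ac)
qed

lemma hecke_square:
  fixes R :: "complex fps ^ ('n::finite \<times> 'n) ^ ('n \<times> 'n)"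
  assumes "(R - mat (fps_exp 1)) ** (R + mat (fps_exp (- 1))) = 0"
  shows "R ** R = mat nu ** R + mat 1"
proof -
  have ee: "fps_exp 1 * fps_exp (- 1) = (1 :: complex fps)" by (simp flip: fps_exp_add_mult)
  have 1: "(R - mat (fps_exp 1)) ** (R + mat (fps_exp (- 1)))
    = R ** R - mat (fps_exp 1) ** R + mat (fps_exp (- 1)) ** R - mat 1"
    by (simp add: matrix_ring_distribs mat_comm[of R] mat_mult_mat ee)
  have 2: "mat nu ** R = mat (fps_exp 1) ** R - mat (fps_exp (- 1)) ** R"
    by (simp add: vec_eq_iff mat_mult_nth nu_def algebra_simps)
  have "R ** R - (mat nu ** R + mat 1) = (R - mat (fps_exp 1)) ** (R + mat (fps_exp (- 1)))"
    unfolding 1 2 by (simp add: algebra_simps)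
  then show ?thesis using assms by simp
qed

text \<open>R-bar is f P (R + \<mu>) with \<mu> = (e^h - e^{-h}) x/(1 - x). By the quadratic
  relation (R + \<mu>)(R - nu - \<mu>) is the scalar 1 - \<mu>(nu + \<mu>), whose constant term in x
  is 1.\<close>

lemma Rbar_invertible:
  fixes R :: "complex fps ^ ('n::finite \<times> 'n) ^ ('n \<times> 'n)"
  assumes M: "M > 0" and R2: "R ** R = mat nu ** R + mat 1"
  shows "Rbar M R ** matrix_inv (Rbar M R) = mat 1" "matrix_inv (Rbar M R) ** Rbar M R = mat 1"
proof -
  define \<mu> where "\<mu> = fps_const nu * fps_X * kser"
  define d where "d = 1 - \<mu> * (fps_const nu + \<mu>)"
  obtain f' where f': "fbar M * f' = 1" using fps_unit[of "fbar M" 1] fbar_0[OF M] by auto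
  have "fps_nth d 0 = 1" by (simp add: d_def \<mu>_def)
  then obtain d' where d': "d * d' = 1" using fps_unit[of d 1] by auto
  define X where "X = cmat R + mat \<mu>"
  define Y where "Y = cmat R - mat (fps_const nu + \<mu>)"
  have eq: "Rbar M R = mat (fbar M) ** (cmat Pmat ** X)"
  proof -
    have 1: "cmat Pmat ** X = cmat (Pmat ** R) + mat \<mu> ** cmat Pmat"
      by (simp add: X_def matrix_ring_distribs cmat_mult mat_comm)
    show ?thesis unfolding 1
      by (simp add: vec_eq_iff mat_mult_nth Rbar_def divide_one_minus_X nu_def[symmetric] \<mu>_def)
         (simp add: cmat_def)
  qed
  have "cmat R ** cmat R = mat (fps_const nu) ** cmat R + mat 1"
    using arg_cong[OF R2, of cmat] by (simp add: cmat_mult cmat_add cmat_mat)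
  then have XY: "X ** Y = mat d" "Y ** X = mat d"
    unfolding X_def Y_def d_def
    by (simp_all add: matrix_ring_distribs
        mat_comm[of "cmat R"] mat_mult_mat)
      (simp_all add: vec_eq_iff mat_mult_nth algebra_simps, simp_all add: mat_def algebra_simps)
  define Z where "Z = mat (d' * f') ** (Y ** cmat Pmat)"
  have PP: "cmat Pmat ** cmat Pmat = (mat 1 :: complex fps fps ^ ('n \<times> 'n) ^ ('n \<times> 'n))"
    by (simp flip: cmat_mult add: Pmat_mult_Pmat cmat_mat)
  have "Rbar M R ** Z = mat (fbar M * (d' * f')) ** (cmat Pmat ** (X ** Y) ** cmat Pmat)"
  proof -
    have "Rbar M R ** Z = mat (fbar M) ** ((cmat Pmat ** X) ** mat (d' * f')) ** (Y ** cmat Pmat)"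
      unfolding eq Z_def by (simp only: matrix_mul_assoc)
    also have "\<dots> = (mat (fbar M) ** mat (d' * f')) ** (cmat Pmat ** (X ** Y) ** cmat Pmat)"
      unfolding mat_comm[of "cmat Pmat ** X"] by (simp only: matrix_mul_assoc)
    finally show ?thesis by (simp only: mat_mult_mat)
  qed
  also have "cmat Pmat ** (X ** Y) ** cmat Pmat = mat d"
    by (simp only: XY mat_comm[of "cmat Pmat" d] matrix_mul_assoc[symmetric] PP matrix_mul_rid)
  also have "mat (fbar M * (d' * f')) ** mat d = (mat (fbar M * f' * (d * d')) :: complex fps fps ^ ('n \<times> 'n) ^ ('n \<times> 'n))"
    by (simp add: mat_mult_mat mult_ac)
  finally have RZ: "Rbar M R ** Z = mat 1" by (simp add: f' d')
  have "Z ** Rbar M R = mat (d' * f') ** (Y ** (cmat Pmat ** (mat (fbar M) ** cmat Pmat) ** X))"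
    unfolding eq Z_def by (simp add: matrix_mul_assoc)
  also have "\<dots> = mat (d' * f' * fbar M) ** (Y ** X)"
  proof -
    have "cmat Pmat ** (mat (fbar M) ** cmat Pmat) = (mat (fbar M) :: complex fps fps ^ ('n \<times> 'n) ^ ('n \<times> 'n))"
      by (simp only: mat_comm[symmetric, of _ "cmat Pmat"] matrix_mul_assoc PP matrix_mul_lid)
    then have "mat (d' * f') ** (Y ** (cmat Pmat ** (mat (fbar M) ** cmat Pmat) ** X))
      = mat (d' * f') ** ((Y ** mat (fbar M)) ** X)" by (simp only: matrix_mul_assoc)
    also have "\<dots> = (mat (d' * f') ** mat (fbar M)) ** (Y ** X)"
      unfolding mat_comm[of Y] by (simp only: matrix_mul_assoc)
    finally show ?thesis by (simp only: mat_mult_mat)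
  qed
  also have "\<dots> = mat (fbar M * f' * (d * d'))" by (simp add: XY mat_mult_mat mult_ac)
  finally have ZR: "Z ** Rbar M R = mat 1" by (simp add: f' d')
  have "\<exists>A'. Rbar M R ** A' = mat 1 \<and> A' ** Rbar M R = mat 1" using RZ ZR by blast
  then show "Rbar M R ** matrix_inv (Rbar M R) = mat 1" "matrix_inv (Rbar M R) ** Rbar M R = mat 1"
    unfolding matrix_inv_def by (metis (mono_tags, lifting) someI_ex)+
qed

section \<open>The Yang--Baxter equation with spectral parameter\<close>

lemma mult_left_cong: "x * y = z * w \<Longrightarrow> x * (y * v) = z * (w * v)" for x :: "'a::semigroup_mult"
  by (metis mult.assoc)

lemma comm_left: "comm x y \<Longrightarrow> x * (y * z) = y * (x * z)" for x :: "'a::semigroup_mult"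
  by (metis mult.assoc comm_def)

lemma expand3:
  fixes a1 :: "'a::{ring,monoid_mult}"
  assumes c: "\<And>a x. a \<in> {a1, a2, a3, b1, b2, b3} \<Longrightarrow> x \<in> {x1, x2, x3, y1, y2, y3} \<Longrightarrow> comm a x"
  shows "(a1 * x1 + b1 * y1) * ((a2 * x2 + b2 * y2) * (a3 * x3 + b3 * y3)) =
     a1 * a2 * a3 * (x1 * (x2 * x3)) + a1 * a2 * b3 * (x1 * (x2 * y3)) + a1 * b2 * a3 * (x1 * (y2 * x3))
   + a1 * b2 * b3 * (x1 * (y2 * y3)) + b1 * a2 * a3 * (y1 * (x2 * x3)) + b1 * a2 * b3 * (y1 * (x2 * y3))
   + b1 * b2 * a3 * (y1 * (y2 * x3)) + b1 * b2 * b3 * (y1 * (y2 * y3))"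
proof -
  have r: "x * (a * z) = a * (x * z)" if "a \<in> {a1, a2, a3, b1, b2, b3}" "x \<in> {x1, x2, x3, y1, y2, y3}" for a x z
    using comm_left[OF c[OF that]] by simp
  note rr = r[of a2 x1] r[of a2 y1] r[of b2 x1] r[of b2 y1] r[of a3 x1] r[of a3 y1] r[of b3 x1] r[of b3 y1]
     r[of a3 x2] r[of a3 y2] r[of b3 x2] r[of b3 y2]
  show ?thesis
    by (simp add: distrib_left distrib_right mult.assoc rr add.assoc)
qed

text \<open>Comparing the eight terms of both expansions, those with no flip, with three flips, and
  with a single flip at either end agree at once. The term B P B leaves n^2 uv(1 - u)(1 - v)(X - Y),
  which is cancelled by the terms with two flips.\<close>

lemma spectral_ybe:
  fixes u v n :: "'a::{ring,monoid_mult}"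
  assumes c: "\<And>a x. a \<in> {u, v, n} \<Longrightarrow> x \<in> {u, v, n, B12, B13, B23, P12, P13, P23} \<Longrightarrow> comm a x"
    and bbb: "B12 * (B13 * B23) = B23 * (B13 * B12)"
    and pbb: "P12 * (B13 * B23) = B23 * (B13 * P12)"
    and bbp: "B12 * (B13 * P23) = P23 * (B13 * B12)"
    and bpb: "B12 * (P13 * B23) = B23 * (P13 * B12) + n * (X - Y)"
    and X: "P12 * (P13 * B23) = X" "P23 * (B13 * P12) = X" "B12 * (P13 * P23) = X"
    and Y: "B23 * (P13 * P12) = Y" "P12 * (B13 * P23) = Y" "P23 * (P13 * B12) = Y"
    and ppp: "P12 * (P13 * P23) = P23 * (P13 * P12)"
  shows "((1 - u) * B12 + n * u * P12) * (((1 - u * v) * B13 + n * (u * v) * P13) * ((1 - v) * B23 + n * v * P23))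
    = ((1 - v) * B23 + n * v * P23) * (((1 - u * v) * B13 + n * (u * v) * P13) * ((1 - u) * B12 + n * u * P12))"
proof -
  have cm: "comm a x" if "a \<in> {1 - u, 1 - u * v, 1 - v, n * u, n * (u * v), n * v}"
     "x \<in> {B12, B13, B23, P12, P13, P23}" for a x
    using that c by (auto intro!: comm_ring)
  have e1: "((1 - u) * B12 + n * u * P12) * (((1 - u * v) * B13 + n * (u * v) * P13) * ((1 - v) * B23 + n * v * P23))
    = (1 - u) * (1 - u * v) * (1 - v) * (B12 * (B13 * B23)) + (1 - u) * (1 - u * v) * (n * v) * (B12 * (B13 * P23))
    + (1 - u) * (n * (u * v)) * (1 - v) * (B12 * (P13 * B23)) + (1 - u) * (n * (u * v)) * (n * v) * (B12 * (P13 * P23))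
    + n * u * (1 - u * v) * (1 - v) * (P12 * (B13 * B23)) + n * u * (1 - u * v) * (n * v) * (P12 * (B13 * P23))
    + n * u * (n * (u * v)) * (1 - v) * (P12 * (P13 * B23)) + n * u * (n * (u * v)) * (n * v) * (P12 * (P13 * P23))"
    by (rule expand3, rule cm) auto
  have e2: "((1 - v) * B23 + n * v * P23) * (((1 - u * v) * B13 + n * (u * v) * P13) * ((1 - u) * B12 + n * u * P12))
    = (1 - v) * (1 - u * v) * (1 - u) * (B23 * (B13 * B12)) + (1 - v) * (1 - u * v) * (n * u) * (B23 * (B13 * P12))
    + (1 - v) * (n * (u * v)) * (1 - u) * (B23 * (P13 * B12)) + (1 - v) * (n * (u * v)) * (n * u) * (B23 * (P13 * P12))
    + n * v * (1 - u * v) * (1 - u) * (P23 * (B13 * B12)) + n * v * (1 - u * v) * (n * u) * (P23 * (B13 * P12))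
    + n * v * (n * (u * v)) * (1 - u) * (P23 * (P13 * B12)) + n * v * (n * (u * v)) * (n * u) * (P23 * (P13 * P12))"
    by (rule expand3, rule cm) auto
  have uv: "v * u = u * v" "u * n = n * u" "v * n = n * v"
    using c[of v u] c[of u n] c[of v n] by (auto simp: comm_def)
  note uv' = uv mult_left_cong[OF uv(1)] mult_left_cong[OF uv(2)] mult_left_cong[OF uv(3)]
  show ?thesis
    unfolding e1 e2 bbb pbb bbp bpb X Y ppp
    by (simp add: left_diff_distrib right_diff_distrib distrib_left distrib_right mult.assoc uv')
qed

section \<open>Constant matrices on legs\<close>

lemma app_cm: "i \<noteq> j \<Longrightarrow> app (cm i j A) \<Phi> I
  = (\<Sum>x\<in>UNIV. \<Sum>y\<in>UNIV. app (spt (A $ (I i, I j) $ (x, y))) (\<Phi> (I(i := x, j := y))))"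
  by (simp add: cm_def app_leg2m UNIV_prod_sum)

lemma cm_mult: "i \<noteq> j \<Longrightarrow> cm i j (A ** B) = cm i j A * cm i j B"
  by (simp add: cm_def leg2m_mult matrix_matrix_mult_def spt_sum spt_mult)

lemma app_Pm: "i \<noteq> j \<Longrightarrow> app (cm i j Pmat) \<Phi> I = \<Phi> (I(i := I j, j := I i))"
  by (simp add: cm_def app_leg2m Pmat_nth if_distrib[of spt] if_distrib[of "\<lambda>x. app x _"] cong: if_cong)

lemma comm_spt_cm: "comm (lift (spt s)) (cm i j A)"
  unfolding cm_def by (intro comm_lift_leg2m comm_spt_spt)

lemma comm_sser_cm: "\<delta> \<noteq> 0 \<Longrightarrow> comm (lift (sser \<delta> f)) (cm i j A)"
  unfolding cm_def by (intro comm_lift_leg2m comm_sym[OF comm_spt_sser])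

lemma Pm_rels:
  assumes "i \<noteq> j" "j \<noteq> k" "i \<noteq> k"
  shows "cm i j Pmat * cm j k A = cm i k A * cm i j Pmat"
    "cm i j Pmat * cm k j A = cm k i A * cm i j Pmat"
    "cm i j Pmat * cm i j A = cm j i A * cm i j Pmat"
    "cm i j Pmat * cm i k A = cm j k A * cm i j Pmat"
    "cm i j Pmat * cm k i A = cm k j A * cm i j Pmat"
    "cm i j Pmat * cm i j Pmat = 1"
  by (intro mvec_eqI; use assms in \<open>simp add: app_Pm app_cm[where A = A] fun_upd_twist\<close>)+

lemma Pm_sym: "i \<noteq> j \<Longrightarrow> cm j i Pmat = cm i j Pmat"
  by (rule mvec_eqI) (simp add: app_Pm fun_upd_twist)

lemma cm_add: "cm i j (A + B) = cm i j A + cm i j B"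
  by (simp add: cm_def spt_add leg2m_add)

lemma cm_mat: "i \<noteq> j \<Longrightarrow> cm i j (mat s) = lift (spt s)"
proof -
  assume ij: "i \<noteq> j"
  have "cm i j (mat s) = leg2m i j (\<lambda>p q. spt s * (if p = q then 1 else 0))"
    by (simp add: cm_def mat_def if_distrib[of spt] if_distrib[of "\<lambda>x. _ * x"] cong: if_cong)
  then show ?thesis using ij by (simp add: leg2m_scale leg2m_one)
qed

text \<open>The braid relation is available through its matrix entries; this expansion carries it to
  any three legs.\<close>

lemma app_cm_braid:
  assumes "i \<noteq> j" "j \<noteq> k" "i \<noteq> k"
  shows "app (cm i j R * (cm j k R * cm i j R)) \<Phi> I
    = (\<Sum>a'\<in>UNIV. \<Sum>b'\<in>UNIV. \<Sum>c'\<in>UNIV. app (spt (\<Sum>x\<in>UNIV. \<Sum>y\<in>UNIV. \<Sum>z\<in>UNIV.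
        R $ (I i, I j) $ (x, y) * (R $ (y, I k) $ (z, c') * R $ (x, z) $ (a', b')))) (\<Phi> (I(i := a', j := b', k := c'))))"
    (is "_ = ?r1")
    "app (cm j k R * (cm i j R * cm j k R)) \<Phi> I
    = (\<Sum>a'\<in>UNIV. \<Sum>b'\<in>UNIV. \<Sum>c'\<in>UNIV. app (spt (\<Sum>x\<in>UNIV. \<Sum>y\<in>UNIV. \<Sum>z\<in>UNIV.
        R $ (I j, I k) $ (y, z) * (R $ (I i, y) $ (a', x) * R $ (x, z) $ (b', c')))) (\<Phi> (I(i := a', j := b', k := c'))))"
    (is "_ = ?r2")
proof -
  let ?V = "\<lambda>a' b' c'. \<Phi> (I(i := a', j := b', k := c'))"
  have ss: "app (spt s) (app (spt t) \<phi>) = app (spt (s * t)) \<phi>" for s t and \<phi> :: "'a ser"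
    by (simp add: spt_mult)
  have "app (cm i j R * (cm j k R * cm i j R)) \<Phi> I
    = (\<Sum>x\<in>UNIV. \<Sum>y\<in>UNIV. \<Sum>z\<in>UNIV. \<Sum>c'\<in>UNIV. \<Sum>a'\<in>UNIV. \<Sum>b'\<in>UNIV.
        app (spt (R $ (I i, I j) $ (x, y) * (R $ (y, I k) $ (z, c') * R $ (x, z) $ (a', b')))) (?V a' b' c'))"
    using assms by (simp add: app_cm app_sum ss fun_upd_twist)
  also have "\<dots> = (\<Sum>a'\<in>UNIV. \<Sum>b'\<in>UNIV. \<Sum>c'\<in>UNIV. \<Sum>x\<in>UNIV. \<Sum>y\<in>UNIV. \<Sum>z\<in>UNIV.
        app (spt (R $ (I i, I j) $ (x, y) * (R $ (y, I k) $ (z, c') * R $ (x, z) $ (a', b')))) (?V a' b' c'))"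
    unfolding sum.cartesian_product
    by (rule sum.reindex_bij_witness[of _ "\<lambda>(a', b', c', x, y, z). (x, y, z, c', a', b')" "\<lambda>(x, y, z, c', a', b'). (a', b', c', x, y, z)"]) auto
  also have "\<dots> = ?r1"
    by (simp add: spt_sum app_sum_left)
  finally show "app (cm i j R * (cm j k R * cm i j R)) \<Phi> I = ?r1" .
  have "?r2 = (\<Sum>a'\<in>UNIV. \<Sum>b'\<in>UNIV. \<Sum>c'\<in>UNIV. \<Sum>x\<in>UNIV. \<Sum>y\<in>UNIV. \<Sum>z\<in>UNIV.
        app (spt (R $ (I j, I k) $ (y, z) * (R $ (I i, y) $ (a', x) * R $ (x, z) $ (b', c')))) (?V a' b' c'))"
    by (simp add: spt_sum app_sum_left)
  also have "\<dots> = (\<Sum>y\<in>UNIV. \<Sum>z\<in>UNIV. \<Sum>a'\<in>UNIV. \<Sum>x\<in>UNIV. \<Sum>b'\<in>UNIV. \<Sum>c'\<in>UNIV.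
        app (spt (R $ (I j, I k) $ (y, z) * (R $ (I i, y) $ (a', x) * R $ (x, z) $ (b', c')))) (?V a' b' c'))"
    unfolding sum.cartesian_product
    by (rule sum.reindex_bij_witness[of _ "\<lambda>(y, z, a', x, b', c'). (a', b', c', x, y, z)" "\<lambda>(a', b', c', x, y, z). (y, z, a', x, b', c')"]) auto
  also have "\<dots> = app (cm j k R * (cm i j R * cm j k R)) \<Phi> I"
    using assms by (simp add: app_cm app_sum ss fun_upd_twist)
  finally show "app (cm j k R * (cm i j R * cm j k R)) \<Phi> I = ?r2" by simp
qed

text \<open>The hypotheses on R in entries, independent of legs and of the coefficient algebra.
  \<open>skew1\<close> and \<open>skew2\<close> come from the two partial traces defining skew
  invertibility, with witness \<open>Psi\<close>.\<close>

locale hecke_data =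
  fixes R Psi :: "complex fps ^ ('n::finite \<times> 'n) ^ ('n \<times> 'n)" and M :: nat
  assumes M: "M > 0"
    and braid_nth: "\<And>a b c a' b' c'.
      (\<Sum>x\<in>UNIV. \<Sum>y\<in>UNIV. \<Sum>z\<in>UNIV. R $ (a, b) $ (x, y) * (R $ (y, c) $ (z, c') * R $ (x, z) $ (a', b'))) =
      (\<Sum>x\<in>UNIV. \<Sum>y\<in>UNIV. \<Sum>z\<in>UNIV. R $ (b, c) $ (y, z) * (R $ (a, y) $ (a', x) * R $ (x, z) $ (b', c')))"
    and square: "R ** R = mat nu ** R + mat 1"
    and skew1: "\<And>a b a' b'. (\<Sum>k\<in>UNIV. \<Sum>l\<in>UNIV. R $ (a, k) $ (b, l) * Psi $ (l, b') $ (k, a'))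
      = (if a = a' \<and> b = b' then 1 else 0)"
    and skew2: "\<And>k l k' l'. (\<Sum>a\<in>UNIV. \<Sum>b\<in>UNIV. Psi $ (l', b) $ (k', a) * R $ (a, k) $ (b, l))
      = (if k = k' \<and> l = l' then 1 else 0)"
begin

abbreviation A :: "nat \<Rightarrow> nat \<Rightarrow> 'n mvec addop" where "A i j \<equiv> cm i j (R ** Pmat)"

abbreviation Pm :: "nat \<Rightarrow> nat \<Rightarrow> 'n mvec addop" where "Pm i j \<equiv> cm i j Pmat"

lemma braid:
  assumes "i \<noteq> j" "j \<noteq> k" "i \<noteq> k"
  shows "cm i j R * (cm j k R * cm i j R) = cm j k R * (cm i j R * cm j k R)"
  by (rule mvec_eqI) (simp only: app_cm_braid[OF assms] braid_nth)

lemma A_eq: "i \<noteq> j \<Longrightarrow> A i j = cm i j R * Pm i j"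
  by (rule cm_mult)

text \<open>All flips are pushed to the right, which turns the indices on the left into those of the
  braid relation for R.\<close>

lemma A_ybe:
  assumes "i \<noteq> j" "j \<noteq> k" "i \<noteq> k"
  shows "A i j * (A i k * A j k) = A j k * (A i k * A i j)"
proof -
  note d = assms assms[symmetric]
  have "A i j * (A i k * A j k) = cm i j R * ((Pm i j * cm i k R) * (Pm i k * (cm j k R * Pm j k)))"
    using d by (simp add: A_eq mult.assoc)
  also have "\<dots> = cm i j R * (cm j k R * (Pm i j * (Pm i k * cm j k R) * Pm j k))"
    unfolding Pm_rels(4)[OF assms] by (simp only: mult.assoc)
  also have "Pm i k * cm j k R = cm j i R * Pm i k" using d Pm_rels(2)[of i k j R] by simp
  also have "Pm i j * (cm j i R * Pm i k) = cm i j R * (Pm i j * Pm i k)"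
    using Pm_rels(3)[of j i k R] d by (simp add: Pm_sym[of i j] mult.assoc[symmetric])
  finally have 1: "A i j * (A i k * A j k) = cm i j R * (cm j k R * cm i j R) * (Pm i j * (Pm i k * Pm j k))"
    by (simp add: mult.assoc)
  have "A j k * (A i k * A i j) = cm j k R * ((Pm j k * cm i k R) * (Pm i k * (cm i j R * Pm i j)))"
    using d by (simp add: A_eq mult.assoc)
  also have "Pm j k * cm i k R = cm i j R * Pm j k" using d Pm_rels(2)[of j k i R] by simp
  also have "cm j k R * ((cm i j R * Pm j k) * (Pm i k * (cm i j R * Pm i j)))
    = cm j k R * (cm i j R * (Pm j k * (Pm i k * cm i j R) * Pm i j))" by (simp only: mult.assoc)
  also have "Pm i k * cm i j R = cm k j R * Pm i k" using d Pm_rels(4)[of i k j R] by simp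
  also have "Pm j k * (cm k j R * Pm i k) = cm j k R * (Pm j k * Pm i k)"
    using Pm_rels(3)[of k j i R] d by (simp add: Pm_sym[of j k] mult.assoc[symmetric])
  finally have 2: "A j k * (A i k * A i j) = cm j k R * (cm i j R * cm j k R) * (Pm j k * (Pm i k * Pm i j))"
    by (simp add: mult.assoc)
  \<comment> \<open>Both products are the transposition of i and k.\<close>
  have 3: "Pm i j * (Pm i k * Pm j k) = Pm j k * (Pm i k * Pm i j)"
    by (rule mvec_eqI) (use d in \<open>simp add: app_Pm fun_upd_twist\<close>)
  show ?thesis unfolding 1 2 3 by (simp only: braid[OF assms])
qed

lemma A_flip:
  assumes "i \<noteq> j"
  shows "A j i = cm i j (Pmat ** R)"
proof -
  obtain k :: nat where "k \<noteq> i" "k \<noteq> j" using ex_new_if_finite[of "{i, j}"] by auto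
  then have "A j i = cm j i R * Pm i j" "Pm i j * cm i j R = cm j i R * Pm i j"
    using assms Pm_rels(3)[of i j k R] by (auto simp: A_eq Pm_sym)
  then show ?thesis using assms by (simp add: cm_mult)
qed

text \<open>The two flips in RP and its mirror image cancel, leaving the square of R, to which the
  quadratic relation applies.\<close>

lemma A_unitary:
  assumes "i \<noteq> j"
  shows "A i j * A j i = 1 + lift (spt nu) * (A i j * Pm i j)"
proof -
  obtain k :: nat where k: "k \<noteq> i" "k \<noteq> j" using ex_new_if_finite[of "{i, j}"] by auto
  have PP: "Pm i j * Pm i j = 1" using Pm_rels(6)[of i j k] assms k by auto
  have "A i j * A j i = cm i j R * (Pm i j * Pm i j) * cm i j R"
    unfolding A_flip[OF assms] cm_mult[OF assms] by (simp only: mult.assoc)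
  also have "\<dots> = cm i j (R ** R)" using assms by (simp add: PP cm_mult)
  also have "\<dots> = lift (spt nu) * cm i j R + 1"
    unfolding square cm_add using assms by (simp add: cm_mult cm_mat lift_ring)
  also have "cm i j R = A i j * Pm i j" using assms by (simp add: A_eq mult.assoc PP)
  finally show ?thesis by (simp add: add.commute)
qed

section \<open>The R-matrix on legs\<close>

text \<open>The matrix X on legs i, j with b times the monomial \<delta> substituted for x: the
  operator counterpart of \<open>sleg\<close>.\<close>

definition sm :: "nat \<Rightarrow> nat \<Rightarrow> (nat \<Rightarrow> nat) \<Rightarrow> complex fps \<Rightarrow> complex fps fps ^ ('n \<times> 'n) ^ ('n \<times> 'n) \<Rightarrow> 'n mvec addop" where
  "sm i j \<delta> b X = leg2m i j (\<lambda>p q. sser \<delta> (rescale b (X $ p $ q)))"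

abbreviation Rb :: "nat \<Rightarrow> nat \<Rightarrow> (nat \<Rightarrow> nat) \<Rightarrow> complex fps \<Rightarrow> 'n mvec addop" where
  "Rb i j \<delta> b \<equiv> sm i j \<delta> b (Rbar M R)"

abbreviation Ri :: "nat \<Rightarrow> nat \<Rightarrow> (nat \<Rightarrow> nat) \<Rightarrow> complex fps \<Rightarrow> 'n mvec addop" where
  "Ri i j \<delta> b \<equiv> sm i j \<delta> b (matrix_inv (Rbar M R))"

lemma sm_mult: "i \<noteq> j \<Longrightarrow> \<delta> \<noteq> 0 \<Longrightarrow> sm i j \<delta> b (X ** Y) = sm i j \<delta> b X * sm i j \<delta> b Y"
  by (simp add: sm_def leg2m_mult matrix_matrix_mult_def rescale_sum rescale_mult sser_sum sser_mult)

lemma sm_one: "i \<noteq> j \<Longrightarrow> \<delta> \<noteq> 0 \<Longrightarrow> sm i j \<delta> b (mat 1) = 1"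
  using leg2m_one[of i j] by (simp add: sm_def mat_def if_distrib[of "rescale b"] if_distrib[of "sser \<delta>"] sser_1 cong: if_cong)

lemma Rb_Ri:
  assumes "i \<noteq> j" "\<delta> \<noteq> 0"
  shows "Rb i j \<delta> b * Ri i j \<delta> b = 1" "Ri i j \<delta> b * Rb i j \<delta> b = 1"
  using assms Rbar_invertible[OF M square] sm_one[OF assms] by (simp_all flip: sm_mult)

definition ux :: "(nat \<Rightarrow> nat) \<Rightarrow> complex fps \<Rightarrow> 'n mvec addop" where
  "ux \<delta> b = lift (sser \<delta> (fps_const b * fps_X))"

abbreviation nn :: "'n mvec addop" where "nn \<equiv> lift (spt nu)"

text \<open>R-bar without its scalar factor. It contains \<open>A j i\<close> because PR on legs i,
  j is RP on legs j, i (\<open>A_flip\<close>).\<close>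

definition rp :: "nat \<Rightarrow> nat \<Rightarrow> (nat \<Rightarrow> nat) \<Rightarrow> complex fps \<Rightarrow> 'n mvec addop" where
  "rp i j \<delta> b = (1 - ux \<delta> b) * A j i + nn * ux \<delta> b * Pm i j"

lemma Rb_eq:
  assumes "i \<noteq> j" "\<delta> \<noteq> 0"
  shows "Rb i j \<delta> b = lift (sser \<delta> (rescale b (phi M))) * rp i j \<delta> b"
proof -
  let ?s = "\<lambda>f. sser \<delta> (rescale b f) :: 'n ser addop"
  have e: "?s (Rbar M R $ p $ q)
    = ?s (phi M) * (?s (1 - fps_X) * spt ((Pmat ** R) $ p $ q) + (spt nu * ?s fps_X) * spt (Pmat $ p $ q))" for p q
    unfolding Rbar_nth rescale_mult rescale_add sser_mult[OF assms(2)] sser_add rescale_const sser_const[OF assms(2)] ..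
  have "rescale b (1 - fps_X) = 1 - fps_const b * fps_X"
    by (simp add: fps_eq_iff fps_X_def algebra_simps)
  moreover have "sser \<delta> (1 - f) = 1 - (sser \<delta> f :: 'n ser addop)" for f
    using sser_add[of \<delta> "1 - f" f] sser_1[OF assms(2)] by (metis add_diff_cancel_right' diff_add_cancel)
  ultimately have u: "lift (?s (1 - fps_X)) = 1 - ux \<delta> b" by (simp add: ux_def lift_ring)
  have "Rb i j \<delta> b = lift (?s (phi M)) * (lift (?s (1 - fps_X)) * cm i j (Pmat ** R) + lift (spt nu * ?s fps_X) * Pm i j)"
    unfolding sm_def e leg2m_scale leg2m_add cm_def ..
  then show ?thesis using assms by (simp add: rp_def u lift_ring ux_def rescale_X A_flip)
qed

lemma comm_ux:
  assumes "\<delta> \<noteq> 0"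
  shows "comm (ux \<delta> b) (cm i j X)" "comm (ux \<delta> b) nn" "\<epsilon> \<noteq> 0 \<Longrightarrow> comm (ux \<delta> b) (ux \<epsilon> b')"
  unfolding ux_def using assms
  by (auto intro: comm_sser_cm comm_lift comm_sser_sser comm_sym[OF comm_spt_sser])

lemma comm_ph_rp: "\<delta> \<noteq> 0 \<Longrightarrow> \<epsilon> \<noteq> 0 \<Longrightarrow> comm (lift (sser \<delta> f)) (rp i j \<epsilon> b)"
  unfolding rp_def ux_def
  by (intro comm_ring comm_sser_cm comm_lift comm_sser_sser comm_sym[OF comm_spt_sser])

text \<open>Up to scalars commuting with X and Y, R-bar is a combination of \<open>A j i\<close> and
  the flip, so the product has to be moved past these two only.\<close>

lemma rp_conj:
  assumes \<delta>: "\<delta> \<noteq> 0" and 1: "X * (Y * A j i) = A j i * (Y' * X')" "X * (Y * Pm i j) = Pm i j * (Y' * X')"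
    and c: "comm (lift (sser \<delta> (rescale b (phi M)))) X" "comm (lift (sser \<delta> (rescale b (phi M)))) Y"
     "comm (ux \<delta> b) X" "comm (ux \<delta> b) Y" "comm nn X" "comm nn Y" "i \<noteq> j"
  shows "X * (Y * Rb i j \<delta> b) = Rb i j \<delta> b * (Y' * X')"
proof -
  let ?p = "lift (sser \<delta> (rescale b (phi M)))"
  have m: "comm ?p (X * Y)" "comm (1 - ux \<delta> b) (X * Y)" "comm (nn * ux \<delta> b) (X * Y)"
    using c by (auto intro!: comm_ring)
  have "X * (Y * Rb i j \<delta> b) = (X * Y) * (?p * ((1 - ux \<delta> b) * A j i)) + (X * Y) * (?p * ((nn * ux \<delta> b) * Pm i j))"
    using Rb_eq[OF \<open>i \<noteq> j\<close> \<delta>] by (simp add: rp_def distrib_left mult.assoc)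
  also have "\<dots> = ?p * ((1 - ux \<delta> b) * ((X * Y) * A j i)) + ?p * ((nn * ux \<delta> b) * ((X * Y) * Pm i j))"
    by (simp only: comm_left[OF comm_sym[OF m(1)]] comm_left[OF comm_sym[OF m(2)]] comm_left[OF comm_sym[OF m(3)]])
  also have "\<dots> = Rb i j \<delta> b * (Y' * X')"
    using Rb_eq[OF \<open>i \<noteq> j\<close> \<delta>] 1 by (simp add: rp_def distrib_left distrib_right mult.assoc)
  finally show ?thesis .
qed

text \<open>For the \<open>A j i\<close> part this is the constant Yang--Baxter equation; for the
  flip it is a relabelling of legs. \<open>Rb_beta\<close> is the mirror case with the third leg in
  second position.\<close>

lemma Rb_alpha:
  assumes d: "i \<noteq> j" "j \<noteq> k" "i \<noteq> k" and \<delta>: "\<delta> \<noteq> 0"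
  shows "A k j * (A k i * Rb i j \<delta> b) = Rb i j \<delta> b * (A k i * A k j)"
proof (rule rp_conj[OF \<delta>])
  show "A k j * (A k i * A j i) = A j i * (A k i * A k j)" using A_ybe[of k j i] d by auto
  show "A k j * (A k i * Pm i j) = Pm i j * (A k i * A k j)"
    using d Pm_rels(2)[of i j k "R ** Pmat"] Pm_rels(5)[of i j k "R ** Pmat"]
    by (simp add: mult.assoc[symmetric]) (simp add: mult.assoc)
qed (use d \<delta> in \<open>auto intro: comm_sser_cm comm_ux comm_spt_cm\<close>)

lemma Rb_beta:
  assumes d: "i \<noteq> j" "j \<noteq> l" "i \<noteq> l" and \<delta>: "\<delta> \<noteq> 0"
  shows "A i l * (A j l * Rb i j \<delta> b) = Rb i j \<delta> b * (A j l * A i l)"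
proof (rule rp_conj[OF \<delta>])
  show "A i l * (A j l * A j i) = A j i * (A j l * A i l)" using A_ybe[of j i l] d by auto
  show "A i l * (A j l * Pm i j) = Pm i j * (A j l * A i l)"
    using d Pm_rels(1)[of i j l "R ** Pmat"] Pm_rels(4)[of i j l "R ** Pmat"]
    by (simp add: mult.assoc[symmetric]) (simp add: mult.assoc)
qed (use d \<delta> in \<open>auto intro: comm_sser_cm comm_ux comm_spt_cm\<close>)

lemma inverse_conj:
  fixes r :: "'a::monoid_mult"
  assumes "x * (y * r) = r * (y' * x')" "r * ri = 1" "ri * r = 1"
  shows "ri * (x * y) = y' * (x' * ri)"
proof -
  have "ri * (x * y) = ri * (x * (y * r)) * ri" by (simp add: mult.assoc assms(2))
  also have "\<dots> = (ri * r) * (y' * (x' * ri))" by (simp only: assms(1) mult.assoc)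
  finally show ?thesis by (simp add: assms(3))
qed

lemma Ri_beta:
  assumes d: "i \<noteq> j" "j \<noteq> l" "i \<noteq> l" and \<delta>: "\<delta> \<noteq> 0"
  shows "Ri i j \<delta> b * (A i l * A j l) = A j l * (A i l * Ri i j \<delta> b)"
  by (rule inverse_conj[OF Rb_beta Rb_Ri]) (use assms in auto)

text \<open>The cubic relations asked for by \<open>spectral_ybe\<close> follow by moving flips to
  the right (\<open>PB\<close>), except for the braid relation itself and for B P B.\<close>

lemma rp_ybe:
  assumes d: "i \<noteq> j" "j \<noteq> k" "i \<noteq> k" and \<delta>: "\<delta> \<noteq> 0" and \<epsilon>: "\<epsilon> \<noteq> 0"
  shows "rp i j \<delta> b * (rp i k (\<delta> + \<epsilon>) (b * c) * rp j k \<epsilon> c) = rp j k \<epsilon> c * (rp i k (\<delta> + \<epsilon>) (b * c) * rp i j \<delta> b)"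
proof -
  have uv: "ux (\<delta> + \<epsilon>) (b * c) = ux \<delta> b * ux \<epsilon> c"
    unfolding ux_def using sser_X_mult[OF \<delta> \<epsilon>] by (metis lift_ring(3))
  note d' = d d[symmetric]
  define S where "S = R ** Pmat"
  have PB: "Pm i j * cm k i S = cm k j S * Pm i j" "Pm i j * cm k j S = cm k i S * Pm i j"
    "Pm i k * cm k j S = cm i j S * Pm i k" "Pm i k * cm j i S = cm j k S * Pm i k"
    "Pm j k * cm k i S = cm j i S * Pm j k" "Pm j k * cm j i S = cm k i S * Pm j k"
    "Pm i j * cm j i S = cm i j S * Pm i j" "Pm i k * cm k i S = cm i k S * Pm i k" "Pm j k * cm k j S = cm j k S * Pm j k"
    "Pm i j * cm i j S = cm j i S * Pm i j" "Pm i k * cm i k S = cm k i S * Pm i k" "Pm j k * cm j k S = cm k j S * Pm j k"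
    "Pm i k * cm i j S = cm k j S * Pm i k" "Pm i k * cm j k S = cm j i S * Pm i k"
    using d' Pm_rels(5)[of i j k S] Pm_rels(2)[of i j k S] Pm_rels(1)[of i k j S] Pm_rels(2)[of i k j S]
      Pm_rels(5)[of i k j S] Pm_rels(1)[of j k i S] Pm_rels(4)[of j k i S] Pm_rels(4)[of i k j S]
      Pm_rels(3)[of j i k S] Pm_rels(3)[of k i j S] Pm_rels(3)[of k j i S]
      Pm_rels(3)[of i j k S] Pm_rels(3)[of i k j S] Pm_rels(3)[of j k i S]
    by (simp_all add: Pm_sym[of i j] Pm_sym[of i k] Pm_sym[of j k])
  note PB' = PB PB[THEN mult_left_cong]
  have Y1: "Pm i j * (Pm i k * Pm j k) = Pm j k * (Pm i k * Pm i j)"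
    and s1: "Pm i j * Pm i k = Pm j k * Pm i j" and s2: "Pm i k * Pm j k = Pm j k * Pm i j"
    and t1: "Pm i k * Pm i j = Pm i j * Pm j k" and t2: "Pm j k * Pm i k = Pm i j * Pm j k"
    by (rule mvec_eqI; use d' in \<open>simp add: app_Pm fun_upd_twist\<close>)+
  \<comment> \<open>X and Y are the normal forms of the words with two flips.\<close>
  define X where "X = cm j i S * (Pm i k * Pm j k)"
  define Y where "Y = cm k j S * (Pm i k * Pm i j)"
  show ?thesis
    unfolding rp_def uv S_def[symmetric]
  proof (rule spectral_ybe[where X = X and Y = Y])
    show "comm a x" if "a \<in> {ux \<delta> b, ux \<epsilon> c, nn}"
       "x \<in> {ux \<delta> b, ux \<epsilon> c, nn, cm j i S, cm k i S, cm k j S, Pm i j, Pm i k, Pm j k}" for a x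
      using that comm_ux[OF \<delta>] comm_ux[OF \<epsilon>] comm_spt_cm \<delta> \<epsilon>
      by (auto intro: comm_sym comm_lift comm_spt_spt)
    show "cm j i S * (cm k i S * cm k j S) = cm k j S * (cm k i S * cm j i S)"
      unfolding S_def using A_ybe[of k j i] d' by auto
    show "Pm i j * (cm k i S * cm k j S) = cm k j S * (cm k i S * Pm i j)"
      by (simp add: PB' mult.assoc)
    show "cm j i S * (cm k i S * Pm j k) = Pm j k * (cm k i S * cm j i S)"
      by (simp add: PB' mult.assoc)
    show "Pm i j * (Pm i k * cm k j S) = X"
      by (simp add: PB' X_def s1 s2)
    show "Pm j k * (cm k i S * Pm i j) = X" by (simp add: PB' X_def s2)
    show "cm j i S * (Pm i k * Pm j k) = X" by (simp add: X_def)
    show "cm k j S * (Pm i k * Pm i j) = Y" by (simp add: Y_def)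
    show "Pm i j * (cm k i S * Pm j k) = Y" by (simp add: PB' Y_def t1)
    show "Pm j k * (Pm i k * cm j i S) = Y" by (simp add: PB' Y_def t1 t2)
    show "Pm i j * (Pm i k * Pm j k) = Pm j k * (Pm i k * Pm i j)" by (rule Y1)
    \<comment> \<open>Here the Hecke relation enters: moving the flip to the front of B P B brings
      together RP and its mirror image, whose product is not 1.\<close>
    have un1: "cm j k S * cm k j S = 1 + nn * (cm j k S * Pm j k)"
      and un2: "cm i j S * cm j i S = 1 + nn * (cm i j S * Pm i j)"
      unfolding S_def using A_unitary d by auto
    have cn: "Pm i k * (nn * z) = nn * (Pm i k * z)" for z
      by (rule comm_left[OF comm_sym[OF comm_spt_cm]])
    have "cm j i S * (Pm i k * cm k j S) = Pm i k * (cm j k S * cm k j S)"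
      by (simp add: PB')
    also have "\<dots> = Pm i k + nn * X" unfolding un1 by (simp add: distrib_left cn PB' X_def)
    finally have 1: "cm j i S * (Pm i k * cm k j S) = Pm i k + nn * X" .
    have "cm k j S * (Pm i k * cm j i S) = Pm i k * (cm i j S * cm j i S)"
      by (simp add: PB')
    also have "\<dots> = Pm i k + nn * Y" unfolding un2 by (simp add: distrib_left cn PB' Y_def)
    finally have 2: "cm k j S * (Pm i k * cm j i S) = Pm i k + nn * Y" .
    show "cm j i S * (Pm i k * cm k j S) = cm k j S * (Pm i k * cm j i S) + nn * (X - Y)"
      unfolding 1 2 by (simp add: right_diff_distrib)
  qed
qed

lemma Rb_ybe:
  assumes d: "i \<noteq> j" "j \<noteq> k" "i \<noteq> k" and \<delta>: "\<delta> \<noteq> 0" and \<epsilon>: "\<epsilon> \<noteq> 0"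
  shows "Rb i j \<delta> b * (Rb i k (\<delta> + \<epsilon>) (b * c) * Rb j k \<epsilon> c) = Rb j k \<epsilon> c * (Rb i k (\<delta> + \<epsilon>) (b * c) * Rb i j \<delta> b)"
proof -
  have \<delta>\<epsilon>: "\<delta> + \<epsilon> \<noteq> 0" using \<delta> by (auto simp: fun_eq_iff)
  define p1 p2 p3 where "p1 = lift (sser \<delta> (rescale b (phi M)) :: 'n ser addop)"
    and "p2 = lift (sser (\<delta> + \<epsilon>) (rescale (b * c) (phi M)) :: 'n ser addop)"
    and "p3 = lift (sser \<epsilon> (rescale c (phi M)) :: 'n ser addop)"
  define r1 r2 r3 where "r1 = rp i j \<delta> b" and "r2 = rp i k (\<delta> + \<epsilon>) (b * c)" and "r3 = rp j k \<epsilon> c"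
  have E: "Rb i j \<delta> b = p1 * r1" "Rb i k (\<delta> + \<epsilon>) (b * c) = p2 * r2" "Rb j k \<epsilon> c = p3 * r3"
    using assms \<delta>\<epsilon> by (simp_all add: Rb_eq p1_def p2_def p3_def r1_def r2_def r3_def)
  have c: "r1 * (p2 * z) = p2 * (r1 * z)" "r1 * (p3 * z) = p3 * (r1 * z)" "r2 * (p3 * z) = p3 * (r2 * z)"
    "r2 * (p1 * z) = p1 * (r2 * z)" "r3 * (p2 * z) = p2 * (r3 * z)" "r3 * (p1 * z) = p1 * (r3 * z)"
    "p3 * (p2 * z) = p2 * (p3 * z)" "p2 * (p1 * z) = p1 * (p2 * z)" "p3 * (p1 * z) = p1 * (p3 * z)" for z
    unfolding p1_def p2_def p3_def r1_def r2_def r3_def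
    by (intro comm_left comm_sym[OF comm_ph_rp] comm_lift comm_sser_sser \<delta> \<epsilon> \<delta>\<epsilon>)+
  have "r1 * (r2 * r3) = r3 * (r2 * r1)"
    unfolding r1_def r2_def r3_def by (rule rp_ybe[OF assms])
  then show ?thesis unfolding E by (simp add: mult.assoc c)
qed

end

section \<open>Moving an operator through a bracket\<close>

text \<open>The bracket over any list of labels. Both orders of two labels are needed for the
  relations of the algebra, see \<open>T_rho\<close>.\<close>

primrec brk :: "(nat \<Rightarrow> 'a::monoid_mult) \<Rightarrow> (nat \<Rightarrow> nat \<Rightarrow> 'a) \<Rightarrow> nat list \<Rightarrow> 'a" where
  "brk L A [] = 1"
| "brk L A (k # ks) = L k * (prod_list (map (A k) ks) * brk L A ks)"

text \<open>Legs and series are hidden, since what follows is algebra in a ring: \<open>t\<close> is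
  the exchange relation with one factor, \<open>ri\<close> and \<open>rb\<close> are mixed
  Yang--Baxter equations, and the remaining axioms express that operators on disjoint legs or
  variables commute.\<close>

locale exchange =
  fixes T :: "'a::{ring,monoid_mult}" and A :: "nat \<Rightarrow> nat \<Rightarrow> 'a" and Rb Ri L :: "nat \<Rightarrow> 'a"
    and z :: nat and S :: "nat set"
  assumes z: "z \<notin> S"
    and t: "\<And>k. k \<in> S \<Longrightarrow> T * (A z k * L k) = Rb k * (L k * (A k z * (T * Ri k)))"
    and ri: "\<And>k l. k \<in> S \<Longrightarrow> l \<in> S \<Longrightarrow> k \<noteq> l \<Longrightarrow> Ri k * (A z l * A k l) = A k l * (A z l * Ri k)"
    and rb: "\<And>k l. k \<in> S \<Longrightarrow> l \<in> S \<Longrightarrow> k \<noteq> l \<Longrightarrow> A k z * (A k l * Rb l) = Rb l * (A k l * A k z)"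
    and cTA: "\<And>k l. k \<in> S \<Longrightarrow> l \<in> S \<Longrightarrow> k \<noteq> l \<Longrightarrow> comm T (A k l)"
    and cAL: "\<And>k l. k \<in> S \<Longrightarrow> l \<in> S \<Longrightarrow> k \<noteq> l \<Longrightarrow> comm (A z k) (L l)"
    and cAL': "\<And>k l. k \<in> S \<Longrightarrow> l \<in> S \<Longrightarrow> k \<noteq> l \<Longrightarrow> comm (A k z) (L l)"
    and cRiL: "\<And>k l. k \<in> S \<Longrightarrow> l \<in> S \<Longrightarrow> k \<noteq> l \<Longrightarrow> comm (Ri k) (L l)"
    and cRbL: "\<And>k l. k \<in> S \<Longrightarrow> l \<in> S \<Longrightarrow> k \<noteq> l \<Longrightarrow> comm (L k) (Rb l)"
    and cAA: "\<And>k l m. k \<in> S \<Longrightarrow> l \<in> S \<Longrightarrow> m \<in> S \<Longrightarrow> distinct [k, l, m] \<Longrightarrow> comm (A z m) (A k l)"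
    and cAA': "\<And>k l m. k \<in> S \<Longrightarrow> l \<in> S \<Longrightarrow> m \<in> S \<Longrightarrow> distinct [k, l, m] \<Longrightarrow> comm (A m z) (A k l)"
    and cRiA: "\<And>k l m. k \<in> S \<Longrightarrow> l \<in> S \<Longrightarrow> m \<in> S \<Longrightarrow> distinct [k, l, m] \<Longrightarrow> comm (Ri m) (A k l)"
    and cRbA: "\<And>k l m. k \<in> S \<Longrightarrow> l \<in> S \<Longrightarrow> m \<in> S \<Longrightarrow> distinct [k, l, m] \<Longrightarrow> comm (A k l) (Rb m)"
begin

abbreviation "PA k ks \<equiv> prod_list (map (A k) ks)"

text \<open>Carries the inverse R-matrix created at leg k past one leg after another with
  \<open>ri\<close>; factors on disjoint pairs of legs can be sorted accordingly.\<close>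

lemma Ri_PA:
  "k \<in> S \<Longrightarrow> set ks \<subseteq> S \<Longrightarrow> distinct (k # ks) \<Longrightarrow> Ri k * (PA z ks * PA k ks) = PA k ks * (PA z ks * Ri k)"
proof (induction ks)
  case (Cons l ks)
  have c1: "comm (PA z ks) (A k l)"
    by (rule comm_sym, rule comm_prod_list) (use Cons.prems in \<open>auto intro!: comm_sym[OF cAA]\<close>)
  have c2: "comm (A z l) (PA k ks)"
    by (rule comm_prod_list) (use Cons.prems in \<open>auto intro!: cAA\<close>)
  have "Ri k * (PA z (l # ks) * PA k (l # ks)) = Ri k * (A z l * (PA z ks * (A k l * PA k ks)))"
    by (simp add: mult.assoc)
  also have "\<dots> = (Ri k * (A z l * A k l)) * (PA z ks * PA k ks)"
    unfolding comm_left[OF c1] by (simp only: mult.assoc)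
  also have "\<dots> = A k l * (A z l * (Ri k * (PA z ks * PA k ks)))"
    using Cons.prems by (subst ri) (auto simp: mult.assoc)
  also have "Ri k * (PA z ks * PA k ks) = PA k ks * (PA z ks * Ri k)" using Cons by auto
  also have "A z l * (PA k ks * (PA z ks * Ri k)) = PA k ks * (A z l * (PA z ks * Ri k))"
    by (rule comm_left[OF c2])
  finally show ?case by (simp add: mult.assoc)
qed simp

lemma A_PA_Rb:
  "k \<in> S \<Longrightarrow> set ks \<subseteq> S \<Longrightarrow> distinct (k # ks) \<Longrightarrow>
    A k z * (PA k ks * prod_list (map Rb ks)) = prod_list (map Rb ks) * (PA k ks * A k z)"
proof (induction ks)
  case (Cons l ks)
  let ?R = "prod_list (map Rb ks)"
  have c1: "comm (PA k ks) (Rb l)"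
    by (rule comm_sym, rule comm_prod_list) (use Cons.prems in \<open>auto intro!: comm_sym[OF cRbA]\<close>)
  have c2: "comm (A k l) ?R"
    by (rule comm_prod_list) (use Cons.prems in \<open>auto intro!: cRbA\<close>)
  have "A k z * (PA k (l # ks) * prod_list (map Rb (l # ks))) = A k z * (A k l * (PA k ks * (Rb l * ?R)))"
    by (simp add: mult.assoc)
  also have "\<dots> = (A k z * (A k l * Rb l)) * (PA k ks * ?R)"
    unfolding comm_left[OF c1] by (simp only: mult.assoc)
  also have "\<dots> = Rb l * (A k l * (A k z * (PA k ks * ?R)))"
    using Cons.prems by (subst rb) (auto simp: mult.assoc)
  also have "A k z * (PA k ks * ?R) = ?R * (PA k ks * A k z)" using Cons by auto
  also have "A k l * (?R * (PA k ks * A k z)) = ?R * (A k l * (PA k ks * A k z))"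
    by (rule comm_left[OF c2])
  finally show ?case by (simp add: mult.assoc)
qed simp

lemma comm_brk:
  assumes "\<And>l. l \<in> set ks \<Longrightarrow> comm x (L l)"
    and "\<And>l m. l \<in> set ks \<Longrightarrow> m \<in> set ks \<Longrightarrow> l \<noteq> m \<Longrightarrow> comm x (A l m)" and "distinct ks"
  shows "comm x (brk L A ks)"
  using assms
proof (induction ks)
  case Nil
  then show ?case by (simp add: comm_ring)
next
  case (Cons k ks)
  show ?case
    by (simp, intro comm_ring comm_prod_list) (use Cons in auto)
qed

text \<open>Passing T through the leading L creates an R-matrix on its left and an inverse on its
  right. The inverse travels to the right end (\<open>Ri_PA\<close>), so inverses pile up in
  reversed order, while the R-matrices created by the tail travel to the left end
  (\<open>A_PA_Rb\<close>).\<close>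

theorem brk_exchange:
  "set ks \<subseteq> S \<Longrightarrow> distinct ks \<Longrightarrow> T * (PA z ks * brk L A ks)
    = prod_list (map Rb ks) * (brk L A ks * (prod_list (map (\<lambda>k. A k z) ks) * (T * prod_list (map Ri (rev ks)))))"
proof (induction ks)
  case (Cons k ks)
  let ?B = "brk L A ks" and ?R = "prod_list (map Rb ks)" and ?Q = "prod_list (map Ri (rev ks))"
    and ?A' = "prod_list (map (\<lambda>k. A k z) ks)"
  have k: "k \<in> S" "k \<notin> set ks" "set ks \<subseteq> S" "distinct ks" using Cons.prems by auto
  have c1: "comm (PA z ks) (L k)"
    by (rule comm_sym, rule comm_prod_list) (use k in \<open>auto intro!: comm_sym[OF cAL]\<close>)
  have c2: "comm T (PA k ks)" by (rule comm_prod_list) (use k in \<open>auto intro!: cTA\<close>)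
  have c3: "comm (Ri k) ?B" by (rule comm_brk) (use k in \<open>auto intro!: cRiL cRiA\<close>)
  have c4: "comm (L k) ?R" by (rule comm_prod_list) (use k in \<open>auto intro!: cRbL\<close>)
  have c5: "comm (A k z) ?B" by (rule comm_brk) (use k in \<open>auto intro!: cAL' cAA'\<close>)
  have "T * (PA z (k # ks) * brk L A (k # ks)) = T * (A z k * (PA z ks * (L k * (PA k ks * ?B))))"
    by (simp add: mult.assoc)
  also have "\<dots> = (T * (A z k * L k)) * (PA z ks * (PA k ks * ?B))"
    unfolding comm_left[OF c1] by (simp only: mult.assoc)
  also have "\<dots> = Rb k * (L k * (A k z * (T * (Ri k * (PA z ks * PA k ks) * ?B))))"
    unfolding t[OF k(1)] by (simp only: mult.assoc)
  also have "Ri k * (PA z ks * PA k ks) * ?B = PA k ks * (PA z ks * (Ri k * ?B))"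
    using Ri_PA[of k ks] k by (simp add: mult.assoc)
  also have "Ri k * ?B = ?B * Ri k" using c3 by (simp add: comm_def)
  also have "T * (PA k ks * (PA z ks * (?B * Ri k))) = PA k ks * ((T * (PA z ks * ?B)) * Ri k)"
    unfolding comm_left[OF c2] by (simp only: mult.assoc)
  also have "T * (PA z ks * ?B) = ?R * (?B * (?A' * (T * ?Q)))" using Cons k by auto
  also have "Rb k * (L k * (A k z * (PA k ks * (?R * (?B * (?A' * (T * ?Q))) * Ri k))))
    = Rb k * (L k * ((A k z * (PA k ks * ?R)) * (?B * (?A' * (T * (?Q * Ri k))))))"
    by (simp only: mult.assoc)
  also have "A k z * (PA k ks * ?R) = ?R * (PA k ks * A k z)"
    using A_PA_Rb[of k ks] k by simp
  also have "Rb k * (L k * ((?R * (PA k ks * A k z)) * (?B * (?A' * (T * (?Q * Ri k))))))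
    = Rb k * (L k * (?R * (PA k ks * (A k z * (?B * (?A' * (T * (?Q * Ri k))))))))"
    by (simp only: mult.assoc)
  also have "\<dots> = Rb k * (?R * (L k * (PA k ks * (?B * (A k z * (?A' * (T * (?Q * Ri k))))))))"
    unfolding comm_left[OF c4] comm_left[OF c5] ..
  finally show ?case by (simp add: mult.assoc)
qed simp

end

section \<open>Construction of the operator\<close>

context
  fixes H :: "'n::finite \<Rightarrow> 'n \<Rightarrow> 'n \<Rightarrow> 'n \<Rightarrow> ('n \<times> 'n \<times> 'n \<times> 'n) \<Rightarrow> complex fps fps"
begin

text \<open>A letter is 0 or 1 minus \<open>lplus\<close>, and T is to be moved past
  \<open>lplus\<close> by the exchange relation. The degree k of \<open>H\<close> in y/x is taken
  both from the exponent s of y and from the exponent r of 1/x.\<close>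

primrec tword :: "'n gen list \<Rightarrow> 'n \<Rightarrow> 'n \<Rightarrow> nat \<Rightarrow> 'n falg" where
  "tword [] i a r = (if i = a \<and> r = 0 then 1 else 0)"
| "tword (g # w) i a r = (case g of (b, l, s) \<Rightarrow> (if b = l \<and> s = 0 then tword w i a r else 0) -
     (\<Sum>c\<in>UNIV. \<Sum>k\<le>min r s. case c of (q, q', p, p') \<Rightarrow>
        falg_const (fps_nth (H i a b l c) k) * (lplus q q' (s - k) * tword w p p' (r - k))))"

definition tlin :: "'n \<Rightarrow> 'n \<Rightarrow> nat \<Rightarrow> 'n falg addop" where
  "tlin i a r = ext (\<lambda>f. case f of FMon w \<Rightarrow> tword w i a r)"

lemma linop_tlin: "linop (tlin i a r)"
  unfolding tlin_def by (rule linop_ext)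

lemma tlin_word: "app (tlin i a r) (word w) = tword w i a r"
  by (simp add: tlin_def ext_word)

lemma tlin_one: "app (tlin i a r) 1 = (if i = a \<and> r = 0 then 1 else 0)"
  using tlin_word[of i a r "[]"] by (simp add: word_Nil)

lemma linop_sum: "(\<And>x. x \<in> X \<Longrightarrow> linop (f x)) \<Longrightarrow> linop (sum f X)"
  by (induction X rule: infinite_finite_induct) auto

lemma tlin_rec:
  "tlin i a r * lmul (lplus b l s) = (\<Sum>c\<in>UNIV. \<Sum>k\<le>min r s. smul (fps_nth (H i a b l c) k) *
     (case c of (q, q', p, p') \<Rightarrow> lmul (lplus q q' (s - k)) * tlin p p' (r - k)))"
proof (rule linop_eq_word)
  show "linop (\<Sum>c\<in>UNIV. \<Sum>k\<le>min r s. smul (fps_nth (H i a b l c) k) *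
     (case c of (q, q', p, p') \<Rightarrow> lmul (lplus q q' (s - k)) * tlin p p' (r - k)))"
    by (intro linop_sum linop_ring linop_smul) (auto intro!: linop_ring linop_tlin)
  fix w
  have "lplus b l s * word w = (if b = l \<and> s = 0 then word w else 0) - word ((b, l, s) # w)"
    by (simp add: word_Cons lplus_def left_diff_distrib del: fps_const_mult)
  then have "app (tlin i a r * lmul (lplus b l s)) (word w)
    = (if b = l \<and> s = 0 then tword w i a r else 0) - tword ((b, l, s) # w) i a r"
    by (simp add: app_diff tlin_word if_distrib[of "app _"] del: tword.simps cong: if_cong)
  also have "\<dots> = app (\<Sum>c\<in>UNIV. \<Sum>k\<le>min r s. smul (fps_nth (H i a b l c) k) *
     (case c of (q, q', p, p') \<Rightarrow> lmul (lplus q q' (s - k)) * tlin p p' (r - k))) (word w)"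
    by (auto simp: app_sum_left tlin_word split_def intro!: sum.cong)
  finally show "app (tlin i a r * lmul (lplus b l s)) (word w)
    = app (\<Sum>c\<in>UNIV. \<Sum>k\<le>min r s. smul (fps_nth (H i a b l c) k) *
     (case c of (q, q', p, p') \<Rightarrow> lmul (lplus q q' (s - k)) * tlin p p' (r - k))) (word w)" .
qed (intro linop_ring linop_tlin linop_lmul)

text \<open>A letter with index s lowers r by at most s, so on a word T is a polynomial in
  1/x.\<close>

lemma tword_decay: "\<exists>r0. \<forall>r\<ge>r0. \<forall>i a. tword w i a r = 0"
proof (induction w)
  case Nil
  then show ?case by (intro exI[of _ 1]) auto
next
  case (Cons g w)
  then obtain r0 where r0: "\<And>r i a. r \<ge> r0 \<Longrightarrow> tword w i a r = 0" by blast
  obtain b l s where g: "g = (b, l, s)" by (cases g) auto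
  show ?case
    by (rule exI[of _ "r0 + s"]) (auto simp: g r0 intro!: sum.neutral)
qed

end

definition Lop :: "nat \<Rightarrow> (nat \<Rightarrow> nat) \<Rightarrow> 'n::finite mvec addop" where
  "Lop k \<epsilon> = leg1m k (\<lambda>a b. cser \<epsilon> (\<lambda>r. lmul (lplus a b r)))"

definition Top :: "('n::finite \<Rightarrow> 'n \<Rightarrow> nat \<Rightarrow> 'n falg addop) \<Rightarrow> nat \<Rightarrow> (nat \<Rightarrow> nat) \<Rightarrow> 'n mvec addop" where
  "Top T k \<delta> = leg1m k (\<lambda>a b. cser \<delta> (T a b))"

text \<open>\<open>b1\<close> and \<open>b2\<close> stand for e^{hc/a} and e^{-hc/a}, which are both
  1 modulo h.\<close>

locale tdata = hecke_data R Psi M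
  for R Psi :: "complex fps ^ ('n::finite \<times> 'n) ^ ('n \<times> 'n)" and M :: nat +
  fixes b1 b2 :: "complex fps"
  assumes b1: "fps_nth b1 0 = 1" and b2: "fps_nth b2 0 = 1"
begin

abbreviation "rb p q \<equiv> rescale b1 (Rbar M R $ p $ q)"
abbreviation "ri p q \<equiv> rescale b2 (matrix_inv (Rbar M R) $ p $ q)"

text \<open>
  The coefficients of the exchange relation of \<open>L\<^sup>-\<close> with \<open>L\<^sup>+\<close> after the matrix \<open>RP\<close> standing
  between the two has been removed by means of \<open>Psi\<close>; \<open>H\<close> then drives the recursion on words.
\<close>

definition W :: "'n \<Rightarrow> 'n \<Rightarrow> 'n \<Rightarrow> 'n \<Rightarrow> ('n \<times> 'n \<times> 'n \<times> 'n) \<Rightarrow> complex fps fps" where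
  "W k j i l = (\<lambda>(q, q', p', p''). \<Sum>p\<in>UNIV. \<Sum>m\<in>UNIV.
     fps_const ((R ** Pmat) $ (q', p) $ (m, p')) * (rb (k, i) (q, p) * ri (p'', m) (j, l)))"

definition H :: "'n \<Rightarrow> 'n \<Rightarrow> 'n \<Rightarrow> 'n \<Rightarrow> ('n \<times> 'n \<times> 'n \<times> 'n) \<Rightarrow> complex fps fps" where
  "H i a b l c = (\<Sum>k\<in>UNIV. \<Sum>j\<in>UNIV. fps_const (Psi $ (j, b) $ (k, a)) * W k j i l c)"

lemma RP_nth: "(R ** Pmat) $ p $ q = R $ p $ prod.swap q"
proof -
  have "(R ** Pmat) $ p $ q = (\<Sum>t\<in>UNIV. if t = prod.swap q then R $ p $ t else 0)"
    unfolding matrix_matrix_mult_def vec_lambda_beta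
    by (rule sum.cong) (auto simp: Pmat_nth)
  then show ?thesis by simp
qed

text \<open>\<open>H\<close> arises from \<open>W\<close> by contraction with \<open>Psi\<close>;
  contraction with RP undoes this by \<open>skew2\<close>.\<close>

lemma skew_W:
  "(\<Sum>t\<in>UNIV. \<Sum>s\<in>UNIV. fps_const ((R ** Pmat) $ (t, k0) $ (j0, s)) * H i t s l c) = W k0 j0 i l c"
proof -
  have "(\<Sum>t\<in>UNIV. \<Sum>s\<in>UNIV. fps_const ((R ** Pmat) $ (t, k0) $ (j0, s)) * H i t s l c)
    = (\<Sum>t\<in>UNIV. \<Sum>s\<in>UNIV. \<Sum>k\<in>UNIV. \<Sum>j\<in>UNIV.
        fps_const (Psi $ (j, s) $ (k, t) * R $ (t, k0) $ (s, j0)) * W k j i l c)"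
    unfolding H_def RP_nth sum_distrib_left
    by (intro sum.cong refl) (simp add: mult.assoc[symmetric] mult.commute)
  also have "\<dots> = (\<Sum>k\<in>UNIV. \<Sum>j\<in>UNIV. \<Sum>t\<in>UNIV. \<Sum>s\<in>UNIV.
        fps_const (Psi $ (j, s) $ (k, t) * R $ (t, k0) $ (s, j0)) * W k j i l c)"
    unfolding sum.cartesian_product
    by (rule sum.reindex_bij_witness[of _ "\<lambda>(k, j, t, s). (t, s, k, j)" "\<lambda>(t, s, k, j). (k, j, t, s)"]) auto
  also have "\<dots> = (\<Sum>k\<in>UNIV. \<Sum>j\<in>UNIV. 
        fps_const (\<Sum>t\<in>UNIV. \<Sum>s\<in>UNIV. Psi $ (j, s) $ (k, t) * R $ (t, k0) $ (s, j0)) * W k j i l c)"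
  proof -
    have "fps_const (sum f X) = (\<Sum>x\<in>X. fps_const (f x))" for f :: "'n \<Rightarrow> complex fps" and X
      by (induction X rule: infinite_finite_induct) (simp_all flip: fps_const_add)
    then show ?thesis by (simp only: sum_distrib_right)
  qed
  also have "\<dots> = (\<Sum>k\<in>UNIV. if k = k0 then \<Sum>j\<in>UNIV. if j = j0 then W k j i l c else 0 else 0)"
    unfolding skew2 by (intro sum.cong refl) (auto intro!: sum.cong simp del: sum.delta sum.delta')
  finally show ?thesis by simp
qed

abbreviation T :: "'n \<Rightarrow> 'n \<Rightarrow> nat \<Rightarrow> 'n falg addop" where "T \<equiv> tlin H"

abbreviation "TT \<delta> a b \<equiv> cser \<delta> (T a b)"
abbreviation LL :: "(nat \<Rightarrow> nat) \<Rightarrow> 'n \<Rightarrow> 'n \<Rightarrow> 'n ser addop" where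
  "LL \<epsilon> a b \<equiv> cser \<epsilon> (\<lambda>r. lmul (lplus a b r))"

lemma TT_LL:
  assumes "\<delta> \<noteq> 0" "\<epsilon> \<noteq> 0"
  shows "TT \<delta> i a * LL \<epsilon> b l = (\<Sum>c\<in>UNIV. sser (\<delta> + \<epsilon>) (H i a b l c) * (case c of (q, q', p, p') \<Rightarrow> LL \<epsilon> q q' * TT \<delta> p p'))"
proof -
  have "TT \<delta> i a * LL \<epsilon> b l = (\<Sum>c\<in>UNIV. sser (\<delta> + \<epsilon>) (H i a b l c) *
     (cser \<epsilon> (\<lambda>s. case c of (q, q', p, p') \<Rightarrow> lmul (lplus q q' s)) * cser \<delta> (\<lambda>r. case c of (q, q', p, p') \<Rightarrow> T p p' r)))"
    by (rule mult_recursion[OF assms]) (simp add: tlin_rec split_def)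
  then show ?thesis by (simp add: split_def)
qed

lemma comm_sser_TT: "\<delta> \<noteq> 0 \<Longrightarrow> \<epsilon> \<noteq> 0 \<Longrightarrow> comm (sser \<epsilon> f) (TT \<delta> a b)"
  by (intro comm_sser fin_mexp linop_tlin)

lemma comm_sser_LL: "\<delta> \<noteq> 0 \<Longrightarrow> \<epsilon> \<noteq> 0 \<Longrightarrow> comm (sser \<epsilon> f) (LL \<delta> a b)"
  by (intro comm_sser fin_mexp linop_lmul)

lemma comm_spt_TT: "\<delta> \<noteq> 0 \<Longrightarrow> comm (spt s) (TT \<delta> a b)"
  by (intro comm_spt fin_mexp linop_tlin)

lemma comm_spt_LL: "\<delta> \<noteq> 0 \<Longrightarrow> comm (spt s) (LL \<delta> a b)"
  by (intro comm_spt fin_mexp linop_lmul)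

text \<open>The recursion was designed for this: putting RP back between T and L replaces
  \<open>H\<close> by \<open>W\<close> (\<open>skew_W\<close>), and \<open>W\<close> collects the
  scalar factors of the right-hand side.\<close>

lemma T_relation:
  assumes ij: "i \<noteq> j" and \<delta>: "\<delta> \<noteq> 0" and \<epsilon>: "\<epsilon> \<noteq> 0"
  shows "Top T i \<delta> * (A i j * Lop j \<epsilon>)
    = Rb j i (\<delta> + \<epsilon>) b1 * (Lop j \<epsilon> * (A j i * (Top T i \<delta> * Ri i j (\<delta> + \<epsilon>) b2)))"
proof -
  have nz: "\<delta> + \<epsilon> \<noteq> 0" using \<delta> by (auto simp: fun_eq_iff)
  let ?S = "sser (\<delta> + \<epsilon>) :: _ \<Rightarrow> 'n ser addop"
  let ?LT = "\<lambda>c. case c of (q, q', p, p') \<Rightarrow> LL \<epsilon> q q' * TT \<delta> p p'"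
  \<comment> \<open>The common matrix entries of both sides, written as scalar series times an entry
    of L times an entry of T.\<close>
  define F where "F = (\<lambda>p q. \<Sum>c\<in>UNIV. ?S (W (snd p) (fst q) (fst p) (snd q) c) * ?LT c)"
  have "Top T i \<delta> * (A i j * Lop j \<epsilon>) = leg2m i j (\<lambda>p q. \<Sum>t\<in>UNIV. TT \<delta> (fst p) t *
      (\<Sum>s\<in>UNIV. spt ((R ** Pmat) $ (t, snd p) $ (fst q, s)) * LL \<epsilon> s (snd q)))"
    unfolding Top_def Lop_def cm_def leg2m_leg1m_second[OF ij] leg1m_leg2m_first[OF ij] ..
  also have "(\<lambda>p q. \<Sum>t\<in>UNIV. TT \<delta> (fst p) t *
      (\<Sum>s\<in>UNIV. spt ((R ** Pmat) $ (t, snd p) $ (fst q, s)) * LL \<epsilon> s (snd q))) = F"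
  proof (intro ext)
    fix p q :: "'n \<times> 'n"
    have "(\<Sum>t\<in>UNIV. TT \<delta> (fst p) t *
        (\<Sum>s\<in>UNIV. spt ((R ** Pmat) $ (t, snd p) $ (fst q, s)) * LL \<epsilon> s (snd q)))
      = (\<Sum>t\<in>UNIV. \<Sum>s\<in>UNIV. spt ((R ** Pmat) $ (t, snd p) $ (fst q, s)) * (TT \<delta> (fst p) t * LL \<epsilon> s (snd q)))"
      unfolding sum_distrib_left comm_left[OF comm_sym[OF comm_spt_TT[OF \<delta>]]] ..
    also have "\<dots> = (\<Sum>t\<in>UNIV. \<Sum>s\<in>UNIV. \<Sum>c\<in>UNIV. 
         ?S (fps_const ((R ** Pmat) $ (t, snd p) $ (fst q, s)) * H (fst p) t s (snd q) c) * ?LT c)"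
      unfolding TT_LL[OF \<delta> \<epsilon>] sum_distrib_left sser_mult[OF nz] sser_const[OF nz] mult.assoc ..
    also have "\<dots> = (\<Sum>c\<in>UNIV. \<Sum>t\<in>UNIV. \<Sum>s\<in>UNIV.
         ?S (fps_const ((R ** Pmat) $ (t, snd p) $ (fst q, s)) * H (fst p) t s (snd q) c) * ?LT c)"
      unfolding sum.swap[of _ _ "UNIV :: ('n \<times> 'n \<times> 'n \<times> 'n) set"] ..
    also have "\<dots> = F p q"
      unfolding F_def skew_W[symmetric] sser_sum sum_distrib_right ..
    finally show "(\<Sum>t\<in>UNIV. TT \<delta> (fst p) t *
        (\<Sum>s\<in>UNIV. spt ((R ** Pmat) $ (t, snd p) $ (fst q, s)) * LL \<epsilon> s (snd q))) = F p q" .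
  qed
  finally have lhs: "Top T i \<delta> * (A i j * Lop j \<epsilon>) = leg2m i j F" .
  have "Rb j i (\<delta> + \<epsilon>) b1 * (Lop j \<epsilon> * (A j i * (Top T i \<delta> * Ri i j (\<delta> + \<epsilon>) b2)))
    = leg2m i j (\<lambda>p q. \<Sum>t\<in>UNIV. ?S (rb (prod.swap p) (prod.swap t)) * (\<Sum>q'\<in>UNIV. LL \<epsilon> (snd t) q' *
       (\<Sum>u\<in>UNIV. spt ((R ** Pmat) $ (prod.swap (fst t, q')) $ (prod.swap u)) *
         (\<Sum>p''\<in>UNIV. TT \<delta> (fst u) p'' * ?S (ri (p'', snd u) q)))))"
    unfolding Top_def Lop_def cm_def sm_def leg2m_swap[OF ij] leg1m_leg2m_first[OF ij]
      leg1m_leg2m_second[OF ij] leg2m_mult[OF ij] fst_conv snd_conv ..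
  also have "(\<lambda>p q. \<Sum>t\<in>UNIV. ?S (rb (prod.swap p) (prod.swap t)) * (\<Sum>q'\<in>UNIV. LL \<epsilon> (snd t) q' *
       (\<Sum>u\<in>UNIV. spt ((R ** Pmat) $ (prod.swap (fst t, q')) $ (prod.swap u)) *
         (\<Sum>p''\<in>UNIV. TT \<delta> (fst u) p'' * ?S (ri (p'', snd u) q))))) = F"
  proof (intro ext)
    fix x y :: "'n \<times> 'n"
    \<comment> \<open>Scalars are moved to the front; the order of L and T is kept.\<close>
    have trm: "?S f * (LL \<epsilon> q q' * (spt s * (TT \<delta> p' p'' * ?S g))) = ?S (fps_const s * (f * g)) * (LL \<epsilon> q q' * TT \<delta> p' p'')"
      for f g s q q' p' p''
    proof -
      have "?S f * (LL \<epsilon> q q' * (spt s * (TT \<delta> p' p'' * ?S g))) = ?S f * (spt s * (LL \<epsilon> q q' * (?S g * TT \<delta> p' p'')))"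
        using comm_left[OF comm_spt_LL[OF \<epsilon>]] comm_sser_TT[OF \<delta> nz] by (simp add: comm_def)
      also have "\<dots> = ?S f * (spt s * (?S g * (LL \<epsilon> q q' * TT \<delta> p' p'')))"
        using comm_left[OF comm_sser_LL[OF \<epsilon> nz]] by simp
      also have "\<dots> = spt s * (?S f * (?S g * (LL \<epsilon> q q' * TT \<delta> p' p'')))"
        by (rule comm_left[OF comm_sym[OF comm_spt_sser[OF nz]]])
      finally show ?thesis by (simp add: sser_mult[OF nz] sser_const[OF nz] mult.assoc)
    qed
    have "(\<Sum>t\<in>UNIV. ?S (rb (prod.swap x) (prod.swap t)) * (\<Sum>q'\<in>UNIV. LL \<epsilon> (snd t) q' *
       (\<Sum>u\<in>UNIV. spt ((R ** Pmat) $ (prod.swap (fst t, q')) $ (prod.swap u)) *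
         (\<Sum>p''\<in>UNIV. TT \<delta> (fst u) p'' * ?S (ri (p'', snd u) y)))))
      = (\<Sum>t\<in>UNIV. \<Sum>q'\<in>UNIV. \<Sum>u\<in>UNIV. \<Sum>p''\<in>UNIV.
         ?S (fps_const ((R ** Pmat) $ (prod.swap (fst t, q')) $ (prod.swap u)) * (rb (prod.swap x) (prod.swap t) * ri (p'', snd u) y))
          * (LL \<epsilon> (snd t) q' * TT \<delta> (fst u) p''))"
      unfolding sum_distrib_left trm ..
    also have "\<dots> = (\<Sum>c\<in>UNIV. \<Sum>p\<in>UNIV. \<Sum>m\<in>UNIV. case c of (q, q', p', p'') \<Rightarrow>
         ?S (fps_const ((R ** Pmat) $ (q', p) $ (m, p')) * (rb (prod.swap x) (q, p) * ri (p'', m) y))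
          * (LL \<epsilon> q q' * TT \<delta> p' p''))"
      unfolding sum.cartesian_product
      by (rule sum.reindex_bij_witness[of _ "\<lambda>((q, q', p', p''), p, m). ((p, q), q', (p', m), p'')" "\<lambda>((p, q), q', (p', m), p''). ((q, q', p', p''), p, m)"]) auto
    also have "\<dots> = F x y"
      unfolding F_def W_def by (rule sum.cong) (auto simp: sser_sum sum_distrib_right prod.swap_def)
    finally show "(\<Sum>t\<in>UNIV. ?S (rb (prod.swap x) (prod.swap t)) * (\<Sum>q'\<in>UNIV. LL \<epsilon> (snd t) q' *
       (\<Sum>u\<in>UNIV. spt ((R ** Pmat) $ (prod.swap (fst t, q')) $ (prod.swap u)) *
         (\<Sum>p''\<in>UNIV. TT \<delta> (fst u) p'' * ?S (ri (p'', snd u) y))))) = F x y" .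
  qed
  finally show ?thesis unfolding lhs by (rule sym)
qed

end

section \<open>Induction over the free algebra for operators on vectors\<close>

text \<open>Leg k and its variable are not touched by D and so are free to carry a new factor L.
  Matrix units on leg k isolate an entry of L and \<open>extract_coeff\<close> isolates a
  coefficient, which yields the step from b to \<open>lplus\<close> times b.\<close>

lemma op_induct:
  fixes D :: "'n::finite mvec addop"
  assumes U: "csub U" and Ds: "\<And>s. comm D (lift (spt s))" and Dsl: "\<And>r. comm (slice k r) D"
    and DE: "\<And>a b. comm D (E k a b)"
    and base: "\<And>\<Phi>. \<Phi> \<in> pw (spn 1) \<Longrightarrow> app D \<Phi> \<in> pw U"
    and step: "\<And>b \<Phi>. (\<And>\<Phi>. \<Phi> \<in> pw (spn b) \<Longrightarrow> app D \<Phi> \<in> pw U) \<Longrightarrow> \<Phi> \<in> pw (spn b) \<Longrightarrow>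
      app (D * Lop k (unit_exp k)) \<Phi> \<in> pw U"
    and \<Phi>: "\<Phi> \<in> pw (spn b)"
  shows "app D \<Phi> \<in> pw U"
proof -
  note sub = csub_submod[OF U]
  let ?K = "{b. \<forall>\<Phi>\<in>pw (spn b). app D \<Phi> \<in> pw U}"
  have coords: "\<exists>u. \<Phi> = (\<lambda>I e. falg_const (u I e) * b)" if "\<Phi> \<in> pw (spn b)" for \<Phi> :: "'n mvec" and b
  proof -
    have "\<forall>I e. \<exists>s. \<Phi> I e = falg_const s * b" using that by (auto simp: pw_def spn_def)
    then obtain u where "\<forall>I e. \<Phi> I e = falg_const (u I e) * b" by metis
    then show ?thesis by (intro exI[of _ u]) (simp add: fun_eq_iff)
  qed
  have mem: "(\<lambda>I e. falg_const (u I e) * b) \<in> pw (spn b)" for u and b :: "'n falg"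
    by (auto simp: pw_def spn_def)
  have "csub ?K"
    unfolding csub_def submod_def
  proof (intro conjI ballI allI impI)
    show "0 \<in> ?K" using pw_0[OF sub] by (auto dest!: coords simp flip: zero_fun_def)
    show "a + b \<in> ?K" if "a \<in> ?K" "b \<in> ?K" for a b
    proof (intro CollectI ballI)
      fix \<Phi> :: "'n mvec" assume "\<Phi> \<in> pw (spn (a + b))"
      then obtain u where "\<Phi> = (\<lambda>I e. falg_const (u I e) * (a + b))" using coords by blast
      then have "\<Phi> = (\<lambda>I e. falg_const (u I e) * a) + (\<lambda>I e. falg_const (u I e) * b)"
        by (simp add: fun_eq_iff distrib_left)
      then show "app D \<Phi> \<in> pw U" using that mem pw_add[OF sub] by (simp add: app_add)
    qed
    show "falg_const s * a \<in> ?K" if "a \<in> ?K" for s a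
    proof (intro CollectI ballI)
      fix \<Phi> :: "'n mvec" assume "\<Phi> \<in> pw (spn (falg_const s * a))"
      then obtain u where "\<Phi> = (\<lambda>I e. falg_const (u I e) * (falg_const s * a))" using coords by blast
      then have "\<Phi> = (\<lambda>I e. falg_const (u I e * s) * a)" by (simp add: falg_const_mult mult.assoc)
      then show "app D \<Phi> \<in> pw U" using that mem by auto
    qed
    show "b \<in> ?K" if lim: "\<forall>m. \<exists>c. b - fps_X ^ m * c \<in> ?K" for b
    proof (intro CollectI ballI)
      fix \<Phi> :: "'n mvec" assume "\<Phi> \<in> pw (spn b)"
      then obtain u where u: "\<Phi> = (\<lambda>I e. falg_const (u I e) * b)" using coords by blast
      show "app D \<Phi> \<in> pw U"
        unfolding pw_def
      proof (intro CollectI allI)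
        fix I e
        show "app D \<Phi> I e \<in> U"
        proof (rule csub_lim[OF U])
          fix m
          obtain c where c: "b - fps_X ^ m * c \<in> ?K" using lim by blast
          define \<Psi> where "\<Psi> = (\<lambda>I e. falg_const (u I e) * c)"
          have "(\<lambda>I e. falg_const (u I e) * (b - fps_X ^ m * c)) = \<Phi> - app (lift (spt (fps_X ^ m))) \<Psi>"
          proof -
            have "fps_X ^ m * (falg_const s * c) = falg_const s * (fps_X ^ m * c)" for s
              by (metis fps_mult_fps_X_power_commute mult.assoc)
            then show ?thesis
              unfolding u \<Psi>_def
              by (simp add: fun_eq_iff app_lift app_spt right_diff_distrib falg_const_X_power)
          qed
          then have "app D (\<Phi> - app (lift (spt (fps_X ^ m))) \<Psi>) \<in> pw U"
            using c mem[of u "b - fps_X ^ m * c"] by auto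
          moreover have "app D (app (lift (spt (fps_X ^ m))) \<Psi>) = app (lift (spt (fps_X ^ m))) (app D \<Psi>)"
            using Ds[of "fps_X ^ m"] unfolding comm_def app_simps(4)[symmetric] by simp
          ultimately have "app D \<Phi> I e - fps_X ^ m * app D \<Psi> I e \<in> U"
            by (simp add: app_diff pw_def app_lift app_spt falg_const_X_power)
          then show "\<exists>c. app D \<Phi> I e - fps_X ^ m * c \<in> U" by blast
        qed
      qed
    qed
  qed
  moreover have "1 \<in> ?K" using base by auto
  moreover have "lplus a c r * b \<in> ?K" if b: "b \<in> ?K" for a c r b
  proof (intro CollectI ballI)
    fix \<Phi> :: "'n mvec" assume \<Phi>: "\<Phi> \<in> pw (spn (lplus a c r * b))"
    let ?L = "\<lambda>x y. lift (cser (unit_exp k) (\<lambda>r. lmul (lplus x y r)))"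
    \<comment> \<open>Summation over d is needed because an entry series without any matrix unit is
      the sum of its restrictions to all indices of leg k.\<close>
    have "?L a c = (\<Sum>d\<in>UNIV. E k d a * (Lop k (unit_exp k) * E k c d))"
    proof -
      have "E k d a * (Lop k (unit_exp k) * E k c d) = ?L a c * E k d d" for d
      proof -
        have "E k d a * (Lop k (unit_exp k) * E k c d)
          = (\<Sum>x\<in>UNIV. \<Sum>y\<in>UNIV. E k d a * (?L x y * (E k x y * E k c d)))"
          unfolding Lop_def leg1m_def by (simp only: sum_distrib_left sum_distrib_right mult.assoc)
        also have "\<dots> = (\<Sum>x\<in>UNIV. \<Sum>y\<in>UNIV. if x = a then if y = c then ?L a c * E k d d else 0 else 0)"
        proof (intro sum.cong refl)
          fix x y
          show "E k d a * (?L x y * (E k x y * E k c d)) = (if x = a then if y = c then ?L a c * E k d d else 0 else 0)"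
            unfolding comm_left[OF comm_lift_E(2)] by (simp add: E_mult)
        qed
        also have "\<dots> = (\<Sum>x\<in>UNIV. if x = a then \<Sum>y\<in>UNIV. if y = c then ?L a c * E k d d else 0 else 0)"
          by (intro sum.cong) auto
        finally show ?thesis by simp
      qed
      then show ?thesis by (simp add: sum_E flip: sum_distrib_left)
    qed
    then have eq: "D * ?L a c = (\<Sum>d\<in>UNIV. E k d a * ((D * Lop k (unit_exp k)) * E k c d))"
      using comm_left[OF DE] by (simp add: sum_distrib_left mult.assoc)
    show "app D \<Phi> \<in> pw U"
    proof (rule extract_coeff[where a = "lplus a c" and r = r and b = b and k = k, OF Dsl _ \<Phi>])
      fix \<Psi> :: "'n mvec" assume "\<Psi> \<in> pw (spn b)"
      then have "app (E k c d) \<Psi> \<in> pw (spn b)" for d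
        by (rule stabD[OF stab_E[OF submod_spn]])
      then have "app (D * Lop k (unit_exp k)) (app (E k c d) \<Psi>) \<in> pw U" for d
        using step[of b] b by blast
      then show "app (D * ?L a c) \<Psi> \<in> pw U"
        unfolding eq app_sum_left using stabD[OF stab_E[OF sub]] by (intro pw_sum[OF sub]) (simp del: app_simps(4) add: app_simps(4)[of "E _ _ _"] app_simps(4)[of "_ * Lop _ _"])
    qed
  qed
  ultimately have "b \<in> ?K" by (rule csub_eq_UNIV)
  then show ?thesis using \<Phi> by blast
qed

lemma csub_const0: "csub {b. fps_nth b 0 = 0}"
  unfolding csub_def submod_def
proof (intro conjI ballI allI impI)
  fix b :: "'a falg" assume "\<forall>m. \<exists>c. b - fps_X ^ m * c \<in> {b. fps_nth b 0 = 0}"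
  then obtain c where "b - fps_X ^ 1 * c \<in> {b. fps_nth b 0 = 0}" by blast
  then show "b \<in> {b. fps_nth b 0 = 0}" by simp
qed (auto simp: )

section \<open>Commutation and stability of the operators in use\<close>

lemma comm_spt_Top: "\<delta> \<noteq> 0 \<Longrightarrow> (\<And>a b r. linop (T a b r)) \<Longrightarrow> comm (lift (spt s)) (Top T k \<delta>)"
  unfolding Top_def by (intro comm_lift_leg1m comm_spt fin_mexp)

lemma comm_spt_Lop: "\<delta> \<noteq> 0 \<Longrightarrow> comm (lift (spt s)) (Lop k \<delta>)"
  unfolding Lop_def by (intro comm_lift_leg1m comm_spt fin_mexp linop_lmul)

lemma comm_E_Top: "k \<noteq> l \<Longrightarrow> comm (E k a b) (Top T l \<delta>)"
  unfolding Top_def by (rule comm_E_leg1m)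

lemma comm_E_Lop: "k \<noteq> l \<Longrightarrow> comm (E k a b) (Lop l \<delta>)"
  unfolding Lop_def by (rule comm_E_leg1m)

lemma comm_E_cm: "k \<noteq> i \<Longrightarrow> k \<noteq> j \<Longrightarrow> comm (E k a b) (cm i j X)"
  unfolding cm_def by (rule comm_E_leg2m)

lemma comm_slice_leg1m: "(\<And>a b. comm (slice k r) (lift (C a b))) \<Longrightarrow> comm (slice k r) (leg1m l C)"
  by (intro comm_leg1m comm_slice_E)

lemma comm_slice_Top: "\<delta> k = 0 \<Longrightarrow> comm (slice k r) (Top T l \<delta>)"
  unfolding Top_def by (intro comm_slice_leg1m comm_slice_gser) simp

lemma comm_slice_cm: "comm (slice k r) (cm i j X)"
  unfolding cm_def by (intro comm_leg2m comm_slice_E comm_slice_spt)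

lemma comm_cm_Top: "\<delta> \<noteq> 0 \<Longrightarrow> (\<And>a b r. linop (T a b r)) \<Longrightarrow> k \<noteq> i \<Longrightarrow> k \<noteq> j \<Longrightarrow> comm (cm i j X) (Top T k \<delta>)"
  unfolding cm_def Top_def by (intro comm_leg2m_leg1m comm_spt fin_mexp)

lemma comm_cm_Lop: "\<delta> \<noteq> 0 \<Longrightarrow> k \<noteq> i \<Longrightarrow> k \<noteq> j \<Longrightarrow> comm (cm i j X) (Lop k \<delta>)"
  unfolding cm_def Lop_def by (intro comm_leg2m_leg1m comm_spt fin_mexp linop_lmul)

lemma comm_cm_cm: "{i, j} \<inter> {k, l} = {} \<Longrightarrow> comm (cm i j X) (cm k l Y)"
  unfolding cm_def by (intro comm_leg2m_leg2m comm_spt_spt)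

lemma stab_cm: "submod U \<Longrightarrow> stab U (cm i j X)"
  unfolding cm_def by (intro stab_leg2m stab_spt)

lemma stab_Lop: "submod U \<Longrightarrow> (\<And>a b. b \<in> U \<Longrightarrow> a * b \<in> U) \<Longrightarrow> stab U (Lop k \<delta>)"
  unfolding Lop_def by (intro stab_leg1m stab_gser) auto

lemma Top_one:
  assumes lin: "\<And>i j r. linop (T i j r)" and one: "\<And>i j r. app (T i j r) 1 = (if i = j \<and> r = 0 then 1 else 0)"
    and \<delta>: "\<delta> \<noteq> 0" and \<Phi>: "\<Phi> \<in> pw (spn 1)"
  shows "app (Top T k \<delta>) \<Phi> = \<Phi>"
proof (intro ext)
  fix I e
  have v: "app (T i j r) (\<Phi> J e') = (if i = j \<and> r = 0 then \<Phi> J e' else 0)" for i j r J e'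
  proof -
    obtain s where "\<Phi> J e' = falg_const s * 1" using \<Phi> by (auto simp: pw_def spn_def)
    then show ?thesis using linopD[OF lin, of i j r s 1] one[of i j r] by auto
  qed
  have "app (Top T k \<delta>) \<Phi> I e = (\<Sum>b\<in>UNIV. \<Sum>r | mexp r \<delta> \<le> e. app (T (I k) b r) (\<Phi> (I(k := b)) (e - mexp r \<delta>)))"
    by (simp add: Top_def app_leg1m sum_fun_apply app_gser)
  also have "\<dots> = (\<Sum>b\<in>UNIV. if b = I k then \<Sum>r | mexp r \<delta> \<le> e. if r = 0 then \<Phi> I e else 0 else 0)"
  proof (intro sum.cong refl)
    fix b
    have "e - (\<lambda>v. 0) = e" by (simp add: fun_eq_iff)
    then show "(\<Sum>r | mexp r \<delta> \<le> e. app (T (I k) b r) (\<Phi> (I(k := b)) (e - mexp r \<delta>)))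
      = (if b = I k then \<Sum>r | mexp r \<delta> \<le> e. if r = 0 then \<Phi> I e else 0 else 0)"
      unfolding v by (auto intro!: sum.cong sum.neutral)
  qed
  also have "\<dots> = \<Phi> I e" using finD[OF fin_mexp[OF \<delta>], of e] by (simp add: le_fun_def)
  finally show "app (Top T k \<delta>) \<Phi> I e = \<Phi> I e" .
qed

context hecke_data begin

lemma stripA:
  assumes "i \<noteq> j" "\<And>a b. comm (E j a b) D" "\<And>a b. comm (E i a b) G"
    "\<And>s. comm (lift (spt s)) D" "\<And>s. comm (lift (spt s)) G"
  shows "D * G = (\<Sum>k\<in>UNIV. \<Sum>l\<in>UNIV. \<Sum>a\<in>UNIV. \<Sum>b\<in>UNIV.
    lift (spt (Psi $ (l, b) $ (k, a))) * (E j b k * ((D * (A i j * G)) * E i l a)))"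
proof (rule strip)
  show "(\<Sum>k\<in>UNIV. \<Sum>l\<in>UNIV. (R ** Pmat) $ (a, k) $ (l, b) * Psi $ (l, b') $ (k, a')) = (if a = a' \<and> b = b' then 1 else 0)"
    for a b a' b'
  proof -
    have "(R ** Pmat) $ (a, k) $ (l, b) = R $ (a, k) $ (b, l)" for k l
    proof -
      have "(R ** Pmat) $ (a, k) $ (l, b) = (\<Sum>t\<in>UNIV. if t = (b, l) then R $ (a, k) $ t else 0)"
        unfolding matrix_matrix_mult_def vec_lambda_beta by (rule sum.cong) (auto simp: Pmat_nth)
      then show ?thesis by simp
    qed
    then show ?thesis using skew1[of a b b' a'] by simp
  qed
qed (use assms in \<open>auto intro: comm_sym\<close>)

text \<open>By \<open>stripA\<close> the product without RP is a combination of products with RP,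
  surrounded by scalars and matrix units; these preserve pointwise membership on both sides.\<close>

lemma strip_mem:
  assumes "i \<noteq> j" "\<And>a b. comm (E j a b) D" "\<And>a b. comm (E i a b) G"
    "\<And>s. comm (lift (spt s)) D" "\<And>s. comm (lift (spt s)) G" "submod U" "submod V"
    and mem: "\<And>\<Phi>. \<Phi> \<in> pw V \<Longrightarrow> app (D * (A i j * G)) \<Phi> \<in> pw U"
    and \<Phi>: "\<Phi> \<in> pw V"
  shows "app (D * G) \<Phi> \<in> pw U"
  unfolding stripA[OF assms(1-5)] app_sum_left app_simps(4)[of "lift _"] app_simps(4)[of "E j _ _"] app_simps(4)[of _ "E i _ _"]
  by (intro pw_sum assms(6) stabD[OF stab_spt] stabD[OF stab_E] mem assms(7) \<Phi>)

lemma comm_spt_sm: "\<delta> \<noteq> 0 \<Longrightarrow> comm (lift (spt s)) (sm i j \<delta> b X)"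
  unfolding sm_def by (intro comm_lift_leg2m comm_spt_sser)

lemma comm_E_sm: "k \<noteq> i \<Longrightarrow> k \<noteq> j \<Longrightarrow> comm (E k x y) (sm i j \<delta> b X)"
  unfolding sm_def by (rule comm_E_leg2m)

lemma comm_slice_sm: "\<delta> k = 0 \<Longrightarrow> comm (slice k r) (sm i j \<delta> b X)"
  unfolding sm_def by (intro comm_leg2m comm_slice_E comm_slice_sser)

lemma comm_sm_Top: "\<delta> \<noteq> 0 \<Longrightarrow> \<epsilon> \<noteq> 0 \<Longrightarrow> (\<And>a b r. linop (T a b r)) \<Longrightarrow> k \<noteq> i \<Longrightarrow> k \<noteq> j \<Longrightarrow> comm (sm i j \<epsilon> b X) (Top T k \<delta>)"
  unfolding sm_def Top_def by (intro comm_leg2m_leg1m comm_sser fin_mexp)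

lemma comm_sm_Lop: "\<delta> \<noteq> 0 \<Longrightarrow> \<epsilon> \<noteq> 0 \<Longrightarrow> k \<noteq> i \<Longrightarrow> k \<noteq> j \<Longrightarrow> comm (sm i j \<epsilon> b X) (Lop k \<delta>)"
  unfolding sm_def Lop_def by (intro comm_leg2m_leg1m comm_sser fin_mexp linop_lmul)

lemma comm_sm_cm: "\<epsilon> \<noteq> 0 \<Longrightarrow> {i, j} \<inter> {k, l} = {} \<Longrightarrow> comm (sm i j \<epsilon> b X) (cm k l Y)"
  unfolding sm_def cm_def by (intro comm_leg2m_leg2m comm_sym[OF comm_spt_sser])

lemma stab_sm: "submod U \<Longrightarrow> stab U (sm i j \<delta> b X)"
  unfolding sm_def by (intro stab_leg2m stab_sser)

text \<open>The quadratic relation for L^- with both operators replaced by 1; it starts the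
  induction in \<open>T_RTT\<close>.\<close>

lemma Rb_A_comm:
  assumes ij: "i \<noteq> j" and \<delta>: "\<delta> \<noteq> 0"
  shows "Rb i j \<delta> b * A i j = A j i * Rb j i \<delta> b"
proof -
  let ?p = "lift (sser \<delta> (rescale b (phi M))) :: 'n mvec addop"
  obtain k :: nat where k: "k \<noteq> i" "k \<noteq> j" using ex_new_if_finite[of "{i, j}"] by auto
  have PA: "Pm i j * A i j = A j i * Pm i j" using Pm_rels(3)[of i j k] ij k by auto
  have c: "comm ?p (A j i)" "comm (1 - ux \<delta> b) (A j i)" "comm (nn * ux \<delta> b) (A j i)"
    using comm_ux[OF \<delta>] by (auto intro!: comm_ring comm_sser_cm \<delta> comm_spt_cm)
  have "A j i * Rb j i \<delta> b = A j i * (?p * ((1 - ux \<delta> b) * A i j)) + A j i * (?p * ((nn * ux \<delta> b) * Pm i j))"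
    using ij \<delta> by (simp add: Rb_eq rp_def Pm_sym[OF ij] distrib_left)
  also have "\<dots> = ?p * ((1 - ux \<delta> b) * (A j i * A i j)) + ?p * ((nn * ux \<delta> b) * (A j i * Pm i j))"
    by (simp only: comm_left[OF comm_sym[OF c(1)]] comm_left[OF comm_sym[OF c(2)]] comm_left[OF comm_sym[OF c(3)]])
  also have "\<dots> = Rb i j \<delta> b * A i j"
    using ij \<delta> by (simp add: Rb_eq rp_def distrib_left distrib_right mult.assoc PA)
  finally show ?thesis by simp
qed

text \<open>Modulo h the term with the flip disappears, as it contains e^h - e^{-h}, and the shift b
  becomes 1.\<close>

lemma Rb_mod_h:
  assumes ij: "i \<noteq> j" and \<delta>: "\<delta> \<noteq> 0" and b: "fps_nth b 0 = 1"
  shows "app (Rb i j \<delta> b - lift (sser \<delta> (phi M * (1 - fps_X))) * A j i) \<Phi> \<in> pw {b. fps_nth b 0 = 0}"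
proof -
  define f where "f p q = rescale b (Rbar M R $ p $ q) - phi M * (1 - fps_X) * fps_const ((Pmat ** R) $ p $ q)" for p q
  have f0: "fps_nth (fps_nth (f p q) r) 0 = 0" for p q r
  proof -
    define x where "x = phi M * (1 - fps_X) * fps_const ((Pmat ** R) $ p $ q)"
    define y where "y = phi M * fps_X * fps_const (Pmat $ p $ q)"
    have "Rbar M R $ p $ q = x + fps_const nu * y"
      unfolding Rbar_nth x_def y_def by (simp add: algebra_simps)
    then have "fps_nth (f p q) r = (b ^ r - 1) * fps_nth x r + b ^ r * nu * fps_nth y r"
      unfolding f_def x_def[symmetric] by (simp add: algebra_simps)
    moreover have "fps_nth (b ^ r) 0 = 1" using b by (simp add: fps_power_zeroth)
    ultimately show ?thesis by (simp add: nu_def)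
  qed
  have sd: "sser \<delta> (g - h) = (sser \<delta> g - sser \<delta> h :: 'n ser addop)" for g h
    using sser_add[of \<delta> "g - h" h] by (metis add_diff_cancel_right' diff_add_cancel)
  have "leg2m i j (\<lambda>p q. sser \<delta> (f p q)) = Rb i j \<delta> b - lift (sser \<delta> (phi M * (1 - fps_X))) * A j i"
  proof -
    have "lift (sser \<delta> (phi M * (1 - fps_X))) * A j i
      = leg2m i j (\<lambda>p q. sser \<delta> (phi M * (1 - fps_X) * fps_const ((Pmat ** R) $ p $ q)))"
      unfolding A_flip[OF ij] unfolding cm_def leg2m_scale[symmetric] sser_mult[OF \<delta>] sser_const[OF \<delta>] ..
    then show ?thesis
      unfolding f_def sm_def sd leg2m_diff by simp
  qed
  moreover have "app (leg2m i j (\<lambda>p q. sser \<delta> (f p q))) \<Phi> \<in> pw {b. fps_nth b 0 = 0}"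
    unfolding pw_def app_leg2m[OF ij] by (auto simp: sum_fun_apply fps_sum_nth sser_def app_gser f0)
  ultimately show ?thesis by simp
qed

end

context tdata begin

lemma nz_add: "\<delta> \<noteq> 0 \<Longrightarrow> \<delta> + \<epsilon> \<noteq> 0" "\<delta> \<noteq> 0 \<Longrightarrow> \<epsilon> + \<delta> \<noteq> 0" for \<delta> \<epsilon> :: "nat \<Rightarrow> nat"
  by (auto simp: fun_eq_iff)

text \<open>The induction is run on D = T - 1. The exchange relation gives D A L as an expression in
  D, controlled by the induction hypothesis, plus the failure of T = 1 to satisfy it, which vanishes
  modulo h.\<close>

lemma T_mod_h:
  "\<Phi> \<in> pw (spn b) \<Longrightarrow> app (Top T 0 (unit_exp 0) - 1) \<Phi> \<in> pw {b. fps_nth b 0 = 0}"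
proof (rule op_induct[where k = 1, OF csub_const0])
  let ?U = "{b :: 'n falg. fps_nth b 0 = 0}"
  let ?D = "Top T 0 (unit_exp 0) - 1" and ?d = "unit_exp 0 + unit_exp 1"
  let ?L = "Lop 1 (unit_exp 1) :: 'n mvec addop" and ?rb = "Rb 1 0 ?d b1" and ?ri = "Ri 0 1 ?d b2"
  let ?s = "lift (sser ?d (phi M * (1 - fps_X))) :: 'n mvec addop"
  note sub = csub_submod[OF csub_const0]
  have nz: "?d \<noteq> 0" by (intro nz_add) simp
  have Dspt: "comm (lift (spt s)) ?D" for s
    by (intro comm_ring comm_spt_Top linop_tlin) simp
  show "comm ?D (lift (spt s))" for s by (rule comm_sym[OF Dspt])
  show "comm (slice 1 r) ?D" for r by (intro comm_ring comm_slice_Top) simp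
  have DE: "comm (E 1 x y) ?D" for x y by (intro comm_ring comm_E_Top) simp
  show "comm ?D (E 1 x y)" for x y by (rule comm_sym[OF DE])
  show "app ?D \<Phi> \<in> pw ?U" if "\<Phi> \<in> pw (spn 1)" for \<Phi>
    using Top_one[OF linop_tlin tlin_one unit_exp_nz that] pw_0[OF sub] by (simp flip: zero_fun_def)
  have stL: "stab ?U ?L" by (rule stab_Lop[OF sub]) simp
  show "app (?D * ?L) \<Phi> \<in> pw ?U" if IH: "\<And>\<Phi>. \<Phi> \<in> pw (spn b) \<Longrightarrow> app ?D \<Phi> \<in> pw ?U"
    and \<Phi>: "\<Phi> \<in> pw (spn b)" for b \<Phi>
  proof (rule strip_mem[where i = 0 and j = 1, OF _ DE _ Dspt _ sub submod_spn _ \<Phi>])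
    fix \<Phi> :: "'n mvec" assume \<Phi>: "\<Phi> \<in> pw (spn b)"
    have "?D * (A 0 1 * ?L) = ?rb * (?L * (A 1 0 * (Top T 0 (unit_exp 0) * ?ri))) - A 0 1 * ?L"
      using T_relation[of 0 1 "unit_exp 0" "unit_exp 1"] by (simp only: left_diff_distrib) simp
    \<comment> \<open>T is split as D + 1, and R-bar times its inverse is inserted after A L, so
      that the second summand has the inverse as its right factor.\<close>
    also have "\<dots> = ?rb * (?L * (A 1 0 * (?D * ?ri))) + (?rb * (?L * A 1 0) - A 0 1 * (?L * Rb 0 1 ?d b2)) * ?ri"
      using Rb_Ri(1)[OF _ nz, of 0 1 b2] by (simp add: algebra_simps)
    \<comment> \<open>Both products are compared with s (RP)_01 L (RP)_10, to which they reduce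
      modulo h.\<close>
    also have "?rb * (?L * A 1 0) - A 0 1 * (?L * Rb 0 1 ?d b2)
      = (?rb - ?s * A 0 1) * (?L * A 1 0) - (A 0 1 * ?L) * (Rb 0 1 ?d b2 - ?s * A 1 0)"
    proof -
      have "comm ?s (A 0 1 * ?L)"
        unfolding Lop_def
        by (intro comm_ring comm_sser_cm nz comm_lift_leg1m comm_sser fin_mexp linop_lmul unit_exp_nz)
      from comm_left[OF comm_sym[OF this]] have "A 0 1 * (?L * (?s * A 1 0)) = ?s * (A 0 1 * (?L * A 1 0))"
        by (simp add: mult.assoc)
      then show ?thesis by (simp add: left_diff_distrib right_diff_distrib mult.assoc)
    qed
    finally have eq: "?D * (A 0 1 * ?L) = ?rb * (?L * (A 1 0 * (?D * ?ri)))
      + ((?rb - ?s * A 0 1) * (?L * A 1 0) - (A 0 1 * ?L) * (Rb 0 1 ?d b2 - ?s * A 1 0)) * ?ri" .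
    have "app ?ri \<Phi> \<in> pw (spn b)" by (rule stabD[OF stab_sm[OF submod_spn] \<Phi>])
    then have "app ?D (app ?ri \<Phi>) \<in> pw ?U" by (rule IH)
    then have 1: "app (?rb * (?L * (A 1 0 * (?D * ?ri)))) \<Phi> \<in> pw ?U"
      unfolding app_simps(4) by (intro stabD[OF stab_sm[OF sub]] stabD[OF stL] stabD[OF stab_cm[OF sub]])
    have 2: "app (?rb - ?s * A 0 1) \<Psi> \<in> pw ?U" for \<Psi>
      by (rule Rb_mod_h) (use nz b1 in auto)
    have 3: "app ((A 0 1 * ?L) * (Rb 0 1 ?d b2 - ?s * A 1 0)) \<Psi> \<in> pw ?U" for \<Psi>
      unfolding app_simps(4)[of "A 0 1 * ?L"]
      by (intro stabD[OF stab_mult[OF stab_cm[OF sub] stL]] Rb_mod_h) (use nz b2 in auto)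
    have 4: "app ((?rb - ?s * A 0 1) * (?L * A 1 0)) \<Psi> \<in> pw ?U" for \<Psi>
      unfolding app_simps(4)[of "?rb - ?s * A 0 1"] by (rule 2)
    show "app (?D * (A 0 1 * ?L)) \<Phi> \<in> pw ?U"
      unfolding eq app_simps(1) app_simps(4)[of _ ?ri] app_simps(2)[of "_ * _" "_ * _"]
      by (intro pw_add[OF sub] pw_diff[OF sub] 1 3 4)
  qed (auto intro!: comm_E_Lop comm_spt_Lop)
qed

end

declare plus_fun_apply [simp del]

context tdata begin

lemma comm_cm_T: "\<delta> \<noteq> 0 \<Longrightarrow> k \<noteq> i \<Longrightarrow> k \<noteq> j \<Longrightarrow> comm (cm i j X) (Top T k \<delta>)"
  by (rule comm_cm_Top) (auto intro: linop_tlin)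

lemma comm_sm_T: "\<delta> \<noteq> 0 \<Longrightarrow> \<epsilon> \<noteq> 0 \<Longrightarrow> k \<noteq> i \<Longrightarrow> k \<noteq> j \<Longrightarrow> comm (sm i j \<epsilon> b X) (Top T k \<delta>)"
  by (rule comm_sm_Top) (auto intro: linop_tlin)

section \<open>The exchange relation for two copies of the operator\<close>

lemma exchange_Top:
  assumes "z \<notin> S" "\<delta> \<noteq> 0" "\<And>k. k \<in> S \<Longrightarrow> \<epsilon> k \<noteq> 0"
  shows "exchange (Top T z \<delta>) A (\<lambda>k. Rb k z (\<delta> + \<epsilon> k) b1) (\<lambda>k. Ri z k (\<delta> + \<epsilon> k) b2) (\<lambda>k. Lop k (\<epsilon> k)) z S"
proof
  note nz = nz_add(1)[OF assms(2)]
  show "z \<notin> S" by fact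
  fix k assume k: "k \<in> S"
  then have zk: "z \<noteq> k" using assms by auto
  show "Top T z \<delta> * (A z k * Lop k (\<epsilon> k)) = Rb k z (\<delta> + \<epsilon> k) b1 *
      (Lop k (\<epsilon> k) * (A k z * (Top T z \<delta> * Ri z k (\<delta> + \<epsilon> k) b2)))"
    by (rule T_relation[OF zk assms(2) assms(3)[OF k]])
  fix l assume l: "l \<in> S" and kl: "k \<noteq> l"
  then have zl: "z \<noteq> l" using assms by auto
  show "Ri z k (\<delta> + \<epsilon> k) b2 * (A z l * A k l) = A k l * (A z l * Ri z k (\<delta> + \<epsilon> k) b2)"
    by (rule Ri_beta) (use zk zl kl nz in auto)
  show "A k z * (A k l * Rb l z (\<delta> + \<epsilon> l) b1) = Rb l z (\<delta> + \<epsilon> l) b1 * (A k l * A k z)"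
    by (rule Rb_alpha) (use zk zl kl nz in auto)
  show "comm (Top T z \<delta>) (A k l)"
    by (rule comm_sym, rule comm_cm_Top) (use zk zl assms linop_tlin in auto)
  show "comm (A z k) (Lop l (\<epsilon> l))" "comm (A k z) (Lop l (\<epsilon> l))"
    by (rule comm_cm_Lop; use zk zl kl l assms in auto)+
  show "comm (Ri z k (\<delta> + \<epsilon> k) b2) (Lop l (\<epsilon> l))"
    by (rule comm_sm_Lop) (use zk zl kl l assms nz in auto)
  show "comm (Lop k (\<epsilon> k)) (Rb l z (\<delta> + \<epsilon> l) b1)"
    by (rule comm_sym, rule comm_sm_Lop) (use zk zl kl k assms nz in auto)
next
  note nz = nz_add(1)[OF assms(2)]
  fix k l m assume "k \<in> S" "l \<in> S" "m \<in> S" "distinct [k, l, m]"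
  then have d: "z \<noteq> k" "z \<noteq> l" "z \<noteq> m" "k \<noteq> l" "k \<noteq> m" "l \<noteq> m" using assms(1) by auto
  show "comm (A z m) (A k l)" "comm (A m z) (A k l)"
    by (rule comm_cm_cm; use d in auto)+
  show "comm (Ri z m (\<delta> + \<epsilon> m) b2) (A k l)" by (rule comm_sm_cm) (use d nz in auto)
  show "comm (A k l) (Rb m z (\<delta> + \<epsilon> m) b1)"
    by (rule comm_sym, rule comm_sm_cm) (use d nz in auto)
qed

lemma inverse_ybe:
  fixes r1 r2 r3 :: "'a::monoid_mult"
  assumes "r1 * (r2 * r3) = r3 * (r2 * r1)" "r1 * s1 = 1" "s1 * r1 = 1" "r2 * s2 = 1" "s2 * r2 = 1"
  shows "s2 * (s1 * r3) = r3 * (s1 * s2)"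
proof -
  have "s2 * (s1 * r3) = s2 * (s1 * (r3 * (r2 * (r1 * (s1 * s2)))))"
    using assms(2,4) by (metis mult.assoc mult.right_neutral mult.left_neutral)
  also have "\<dots> = s2 * (s1 * ((r3 * (r2 * r1)) * (s1 * s2)))" by (simp only: mult.assoc)
  also have "\<dots> = s2 * ((s1 * r1) * (r2 * (r3 * (s1 * s2))))"
    unfolding assms(1)[symmetric] by (simp only: mult.assoc)
  also have "\<dots> = (s2 * r2) * (r3 * (s1 * s2))" by (simp add: assms(3) mult.assoc)
  finally show ?thesis by (simp add: assms(5))
qed

text \<open>The composite of two copies of T obeys an exchange relation with a third leg, of the
  same shape as that of a single T.\<close>

lemma TAT_L:
  assumes d: "distinct [i, j, k]" and nz: "\<delta> \<noteq> 0" "\<delta>' \<noteq> 0" "\<epsilon> \<noteq> 0"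
  shows "Top T i \<delta> * (A i j * (Top T j \<delta>' * (A i k * (A j k * Lop k \<epsilon>))))
    = Rb k j (\<delta>' + \<epsilon>) b1 * (Rb k i (\<delta> + \<epsilon>) b1 * (Lop k \<epsilon> * (A k i * (A k j *
       (Top T i \<delta> * (A i j * (Top T j \<delta>' * (Ri i k (\<delta> + \<epsilon>) b2 * Ri j k (\<delta>' + \<epsilon>) b2))))))))"
proof -
  let ?T1 = "Top T i \<delta>" and ?T2 = "Top T j \<delta>'" and ?L = "Lop k \<epsilon> :: 'n mvec addop"
  let ?Rkj = "Rb k j (\<delta>' + \<epsilon>) b1" and ?Rki = "Rb k i (\<delta> + \<epsilon>) b1"
  let ?Rik = "Ri i k (\<delta> + \<epsilon>) b2" and ?Rjk = "Ri j k (\<delta>' + \<epsilon>) b2"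
  have d': "i \<noteq> j" "j \<noteq> k" "i \<noteq> k" "j \<noteq> i" "k \<noteq> j" "k \<noteq> i" using d by auto
  note nza = nz_add(1)[OF nz(1), of \<epsilon>] nz_add(1)[OF nz(2), of \<epsilon>]
  have t1: "?T1 * (A i k * ?L) = ?Rki * (?L * (A k i * (?T1 * ?Rik)))"
    and t2: "?T2 * (A j k * ?L) = ?Rkj * (?L * (A k j * (?T2 * ?Rjk)))"
    using T_relation d' nz by auto
  have "?T1 * (A i j * (?T2 * (A i k * (A j k * ?L)))) = ?T1 * (A i j * (A i k * (?T2 * (A j k * ?L))))"
    using comm_left[OF comm_sym[OF comm_cm_T[OF nz(2), of j i k]]] d' by simp
  also have "\<dots> = ?T1 * ((A i j * (A i k * ?Rkj)) * (?L * (A k j * (?T2 * ?Rjk))))"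
    unfolding t2 by (simp only: mult.assoc)
  also have "A i j * (A i k * ?Rkj) = ?Rkj * (A i k * A i j)"
    by (rule Rb_alpha) (use d' nza in auto)
  also have "?T1 * ((?Rkj * (A i k * A i j)) * (?L * (A k j * (?T2 * ?Rjk))))
    = ?T1 * (?Rkj * (A i k * (A i j * (?L * (A k j * (?T2 * ?Rjk))))))" by (simp only: mult.assoc)
  also have "\<dots> = ?Rkj * (?T1 * (A i k * (?L * (A i j * (A k j * (?T2 * ?Rjk))))))"
    using d' by (simp add: comm_left[OF comm_sym[OF comm_sm_T[OF nz(1) nza(2), of i k j]]]
      comm_left[OF comm_cm_Lop[OF nz(3), of k i j]])
  also have "\<dots> = ?Rkj * ((?T1 * (A i k * ?L)) * (A i j * (A k j * (?T2 * ?Rjk))))"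
    by (simp only: mult.assoc)
  also have "\<dots> = ?Rkj * (?Rki * (?L * (A k i * (?T1 * ((?Rik * (A i j * A k j)) * (?T2 * ?Rjk))))))"
    unfolding t1 by (simp only: mult.assoc)
  also have "?Rik * (A i j * A k j) = A k j * (A i j * ?Rik)"
    by (rule Ri_beta) (use d' nza in auto)
  also have "?T1 * ((A k j * (A i j * ?Rik)) * (?T2 * ?Rjk)) = ?T1 * (A k j * (A i j * (?Rik * (?T2 * ?Rjk))))"
    by (simp only: mult.assoc)
  also have "\<dots> = A k j * (?T1 * (A i j * (?T2 * (?Rik * ?Rjk))))"
    using comm_left[OF comm_sym[OF comm_cm_T[OF nz(1), of i k j]]]
      comm_left[OF comm_sm_T[OF nz(2) nza(1), of j i k]] d' by simp
  finally show ?thesis .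
qed

text \<open>The variables are 1/x_1 and x_1/x_2, so 1/x_2 has exponent \<delta> + u and all three
  series have nonnegative exponents. Induction on an auxiliary leg 3 works because both sides pass
  L_3 by the same formula \<open>?Q\<close>.\<close>

lemma T_RTT:
  fixes b :: "'n falg"
  defines "\<delta> \<equiv> unit_exp 1" and "u \<equiv> unit_exp 2"
  assumes \<Phi>: "\<Phi> \<in> pw (spn b)"
  shows "app (Rb 1 2 u 1 * (Top T 1 \<delta> * (A 1 2 * Top T 2 (\<delta> + u)))) \<Phi>
    = app (Top T 2 (\<delta> + u) * (A 2 1 * (Top T 1 \<delta> * Rb 2 1 u 1))) \<Phi>"
proof -
  define X where "X = Rb 1 2 u 1 * (Top T 1 \<delta> * (A 1 2 * Top T 2 (\<delta> + u)))"
  define Y where "Y = Top T 2 (\<delta> + u) * (A 2 1 * (Top T 1 \<delta> * Rb 2 1 u 1))"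
  define w where "w = unit_exp 3"
  have nz: "\<delta> \<noteq> 0" "u \<noteq> 0" "w \<noteq> 0" "\<delta> + u \<noteq> 0" "\<delta> + w \<noteq> 0" "\<delta> + u + w \<noteq> 0"
    by (auto simp: \<delta>_def u_def w_def fun_eq_iff unit_exp_def plus_fun_apply)
  let ?L = "Lop 3 w :: 'n mvec addop"
  let ?R31 = "Rb 3 1 (\<delta> + w) b1" and ?R32 = "Rb 3 2 (\<delta> + u + w) b1"
  let ?S13 = "Ri 1 3 (\<delta> + w) b2" and ?S23 = "Ri 2 3 (\<delta> + u + w) b2"
  let ?T1 = "Top T 1 \<delta>" and ?T2 = "Top T 2 (\<delta> + u)"
  let ?Q = "\<lambda>x. ?R31 * (?R32 * (?L * (A 3 2 * (A 3 1 * (x * (?S13 * ?S23))))))"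
  have yb: "?R31 * (?R32 * Rb 1 2 u 1) = Rb 1 2 u 1 * (?R32 * ?R31)"
    using Rb_ybe[of 3 1 2 "\<delta> + w" u b1 1] nz by (simp add: add_ac)
  have yb': "Rb 1 3 (\<delta> + w) b2 * (Rb 2 3 (\<delta> + u + w) b2 * Rb 2 1 u 1) = Rb 2 1 u 1 * (Rb 2 3 (\<delta> + u + w) b2 * Rb 1 3 (\<delta> + w) b2)"
    using Rb_ybe[of 2 1 3 u "\<delta> + w" 1 b2] nz by (simp add: add_ac)
  have "X * (A 1 3 * (A 2 3 * ?L)) = Rb 1 2 u 1 * (?T1 * (A 1 2 * (?T2 * (A 1 3 * (A 2 3 * ?L)))))"
    by (simp add: X_def mult.assoc)
  also have "\<dots> = (Rb 1 2 u 1 * (?R32 * ?R31)) * (?L * (A 3 1 * (A 3 2 *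
       (?T1 * (A 1 2 * (?T2 * (?S13 * ?S23)))))))"
    using TAT_L[of 1 2 3 \<delta> "\<delta> + u" w] nz by (simp add: mult.assoc)
  also have "\<dots> = ?R31 * (?R32 * (Rb 1 2 u 1 * (?L * (A 3 1 * (A 3 2 *
       (?T1 * (A 1 2 * (?T2 * (?S13 * ?S23)))))))))"
    unfolding yb[symmetric] by (simp only: mult.assoc)
  also have "\<dots> = ?R31 * (?R32 * (?L * ((Rb 1 2 u 1 * (A 3 1 * A 3 2)) *
       (?T1 * (A 1 2 * (?T2 * (?S13 * ?S23)))))))"
    using comm_left[OF comm_sm_Lop[OF nz(3) nz(2), of 3 1 2]] by (simp add: mult.assoc)
  also have "Rb 1 2 u 1 * (A 3 1 * A 3 2) = A 3 2 * (A 3 1 * Rb 1 2 u 1)"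
    using Rb_alpha[of 1 2 3 u 1] nz by simp
  finally have 1: "X * (A 1 3 * (A 2 3 * ?L)) = ?Q X"
    by (simp add: X_def mult.assoc)
  have "Y * (A 1 3 * (A 2 3 * ?L)) = ?T2 * (A 2 1 * (?T1 * ((Rb 2 1 u 1 * (A 1 3 * A 2 3)) * ?L)))"
    by (simp add: Y_def mult.assoc)
  also have "Rb 2 1 u 1 * (A 1 3 * A 2 3) = A 2 3 * (A 1 3 * Rb 2 1 u 1)"
    using Rb_beta[of 2 1 3 u 1] nz by simp
  also have "?T2 * (A 2 1 * (?T1 * ((A 2 3 * (A 1 3 * Rb 2 1 u 1)) * ?L)))
    = ?T2 * (A 2 1 * (?T1 * (A 2 3 * (A 1 3 * (Rb 2 1 u 1 * ?L)))))" by (simp only: mult.assoc)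
  also have "Rb 2 1 u 1 * ?L = ?L * Rb 2 1 u 1"
    using comm_sm_Lop[OF nz(3) nz(2), of 3 2 1] by (simp add: comm_def)
  also have "?T2 * (A 2 1 * (?T1 * (A 2 3 * (A 1 3 * (?L * Rb 2 1 u 1)))))
    = (?T2 * (A 2 1 * (?T1 * (A 2 3 * (A 1 3 * ?L))))) * Rb 2 1 u 1" by (simp only: mult.assoc)
  also have "\<dots> = ?R31 * (?R32 * (?L * (A 3 2 * (A 3 1 * (?T2 * (A 2 1 * (?T1 * (?S23 * (?S13 * Rb 2 1 u 1)))))))))"
    using TAT_L[of 2 1 3 "\<delta> + u" \<delta> w] nz by (simp add: mult.assoc)
  also have "?S23 * (?S13 * Rb 2 1 u 1) = Rb 2 1 u 1 * (?S13 * ?S23)"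
    by (rule inverse_ybe[where ?r2.0 = "Rb 2 3 (\<delta> + u + w) b2" and ?r1.0 = "Rb 1 3 (\<delta> + w) b2"])
       (use yb' nz Rb_Ri in auto)
  finally have 2: "Y * (A 1 3 * (A 2 3 * ?L)) = ?Q Y"
    by (simp add: Y_def mult.assoc)
  \<comment> \<open>The relation is linear in the operator, so the difference obeys it too, and the
    induction hypothesis applies inside \<open>?Q\<close>.\<close>
  have 3: "(X - Y) * (A 1 3 * (A 2 3 * ?L)) = ?Q (X - Y)"
    by (simp only: left_diff_distrib right_diff_distrib 1 2)
  have "app (X - Y) \<Phi> \<in> pw {0}"
  proof (rule op_induct[where k = 3, OF csub_0])
    note sub = csub_submod[OF csub_0]
    have cs: "comm (lift (spt s)) (X - Y)" for s unfolding X_def Y_def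
      by (intro comm_ring comm_spt_sm comm_spt_cm comm_spt_Top linop_tlin nz)
    then show "comm (X - Y) (lift (spt s))" for s by (rule comm_sym)
    show "comm (slice 3 r) (X - Y)" for r unfolding X_def Y_def
      by (intro comm_ring comm_slice_sm comm_slice_cm comm_slice_Top) (auto simp: \<delta>_def u_def plus_fun_apply)
    have cE: "comm (E 3 x y) (X - Y)" for x y unfolding X_def Y_def
      by (intro comm_ring comm_E_sm comm_E_cm comm_E_Top) auto
    then show "comm (X - Y) (E 3 x y)" for x y by (rule comm_sym)
    show "app (X - Y) \<Phi> \<in> pw {0}" if \<Phi>: "\<Phi> \<in> pw (spn 1)" for \<Phi>
    proof -
      note T1 = Top_one[OF linop_tlin tlin_one]
      have s: "app (cm i j Z) \<Phi> \<in> pw (spn 1)" "app (sm i j \<epsilon> c Z') \<Phi> \<in> pw (spn 1)" if "\<Phi> \<in> pw (spn 1)" for i j Z \<Phi> \<epsilon> c Z'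
        using stabD[OF stab_cm[OF submod_spn] that] stabD[OF stab_sm[OF submod_spn] that] by auto
      have "app X \<Phi> = app (Rb 1 2 u 1 * A 1 2) \<Phi>"
        unfolding X_def app_simps(4) T1[OF nz(4) \<Phi>] T1[OF nz(1) s(1)[OF \<Phi>]] ..
      moreover have "app Y \<Phi> = app (A 2 1 * Rb 2 1 u 1) \<Phi>"
        unfolding Y_def app_simps(4) T1[OF nz(1) s(2)[OF \<Phi>]] T1[OF nz(4) s(1)[OF s(2)[OF \<Phi>]]] ..
      moreover have "Rb 1 2 u 1 * A 1 2 = A 2 1 * Rb 2 1 u 1" by (rule Rb_A_comm) (use nz in auto)
      ultimately have "app X \<Phi> = app Y \<Phi>" by (simp only:)
      then show ?thesis by (simp add: pw_def)
    qed
    show "app ((X - Y) * Lop 3 (unit_exp 3)) \<Phi> \<in> pw {0}"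
      if IH: "\<And>\<Phi>. \<Phi> \<in> pw (spn b) \<Longrightarrow> app (X - Y) \<Phi> \<in> pw {0}" and \<Phi>: "\<Phi> \<in> pw (spn b)" for b \<Phi>
      unfolding w_def[symmetric]
    \<comment> \<open>Two matrices RP stand between the difference and L_3, one for each of the legs
      1 and 2; they are removed one at a time.\<close>
    proof (rule strip_mem[where i = 2 and j = 3, OF _ cE _ cs _ sub submod_spn _ \<Phi>])
      fix \<Phi> :: "'n mvec" assume \<Phi>: "\<Phi> \<in> pw (spn b)"
      show "app ((X - Y) * (A 2 3 * ?L)) \<Phi> \<in> pw {0}"
      proof (rule strip_mem[where i = 1 and j = 3, OF _ cE _ cs _ sub submod_spn _ \<Phi>])
        fix \<Phi> :: "'n mvec" assume \<Phi>: "\<Phi> \<in> pw (spn b)"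
        have "app (?S13 * ?S23) \<Phi> \<in> pw (spn b)"
          by (intro stabD[OF stab_mult] stab_sm submod_spn \<Phi>)
        from IH[OF this] have "app (X - Y) (app (?S13 * ?S23) \<Phi>) = 0"
          by (auto simp: pw_def fun_eq_iff)
        then have "app (?Q (X - Y)) \<Phi> = 0" by (simp only: app_simps(4) app_0)
        then show "app ((X - Y) * (A 1 3 * (A 2 3 * ?L))) \<Phi> \<in> pw {0}" unfolding 3 by (simp add: pw_def)
      qed (auto intro!: comm_ring comm_E_cm comm_E_Lop comm_spt_cm comm_spt_Lop nz)
    qed (auto intro!: comm_E_Lop comm_spt_Lop nz)
  qed fact
  then show ?thesis by (auto simp: pw_def X_def Y_def fun_eq_iff)
qed

end

section \<open>Inverses of operators congruent to the identity\<close>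

text \<open>The h-adically convergent sum of h^k times the k-th series.\<close>

definition xsum :: "(nat \<Rightarrow> 'a::comm_monoid_add fps) \<Rightarrow> 'a fps" where
  "xsum a = Abs_fps (\<lambda>n. \<Sum>k\<le>n. fps_nth (a k) (n - k))"

lemma xsum_rec: "xsum a = a 0 + fps_X * xsum (\<lambda>k. a (Suc k))" for a :: "nat \<Rightarrow> 'a::ring_1 fps"
proof (rule fps_ext)
  fix n show "fps_nth (xsum a) n = fps_nth (a 0 + fps_X * xsum (\<lambda>k. a (Suc k))) n"
    by (cases n) (simp_all add: xsum_def sum.atMost_Suc_shift del: sum.atMost_Suc)
qed

lemma xsum_split: "xsum a = (\<Sum>k<m. fps_X ^ k * a k) + fps_X ^ m * xsum (\<lambda>k. a (k + m))"
  for a :: "nat \<Rightarrow> 'a::ring_1 fps"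
proof (induction m)
  case (Suc m)
  have "xsum a = (\<Sum>k<m. fps_X ^ k * a k) + fps_X ^ m * (a m + fps_X * xsum (\<lambda>k. a (Suc k + m)))"
    using Suc xsum_rec[of "\<lambda>k. a (k + m)"] by simp
  then show ?case by (simp add: distrib_left mult.assoc[symmetric] power_commutes add.assoc)
qed simp

lemma xsum_add: "xsum (\<lambda>k. a k + b k) = xsum a + xsum b"
  by (simp add: fps_eq_iff xsum_def sum.distrib)

lemma xsum_0: "xsum (\<lambda>k. 0) = 0"
  by (simp add: fps_eq_iff xsum_def)

lemma xsum_sum: "xsum (\<lambda>k. \<Sum>x\<in>X. f x k) = (\<Sum>x\<in>X. xsum (f x))"
  by (induction X rule: infinite_finite_induct) (simp_all add: xsum_0 xsum_add)

lemma app_xsum: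
  assumes "linop f"
  shows "app f (xsum a) = xsum (\<lambda>k. app f (a k))"
proof -
  have "app f (xsum a) - xsum (\<lambda>k. app f (a k)) = 0"
  proof (rule X_power_dvd_all_imp_0)
    fix m
    have "app f (xsum a) - xsum (\<lambda>k. app f (a k))
      = fps_X ^ m * (app f (xsum (\<lambda>k. a (k + m))) - xsum (\<lambda>k. app f (a (k + m))))"
      by (subst (1 2) xsum_split[where m = m])
         (simp add: app_add app_sum linop_X[OF assms] right_diff_distrib)
    then show "\<exists>c. app f (xsum a) - xsum (\<lambda>k. app f (a k)) = fps_X ^ m * c" by blast
  qed
  then show ?thesis by simp
qed

type_synonym 'n opmat = "'n \<Rightarrow> 'n \<Rightarrow> nat \<Rightarrow> 'n falg addop"

definition conv :: "'n::finite opmat \<Rightarrow> 'n opmat \<Rightarrow> 'n opmat" where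
  "conv a b = (\<lambda>i j e. \<Sum>k\<in>UNIV. \<Sum>r=0..e. a i k r * b k j (e - r))"

definition idm :: "'n opmat" where
  "idm i j r = (if i = j \<and> r = 0 then 1 else 0)"

lemma conv_assoc: "conv (conv a b) c = conv a (conv b c)"
proof -
  \<comment> \<open>\<open>conv\<close> is matrix multiplication over power series with operator
    coefficients; associativity is inherited from that ring.\<close>
  have c: "conv a b i j e = fps_nth (\<Sum>k\<in>UNIV. Abs_fps (a i k) * Abs_fps (b k j)) e" for a b :: "'a opmat" and i j e
    by (simp add: conv_def fps_sum_nth fps_mult_nth)
  have A: "Abs_fps (conv a b i j) = (\<Sum>k\<in>UNIV. Abs_fps (a i k) * Abs_fps (b k j))" for a b :: "'a opmat" and i j
    by (simp add: fps_eq_iff c)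
  have "(\<Sum>k\<in>UNIV. (\<Sum>l\<in>UNIV. Abs_fps (a i l) * Abs_fps (b l k)) * Abs_fps (c k j))
    = (\<Sum>l\<in>UNIV. Abs_fps (a i l) * (\<Sum>k\<in>UNIV. Abs_fps (b l k) * Abs_fps (c k j)))" for i j
    unfolding sum_distrib_left sum_distrib_right mult.assoc by (rule sum.swap)
  then show ?thesis by (intro ext) (simp only: c A)
qed

lemma conv_idm_left: "conv idm a = a"
proof (intro ext)
  fix i j e
  have "conv idm a i j e = (\<Sum>k\<in>UNIV. if k = i then \<Sum>r=0..e. if r = 0 then a i j e else 0 else 0)"
    unfolding conv_def by (intro sum.cong) (auto simp: idm_def simp del: sum.delta sum.delta' intro!: sum.cong sum.neutral)
  then show "conv idm a i j e = a i j e" by simp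
qed

lemma conv_idm_right: "conv a idm = a"
proof (intro ext)
  fix i j e
  have "conv a idm i j e = (\<Sum>k\<in>UNIV. if k = j then \<Sum>r=0..e. if r = e then a i j e else 0 else 0)"
    unfolding conv_def by (intro sum.cong) (auto simp: idm_def simp del: sum.delta sum.delta' intro!: sum.cong sum.neutral)
  then show "conv a idm i j e = a i j e" by simp
qed

definition decays :: "'n opmat \<Rightarrow> bool" where
  "decays a \<longleftrightarrow> (\<forall>b k. \<exists>r0. \<forall>r\<ge>r0. \<forall>i j. \<exists>c. app (a i j r) b = fps_X ^ k * c)"

lemma X_power_dvd_add: "\<exists>c. x = fps_X ^ k * c \<Longrightarrow> \<exists>c. y = fps_X ^ k * c \<Longrightarrow> \<exists>c. x + y = fps_X ^ k * c"
  for x y :: "'a::ring_1 fps"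
proof -
  assume "\<exists>c. x = fps_X ^ k * c" "\<exists>c. y = fps_X ^ k * c"
  then obtain c d where "x = fps_X ^ k * c" "y = fps_X ^ k * d" by blast
  then show ?thesis by (intro exI[of _ "c + d"]) (simp add: distrib_left)
qed

lemma X_power_dvd_sum: "(\<And>i. i \<in> A \<Longrightarrow> \<exists>c. f i = fps_X ^ k * c) \<Longrightarrow> \<exists>c. sum f A = fps_X ^ k * c"
  for f :: "'x \<Rightarrow> 'a::ring_1 fps"
proof (induction A rule: infinite_finite_induct)
  case (insert x F)
  then have "\<exists>c. f x + sum f F = fps_X ^ k * c" by (intro X_power_dvd_add) auto
  then show ?case using insert by simp
qed (auto intro: exI[of _ 0])

text \<open>In a large total degree either the right factor has degree at least s0, where it is
  small, or the left one is applied to one of finitely many elements in a degree beyond all their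
  bounds.\<close>

lemma decays_conv:
  fixes a c :: "'n::finite opmat"
  assumes a: "decays a" "\<And>i j r. linop (a i j r)" and c: "decays c"
  shows "decays (conv a c)"
  unfolding decays_def
proof (intro allI)
  fix b :: "'n falg" and k
  obtain s0 where s0: "\<And>s i j. s \<ge> s0 \<Longrightarrow> \<exists>d. app (c i j s) b = fps_X ^ k * d"
    using c unfolding decays_def by blast
  have "\<forall>l j s. \<exists>r0. \<forall>r\<ge>r0. \<forall>i j'. \<exists>d. app (a i j' r) (app (c l j s) b) = fps_X ^ k * d"
    using a(1) unfolding decays_def by blast
  then obtain r0 where r0: "\<And>l j s r i j'. r \<ge> r0 l j s \<Longrightarrow> \<exists>d. app (a i j' r) (app (c l j s) b) = fps_X ^ k * d"
    by metis
  define r1 where "r1 = (\<Sum>l\<in>UNIV. \<Sum>j\<in>UNIV. \<Sum>s<s0. r0 l j s)"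
  have r1: "r0 l j s \<le> r1" if "s < s0" for l j s
  proof -
    have "r0 l j s \<le> (\<Sum>s<s0. r0 l j s)" using that by (intro member_le_sum) auto
    also have "\<dots> \<le> (\<Sum>j\<in>UNIV. \<Sum>s<s0. r0 l j s)" by (rule member_le_sum[of j]) auto
    also have "\<dots> \<le> r1" unfolding r1_def by (rule member_le_sum[of l]) auto
    finally show ?thesis .
  qed
  show "\<exists>e0. \<forall>e\<ge>e0. \<forall>i j. \<exists>d. app (conv a c i j e) b = fps_X ^ k * d"
  proof (intro exI[of _ "r1 + s0"] allI impI)
    fix e i j assume e: "e \<ge> r1 + s0"
    have "\<exists>d. app (a i l r) (app (c l j (e - r)) b) = fps_X ^ k * d" for l r
    proof (cases "e - r \<ge> s0")
      case True
      then obtain d where "app (c l j (e - r)) b = fps_X ^ k * d" using s0 by blast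
      then show ?thesis using linop_X[OF a(2)] by metis
    next
      case False
      then have "r \<ge> r0 l j (e - r)" using r1[of "e - r" l j] e by linarith
      then show ?thesis by (rule r0)
    qed
    then show "\<exists>d. app (conv a c i j e) b = fps_X ^ k * d"
      unfolding conv_def app_sum_left app_simps by (intro X_power_dvd_sum) auto
  qed
qed

lemma linop_conv: "(\<And>i j r. linop (a i j r)) \<Longrightarrow> (\<And>i j r. linop (c i j r)) \<Longrightarrow> linop (conv a c i j r)"
  unfolding conv_def by (intro linop_sum linop_ring)

lemma fps_X_mult_cancel: "fps_X * a = fps_X * b \<Longrightarrow> a = b" for a b :: "'a::ring_1 fps"
  by (metis fps_shift_times_fps_X' fps_mult_fps_X_commute)

text \<open>With T = 1 - hC the inverse is the sum of the h^m C^m. The last clause transfers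
  invariance to it, for closed submodules in which division by h is possible; it will be applied to
  the ideal of relations.\<close>

theorem inverse_exists:
  fixes T :: "'n::finite opmat"
  assumes lin: "\<And>i j r. linop (T i j r)" and dec: "decays T"
    and modh: "\<And>i j r b. fps_nth (app (T i j r - idm i j r) b) 0 = 0"
  obtains T' where "\<And>i j r. linop (T' i j r)" "decays T'" "conv T T' = idm" "conv T' T = idm"
    "\<And>U i j r x. csub U \<Longrightarrow> (\<And>x. fps_X * x \<in> U \<Longrightarrow> x \<in> U) \<Longrightarrow> (\<And>i j r x. x \<in> U \<Longrightarrow> app (T i j r) x \<in> U) \<Longrightarrow>
      x \<in> U \<Longrightarrow> app (T' i j r) x \<in> U"
proof -
  \<comment> \<open>This is (1 - T)/h; the shift loses nothing because \<open>modh\<close> makes the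
    constant coefficient vanish.\<close>
  define C where "C i j r = Addop (\<lambda>b. fps_shift 1 (app (idm i j r - T i j r) b))" for i j r
  have appC: "app (C i j r) b = fps_shift 1 (app (idm i j r - T i j r) b)" for i j r b
    unfolding C_def by (subst app_Addop) (auto simp: app_add fps_eq_iff algebra_simps)
  have XC: "fps_X * app (C i j r) b = app (idm i j r) b - app (T i j r) b" for i j r b
  proof (rule fps_ext)
    fix n
    show "fps_nth (fps_X * app (C i j r) b) n = fps_nth (app (idm i j r) b - app (T i j r) b) n"
      using modh[of i j r b] unfolding appC by (cases n) auto
  qed
  have lidm: "linop (idm i j r)" for i j :: 'n and r
    by (auto simp: idm_def)
  have linC: "linop (C i j r)" for i j r
    unfolding linop_def
  proof (intro allI, rule fps_X_mult_cancel)
    fix s b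
    have "fps_X * app (C i j r) (falg_const s * b) = falg_const s * (fps_X * app (C i j r) b)"
      by (simp add: XC linopD[OF lidm] linopD[OF lin] right_diff_distrib)
    also have "\<dots> = fps_X * (falg_const s * app (C i j r) b)"
      by (metis fps_mult_fps_X_commute mult.assoc)
    finally show "fps_X * app (C i j r) (falg_const s * b) = fps_X * (falg_const s * app (C i j r) b)" .
  qed
  define Cp where "Cp = rec_nat idm (\<lambda>m. conv C)"
  have Cp: "Cp 0 = idm" "Cp (Suc m) = conv C (Cp m)" for m by (simp_all add: Cp_def)
  have linCp: "linop (Cp m i j r)" for m i j r
    by (induction m arbitrary: i j r) (auto simp: Cp lidm intro!: linop_conv linC)
  have CpC: "conv (Cp m) C = Cp (Suc m)" for m
    by (induction m) (simp_all add: Cp conv_idm_left conv_idm_right conv_assoc)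
  define T' where "T' i j r = Addop (\<lambda>b. xsum (\<lambda>m. app (Cp m i j r) b))" for i j r
  have appT': "app (T' i j r) b = xsum (\<lambda>m. app (Cp m i j r) b)" for i j r b
    unfolding T'_def by (subst app_Addop) (auto simp: app_add xsum_add)
  have T'_rec: "app (T' i j r) b = app (idm i j r) b + fps_X * xsum (\<lambda>m. app (Cp (Suc m) i j r) b)" for i j r b
    unfolding appT' by (subst xsum_rec) (simp add: Cp(1))
  have linT': "linop (T' i j r)" for i j r
    unfolding linop_def appT' by (simp add: linopD[OF linCp] app_xsum[OF linop_smul, unfolded app_smul])
  have CT': "app (conv C T' i j e) b = xsum (\<lambda>m. app (Cp (Suc m) i j e) b)" for i j e b
    unfolding Cp(2) conv_def app_sum_left app_simps appT' app_xsum[OF linC] xsum_sum ..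
  have T'C: "app (conv T' C i j e) b = xsum (\<lambda>m. app (Cp (Suc m) i j e) b)" for i j e b
    unfolding CpC[symmetric] conv_def app_sum_left app_simps appT' xsum_sum ..
  have Teq: "app (T i j r) b = app (idm i j r) b - fps_X * app (C i j r) b" for i j r b
    by (simp add: XC)
  have 1: "conv T T' = idm"
  proof (intro ext addop_eqI)
    fix i j e b
    have "app (conv T T' i j e) b = app (conv idm T' i j e) b - fps_X * app (conv C T' i j e) b"
      unfolding conv_def app_sum_left app_simps Teq sum_subtractf sum_distrib_left ..
    then show "app (conv T T' i j e) b = app (idm i j e) b"
      by (simp add: conv_idm_left CT' T'_rec)
  qed
  have 2: "conv T' T = idm"
  proof (intro ext addop_eqI)
    fix i j e b
    have "app (conv T' T i j e) b = app (conv T' idm i j e) b - fps_X * app (conv T' C i j e) b"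
      unfolding conv_def app_sum_left app_simps Teq app_diff linop_X[OF linT', of _ _ _ 1, simplified] sum_subtractf sum_distrib_left ..
    then show "app (conv T' T i j e) b = app (idm i j e) b"
      by (simp add: conv_idm_right T'C T'_rec)
  qed
  have decI: "decays idm"
    unfolding decays_def by (intro allI exI[of _ 1]) (auto simp: idm_def intro!: exI[of _ 0])
  have decC: "decays C"
    unfolding decays_def
  proof (intro allI)
    fix b k
    obtain r0 where r0: "\<And>r i j. r \<ge> r0 \<Longrightarrow> \<exists>c. app (T i j r) b = fps_X ^ Suc k * c"
      using dec unfolding decays_def by blast
    show "\<exists>r0. \<forall>r\<ge>r0. \<forall>i j. \<exists>c. app (C i j r) b = fps_X ^ k * c"
    proof (intro exI[of _ "Suc r0"] allI impI)
      fix r i j assume r: "r \<ge> Suc r0"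
      then obtain c where c: "app (T i j r) b = fps_X ^ Suc k * c" using r0[of r i j] by auto
      have "fps_X * app (C i j r) b = fps_X * (fps_X ^ k * (- c))"
        unfolding XC c using r by (simp add: idm_def mult.assoc)
      then show "\<exists>c. app (C i j r) b = fps_X ^ k * c" using fps_X_mult_cancel by blast
    qed
  qed
  have decCp: "decays (Cp m)" for m
    by (induction m) (auto simp: Cp decI intro!: decays_conv decC linC)
  have 3: "decays T'"
    unfolding decays_def
  proof (intro allI)
    fix b k
    have "\<forall>m. \<exists>r0. \<forall>r\<ge>r0. \<forall>i j. \<exists>c. app (Cp m i j r) b = fps_X ^ k * c"
      using decCp unfolding decays_def by blast
    then obtain r0 where r0: "\<And>m r i j. r \<ge> r0 m \<Longrightarrow> \<exists>c. app (Cp m i j r) b = fps_X ^ k * c" by metis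
    \<comment> \<open>Terms with m \<ge> k are divisible by h^k in any case, so finitely many bounds
      have to be respected.\<close>
    show "\<exists>r0. \<forall>r\<ge>r0. \<forall>i j. \<exists>c. app (T' i j r) b = fps_X ^ k * c"
    proof (intro exI[of _ "\<Sum>m<k. r0 m"] allI impI)
      fix r i j assume r: "r \<ge> (\<Sum>m<k. r0 m)"
      have "\<exists>c. fps_X ^ m * app (Cp m i j r) b = fps_X ^ k * c" if "m < k" for m
      proof -
        have "r0 m \<le> (\<Sum>m<k. r0 m)" using that by (intro member_le_sum) auto
        then obtain c where c: "app (Cp m i j r) b = fps_X ^ k * c" using r0[of m r i j] r by auto
        have "fps_X ^ m * (fps_X ^ k * c) = fps_X ^ k * (fps_X ^ m * c)"
          by (simp only: mult.assoc[symmetric] power_add[symmetric] add.commute)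
        then show ?thesis unfolding c by blast
      qed
      then show "\<exists>c. app (T' i j r) b = fps_X ^ k * c"
        unfolding appT' xsum_split[of "\<lambda>m. app (Cp m i j r) b" k]
        by (intro X_power_dvd_add X_power_dvd_sum) auto
    qed
  qed
  have 4: "app (T' i j r) x \<in> U" if U: "csub U" and sat: "\<And>x. fps_X * x \<in> U \<Longrightarrow> x \<in> U"
    and T: "\<And>i j r x. x \<in> U \<Longrightarrow> app (T i j r) x \<in> U" and x: "x \<in> U" for U i j r x
  proof -
    note sub = csub_submod[OF U]
    \<comment> \<open>h C x is x or 0 minus T x, hence in U, and \<open>sat\<close> divides by
      h.\<close>
    have C: "app (C i j r) x \<in> U" if "x \<in> U" for i j r x
      by (rule sat, unfold XC) (use that T submodD(1)[OF sub] in \<open>auto simp: idm_def intro!: submod_diff[OF sub] submod_uminus[OF sub]\<close>)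
    have Cp: "app (Cp m i j r) x \<in> U" for m i j r
    proof (induction m arbitrary: i j r)
      case 0
      then show ?case using x submodD(1)[OF sub] by (auto simp: Cp idm_def)
    next
      case (Suc m)
      then show ?case unfolding Cp(2) conv_def app_sum_left app_simps by (intro submod_sum[OF sub] C)
    qed
    show ?thesis
    proof (rule csub_lim[OF U])
      fix m
      have "app (T' i j r) x - fps_X ^ m * xsum (\<lambda>k. app (Cp (k + m) i j r) x) = (\<Sum>k<m. falg_const (fps_X ^ k) * app (Cp k i j r) x)"
        unfolding appT' xsum_split[of "\<lambda>k. app (Cp k i j r) x" m] by (simp add: falg_const_X_power)
      also have "\<dots> \<in> U" by (intro submod_sum[OF sub] submodD(3)[OF sub] Cp)
      finally show "\<exists>c. app (T' i j r) x - fps_X ^ m * c \<in> U" by blast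
    qed
  qed
  from that[OF linT' 3 1 2 4] show ?thesis .
qed

section \<open>The operator preserves the ideal of relations\<close>

text \<open>The basis column J with entry c in exponent 0: applying a matrix to it reads off column
  J, evaluated at c.\<close>

definition sg :: "(nat \<Rightarrow> 'n) \<Rightarrow> 'n falg \<Rightarrow> 'n mvec" where
  "sg J c = (\<lambda>I. if I = J then sing 0 c else 0)"

text \<open>A test for the absence of the variable x_0: an operator commuting with it keeps
  arguments of degree 0 in x_0 in degree 0.\<close>

definition zproj :: "nat \<Rightarrow> 'n mvec addop" where
  "zproj k = Addop (\<lambda>\<Phi> I e. if e k = 0 then \<Phi> I e else 0)"

lemma app_zproj: "app (zproj k) \<Phi> I e = (if e k = 0 then \<Phi> I e else 0)"
  by (simp add: zproj_def app_Addop fun_eq_iff plus_fun_apply)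

lemma comm_zproj_E: "comm (zproj k) (E l a b)"
  unfolding comm_def by (rule mvec_eqI) (auto simp: fun_eq_iff app_E app_zproj)

lemma comm_zproj_gser:
  assumes "\<And>x. w x k = 0"
  shows "comm (zproj k) (lift (gser w g))"
  unfolding comm_def
proof (rule mvec_eqI, rule ext)
  fix \<Phi> :: "'b mvec" and I e
  have "(e - w x) k = 0 \<longleftrightarrow> e k = 0" for x using assms[of x] by simp
  then show "app (zproj k * lift (gser w g)) \<Phi> I e = app (lift (gser w g) * zproj k) \<Phi> I e"
    by (auto simp: app_zproj app_lift app_gser)
qed

text \<open>Of the sum over columns and degrees a single term survives, so an entry of T applied to
  a coefficient of \<Psi> can be recovered from the operator on vectors.\<close>

lemma Top_value:
  fixes T :: "'n::finite opmat"
  assumes supp: "\<And>I e. I 0 \<noteq> j \<or> e 0 \<noteq> 0 \<Longrightarrow> \<Psi> I e = 0" and I: "I 0 = j" and e: "e 0 = 0"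
  shows "app (Top T 0 (unit_exp 0)) \<Psi> (I(0 := i)) (e(0 := r)) = app (T i j r) (\<Psi> I e)"
proof -
  let ?I = "I(0 := i)" and ?e = "e(0 := r)"
  have "app (Top T 0 (unit_exp 0)) \<Psi> ?I ?e
    = (\<Sum>b\<in>UNIV. \<Sum>r' | mexp r' (unit_exp 0) \<le> ?e. app (T i b r') (\<Psi> (I(0 := b)) (?e - mexp r' (unit_exp 0))))"
    by (simp add: Top_def app_leg1m sum_fun_apply app_gser)
  also have "\<dots> = (\<Sum>b\<in>UNIV. if b = j then app (T i j r) (\<Psi> I e) else 0)"
  proof (intro sum.cong refl)
    fix b
    have er: "?e - mexp r (unit_exp 0) = e" using e by (auto simp: fun_eq_iff unit_exp_def)
    have "(\<Sum>r' | mexp r' (unit_exp 0) \<le> ?e. app (T i b r') (\<Psi> (I(0 := b)) (?e - mexp r' (unit_exp 0))))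
      = (\<Sum>r'\<in>{r}. app (T i b r') (\<Psi> (I(0 := b)) (?e - mexp r' (unit_exp 0))))"
    proof (rule sum.mono_neutral_right)
      show "finite {r'. mexp r' (unit_exp 0) \<le> ?e}" by (rule finD[OF fin_mexp]) simp
      show "{r} \<subseteq> {r'. mexp r' (unit_exp 0) \<le> ?e}" by (auto simp: le_fun_def unit_exp_def)
      show "\<forall>r'\<in>{r'. mexp r' (unit_exp 0) \<le> ?e} - {r}. app (T i b r') (\<Psi> (I(0 := b)) (?e - mexp r' (unit_exp 0))) = 0"
      proof
        fix r' assume r': "r' \<in> {r'. mexp r' (unit_exp 0) \<le> ?e} - {r}"
        then have "r' * unit_exp 0 0 \<le> ?e 0" unfolding le_fun_def by blast
        then have "(?e - mexp r' (unit_exp 0)) 0 \<noteq> 0" using r' by simp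
        then show "app (T i b r') (\<Psi> (I(0 := b)) (?e - mexp r' (unit_exp 0))) = 0" using supp by simp
      qed
    qed
    also have "\<dots> = app (T i b r) (\<Psi> (I(0 := b)) e)" by (simp add: er del: fun_upd_apply)
    also have "\<dots> = (if b = j then app (T i j r) (\<Psi> I e) else 0)"
      using supp[of "I(0 := b)" e] I by auto
    finally show "(\<Sum>r' | mexp r' (unit_exp 0) \<le> ?e. app (T i b r') (\<Psi> (I(0 := b)) (?e - mexp r' (unit_exp 0))))
      = (if b = j then app (T i j r) (\<Psi> I e) else 0)" .
  qed
  finally show ?thesis by simp
qed

lemma Top_extract:
  fixes T :: "'n::finite opmat"
  assumes mem: "app (Top T 0 (unit_exp 0)) \<Psi> \<in> pw U"
    and supp: "\<And>I e. I 0 \<noteq> j \<or> e 0 \<noteq> 0 \<Longrightarrow> \<Psi> I e = 0" and I: "I 0 = j" and e: "e 0 = 0"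
  shows "app (T i j r) (\<Psi> I e) \<in> U"
proof -
  have "app (Top T 0 (unit_exp 0)) \<Psi> (I(0 := i)) (e(0 := r)) \<in> U" using mem unfolding pw_def by blast
  moreover have "app (Top T 0 (unit_exp 0)) \<Psi> (I(0 := i)) (e(0 := r)) = app (T i j r) (\<Psi> I e)"
    by (rule Top_value) (erule supp, rule I, rule e)
  ultimately show ?thesis by simp
qed

context tdata begin

text \<open>The difference of the two sides of the defining relation, in the variables x_1/x_2
  (\<open>unit_exp 1\<close>) and x_2 (\<open>unit_exp 2\<close>); L_1 therefore has the sum of the
  two exponents.\<close>

definition rho :: "'n mvec addop" where
  "rho = Rb 1 2 (unit_exp 1) 1 * (Lop 1 (unit_exp 1 + unit_exp 2) * (A 1 2 * Lop 2 (unit_exp 2)))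
    - Lop 2 (unit_exp 2) * (A 2 1 * (Lop 1 (unit_exp 1 + unit_exp 2) * Rb 2 1 (unit_exp 1) 1))"

text \<open>T is moved through both terms of the relation by \<open>brk_exchange\<close>, with the
  labels in the orders 1, 2 and 2, 1. Yang--Baxter equations with the R-matrix on legs 1, 2 bring
  the outer factors into the same order, so \<open>rho\<close> reappears in the middle.\<close>

lemma T_rho:
  defines "\<delta> \<equiv> unit_exp 0" and "u \<equiv> unit_exp 1" and "v \<equiv> unit_exp 2"
  shows "Top T 0 \<delta> * (A 0 2 * (A 0 1 * rho))
    = Rb 2 0 (\<delta> + v) b1 * (Rb 1 0 (\<delta> + (u + v)) b1 * (rho * (A 1 0 * (A 2 0 *
       (Top T 0 \<delta> * (Ri 0 2 (\<delta> + v) b2 * Ri 0 1 (\<delta> + (u + v)) b2))))))"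
proof -
  let ?T = "Top T 0 \<delta>" and ?R1 = "Rb 1 0 (\<delta> + (u + v)) b1" and ?R2 = "Rb 2 0 (\<delta> + v) b1"
  let ?S1 = "Ri 0 1 (\<delta> + (u + v)) b2" and ?S2 = "Ri 0 2 (\<delta> + v) b2"
  let ?L1 = "Lop 1 (u + v) :: 'n mvec addop" and ?L2 = "Lop 2 v :: 'n mvec addop"
  let ?R12 = "Rb 1 2 u 1" and ?R21 = "Rb 2 1 u 1"
  have nz: "\<delta> \<noteq> 0" "u \<noteq> 0" "v \<noteq> 0" "u + v \<noteq> 0" "\<delta> + v \<noteq> 0" "\<delta> + (u + v) \<noteq> 0"
    by (auto simp: \<delta>_def u_def v_def fun_eq_iff unit_exp_def plus_fun_apply)
  interpret ex: exchange ?T A "\<lambda>k. Rb k 0 (\<delta> + (if k = 1 then u + v else v)) b1"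
    "\<lambda>k. Ri 0 k (\<delta> + (if k = 1 then u + v else v)) b2" "\<lambda>k. Lop k (if k = 1 then u + v else v)" 0 "{1, 2}"
    by (rule exchange_Top) (use nz in auto)
  have e12: "?T * (A 0 1 * (A 0 2 * (?L1 * (A 1 2 * ?L2)))) = ?R1 * (?R2 * (?L1 * (A 1 2 * (?L2 * (A 1 0 * (A 2 0 * (?T * (?S2 * ?S1))))))))"
    using ex.brk_exchange[of "[1, 2]"] by (simp add: mult.assoc)
  have e21: "?T * (A 0 2 * (A 0 1 * (?L2 * (A 2 1 * ?L1)))) = ?R2 * (?R1 * (?L2 * (A 2 1 * (?L1 * (A 2 0 * (A 1 0 * (?T * (?S1 * ?S2))))))))"
    using ex.brk_exchange[of "[2, 1]"] by (simp add: mult.assoc)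
  have y1: "?R12 * (?R1 * ?R2) = ?R2 * (?R1 * ?R12)"
    using Rb_ybe[of 1 2 0 u "\<delta> + v" 1 b1] nz by (simp add: add_ac)
  have y2: "?S1 * (?S2 * ?R21) = ?R21 * (?S2 * ?S1)"
  proof (rule inverse_ybe[where ?r2.0 = "Rb 0 1 (\<delta> + (u + v)) b2" and ?r1.0 = "Rb 0 2 (\<delta> + v) b2"])
    show "Rb 0 2 (\<delta> + v) b2 * (Rb 0 1 (\<delta> + (u + v)) b2 * ?R21) = ?R21 * (Rb 0 1 (\<delta> + (u + v)) b2 * Rb 0 2 (\<delta> + v) b2)"
      using Rb_ybe[of 0 2 1 "\<delta> + v" u b2 1] nz by (simp add: add_ac)
  qed (use nz Rb_Ri in auto)
  have "?T * (A 0 2 * (A 0 1 * (?R12 * (?L1 * (A 1 2 * ?L2)))))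
    = ?T * ((A 0 2 * (A 0 1 * ?R12)) * (?L1 * (A 1 2 * ?L2)))" by (simp only: mult.assoc)
  also have "A 0 2 * (A 0 1 * ?R12) = ?R12 * (A 0 1 * A 0 2)"
    by (rule Rb_alpha) (use nz in auto)
  also have "?T * ((?R12 * (A 0 1 * A 0 2)) * (?L1 * (A 1 2 * ?L2))) = ?T * (?R12 * (A 0 1 * (A 0 2 * (?L1 * (A 1 2 * ?L2)))))"
    by (simp only: mult.assoc)
  also have "\<dots> = ?R12 * (?T * (A 0 1 * (A 0 2 * (?L1 * (A 1 2 * ?L2)))))"
    by (rule comm_left[OF comm_sym[OF comm_sm_T]]) (use nz in auto)
  also have "\<dots> = (?R12 * (?R1 * ?R2)) * (?L1 * (A 1 2 * (?L2 * (A 1 0 * (A 2 0 * (?T * (?S2 * ?S1)))))))"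
    unfolding e12 by (simp only: mult.assoc)
  finally have 1: "?T * (A 0 2 * (A 0 1 * (?R12 * (?L1 * (A 1 2 * ?L2)))))
    = ?R2 * (?R1 * ((?R12 * (?L1 * (A 1 2 * ?L2))) * (A 1 0 * (A 2 0 * (?T * (?S2 * ?S1))))))"
    unfolding y1 by (simp only: mult.assoc)
  have "?T * (A 0 2 * (A 0 1 * (?L2 * (A 2 1 * (?L1 * ?R21)))))
    = (?T * (A 0 2 * (A 0 1 * (?L2 * (A 2 1 * ?L1))))) * ?R21" by (simp only: mult.assoc)
  also have "\<dots> = ?R2 * (?R1 * (?L2 * (A 2 1 * (?L1 * (A 2 0 * (A 1 0 * (?T * (?S1 * (?S2 * ?R21)))))))))"
    unfolding e21 by (simp only: mult.assoc)
  also have "?T * (?S1 * (?S2 * ?R21)) = ?R21 * (?T * (?S2 * ?S1))"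
    unfolding y2 by (rule comm_left[OF comm_sym[OF comm_sm_T]]) (use nz in auto)
  also have "?L1 * (A 2 0 * (A 1 0 * (?R21 * (?T * (?S2 * ?S1))))) = ?L1 * ((A 2 0 * (A 1 0 * ?R21)) * (?T * (?S2 * ?S1)))"
    by (simp only: mult.assoc)
  also have "A 2 0 * (A 1 0 * ?R21) = ?R21 * (A 1 0 * A 2 0)"
    by (rule Rb_beta) (use nz in auto)
  finally have 2: "?T * (A 0 2 * (A 0 1 * (?L2 * (A 2 1 * (?L1 * ?R21)))))
    = ?R2 * (?R1 * ((?L2 * (A 2 1 * (?L1 * ?R21))) * (A 1 0 * (A 2 0 * (?T * (?S2 * ?S1))))))"
    by (simp only: mult.assoc)
  show ?thesis
    unfolding rho_def u_def[symmetric] v_def[symmetric]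
    by (simp only: left_diff_distrib right_diff_distrib 1 2)
qed

text \<open>In \<open>T_rho\<close> only R-matrices, which preserve U, stand to the left of
  \<open>rho\<close>; what stands to its right is an argument of \<open>rho\<close>.\<close>

lemma T_rho_mem:
  assumes U: "submod U" and rho: "\<And>\<Phi>. app rho \<Phi> \<in> pw U"
  shows "app (Top T 0 (unit_exp 0) * rho) \<Phi> \<in> pw U"
proof -
  have sU: "submod UNIV" by (simp add: submod_def)
  have nz: "unit_exp 1 + unit_exp 2 \<noteq> 0" by (rule nz_add) simp
  have rE: "comm (E 0 x y) rho" for x y
    unfolding rho_def by (intro comm_ring comm_E_sm comm_E_Lop comm_E_cm) auto
  have rs: "comm (lift (spt s)) rho" for s
    unfolding rho_def by (intro comm_ring comm_spt_sm comm_spt_Lop comm_spt_cm nz unit_exp_nz)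
  have Ts: "comm (lift (spt s)) (Top T 0 (unit_exp 0))" for s
    by (intro comm_spt_Top linop_tlin unit_exp_nz)
  have 1: "app ((Top T 0 (unit_exp 0) * A 0 2) * rho) \<Phi> \<in> pw U" for \<Phi>
  proof (rule strip_mem[where i = 0 and j = 1, OF _ _ rE _ rs U sU])
    fix \<Phi> :: "'n mvec"
    show "app (Top T 0 (unit_exp 0) * A 0 2 * (A 0 1 * rho)) \<Phi> \<in> pw U"
      unfolding mult.assoc T_rho app_simps(4)[of "sm _ _ _ _ _"] app_simps(4)[of rho]
      by (intro stabD[OF stab_sm[OF U]] rho)
  qed (auto simp: pw_def intro!: comm_ring Ts comm_spt_cm comm_E_Top comm_E_cm)
  show ?thesis
  proof (rule strip_mem[where i = 0 and j = 2, OF _ _ rE Ts rs U sU])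
    fix \<Phi> :: "'n mvec"
    show "app (Top T 0 (unit_exp 0) * (A 0 2 * rho)) \<Phi> \<in> pw U"
      using 1 by (simp only: mult.assoc)
  qed (auto simp: pw_def intro!: comm_E_Top)
qed

lemma rho_supp: "e 0 \<noteq> 0 \<Longrightarrow> app rho (sg J c) I e = 0"
proof -
  assume e: "e 0 \<noteq> 0"
  have cz1: "comm (zproj 0) (cm p q X :: 'n mvec addop)" for p q X
    unfolding cm_def spt_def by (intro comm_leg2m comm_zproj_E comm_zproj_gser) simp
  have cz2: "comm (zproj 0) (Lop p \<epsilon> :: 'n mvec addop)" if "\<epsilon> 0 = 0" for p \<epsilon>
    unfolding Lop_def by (intro comm_leg1m comm_zproj_E comm_zproj_gser) (simp add: that)
  have cz3: "comm (zproj 0) (sm p q \<epsilon> b Y)" if "\<epsilon> 0 = 0" for p q \<epsilon> b Y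
    unfolding sm_def sser_def by (intro comm_leg2m comm_zproj_E comm_zproj_gser) (simp add: that)
  have "comm (zproj 0) rho"
    unfolding rho_def by (intro comm_ring cz1 cz2 cz3) (auto simp: plus_fun_apply)
  then have "app rho (app (zproj 0) (sg J c)) = app (zproj 0) (app rho (sg J c))"
    unfolding comm_def app_simps(4)[symmetric] by simp
  moreover have "app (zproj 0) (sg J c) = sg J c"
    by (auto simp: fun_eq_iff app_zproj sg_def sing_def)
  ultimately show ?thesis using app_zproj[of 0 "app rho (sg J c)" I e] e by simp
qed

text \<open>\<open>rho\<close> leaves leg 0 alone, so the common index of I and J there can be moved
  to j, where the entry of T is read off.\<close>

lemma T_rho_value:
  assumes U: "submod U" and rho: "\<And>\<Phi>. app rho \<Phi> \<in> pw U" and I: "I 0 = J 0"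
  shows "app (T i j r) (app rho (sg J c) I e) \<in> U"
proof (cases "e 0 = 0")
  case True
  let ?\<Phi> = "app (E 0 j (J 0)) (sg J c)"
  have rE: "comm (E 0 x y) rho" for x y
    unfolding rho_def by (intro comm_ring comm_E_sm comm_E_Lop comm_E_cm) auto
  have eq: "app rho ?\<Phi> = app (E 0 j (J 0)) (app rho (sg J c))"
    using rE[of j "J 0"] unfolding comm_def app_simps(4)[symmetric] by simp
  have "app (T i j r) (app rho ?\<Phi> (I(0 := j)) e) \<in> U"
  proof (rule Top_extract[where \<Psi> = "app rho ?\<Phi>" and I = "I(0 := j)" and e = e])
    show "app (Top T 0 (unit_exp 0)) (app rho ?\<Phi>) \<in> pw U"
      using T_rho_mem[OF U rho] by simp
    show "app rho ?\<Phi> I e = 0" if "I 0 \<noteq> j \<or> e 0 \<noteq> 0" for I e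
      using that rho_supp unfolding eq app_E by auto
  qed (use True in auto)
  moreover have "app rho ?\<Phi> (I(0 := j)) e = app rho (sg J c) I e"
    unfolding eq app_E using I by (simp add: fun_upd_idem)
  ultimately show ?thesis by simp
next
  case False
  then show ?thesis using rho_supp submodD(1)[OF U] by simp
qed

definition rmul :: "'n falg \<Rightarrow> 'n falg addop" where
  "rmul y = Addop (\<lambda>x. x * y)"

lemma app_rmul: "app (rmul y) x = x * y"
  unfolding rmul_def by (subst app_Addop) (auto simp: distrib_right)

lemma linop_rmul: "linop (rmul y)"
  by (simp add: linop_def app_rmul mult.assoc)

text \<open>The elements that T sends into J form a left ideal, since T moves past
  \<open>lplus\<close> leaving an entry of L^+ on the left. A two-sided, closed and saturated ideal
  is made of them and shown to contain the relations; it then contains J by minimality.\<close>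

theorem T_preserves:
  assumes J: "csub J" "\<And>a x. x \<in> J \<Longrightarrow> a * x \<in> J" "\<And>x. fps_X * x \<in> J \<Longrightarrow> x \<in> J"
    and least: "\<And>I. csub I \<Longrightarrow> (\<And>a x. x \<in> I \<Longrightarrow> a * x \<in> I) \<Longrightarrow> (\<And>a x. x \<in> I \<Longrightarrow> x * a \<in> I) \<Longrightarrow>
      (\<And>x. fps_X * x \<in> I \<Longrightarrow> x \<in> I) \<Longrightarrow> rels \<subseteq> I \<Longrightarrow> J \<subseteq> I"
    and rels: "\<And>y. y \<in> rels \<Longrightarrow> \<exists>I K e. I 0 = K 0 \<and> (\<forall>c. y * c = app rho (sg K c) I e)"
    and rho: "\<And>\<Phi>. app rho \<Phi> \<in> pw J" and x: "x \<in> J"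
  shows "app (T i j r) x \<in> J"
proof -
  note sub = csub_submod[OF J(1)]
  define J1 where "J1 = {x. \<forall>t\<in>UNIV. x \<in> {x. app (case t of (i, j, r) \<Rightarrow> T i j r) x \<in> J}}"
  have J1: "csub J1" unfolding J1_def
    by (intro csub_Inter csub_vimage J(1)) (auto intro: linop_tlin)
  have J1_iff: "x \<in> J1 \<longleftrightarrow> (\<forall>i j r. app (T i j r) x \<in> J)" for x by (auto simp: J1_def)
  have left: "d * y \<in> J1" if "y \<in> J1" for d y
  proof -
    have "csub {d. \<forall>y\<in>J1. d \<in> {d. app (rmul y) d \<in> J1}}"
      by (intro csub_Inter csub_vimage J1 linop_rmul)
    then have "d \<in> {d. \<forall>y\<in>J1. d \<in> {d. app (rmul y) d \<in> J1}}"
    proof (rule csub_eq_UNIV)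
      fix a b s d assume d: "d \<in> {d. \<forall>y\<in>J1. d \<in> {d. app (rmul y) d \<in> J1}}"
      have "app (T i j r) (lplus a b s * (d * y)) \<in> J" if "y \<in> J1" for i j r y
      proof -
        have dy: "app (T i j r) (d * y) \<in> J" for i j r using d that by (auto simp: app_rmul J1_iff)
        have "app (T i j r) (lplus a b s * (d * y)) = app (T i j r * lmul (lplus a b s)) (d * y)" by simp
        also have "\<dots> \<in> J" unfolding tlin_rec app_sum_left
          by (intro submod_sum[OF sub]) (auto simp: split_def intro!: submodD(3)[OF sub] J(2) dy)
        finally show ?thesis .
      qed
      then show "lplus a b s * d \<in> {d. \<forall>y\<in>J1. d \<in> {d. app (rmul y) d \<in> J1}}"
        by (auto simp: app_rmul J1_iff mult.assoc)
    qed (auto simp: app_rmul)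
    then show ?thesis using that by (auto simp: app_rmul)
  qed
  \<comment> \<open>Right multiplication need not preserve \<open>J1\<close>; demanding x c in
    \<open>J1\<close> for all c does. This is why the relations are tested on every c.\<close>
  define J2 where "J2 = {x. \<forall>c\<in>UNIV. x \<in> {x. app (rmul c) x \<in> J1}}"
  have J2_iff: "x \<in> J2 \<longleftrightarrow> (\<forall>c. x * c \<in> J1)" for x by (auto simp: J2_def app_rmul)
  have "J \<subseteq> J2"
  proof (rule least)
    show "csub J2" unfolding J2_def by (intro csub_Inter csub_vimage J1 linop_rmul)
    show "a * x \<in> J2" if "x \<in> J2" for a x using that left by (auto simp: J2_iff mult.assoc)
    show "x * a \<in> J2" if "x \<in> J2" for a x using that by (auto simp: J2_iff mult.assoc)
    show "x \<in> J2" if "fps_X * x \<in> J2" for x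
      unfolding J2_iff J1_iff
    proof (intro allI)
      fix c i j r
      have "app (T i j r) (fps_X ^ 1 * (x * c)) \<in> J"
        using that by (auto simp: J2_iff J1_iff mult.assoc)
      then have "fps_X * app (T i j r) (x * c) \<in> J"
        unfolding linop_X[OF linop_tlin] by simp
      then show "app (T i j r) (x * c) \<in> J" by (rule J(3))
    qed
    show "rels \<subseteq> J2"
    proof
      fix y assume "y \<in> rels"
      then obtain I K e where y: "I 0 = K 0" "\<And>c. y * c = app rho (sg K c) I e" using rels by blast
      then show "y \<in> J2" unfolding J2_iff J1_iff using T_rho_value[where I = I and J = K, OF sub rho y(1)] by simp
    qed
  qed
  then have "x * 1 \<in> J1" using x J2_iff by blast
  then show ?thesis by (simp add: J1_iff)
qed

text \<open>On words T is a polynomial in 1/x. For fixed k the property is closed, because a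
  multiple of h^k is already divisible enough.\<close>

lemma T_decays: "decays T"
  unfolding decays_def
proof (intro allI)
  fix b :: "'n falg" and k
  let ?K = "{b. \<exists>r0. \<forall>r\<ge>r0. \<forall>i j. \<exists>c. app (T i j r) b = fps_X ^ k * c}"
  have "csub ?K"
    unfolding csub_def submod_def
  proof (intro conjI ballI allI impI)
    show "0 \<in> ?K" by (auto intro!: exI[of _ 0])
    show "a + b \<in> ?K" if ab: "a \<in> ?K" "b \<in> ?K" for a b
    proof -
      obtain r1 where r1: "\<And>r i j. r \<ge> r1 \<Longrightarrow> \<exists>c. app (T i j r) a = fps_X ^ k * c" using ab(1) by blast
      obtain r2 where r2: "\<And>r i j. r \<ge> r2 \<Longrightarrow> \<exists>c. app (T i j r) b = fps_X ^ k * c" using ab(2) by blast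
      show ?thesis
        by (intro CollectI exI[of _ "r1 + r2"] allI impI, unfold app_add, intro X_power_dvd_add r1 r2) auto
    qed
    show "falg_const s * a \<in> ?K" if a: "a \<in> ?K" for s a
    proof -
      obtain r1 where r1: "\<And>r i j. r \<ge> r1 \<Longrightarrow> \<exists>c. app (T i j r) a = fps_X ^ k * c" using a by blast
      have "\<exists>c. app (T i j r) (falg_const s * a) = fps_X ^ k * c" if r: "r \<ge> r1" for r i j
      proof -
        obtain c where c: "app (T i j r) a = fps_X ^ k * c" using r1[OF r] by blast
        show ?thesis
          by (rule exI[of _ "falg_const s * c"])
             (simp only: linopD[OF linop_tlin] c, metis fps_mult_fps_X_power_commute mult.assoc)
      qed
      then show ?thesis by blast
    qed
    show "b \<in> ?K" if lim: "\<forall>m. \<exists>c. b - fps_X ^ m * c \<in> ?K" for b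
    proof -
      obtain c where "b - fps_X ^ k * c \<in> ?K" using lim by blast
      then obtain r1 where r1: "\<And>r i j. r \<ge> r1 \<Longrightarrow> \<exists>d. app (T i j r) (b - fps_X ^ k * c) = fps_X ^ k * d" by blast
      have "\<exists>d. app (T i j r) b = fps_X ^ k * d" if r: "r \<ge> r1" for r i j
      proof -
        have "app (T i j r) b = app (T i j r) (b - fps_X ^ k * c) + fps_X ^ k * app (T i j r) c"
          by (simp add: app_diff linop_X[OF linop_tlin])
        then show ?thesis using X_power_dvd_add[OF r1[OF r, of i j]] by auto
      qed
      then show ?thesis by blast
    qed
  qed
  then have "b \<in> ?K"
  proof (rule csub_eq_UNIV_word)
    fix w
    obtain r0 where "\<And>r i a. r \<ge> r0 \<Longrightarrow> tword H w i a r = 0" using tword_decay by blast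
    then have "\<forall>r\<ge>r0. \<forall>i j. app (T i j r) (word w) = fps_X ^ k * 0" by (simp add: tlin_word)
    then show "word w \<in> ?K" by blast
  qed
  then show "\<exists>r0. \<forall>r\<ge>r0. \<forall>i j. \<exists>c. app (T i j r) b = fps_X ^ k * c" by blast
qed

lemma T_idm_mod_h: "fps_nth (app (T i j r - idm i j r) b) 0 = 0"
proof -
  \<comment> \<open>With b placed at index j of leg 0 and at exponent 0, the element T b is a single
    coefficient of the image.\<close>
  define \<Phi> :: "'n mvec" where "\<Phi> = (\<lambda>I e. if I 0 = j \<and> e = 0 then b else 0)"
  have "\<Phi> \<in> pw (spn b)"
    using submodD(1)[OF submod_spn[of b]] by (auto simp: \<Phi>_def pw_def spn_def intro!: exI[of _ 1])
  from T_mod_h[OF this] have m: "app (Top T 0 (unit_exp 0) - 1) \<Phi> \<in> pw {b. fps_nth b 0 = 0}" .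
  define e where "e = mexp r (unit_exp 0)"
  have le: "mexp r' (unit_exp 0) \<le> e \<longleftrightarrow> r' \<le> r" for r'
    by (auto simp: e_def le_fun_def unit_exp_def)
  have e0: "e - mexp r' (unit_exp 0) = 0 \<longleftrightarrow> r' = r" if "r' \<le> r" for r'
    using that by (auto simp: e_def fun_eq_iff unit_exp_def)
  have "app (Top T 0 (unit_exp 0)) \<Phi> (\<lambda>_. i) e
    = (\<Sum>x\<in>UNIV. \<Sum>r'\<in>{..r}. app (T i x r') (\<Phi> ((\<lambda>_. i)(0 := x)) (e - mexp r' (unit_exp 0))))"
    by (simp add: Top_def app_leg1m sum_fun_apply app_gser le atMost_def)
  also have "\<dots> = (\<Sum>x\<in>UNIV. if x = j then \<Sum>r'\<in>{..r}. if r' = r then app (T i j r) b else 0 else 0)"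
    by (intro sum.cong refl) (auto simp: \<Phi>_def e0 simp del: sum.delta sum.delta' intro!: sum.cong sum.neutral)
  also have "\<dots> = app (T i j r) b" by simp
  finally have 1: "app (Top T 0 (unit_exp 0)) \<Phi> (\<lambda>_. i) e = app (T i j r) b" .
  have "e = 0 \<longleftrightarrow> r = 0" by (auto simp: e_def fun_eq_iff unit_exp_def)
  then have 2: "\<Phi> (\<lambda>_. i) e = app (idm i j r) b" by (auto simp: \<Phi>_def idm_def)
  have "fps_nth (app (Top T 0 (unit_exp 0) - 1) \<Phi> (\<lambda>_. i) e) 0 = 0" using m by (auto simp: pw_def)
  then show ?thesis by (simp add: 1 2)
qed

end

section \<open>Series of matrices as operators\<close>

lemma idx_update: "I \<in> idx S \<Longrightarrow> k \<in> S \<Longrightarrow> I(k := b) \<in> idx S"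
  by (auto simp: idx_def PiE_def extensional_def)

text \<open>
  \<open>ev f c\<close> is the value of \<open>f \<in> K\<close> at (the class of) \<open>c\<close>, and \<open>\<iota>\<close> is the monomial change of
  variables after which all series have exponents in \<open>\<nat>\<close>; it is what turns the product of
  matrices into composition of operators on \<^typ>\<open>'n mvec\<close>.
\<close>

locale rep =
  fixes K :: "(complex fps, 'k) module" and ev :: "'k \<Rightarrow> 'n::finite falg \<Rightarrow> 'y" and cl :: "'n falg \<Rightarrow> 'y"
    and S :: "nat set" and \<iota> :: "(nat \<Rightarrow> nat) \<Rightarrow> nat \<Rightarrow> int"
  assumes abelian_monoid_K: "abelian_monoid K"
    and mult_closed: "\<And>f g. f \<in> carrier K \<Longrightarrow> g \<in> carrier K \<Longrightarrow> f \<otimes>\<^bsub>K\<^esub> g \<in> carrier K"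
    and null: "\<And>f. f \<in> carrier K \<Longrightarrow> \<zero>\<^bsub>K\<^esub> \<otimes>\<^bsub>K\<^esub> f = \<zero>\<^bsub>K\<^esub>" "\<And>f. f \<in> carrier K \<Longrightarrow> f \<otimes>\<^bsub>K\<^esub> \<zero>\<^bsub>K\<^esub> = \<zero>\<^bsub>K\<^esub>"
    and one_closed: "\<one>\<^bsub>K\<^esub> \<in> carrier K"
    and ev_zero: "\<And>c. ev \<zero>\<^bsub>K\<^esub> c = cl 0"
    and ev_one: "\<And>c. ev \<one>\<^bsub>K\<^esub> c = cl c"
    and ev_add: "\<And>f g c x y. f \<in> carrier K \<Longrightarrow> g \<in> carrier K \<Longrightarrow> ev f c = cl x \<Longrightarrow> ev g c = cl y \<Longrightarrow>
      ev (f \<oplus>\<^bsub>K\<^esub> g) c = cl (x + y)"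
    and scal_closed: "\<And>s. s \<odot>\<^bsub>K\<^esub> \<one>\<^bsub>K\<^esub> \<in> carrier K"
    and ev_scal: "\<And>s g c x. g \<in> carrier K \<Longrightarrow> ev g c = cl x \<Longrightarrow>
      ev ((s \<odot>\<^bsub>K\<^esub> \<one>\<^bsub>K\<^esub>) \<otimes>\<^bsub>K\<^esub> g) c = cl (falg_const s * x)"
    and finite_S: "finite S"
    and iota_add: "\<And>e e' v. \<iota> (e + e') v = \<iota> e v + \<iota> e' v"
    and iota_inj: "inj \<iota>"
begin

interpretation K: abelian_monoid K by (rule abelian_monoid_K)

text \<open>Stated with an arbitrary g applied before f, because a product of matrices is evaluated
  from its right end.\<close>

definition lifts :: "'k \<Rightarrow> 'n falg addop \<Rightarrow> bool" where
  "lifts f \<phi> \<longleftrightarrow> f \<in> carrier K \<and> (\<forall>g\<in>carrier K. \<forall>c x. ev g c = cl x \<longrightarrow> ev (f \<otimes>\<^bsub>K\<^esub> g) c = cl (app \<phi> x))"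

lemma lifts_zero: "lifts \<zero>\<^bsub>K\<^esub> 0"
  by (auto simp: lifts_def null ev_zero)

lemma lifts_scal: "lifts (s \<odot>\<^bsub>K\<^esub> \<one>\<^bsub>K\<^esub>) (smul s)"
  by (auto simp: lifts_def scal_closed ev_scal)

text \<open>\<Psi> describes column J of B by representatives, for all arguments c. Entries at
  exponents outside the range of \<iota> must vanish, so that the change of variables loses
  nothing.\<close>

definition repr :: "(nat \<Rightarrow> 'n) \<Rightarrow> ('n, 'k) tmat \<Rightarrow> ('n falg \<Rightarrow> 'n mvec) \<Rightarrow> bool" where
  "repr J B \<Psi> \<longleftrightarrow> (\<forall>I\<in>idx S. \<forall>\<gamma>. B I J \<gamma> \<in> carrier K \<and> (\<gamma> \<notin> range \<iota> \<longrightarrow> B I J \<gamma> = \<zero>\<^bsub>K\<^esub>) \<and>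
     (\<forall>e c. \<gamma> = \<iota> e \<longrightarrow> ev (B I J \<gamma>) c = cl (\<Psi> c I e)))"

text \<open>Defined by the effect on every represented column: \<open>tprod\<close> is a right fold,
  so its representation follows without associativity of \<open>tmult\<close>.\<close>

definition oprep :: "('n, 'k) tmat \<Rightarrow> 'n mvec addop \<Rightarrow> bool" where
  "oprep A a \<longleftrightarrow> (\<forall>J\<in>idx S. \<forall>B \<Psi>. repr J B \<Psi> \<longrightarrow> repr J (tmult K S A B) (\<lambda>c. app a (\<Psi> c)))"

lemma finite_idx: "finite (idx S :: (nat \<Rightarrow> 'n) set)"
  unfolding idx_def using finite_S by (intro finite_PiE) auto

lemma iota_0: "\<iota> 0 = (\<lambda>_. 0)"
  using iota_add[of 0 0] by (auto simp: fun_eq_iff)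

lemma iota_mexp: "\<iota> (mexp r \<delta>) v = int r * \<iota> \<delta> v"
proof (induction r)
  case 0
  then show ?case using iota_0 by (simp add: zero_fun_def)
next
  case (Suc r)
  have "mexp (Suc r) \<delta> = mexp r \<delta> + \<delta>" by (simp add: fun_eq_iff plus_fun_apply)
  then show ?case using Suc by (simp add: iota_add algebra_simps)
qed

lemma ev_finsum:
  assumes "finite X" "\<And>x. x \<in> X \<Longrightarrow> f x \<in> carrier K" "\<And>x. x \<in> X \<Longrightarrow> ev (f x) c = cl (k x)"
  shows "ev (finsum K f X) c = cl (\<Sum>x\<in>X. k x)"
  using assms
proof (induction X)
  case empty
  then show ?case by (simp add: ev_zero)
next
  case (insert x X)
  then show ?case by (auto simp: Pi_def intro!: ev_add)
qed

text \<open>The one place where the sum over nonzero contributions in \<open>tmult\<close> is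
  identified with a finite sum; one- and two-leg matrices, constant or with series entries, are
  special cases.\<close>

lemma oprep_kernel:
  fixes A :: "('n, 'k) tmat"
  assumes \<delta>: "\<delta> \<noteq> 0"
    and lift: "\<And>I T r. I \<in> idx S \<Longrightarrow> T \<in> idx S \<Longrightarrow> lifts (A I T (\<iota> (mexp r \<delta>))) (\<phi> I T r)"
    and supp: "\<And>I T \<alpha>. I \<in> idx S \<Longrightarrow> T \<in> idx S \<Longrightarrow> \<alpha> \<notin> range (\<lambda>r. \<iota> (mexp r \<delta>)) \<Longrightarrow> A I T \<alpha> = \<zero>\<^bsub>K\<^esub>"
    and act: "\<And>\<Phi> I e. I \<in> idx S \<Longrightarrow> app a \<Phi> I e = (\<Sum>T\<in>idx S. \<Sum>r | mexp r \<delta> \<le> e. app (\<phi> I T r) (\<Phi> T (e - mexp r \<delta>)))"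
  shows "oprep A a"
  unfolding oprep_def
proof (intro ballI allI impI)
  fix J :: "nat \<Rightarrow> 'n" and B \<Psi>
  assume J: "J \<in> idx S" and B: "repr J B \<Psi>"
  show "repr J (tmult K S A B) (\<lambda>c. app a (\<Psi> c))"
    unfolding repr_def
  proof (intro ballI allI)
    fix I :: "nat \<Rightarrow> 'n" and \<gamma>
    assume I: "I \<in> idx S"
    let ?f = "\<lambda>(T, \<alpha>). A I T \<alpha> \<otimes>\<^bsub>K\<^esub> B T J (\<lambda>v. \<gamma> v - \<alpha> v)"
    let ?X = "{(T, \<alpha>). T \<in> idx S \<and> A I T \<alpha> \<noteq> \<zero>\<^bsub>K\<^esub> \<and> B T J (\<lambda>v. \<gamma> v - \<alpha> v) \<noteq> \<zero>\<^bsub>K\<^esub>}"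
    have Bc: "B T J \<beta> \<in> carrier K" if "T \<in> idx S" for T \<beta> using B that by (auto simp: repr_def)
    have B0: "B T J \<beta> = \<zero>\<^bsub>K\<^esub>" if "T \<in> idx S" "\<beta> \<notin> range \<iota>" for T \<beta> using B that by (auto simp: repr_def)
    have Be: "ev (B T J (\<iota> e)) c = cl (\<Psi> c T e)" if "T \<in> idx S" for T e c using B that by (auto simp: repr_def)
    have Ac: "A I T \<alpha> \<in> carrier K" if "T \<in> idx S" for T \<alpha>
      using supp[OF I that, of \<alpha>] lift[OF I that] by (cases "\<alpha> \<in> range (\<lambda>r. \<iota> (mexp r \<delta>))") (auto simp: lifts_def)
    have fc: "?f x \<in> carrier K" if "fst x \<in> idx S" for x
      using that by (auto simp: split_def intro!: mult_closed Ac Bc)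
    \<comment> \<open>In a contributing term both exponents lie in the range of \<iota>, hence so
      does their sum.\<close>
    have ran: "\<exists>r e'. \<alpha> = \<iota> (mexp r \<delta>) \<and> (\<lambda>v. \<gamma> v - \<alpha> v) = \<iota> e' \<and> \<gamma> = \<iota> (mexp r \<delta> + e')" if "(T, \<alpha>) \<in> ?X" for T \<alpha>
    proof -
      have T: "T \<in> idx S" "A I T \<alpha> \<noteq> \<zero>\<^bsub>K\<^esub>" and "B T J (\<lambda>v. \<gamma> v - \<alpha> v) \<noteq> \<zero>\<^bsub>K\<^esub>" using that by auto
      then have Br: "(\<lambda>v. \<gamma> v - \<alpha> v) \<in> range \<iota>" using B0 by blast
      from T have "\<alpha> \<in> range (\<lambda>r. \<iota> (mexp r \<delta>))" using supp[OF I, of T \<alpha>] by blast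
      then obtain r where r: "\<alpha> = \<iota> (mexp r \<delta>)" by blast
      obtain e' where e': "(\<lambda>v. \<gamma> v - \<alpha> v) = \<iota> e'" using Br by blast
      have "\<gamma> = \<iota> (mexp r \<delta> + e')" using e' r by (simp add: fun_eq_iff iota_add) (metis add.commute diff_add_cancel)
      then show ?thesis using r e' by blast
    qed
    show "tmult K S A B I J \<gamma> \<in> carrier K \<and> (\<gamma> \<notin> range \<iota> \<longrightarrow> tmult K S A B I J \<gamma> = \<zero>\<^bsub>K\<^esub>) \<and>
      (\<forall>e c. \<gamma> = \<iota> e \<longrightarrow> ev (tmult K S A B I J \<gamma>) c = cl (app a (\<Psi> c) I e))"
    proof (intro conjI impI allI)
      show "tmult K S A B I J \<gamma> \<in> carrier K"
        unfolding tmult_def by (intro K.finsum_closed) (auto intro!: mult_closed Ac Bc)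
      show "tmult K S A B I J \<gamma> = \<zero>\<^bsub>K\<^esub>" if "\<gamma> \<notin> range \<iota>"
      proof -
        have "?X = {}" using ran that by blast
        then show ?thesis unfolding tmult_def by (simp only: K.finsum_empty)
      qed
      fix e c assume \<gamma>: "\<gamma> = \<iota> e"
      \<comment> \<open>The index set of the sum on the operator side. It may contain terms that
        \<open>tmult\<close> omits, all of which are 0.\<close>
      let ?Z = "(idx S :: (nat \<Rightarrow> 'n) set) \<times> {r. mexp r \<delta> \<le> e}"
      let ?h = "\<lambda>(T, r). (T, \<iota> (mexp r \<delta>))"
      have fz: "finite ?Z" using finite_idx finD[OF fin_mexp[OF \<delta>]] by auto
      have XZ: "?X \<subseteq> ?h ` ?Z"
      proof
        fix x assume x: "x \<in> ?X"
        obtain T \<alpha> where T: "x = (T, \<alpha>)" by (cases x)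
        then obtain r e' where r: "\<alpha> = \<iota> (mexp r \<delta>)" "\<gamma> = \<iota> (mexp r \<delta> + e')" using ran[of T \<alpha>] x by blast
        then have "e = mexp r \<delta> + e'" using \<gamma> iota_inj by (auto dest: injD)
        then have "mexp r \<delta> \<le> e" by (auto simp: le_fun_def plus_fun_apply)
        then show "x \<in> ?h ` ?Z" using T r x by auto
      qed
      have inj: "inj_on ?h ?Z"
      proof (rule inj_onI)
        fix x y assume "x \<in> ?Z" "y \<in> ?Z" and eq: "?h x = ?h y"
        obtain T r T' r' where xy: "x = (T, r)" "y = (T', r')" by (cases x, cases y)
        have "mexp r \<delta> = mexp r' \<delta>" using eq xy iota_inj by (auto dest: injD)
        moreover obtain v where "\<delta> v \<noteq> 0" using \<delta> by (auto simp: fun_eq_iff)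
        ultimately have "r = r'" by (metis mult_cancel2)
        then show "x = y" using eq xy by simp
      qed
      have "tmult K S A B I J \<gamma> = finsum K ?f ?X" by (simp add: tmult_def)
      also have "\<dots> = finsum K ?f (?h ` ?Z)"
      proof (rule K.add.finprod_mono_neutral_cong_left)
        show "finite (?h ` ?Z)" using fz by simp
        show "?f x = \<zero>\<^bsub>K\<^esub>" if "x \<in> ?h ` ?Z - ?X" for x
        proof -
          obtain T \<alpha> where T: "x = (T, \<alpha>)" by (cases x)
          then have "A I T \<alpha> = \<zero>\<^bsub>K\<^esub> \<or> B T J (\<lambda>v. \<gamma> v - \<alpha> v) = \<zero>\<^bsub>K\<^esub>" "T \<in> idx S" using that by auto
          then show ?thesis using T Ac Bc null by auto
        qed
        show "?f \<in> ?h ` ?Z \<rightarrow> carrier K" using fc by auto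
      qed (use XZ in auto)
      also have "\<dots> = finsum K (\<lambda>x. ?f (?h x)) ?Z"
        by (rule K.finsum_reindex[OF _ inj]) (use fc in auto)
      finally have eq: "tmult K S A B I J \<gamma> = finsum K (\<lambda>x. ?f (?h x)) ?Z" .
      have "ev (finsum K (\<lambda>x. ?f (?h x)) ?Z) c
        = cl (\<Sum>x\<in>?Z. case x of (T, r) \<Rightarrow> app (\<phi> I T r) (\<Psi> c T (e - mexp r \<delta>)))"
      proof (rule ev_finsum[OF fz])
        fix x assume x: "x \<in> ?Z"
        obtain T r where T: "x = (T, r)" by (cases x)
        then have T': "T \<in> idx S" "mexp r \<delta> \<le> e" using x by auto
        show "?f (?h x) \<in> carrier K" using T T' by (auto intro!: mult_closed Ac Bc)
        have "e = mexp r \<delta> + (e - mexp r \<delta>)" using T'(2) by (auto simp: fun_eq_iff le_fun_def plus_fun_apply)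
        then have "\<iota> e v = \<iota> (mexp r \<delta>) v + \<iota> (e - mexp r \<delta>) v" for v using iota_add by metis
        then have "(\<lambda>v. \<gamma> v - \<iota> (mexp r \<delta>) v) = \<iota> (e - mexp r \<delta>)" by (simp add: \<gamma> fun_eq_iff)
        then show "ev (?f (?h x)) c = cl (case x of (T, r) \<Rightarrow> app (\<phi> I T r) (\<Psi> c T (e - mexp r \<delta>)))"
          using lift[OF I T'(1), of r] Be[OF T'(1)] Bc[OF T'(1)] T by (auto simp: lifts_def)
      qed
      also have "(\<Sum>x\<in>?Z. case x of (T, r) \<Rightarrow> app (\<phi> I T r) (\<Psi> c T (e - mexp r \<delta>))) = app a (\<Psi> c) I e"
        unfolding act[OF I] by (simp add: sum.cartesian_product)
      finally show "ev (tmult K S A B I J \<gamma>) c = cl (app a (\<Psi> c) I e)" by (simp only: eq)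
    qed
  qed
qed

lemma oprep_leg1:
  assumes k: "k \<in> S" and \<delta>: "\<delta> \<noteq> 0"
    and lift: "\<And>i j r. lifts (a i j (\<iota> (mexp r \<delta>))) (g i j r)"
    and supp: "\<And>i j \<alpha>. \<alpha> \<notin> range (\<lambda>r. \<iota> (mexp r \<delta>)) \<Longrightarrow> a i j \<alpha> = \<zero>\<^bsub>K\<^esub>"
  shows "oprep (leg1 K S k a) (leg1m k (\<lambda>i j. cser \<delta> (g i j)))"
proof (rule oprep_kernel[OF \<delta>])
  let ?\<phi> = "\<lambda>I T r. if \<forall>t\<in>S - {k}. I t = T t then g (I k) (T k) r else 0"
  show "lifts (leg1 K S k a I T (\<iota> (mexp r \<delta>))) (?\<phi> I T r)" for I T r
    using lift lifts_zero by (auto simp: leg1_def)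
  show "leg1 K S k a I T \<alpha> = \<zero>\<^bsub>K\<^esub>" if "\<alpha> \<notin> range (\<lambda>r. \<iota> (mexp r \<delta>))" for I T \<alpha>
    using supp[OF that] by (auto simp: leg1_def)
  fix \<Phi> :: "'n mvec" and I :: "nat \<Rightarrow> 'n" and e assume I: "I \<in> idx S"
  have "(\<Sum>T\<in>idx S. \<Sum>r | mexp r \<delta> \<le> e. app (?\<phi> I T r) (\<Phi> T (e - mexp r \<delta>)))
    = (\<Sum>T\<in>(\<lambda>b. I(k := b)) ` UNIV. \<Sum>r | mexp r \<delta> \<le> e. app (?\<phi> I T r) (\<Phi> T (e - mexp r \<delta>)))"
  proof (rule sum.mono_neutral_right)
    show "finite (idx S :: (nat \<Rightarrow> 'n) set)" by (rule finite_idx)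
    show "(\<lambda>b. I(k := b)) ` UNIV \<subseteq> idx S" using idx_update[OF I k] by auto
    show "\<forall>T\<in>idx S - (\<lambda>b. I(k := b)) ` UNIV. (\<Sum>r | mexp r \<delta> \<le> e. app (?\<phi> I T r) (\<Phi> T (e - mexp r \<delta>))) = 0"
    proof
      fix T assume T: "T \<in> idx S - (\<lambda>b. I(k := b)) ` UNIV"
      have "\<not> (\<forall>t\<in>S - {k}. I t = T t)"
      proof
        assume *: "\<forall>t\<in>S - {k}. I t = T t"
        \<comment> \<open>Outside S both multi-indices are \<open>undefined\<close>, so agreement on
          S without k is agreement everywhere but at k.\<close>
        have "T = I(k := T k)"
        proof
          fix x
          show "T x = (I(k := T k)) x"
            using * T I by (cases "x \<in> S") (auto simp: idx_def PiE_def extensional_def)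
        qed
        then show False using T by blast
      qed
      then show "(\<Sum>r | mexp r \<delta> \<le> e. app (?\<phi> I T r) (\<Phi> T (e - mexp r \<delta>))) = 0"
        by (simp only: if_False app_simps sum.neutral_const)
    qed
  qed
  also have "\<dots> = (\<Sum>b\<in>UNIV. \<Sum>r | mexp r \<delta> \<le> e. app (g (I k) b r) (\<Phi> (I(k := b)) (e - mexp r \<delta>)))"
    by (subst sum.reindex) (auto simp: inj_on_def dest: fun_upd_eqD)
  finally show "app (leg1m k (\<lambda>i j. cser \<delta> (g i j))) \<Phi> I e
    = (\<Sum>T\<in>idx S. \<Sum>r | mexp r \<delta> \<le> e. app (?\<phi> I T r) (\<Phi> T (e - mexp r \<delta>)))"
    by (simp add: app_leg1m sum_fun_apply app_gser)
qed

lemma oprep_leg2: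
  assumes i: "i \<in> S" and j: "j \<in> S" and ij: "i \<noteq> j" and \<delta>: "\<delta> \<noteq> 0"
    and lift: "\<And>p q r. lifts (a p q (\<iota> (mexp r \<delta>))) (g p q r)"
    and supp: "\<And>p q \<alpha>. \<alpha> \<notin> range (\<lambda>r. \<iota> (mexp r \<delta>)) \<Longrightarrow> a p q \<alpha> = \<zero>\<^bsub>K\<^esub>"
  shows "oprep (leg2 K S i j a) (leg2m i j (\<lambda>p q. cser \<delta> (g p q)))"
proof (rule oprep_kernel[OF \<delta>])
  let ?\<phi> = "\<lambda>I T r. if \<forall>t\<in>S - {i, j}. I t = T t then g (I i, I j) (T i, T j) r else 0"
  let ?u = "\<lambda>I q. I(i := fst q, j := snd q)"
  show "lifts (leg2 K S i j a I T (\<iota> (mexp r \<delta>))) (?\<phi> I T r)" for I T r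
    using lift lifts_zero by (auto simp: leg2_def)
  show "leg2 K S i j a I T \<alpha> = \<zero>\<^bsub>K\<^esub>" if "\<alpha> \<notin> range (\<lambda>r. \<iota> (mexp r \<delta>))" for I T \<alpha>
    using supp[OF that] by (auto simp: leg2_def)
  fix \<Phi> :: "'n mvec" and I :: "nat \<Rightarrow> 'n" and e assume I: "I \<in> idx S"
  have "(\<Sum>T\<in>idx S. \<Sum>r | mexp r \<delta> \<le> e. app (?\<phi> I T r) (\<Phi> T (e - mexp r \<delta>)))
    = (\<Sum>T\<in>?u I ` UNIV. \<Sum>r | mexp r \<delta> \<le> e. app (?\<phi> I T r) (\<Phi> T (e - mexp r \<delta>)))"
  proof (rule sum.mono_neutral_right)
    show "finite (idx S :: (nat \<Rightarrow> 'n) set)" by (rule finite_idx)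
    show "?u I ` UNIV \<subseteq> idx S" using idx_update[OF idx_update[OF I i] j] by auto
    show "\<forall>T\<in>idx S - ?u I ` UNIV. (\<Sum>r | mexp r \<delta> \<le> e. app (?\<phi> I T r) (\<Phi> T (e - mexp r \<delta>))) = 0"
    proof
      fix T assume T: "T \<in> idx S - ?u I ` UNIV"
      have "\<not> (\<forall>t\<in>S - {i, j}. I t = T t)"
      proof
        assume *: "\<forall>t\<in>S - {i, j}. I t = T t"
        have "T = ?u I (T i, T j)"
        proof
          fix x
          show "T x = (?u I (T i, T j)) x"
            using * T I by (cases "x \<in> S") (auto simp: idx_def PiE_def extensional_def)
        qed
        then show False using T by blast
      qed
      then show "(\<Sum>r | mexp r \<delta> \<le> e. app (?\<phi> I T r) (\<Phi> T (e - mexp r \<delta>))) = 0"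
        by (simp only: if_False app_simps sum.neutral_const)
    qed
  qed
  also have "\<dots> = (\<Sum>q\<in>UNIV. \<Sum>r | mexp r \<delta> \<le> e. app (g (I i, I j) q r) (\<Phi> (?u I q) (e - mexp r \<delta>)))"
  proof (subst sum.reindex)
    show "inj (?u I)"
    proof (rule injI)
      fix x y assume "?u I x = ?u I y"
      then have "?u I x i = ?u I y i" "?u I x j = ?u I y j" by (simp_all only:)
      then show "x = y" using ij by (auto simp: prod_eq_iff)
    qed
  qed (use ij in auto)
  finally show "app (leg2m i j (\<lambda>p q. cser \<delta> (g p q))) \<Phi> I e
    = (\<Sum>T\<in>idx S. \<Sum>r | mexp r \<delta> \<le> e. app (?\<phi> I T r) (\<Phi> T (e - mexp r \<delta>)))"
    by (simp add: app_leg2m[OF ij] sum_fun_apply app_gser)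
qed

lemma oprep_cleg:
  assumes "i \<in> S" "j \<in> S" "i \<noteq> j"
  shows "oprep (cleg K S i j X) (cm i j X)"
proof -
  \<comment> \<open>A constant is a series in any monomial; the exponent chosen here is
    arbitrary.\<close>
  let ?\<delta> = "unit_exp 0"
  have 0: "\<iota> (mexp r ?\<delta>) = (\<lambda>_. 0) \<longleftrightarrow> r = 0" for r
  proof
    assume "\<iota> (mexp r ?\<delta>) = (\<lambda>_. 0)"
    then have "\<iota> (mexp r ?\<delta>) = \<iota> 0" by (simp only: iota_0)
    then have "mexp r ?\<delta> = 0" by (rule injD[OF iota_inj])
    then have "r * ?\<delta> 0 = 0" by (metis zero_fun_apply)
    then show "r = 0" by simp
  qed (simp add: iota_0 flip: zero_fun_def)
  have "oprep (cleg K S i j X) (leg2m i j (\<lambda>p q. cser ?\<delta> (\<lambda>r. smul (fps_nth (fps_const (X $ p $ q)) r))))"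
    unfolding cleg_def
  proof (rule oprep_leg2[OF assms unit_exp_nz])
    show "lifts (if \<iota> (mexp r ?\<delta>) = (\<lambda>_. 0) then X $ p $ q \<odot>\<^bsub>K\<^esub> \<one>\<^bsub>K\<^esub> else \<zero>\<^bsub>K\<^esub>) (smul (fps_nth (fps_const (X $ p $ q)) r))" for p q r
      using 0 lifts_scal lifts_zero by auto
    show "(if \<alpha> = (\<lambda>_. 0) then X $ p $ q \<odot>\<^bsub>K\<^esub> \<one>\<^bsub>K\<^esub> else \<zero>\<^bsub>K\<^esub>) = \<zero>\<^bsub>K\<^esub>"
      if "\<alpha> \<notin> range (\<lambda>r. \<iota> (mexp r ?\<delta>))" for p q \<alpha>
      using that 0 by (metis rangeI)
  qed
  then show ?thesis
    unfolding cm_def sser_def[symmetric] sser_const[OF unit_exp_nz] .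
qed

lemma oprep_sleg:
  assumes "i \<in> S" "j \<in> S" "i \<noteq> j" and uv: "u \<noteq> v" and \<delta>: "\<iota> \<delta> = (\<lambda>_. 0)(u := 1, v := - 1)"
  shows "oprep (sleg K S i j X b u v) (leg2m i j (\<lambda>p q. sser \<delta> (rescale b (X $ p $ q))))"
proof -
  have nz: "\<delta> \<noteq> 0"
  proof
    assume "\<delta> = 0"
    then have "\<iota> \<delta> u = 0" by (simp add: iota_0)
    then show False using \<delta> uv by simp
  qed
  have io: "\<iota> (mexp r \<delta>) = (\<lambda>_. 0)(u := int r, v := - int r)" for r
    by (auto simp: fun_eq_iff iota_mexp \<delta>)
  show ?thesis
    unfolding sleg_def sser_def
  proof (rule oprep_leg2[OF assms(1-3) nz])
    fix p q
    show "lifts (if 0 \<le> \<iota> (mexp r \<delta>) u \<and> \<iota> (mexp r \<delta>) = (\<lambda>_. 0)(u := \<iota> (mexp r \<delta>) u, v := - \<iota> (mexp r \<delta>) u)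
       then (b ^ nat (\<iota> (mexp r \<delta>) u) * fps_nth (X $ p $ q) (nat (\<iota> (mexp r \<delta>) u))) \<odot>\<^bsub>K\<^esub> \<one>\<^bsub>K\<^esub> else \<zero>\<^bsub>K\<^esub>)
       (smul (fps_nth (rescale b (X $ p $ q)) r))" for r
      unfolding io using uv lifts_scal by auto
    show "(if 0 \<le> \<alpha> u \<and> \<alpha> = (\<lambda>_. 0)(u := \<alpha> u, v := - \<alpha> u)
       then (b ^ nat (\<alpha> u) * fps_nth (X $ p $ q) (nat (\<alpha> u))) \<odot>\<^bsub>K\<^esub> \<one>\<^bsub>K\<^esub> else \<zero>\<^bsub>K\<^esub>) = \<zero>\<^bsub>K\<^esub>"
      if "\<alpha> \<notin> range (\<lambda>r. \<iota> (mexp r \<delta>))" for \<alpha>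
    proof -
      have "\<not> (0 \<le> \<alpha> u \<and> \<alpha> = (\<lambda>_. 0)(u := \<alpha> u, v := - \<alpha> u))"
      proof
        assume a: "0 \<le> \<alpha> u \<and> \<alpha> = (\<lambda>_. 0)(u := \<alpha> u, v := - \<alpha> u)"
        then have "\<alpha> = \<iota> (mexp (nat (\<alpha> u)) \<delta>)" unfolding io by simp
        then show False using that by blast
      qed
      then show ?thesis by auto
    qed
  qed
qed

lemma oprep_Lp:
  assumes k: "k \<in> S" and \<epsilon>: "\<iota> \<epsilon> = (\<lambda>_. 0)(k := 1)" and \<rho>: "\<And>a. lifts (\<rho> a) (lmul a)"
  shows "oprep (Lp K \<rho> S k) (Lop k \<epsilon>)"
proof -
  have nz: "\<epsilon> \<noteq> 0"
  proof
    assume "\<epsilon> = 0"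
    then have "\<iota> \<epsilon> k = 0" by (simp add: iota_0)
    then show False using \<epsilon> by simp
  qed
  have io: "\<iota> (mexp r \<epsilon>) = (\<lambda>_. 0)(k := int r)" for r
    by (auto simp: fun_eq_iff iota_mexp \<epsilon>)
  show ?thesis
    unfolding Lp_def Lop_def
  proof (rule oprep_leg1[OF k nz])
    fix i j
    show "lifts (if 0 \<le> \<iota> (mexp r \<epsilon>) k \<and> \<iota> (mexp r \<epsilon>) = (\<lambda>_. 0)(k := \<iota> (mexp r \<epsilon>) k)
       then \<rho> (lplus i j (nat (\<iota> (mexp r \<epsilon>) k))) else \<zero>\<^bsub>K\<^esub>) (lmul (lplus i j r))" for r
      unfolding io using \<rho> by simp
    show "(if 0 \<le> \<alpha> k \<and> \<alpha> = (\<lambda>_. 0)(k := \<alpha> k) then \<rho> (lplus i j (nat (\<alpha> k))) else \<zero>\<^bsub>K\<^esub>) = \<zero>\<^bsub>K\<^esub>"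
      if "\<alpha> \<notin> range (\<lambda>r. \<iota> (mexp r \<epsilon>))" for \<alpha>
    proof -
      have "\<not> (0 \<le> \<alpha> k \<and> \<alpha> = (\<lambda>_. 0)(k := \<alpha> k))"
      proof
        assume a: "0 \<le> \<alpha> k \<and> \<alpha> = (\<lambda>_. 0)(k := \<alpha> k)"
        then have "\<alpha> = \<iota> (mexp (nat (\<alpha> k)) \<epsilon>)" unfolding io by simp
        then show False using that by blast
      qed
      then show ?thesis by auto
    qed
  qed
qed

lemma oprep_Lm:
  assumes k: "k \<in> S" and \<epsilon>: "\<iota> \<epsilon> = (\<lambda>_. 0)(k := - 1)" and l: "\<And>i j r. lifts (l i j r) (T i j r)"
  shows "oprep (leg1 K S k (\<lambda>i j \<gamma>. if \<gamma> k \<le> 0 \<and> \<gamma> = (\<lambda>_. 0)(k := \<gamma> k) then l i j (nat (- \<gamma> k)) else \<zero>\<^bsub>K\<^esub>))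
    (Top T k \<epsilon>)"
proof -
  have nz: "\<epsilon> \<noteq> 0"
  proof
    assume "\<epsilon> = 0"
    then have "\<iota> \<epsilon> k = 0" by (simp add: iota_0)
    then show False using \<epsilon> by simp
  qed
  have io: "\<iota> (mexp r \<epsilon>) = (\<lambda>_. 0)(k := - int r)" for r
    by (auto simp: fun_eq_iff iota_mexp \<epsilon>)
  show ?thesis
    unfolding Top_def
  proof (rule oprep_leg1[OF k nz])
    fix i j
    show "lifts (if \<iota> (mexp r \<epsilon>) k \<le> 0 \<and> \<iota> (mexp r \<epsilon>) = (\<lambda>_. 0)(k := \<iota> (mexp r \<epsilon>) k)
       then l i j (nat (- \<iota> (mexp r \<epsilon>) k)) else \<zero>\<^bsub>K\<^esub>) (T i j r)" for r
      unfolding io using l by simp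
    show "(if \<alpha> k \<le> 0 \<and> \<alpha> = (\<lambda>_. 0)(k := \<alpha> k) then l i j (nat (- \<alpha> k)) else \<zero>\<^bsub>K\<^esub>) = \<zero>\<^bsub>K\<^esub>"
      if "\<alpha> \<notin> range (\<lambda>r. \<iota> (mexp r \<epsilon>))" for \<alpha>
    proof -
      have "\<not> (\<alpha> k \<le> 0 \<and> \<alpha> = (\<lambda>_. 0)(k := \<alpha> k))"
      proof
        assume a: "\<alpha> k \<le> 0 \<and> \<alpha> = (\<lambda>_. 0)(k := \<alpha> k)"
        then have "\<alpha> = \<iota> (mexp (nat (- \<alpha> k)) \<epsilon>)" unfolding io by simp
        then show False using that by blast
      qed
      then show ?thesis by auto
    qed
  qed
qed

lemma repr_tone: "J \<in> idx S \<Longrightarrow> repr J (tone K) (\<lambda>c. sg J c)"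
proof -
  have "\<iota> e = (\<lambda>_. 0) \<longleftrightarrow> e = 0" for e
    using iota_0 iota_inj by (metis injD)
  then show ?thesis
    unfolding repr_def tone_def
    by (auto simp: one_closed ev_one ev_zero sg_def sing_def iota_0 image_iff)
       (metis iota_0 rangeI)+
qed

lemma repr_tprod:
  "list_all2 oprep As as \<Longrightarrow> J \<in> idx S \<Longrightarrow> repr J (tprod K S As) (\<lambda>c. app (prod_list as) (sg J c))"
proof (induction rule: list_all2_induct)
  case Nil
  then show ?case by (simp add: tprod_def repr_tone)
next
  case (Cons A As a as)
  then have "repr J (tmult K S A (tprod K S As)) (\<lambda>c. app a (app (prod_list as) (sg J c)))"
    unfolding oprep_def by blast
  then show ?case by (simp add: tprod_def)
qed

lemma ev_tprod:
  assumes "list_all2 oprep As as" "I \<in> idx S" "J \<in> idx S"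
  shows "ev (tprod K S As I J (\<iota> e)) c = cl (app (prod_list as) (sg J c) I e)"
    "tprod K S As I J \<gamma> \<in> carrier K" "\<gamma> \<notin> range \<iota> \<Longrightarrow> tprod K S As I J \<gamma> = \<zero>\<^bsub>K\<^esub>"
  using repr_tprod[OF assms(1,3)] assms(2) unfolding repr_def by auto

lemma teq_tprod:
  assumes ext: "\<And>f g. f \<in> carrier K \<Longrightarrow> g \<in> carrier K \<Longrightarrow> (\<And>c. ev f c = ev g c) \<Longrightarrow> f = g"
    and "list_all2 oprep As as" "list_all2 oprep Bs bs"
    and eq: "\<And>J c. J \<in> idx S \<Longrightarrow> app (prod_list as) (sg J c) = app (prod_list bs) (sg J c)"
  shows "teq S (tprod K S As) (tprod K S Bs)"
  unfolding teq_def
proof (intro ballI allI)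
  fix I J :: "nat \<Rightarrow> 'n" and \<gamma> assume I: "I \<in> idx S" and J: "J \<in> idx S"
  note a = ev_tprod[OF assms(2) I J] and b = ev_tprod[OF assms(3) I J]
  show "tprod K S As I J \<gamma> = tprod K S Bs I J \<gamma>"
  proof (cases "\<gamma> \<in> range \<iota>")
    case True
    then obtain e where \<gamma>: "\<gamma> = \<iota> e" by blast
    show ?thesis unfolding \<gamma> by (rule ext[OF a(2) b(2)]) (simp add: a(1) b(1) eq[OF J])
  next
    case False
    then show ?thesis using a(3) b(3) by simp
  qed
qed

end

section \<open>The ideal of relations\<close>

lemma ring_free_alg: "ring (free_alg :: (complex fps, 'n falg) module)"
proof (intro ringI abelian_groupI monoidI)
  fix x :: "'n falg" assume "x \<in> carrier free_alg"
  show "\<exists>y\<in>carrier free_alg. y \<oplus>\<^bsub>free_alg\<^esub> x = \<zero>\<^bsub>free_alg\<^esub>"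
    by (rule bexI[of _ "- x"]) (simp_all add: free_alg_def)
qed (simp_all add: free_alg_def algebra_simps)

text \<open>The distance of two series is 2 to minus the order of their difference, so small balls
  around b are cosets of multiples of h^m.\<close>

lemma closed_iff_csub:
  fixes I :: "'n falg set"
  assumes "submod I"
  shows "closed I \<longleftrightarrow> csub I"
proof
  assume c: "closed I"
  show "csub I" unfolding csub_def
  proof (intro conjI allI impI assms)
    fix b assume lim: "\<forall>m. \<exists>c. b - fps_X ^ m * c \<in> I"
    show "b \<in> I"
    proof (rule ccontr)
      assume "b \<notin> I"
      then obtain r where r: "r > 0" "{y. dist y b < r} \<subseteq> - I"
        using c unfolding closed_def open_fps_def by blast
      obtain m where m: "inverse (2 ^ m :: real) < r"
        using real_arch_pow_inv[OF r(1), of "1 / 2"] by (auto simp: power_one_over inverse_eq_divide)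
      obtain d where d: "b - fps_X ^ m * d \<in> I" using lim by blast
      have "dist (b - fps_X ^ m * d) b < r"
      proof (cases "fps_X ^ m * d = 0")
        case False
        then have "m \<le> subdegree (fps_X ^ m * d)"
          by (intro subdegree_geI) (auto simp: fps_X_power_mult_nth)
        then have "inverse (2 ^ subdegree (fps_X ^ m * d)) \<le> inverse (2 ^ m :: real)"
          by (intro le_imp_inverse_le power_increasing) auto
        also note m
        finally show ?thesis using False by (simp add: dist_fps_def)
      qed (use r in \<open>simp add: dist_fps_def\<close>)
      then show False using r(2) d by blast
    qed
  qed
next
  assume I: "csub I"
  show "closed I" unfolding closed_def open_fps_def
  proof
    fix a assume "a \<in> - I"
    then obtain m where m: "\<And>c. a - fps_X ^ m * c \<notin> I" using csub_lim[OF I, of a] by blast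
    show "\<exists>r>0. {y. dist y a < r} \<subseteq> - I"
    proof (intro exI[of _ "inverse (2 ^ m)"] conjI subsetI)
      fix y assume y: "y \<in> {y. dist y a < inverse (2 ^ m)}"
      have "fps_nth (a - y) k = 0" if "k < m" for k
      proof (cases "a = y")
        case False
        then have "inverse (2 ^ subdegree (y - a)) < inverse (2 ^ m :: real)"
          using y by (auto simp: dist_fps_def)
        then have "m < subdegree (y - a)" by simp
        then have "fps_nth (y - a) k = 0" using that nth_less_subdegree_zero[of k "y - a"] by simp
        then show ?thesis by simp
      qed simp
      then obtain c where "a - y = fps_X ^ m * c" using fps_nth_eq_0_imp_X_power by blast
      then have "y = a - fps_X ^ m * c" by (simp add: algebra_simps)
      then show "y \<in> - I" using m by simp
    qed simp
  qed
qed

lemma ideal_free_alg_iff: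
  "ideal I (free_alg :: (complex fps, 'n falg) module) \<longleftrightarrow>
    0 \<in> I \<and> (\<forall>a\<in>I. \<forall>b\<in>I. a + b \<in> I) \<and> (\<forall>a\<in>I. - a \<in> I) \<and> (\<forall>a\<in>I. \<forall>x. x * a \<in> I \<and> a * x \<in> I)"
    (is "_ \<longleftrightarrow> ?rhs")
proof
  have inv: "a_inv free_alg x = - x" for x :: "'n falg"
  proof -
    interpret ring "free_alg :: (complex fps, 'n falg) module" by (rule ring_free_alg)
    have "- x = \<ominus>\<^bsub>free_alg\<^esub> x" by (rule sym, rule minus_equality) (simp_all add: free_alg_def)
    then show ?thesis by simp
  qed
  {
    assume I: "ideal I (free_alg :: (complex fps, 'n falg) module)"
    interpret ideal I "free_alg :: (complex fps, 'n falg) module" by (rule I)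
    show ?rhs
    proof (intro conjI ballI allI)
      show "0 \<in> I" using additive_subgroup.zero_closed[OF is_additive_subgroup] by (simp add: free_alg_def)
      fix a assume a: "a \<in> I"
      show "a + b \<in> I" if "b \<in> I" for b using additive_subgroup.a_closed[OF is_additive_subgroup a that] by (simp add: free_alg_def)
      show "- a \<in> I" using I_l_closed[OF a, of "- 1"] by (simp add: free_alg_def)
      show "x * a \<in> I" "a * x \<in> I" for x
        using I_l_closed[OF a, of x] I_r_closed[OF a, of x] by (simp_all add: free_alg_def)
    qed
  }
  assume rhs: ?rhs
  show "ideal I (free_alg :: (complex fps, 'n falg) module)"
  proof (rule idealI[OF ring_free_alg])
    interpret ring "free_alg :: (complex fps, 'n falg) module" by (rule ring_free_alg)
    show "subgroup I (add_monoid (free_alg :: (complex fps, 'n falg) module))"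
    proof (rule add.subgroupI)
      show "I \<subseteq> carrier free_alg" by (simp add: free_alg_def)
      show "I \<noteq> {}" using rhs by auto
      show "a_inv free_alg a \<in> I" if "a \<in> I" for a using rhs that by (simp add: inv)
      show "a \<oplus>\<^bsub>free_alg\<^esub> b \<in> I" if "a \<in> I" "b \<in> I" for a b using rhs that by (simp add: free_alg_def)
    qed
  qed (use rhs in \<open>auto simp: free_alg_def\<close>)
qed

context
  fixes M :: nat and R :: "complex fps ^ ('n::finite \<times> 'n) ^ ('n \<times> 'n)"
begin

abbreviation "J \<equiv> Y_ideal M R"
abbreviation "cls \<equiv> Y_class M R"
abbreviation "V \<equiv> Yplus M R"

lemma J_ideal: "ideal J free_alg"
proof -
  let ?C = "{I. ideal I free_alg \<and> Y_relations M R \<subseteq> I \<and> closed I \<and> (\<forall>a. fps_X * a \<in> I \<longrightarrow> a \<in> I)}"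
  have C: "0 \<in> I \<and> (\<forall>a\<in>I. \<forall>b\<in>I. a + b \<in> I) \<and> (\<forall>a\<in>I. - a \<in> I) \<and> (\<forall>a\<in>I. \<forall>x. x * a \<in> I \<and> a * x \<in> I)"
    if "I \<in> ?C" for I
    unfolding ideal_free_alg_iff[symmetric] using that by blast
  have mem: "x \<in> J \<longleftrightarrow> (\<forall>I. I \<in> ?C \<longrightarrow> x \<in> I)" for x
    unfolding Y_ideal_def by (simp only: Inter_iff Ball_def)
  show ?thesis unfolding ideal_free_alg_iff
  proof (intro conjI ballI allI)
    show "0 \<in> J" unfolding mem using C by blast
    fix a assume a: "a \<in> J"
    show "a + b \<in> J" if b: "b \<in> J" for b
      unfolding mem
    proof (intro allI impI)
      fix I assume I: "I \<in> ?C"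
      have "a \<in> I" "b \<in> I" using a b I unfolding mem by blast+
      then show "a + b \<in> I" using C[OF I] by blast
    qed
    show "- a \<in> J" unfolding mem
    proof (intro allI impI)
      fix I assume I: "I \<in> ?C"
      have "a \<in> I" using a I unfolding mem by blast
      then show "- a \<in> I" using C[OF I] by blast
    qed
    show "x * a \<in> J" "a * x \<in> J" for x
    proof -
      have "x * a \<in> I \<and> a * x \<in> I" if I: "I \<in> ?C" for I
      proof -
        have "a \<in> I" using a I unfolding mem by blast
        then show ?thesis using C[OF I] by blast
      qed
      then show "x * a \<in> J" "a * x \<in> J" unfolding mem by blast+
    qed
  qed
qed

lemma J_props:
  shows "submod J" "csub J" "x \<in> J \<Longrightarrow> a * x \<in> J" "x \<in> J \<Longrightarrow> x * a \<in> J" "fps_X * x \<in> J \<Longrightarrow> x \<in> J"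
    "Y_relations M R \<subseteq> J"
proof -
  note I = J_ideal[unfolded ideal_free_alg_iff]
  show s: "submod J" unfolding submod_def using I by blast
  have "closed J" unfolding Y_ideal_def by (rule closed_Inter) blast
  then show "csub J" using closed_iff_csub[OF s] by simp
  show "x \<in> J \<Longrightarrow> a * x \<in> J" "x \<in> J \<Longrightarrow> x * a \<in> J" using I by auto
  show "Y_relations M R \<subseteq> J" unfolding Y_ideal_def by (rule Inter_greatest) simp
  show "x \<in> J" if x: "fps_X * x \<in> J"
    unfolding Y_ideal_def
  proof (rule InterI)
    fix I assume I: "I \<in> {I. ideal I free_alg \<and> Y_relations M R \<subseteq> I \<and> closed I \<and> (\<forall>a. fps_X * a \<in> I \<longrightarrow> a \<in> I)}"
    have "fps_X * x \<in> I" using InterD[OF x[unfolded Y_ideal_def] I] .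
    then show "x \<in> I" using I by blast
  qed
qed

lemma J_least:
  assumes "csub I" "\<And>a x. x \<in> I \<Longrightarrow> a * x \<in> I" "\<And>a x. x \<in> I \<Longrightarrow> x * a \<in> I"
    "\<And>x. fps_X * x \<in> I \<Longrightarrow> x \<in> I" "Y_relations M R \<subseteq> I"
  shows "J \<subseteq> I"
proof -
  have s: "submod I" by (rule csub_submod[OF assms(1)])
  have "ideal I free_alg" unfolding ideal_free_alg_iff
  proof (intro conjI ballI allI)
    show "0 \<in> I" by (rule submodD(1)[OF s])
    fix a assume a: "a \<in> I"
    show "a + b \<in> I" if "b \<in> I" for b by (rule submodD(2)[OF s a that])
    show "- a \<in> I" by (rule submod_uminus[OF s a])
    show "x * a \<in> I" "a * x \<in> I" for x by (rule assms(2)[OF a], rule assms(3)[OF a])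
  qed
  moreover have "closed I" by (rule iffD2[OF closed_iff_csub[OF s] assms(1)])
  ultimately have "I \<in> {I. ideal I free_alg \<and> Y_relations M R \<subseteq> I \<and> closed I \<and> (\<forall>a. fps_X * a \<in> I \<longrightarrow> a \<in> I)}"
    using assms(4,5) by blast
  then show ?thesis unfolding Y_ideal_def by (rule Inter_lower)
qed

section \<open>The quotient algebra\<close>

lemma cls_eq_iff: "cls a = cls b \<longleftrightarrow> a - b \<in> J"
proof -
  have c: "cls a = {j + a | j. j \<in> J}" for a
    unfolding Y_class_def a_r_coset_def' by (simp add: free_alg_def) blast
  show ?thesis
  proof
    assume "cls a = cls b"
    moreover have "a \<in> cls a" unfolding c using submodD(1)[OF J_props(1)] by (intro CollectI exI[of _ 0]) simp
    ultimately have "a \<in> cls b" by simp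
    then obtain j where "a = j + b" "j \<in> J" unfolding c by blast
    then show "a - b \<in> J" by simp
  next
    assume ab: "a - b \<in> J"
    show "cls a = cls b" unfolding c
    proof (rule subset_antisym)
      show "{j + a |j. j \<in> J} \<subseteq> {j + b |j. j \<in> J}"
      proof
        fix x assume "x \<in> {j + a |j. j \<in> J}"
        then obtain j where j: "x = j + a" "j \<in> J" by blast
        then have "x = (j + (a - b)) + b" "j + (a - b) \<in> J" using submodD(2)[OF J_props(1) _ ab] by simp_all
        then show "x \<in> {j + b |j. j \<in> J}" by blast
      qed
      show "{j + b |j. j \<in> J} \<subseteq> {j + a |j. j \<in> J}"
      proof
        fix x assume "x \<in> {j + b |j. j \<in> J}"
        then obtain j where j: "x = j + b" "j \<in> J" by blast
        then have "x = (j - (a - b)) + a" "j - (a - b) \<in> J" using submod_diff[OF J_props(1) _ ab] by simp_all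
        then show "x \<in> {j + a |j. j \<in> J}" by blast
      qed
    qed
  qed
qed

lemma V_simps:
  "carrier V = range cls" "cls a \<oplus>\<^bsub>V\<^esub> cls b = cls (a + b)" "cls a \<otimes>\<^bsub>V\<^esub> cls b = cls (a * b)"
  "\<zero>\<^bsub>V\<^esub> = cls 0" "\<one>\<^bsub>V\<^esub> = cls 1" "s \<odot>\<^bsub>V\<^esub> cls a = cls (falg_const s * a)"
proof -
  interpret ideal J "free_alg :: (complex fps, 'n falg) module" by (rule J_ideal)
  have cf: "x \<in> carrier free_alg" for x :: "'n falg" by (simp add: free_alg_def)
  have m: "cls a \<otimes>\<^bsub>free_alg Quot J\<^esub> cls b = cls (a * b)" for a b
    using rcoset_mult_add[OF cf[of a] cf[of b]] by (simp add: FactRing_def Y_class_def) (simp add: free_alg_def)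
  have "carrier V = (\<Union>a\<in>carrier free_alg. {J +>\<^bsub>free_alg\<^esub> a})"
    by (simp add: Yplus_def Let_def FactRing_def A_RCOSETS_def')
  then show "carrier V = range cls" by (simp add: Y_class_def free_alg_def UNION_singleton_eq_range)
  show "cls a \<oplus>\<^bsub>V\<^esub> cls b = cls (a + b)"
    using a_rcos_sum[OF cf[of a] cf[of b]] by (simp add: Yplus_def Let_def FactRing_def Y_class_def) (simp add: free_alg_def)
  show "cls a \<otimes>\<^bsub>V\<^esub> cls b = cls (a * b)" using m by (simp add: Yplus_def Let_def)
  have "cls 0 = J" unfolding Y_class_def a_r_coset_def' by (simp add: free_alg_def)
  then show "\<zero>\<^bsub>V\<^esub> = cls 0" by (simp add: Yplus_def Let_def FactRing_def)
  show "\<one>\<^bsub>V\<^esub> = cls 1" by (simp add: Yplus_def Let_def FactRing_def Y_class_def free_alg_def)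
  show "s \<odot>\<^bsub>V\<^esub> cls a = cls (falg_const s * a)" using m by (simp add: Yplus_def Let_def)
qed

lemma V_cases: "v \<in> carrier V \<Longrightarrow> \<exists>a. v = cls a"
  unfolding V_simps(1) by blast

lemma cls_in: "cls a \<in> carrier V"
  unfolding V_simps(1) by blast

lemma HomD:
  assumes "f \<in> Hom V V"
  shows "f (cls a) \<in> carrier V" "f (cls (a + b)) = f (cls a) \<oplus>\<^bsub>V\<^esub> f (cls b)"
    "f (cls (falg_const s * a)) = s \<odot>\<^bsub>V\<^esub> f (cls a)" "f \<in> extensional (carrier V)"
proof -
  have f: "f \<in> carrier V \<rightarrow>\<^sub>E carrier V" "\<And>v w. v \<in> carrier V \<Longrightarrow> w \<in> carrier V \<Longrightarrow> f (v \<oplus>\<^bsub>V\<^esub> w) = f v \<oplus>\<^bsub>V\<^esub> f w"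
    "\<And>s v. v \<in> carrier V \<Longrightarrow> f (s \<odot>\<^bsub>V\<^esub> v) = s \<odot>\<^bsub>V\<^esub> f v"
    using assms unfolding Hom_def by blast+
  show "f (cls a) \<in> carrier V" using PiE_mem[OF f(1) cls_in] .
  show "f (cls (a + b)) = f (cls a) \<oplus>\<^bsub>V\<^esub> f (cls b)" using f(2)[OF cls_in cls_in, of a b] by (simp only: V_simps(2))
  show "f (cls (falg_const s * a)) = s \<odot>\<^bsub>V\<^esub> f (cls a)" using f(3)[OF cls_in, of s a] by (simp only: V_simps(6))
  show "f \<in> extensional (carrier V)" using f(1) by (simp add: PiE_def)
qed

lemma HomI:
  assumes "f \<in> extensional (carrier V)" "\<And>a. f (cls a) \<in> carrier V"
    "\<And>a b. f (cls (a + b)) = f (cls a) \<oplus>\<^bsub>V\<^esub> f (cls b)" "\<And>s a. f (cls (falg_const s * a)) = s \<odot>\<^bsub>V\<^esub> f (cls a)"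
  shows "f \<in> Hom V V"
  unfolding Hom_def
proof (intro CollectI conjI ballI allI)
  show "f \<in> carrier V \<rightarrow>\<^sub>E carrier V"
  proof (rule PiE_I)
    fix v assume "v \<in> carrier V"
    then show "f v \<in> carrier V" using V_cases[of v] assms(2) by blast
  next
    fix v assume "v \<notin> carrier V"
    then show "f v = undefined" using assms(1) by (simp add: extensional_def)
  qed
  fix v assume "v \<in> carrier V"
  then obtain a where a: "v = cls a" using V_cases by blast
  show "f (v \<oplus>\<^bsub>V\<^esub> w) = f v \<oplus>\<^bsub>V\<^esub> f w" if "w \<in> carrier V" for w
  proof -
    obtain b where "w = cls b" using V_cases \<open>w \<in> carrier V\<close> by blast
    then show ?thesis unfolding a by (simp only: V_simps(2) assms(3))
  qed
  show "f (s \<odot>\<^bsub>V\<^esub> v) = s \<odot>\<^bsub>V\<^esub> f v" for s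
    unfolding a by (simp only: V_simps(6) assms(4))
qed

lemma Hom_ext:
  assumes "f \<in> Hom V V" "g \<in> Hom V V" "\<And>a. f (cls a) = g (cls a)"
  shows "f = g"
proof (rule extensionalityI)
  show "f \<in> extensional (carrier V)" "g \<in> extensional (carrier V)" using HomD(4) assms by auto
  show "f v = g v" if "v \<in> carrier V" for v using V_cases[OF that] assms(3) by auto
qed

lemma Hom_lift:
  assumes "f \<in> extensional (carrier V)" "linop \<phi>" "\<And>a. f (cls a) = cls (app \<phi> a)"
  shows "f \<in> Hom V V"
  by (rule HomI[OF assms(1)]) (simp_all only: assms(3) cls_in V_simps(2,6) app_add linopD[OF assms(2)])

lemma Hom_rep: "f \<in> Hom V V \<Longrightarrow> \<exists>F. \<forall>a. f (cls a) = cls (F a)"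
  by (rule choice) (use V_cases[OF HomD(1)] in blast)

lemma End_closed:
  assumes f: "f \<in> Hom V V" and g: "g \<in> Hom V V"
  shows "(\<lambda>v\<in>carrier V. f (g v)) \<in> Hom V V" "(\<lambda>v\<in>carrier V. f v \<oplus>\<^bsub>V\<^esub> g v) \<in> Hom V V"
    "(\<lambda>v\<in>carrier V. v) \<in> Hom V V" "(\<lambda>v\<in>carrier V. \<zero>\<^bsub>V\<^esub>) \<in> Hom V V"
    "(\<lambda>v\<in>carrier V. s \<odot>\<^bsub>V\<^esub> v) \<in> Hom V V"
proof -
  obtain F where F: "f (cls a) = cls (F a)" for a using Hom_rep[OF f] by blast
  obtain G where G: "g (cls a) = cls (G a)" for a using Hom_rep[OF g] by blast
  have Fa: "cls (F (a + b)) = cls (F a + F b)" "cls (F (falg_const s * a)) = cls (falg_const s * F a)" for a b s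
    using HomD(2,3)[OF f] by (simp_all only: F V_simps(2,6))
  have Ga: "cls (G (a + b)) = cls (G a + G b)" "cls (G (falg_const s * a)) = cls (falg_const s * G a)" for a b s
    using HomD(2,3)[OF g] by (simp_all only: G V_simps(2,6))
  have FG: "cls a = cls b \<Longrightarrow> cls (F a) = cls (F b)" for a b by (simp only: F[symmetric])
  have add: "cls a = cls a' \<Longrightarrow> cls b = cls b' \<Longrightarrow> cls (a + b) = cls (a' + b')" for a a' b b'
    by (simp only: V_simps(2)[symmetric])
  show "(\<lambda>v\<in>carrier V. f (g v)) \<in> Hom V V"
    by (rule HomI) (simp_all add: cls_in F G V_simps(2,6) FG[OF Ga(1)] FG[OF Ga(2)] Fa)
  show "(\<lambda>v\<in>carrier V. f v \<oplus>\<^bsub>V\<^esub> g v) \<in> Hom V V"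
  proof (rule HomI)
    fix a b s
    have "cls (F (a + b) + G (a + b)) = cls (F a + F b + (G a + G b))" by (intro add Fa Ga)
    then show "(\<lambda>v\<in>carrier V. f v \<oplus>\<^bsub>V\<^esub> g v) (cls (a + b)) = (\<lambda>v\<in>carrier V. f v \<oplus>\<^bsub>V\<^esub> g v) (cls a) \<oplus>\<^bsub>V\<^esub> (\<lambda>v\<in>carrier V. f v \<oplus>\<^bsub>V\<^esub> g v) (cls b)"
      by (simp add: cls_in F G V_simps(2) add_ac)
    have "cls (F (falg_const s * a) + G (falg_const s * a)) = cls (falg_const s * F a + falg_const s * G a)" by (intro add Fa Ga)
    then show "(\<lambda>v\<in>carrier V. f v \<oplus>\<^bsub>V\<^esub> g v) (cls (falg_const s * a)) = s \<odot>\<^bsub>V\<^esub> (\<lambda>v\<in>carrier V. f v \<oplus>\<^bsub>V\<^esub> g v) (cls a)"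
      by (simp add: cls_in F G V_simps(2,6) distrib_left)
  qed (auto simp: cls_in F G V_simps(2))
  show "(\<lambda>v\<in>carrier V. v) \<in> Hom V V" "(\<lambda>v\<in>carrier V. \<zero>\<^bsub>V\<^esub>) \<in> Hom V V" "(\<lambda>v\<in>carrier V. s \<odot>\<^bsub>V\<^esub> v) \<in> Hom V V"
  proof -
    show "(\<lambda>v\<in>carrier V. v) \<in> Hom V V" by (rule Hom_lift[of _ 1]) (auto simp: cls_in)
    show "(\<lambda>v\<in>carrier V. \<zero>\<^bsub>V\<^esub>) \<in> Hom V V" by (rule Hom_lift[of _ 0]) (auto simp: cls_in V_simps(4))
    show "(\<lambda>v\<in>carrier V. s \<odot>\<^bsub>V\<^esub> v) \<in> Hom V V" by (rule Hom_lift[of _ "smul s"]) (auto simp: cls_in V_simps(6))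
  qed
qed

lemma YEnd_simps:
  "carrier (YEnd M R) = Hom V V" "f \<otimes>\<^bsub>YEnd M R\<^esub> g = (\<lambda>v\<in>carrier V. f (g v))"
  "f \<oplus>\<^bsub>YEnd M R\<^esub> g = (\<lambda>v\<in>carrier V. f v \<oplus>\<^bsub>V\<^esub> g v)" "\<one>\<^bsub>YEnd M R\<^esub> = (\<lambda>v\<in>carrier V. v)"
  "\<zero>\<^bsub>YEnd M R\<^esub> = (\<lambda>v\<in>carrier V. \<zero>\<^bsub>V\<^esub>)" "s \<odot>\<^bsub>YEnd M R\<^esub> f = (\<lambda>v\<in>carrier V. s \<odot>\<^bsub>V\<^esub> f v)"
  by (simp_all add: End_alg_def)

lemma YEnd_closed:
  assumes "f \<in> carrier (YEnd M R)" "g \<in> carrier (YEnd M R)"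
  shows "f \<oplus>\<^bsub>YEnd M R\<^esub> g \<in> carrier (YEnd M R)" "f \<otimes>\<^bsub>YEnd M R\<^esub> g \<in> carrier (YEnd M R)"
  using End_closed[of f g] assms by (auto simp: YEnd_simps)

lemma YEnd_consts_closed:
  "\<zero>\<^bsub>YEnd M R\<^esub> \<in> carrier (YEnd M R)" "\<one>\<^bsub>YEnd M R\<^esub> \<in> carrier (YEnd M R)" "s \<odot>\<^bsub>YEnd M R\<^esub> \<one>\<^bsub>YEnd M R\<^esub> \<in> carrier (YEnd M R)"
proof -
  have 1: "(\<lambda>v\<in>carrier V. v) \<in> Hom V V" by (rule Hom_lift[of _ 1]) (auto simp: cls_in)
  have "(\<lambda>v\<in>carrier V. s \<odot>\<^bsub>V\<^esub> (\<lambda>v\<in>carrier V. v) v) = (\<lambda>v\<in>carrier V. s \<odot>\<^bsub>V\<^esub> v)"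
    by (rule restrict_ext) simp
  then show "\<zero>\<^bsub>YEnd M R\<^esub> \<in> carrier (YEnd M R)" "\<one>\<^bsub>YEnd M R\<^esub> \<in> carrier (YEnd M R)" "s \<odot>\<^bsub>YEnd M R\<^esub> \<one>\<^bsub>YEnd M R\<^esub> \<in> carrier (YEnd M R)"
    using End_closed[OF 1 1] by (simp_all add: YEnd_simps)
qed

lemma YEnd_app:
  "(f \<oplus>\<^bsub>YEnd M R\<^esub> g) (cls a) = f (cls a) \<oplus>\<^bsub>V\<^esub> g (cls a)" "(f \<otimes>\<^bsub>YEnd M R\<^esub> g) (cls a) = f (g (cls a))"
  "\<zero>\<^bsub>YEnd M R\<^esub> (cls a) = cls 0" "\<one>\<^bsub>YEnd M R\<^esub> (cls a) = cls a"
  "(s \<odot>\<^bsub>YEnd M R\<^esub> \<one>\<^bsub>YEnd M R\<^esub>) (cls a) = cls (falg_const s * a)"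
  by (simp_all add: YEnd_simps cls_in V_simps(4,6))

lemma YEnd_ext:
  assumes "f \<in> carrier (YEnd M R)" "g \<in> carrier (YEnd M R)" "\<And>a. f (cls a) = g (cls a)"
  shows "f = g"
  using assms Hom_ext by (simp add: YEnd_simps(1))

lemma YEnd_rep: "f \<in> carrier (YEnd M R) \<Longrightarrow> \<exists>F. \<forall>a. f (cls a) = cls (F a)"
  using Hom_rep by (simp add: YEnd_simps(1))

lemma abelian_monoid_YEnd: "abelian_monoid (YEnd M R)"
proof (rule abelian_monoidI)
  show "f \<oplus>\<^bsub>YEnd M R\<^esub> g = g \<oplus>\<^bsub>YEnd M R\<^esub> f" if fg: "f \<in> carrier (YEnd M R)" "g \<in> carrier (YEnd M R)" for f g
  proof (rule YEnd_ext)
    obtain F where "\<And>a. f (cls a) = cls (F a)" using YEnd_rep[OF fg(1)] by blast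
    moreover obtain G where "\<And>a. g (cls a) = cls (G a)" using YEnd_rep[OF fg(2)] by blast
    ultimately show "(f \<oplus>\<^bsub>YEnd M R\<^esub> g) (cls a) = (g \<oplus>\<^bsub>YEnd M R\<^esub> f) (cls a)" for a
      by (simp add: YEnd_app V_simps(2) add.commute)
  qed (intro YEnd_closed fg)+
  show "\<zero>\<^bsub>YEnd M R\<^esub> \<oplus>\<^bsub>YEnd M R\<^esub> f = f" if f: "f \<in> carrier (YEnd M R)" for f
  proof (rule YEnd_ext)
    obtain F where "\<And>a. f (cls a) = cls (F a)" using YEnd_rep[OF f] by blast
    then show "(\<zero>\<^bsub>YEnd M R\<^esub> \<oplus>\<^bsub>YEnd M R\<^esub> f) (cls a) = f (cls a)" for a
      by (simp add: YEnd_app V_simps(2))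
  qed (intro YEnd_closed YEnd_consts_closed f)+
  show "f \<oplus>\<^bsub>YEnd M R\<^esub> g \<oplus>\<^bsub>YEnd M R\<^esub> h = f \<oplus>\<^bsub>YEnd M R\<^esub> (g \<oplus>\<^bsub>YEnd M R\<^esub> h)"
    if fgh: "f \<in> carrier (YEnd M R)" "g \<in> carrier (YEnd M R)" "h \<in> carrier (YEnd M R)" for f g h
  proof (rule YEnd_ext)
    obtain F where "\<And>a. f (cls a) = cls (F a)" using YEnd_rep[OF fgh(1)] by blast
    moreover obtain G where "\<And>a. g (cls a) = cls (G a)" using YEnd_rep[OF fgh(2)] by blast
    moreover obtain H where "\<And>a. h (cls a) = cls (H a)" using YEnd_rep[OF fgh(3)] by blast
    ultimately show "(f \<oplus>\<^bsub>YEnd M R\<^esub> g \<oplus>\<^bsub>YEnd M R\<^esub> h) (cls a) = (f \<oplus>\<^bsub>YEnd M R\<^esub> (g \<oplus>\<^bsub>YEnd M R\<^esub> h)) (cls a)" for a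
      by (simp add: YEnd_app V_simps(2) add.assoc)
  qed (intro YEnd_closed fgh)+
qed (intro YEnd_closed YEnd_consts_closed; assumption)+

text \<open>Endomorphisms of the quotient are handled through their values at classes. The change of
  variables stays free, because each identity needs its own.\<close>

lemma rep_YEnd:
  assumes "finite S" "\<And>e e' v. \<iota> (e + e') v = \<iota> e v + \<iota> e' v" "inj \<iota>"
  shows "rep (YEnd M R) (\<lambda>f c. f (cls c)) cls S \<iota>"
proof (rule rep.intro)
  show "finite S" "inj \<iota>" "\<And>e e' v. \<iota> (e + e') v = \<iota> e v + \<iota> e' v" using assms by auto
  show "abelian_monoid (YEnd M R)" by (rule abelian_monoid_YEnd)
  show "f \<otimes>\<^bsub>YEnd M R\<^esub> g \<in> carrier (YEnd M R)" if "f \<in> carrier (YEnd M R)" "g \<in> carrier (YEnd M R)" for f g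
    using YEnd_closed that by blast
  show "\<one>\<^bsub>YEnd M R\<^esub> \<in> carrier (YEnd M R)" "\<And>s. s \<odot>\<^bsub>YEnd M R\<^esub> \<one>\<^bsub>YEnd M R\<^esub> \<in> carrier (YEnd M R)"
    by (rule YEnd_consts_closed)+
  show "\<zero>\<^bsub>YEnd M R\<^esub> \<otimes>\<^bsub>YEnd M R\<^esub> f = \<zero>\<^bsub>YEnd M R\<^esub>" if f: "f \<in> carrier (YEnd M R)" for f
  proof (rule YEnd_ext)
    obtain F where "\<And>a. f (cls a) = cls (F a)" using YEnd_rep[OF f] by blast
    then show "(\<zero>\<^bsub>YEnd M R\<^esub> \<otimes>\<^bsub>YEnd M R\<^esub> f) (cls a) = \<zero>\<^bsub>YEnd M R\<^esub> (cls a)" for a by (simp add: YEnd_app)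
  qed (intro YEnd_closed YEnd_consts_closed f)+
  show "f \<otimes>\<^bsub>YEnd M R\<^esub> \<zero>\<^bsub>YEnd M R\<^esub> = \<zero>\<^bsub>YEnd M R\<^esub>" if f: "f \<in> carrier (YEnd M R)" for f
  proof (rule YEnd_ext)
    have f': "f \<in> Hom V V" using f by (simp add: YEnd_simps)
    obtain F where F: "\<And>a. f (cls a) = cls (F a)" using YEnd_rep[OF f] by blast
    have "f (cls 0) = cls 0"
      using HomD(3)[OF f', of 0 0] by (simp add: F V_simps(6))
    then show "(f \<otimes>\<^bsub>YEnd M R\<^esub> \<zero>\<^bsub>YEnd M R\<^esub>) (cls a) = \<zero>\<^bsub>YEnd M R\<^esub> (cls a)" for a by (simp add: YEnd_app)
  qed (intro YEnd_closed YEnd_consts_closed f)+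
  show "(f \<oplus>\<^bsub>YEnd M R\<^esub> g) (cls c) = cls (x + y)" if "f (cls c) = cls x" "g (cls c) = cls y" for f g c x y
    using that by (simp add: YEnd_app V_simps(2))
  show "((s \<odot>\<^bsub>YEnd M R\<^esub> \<one>\<^bsub>YEnd M R\<^esub>) \<otimes>\<^bsub>YEnd M R\<^esub> g) (cls c) = cls (falg_const s * x)" if "g (cls c) = cls x" for s g c x
    using that by (simp only: YEnd_app)
qed (simp_all add: YEnd_app)

lemma lifts_YEnd:
  assumes "rep (YEnd M R) (\<lambda>f c. f (cls c)) cls S \<iota>"
    and "f \<in> extensional (carrier V)" "linop \<phi>" "\<And>a. f (cls a) = cls (app \<phi> a)"
  shows "rep.lifts (YEnd M R) (\<lambda>f c. f (cls c)) cls f \<phi>"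
proof -
  interpret rep "YEnd M R" "\<lambda>f c. f (cls c)" cls S \<iota> by fact
  show ?thesis unfolding lifts_def
  proof (intro conjI ballI allI impI)
    show "f \<in> carrier (YEnd M R)" unfolding YEnd_simps(1) by (rule Hom_lift[OF assms(2-4)])
    show "(f \<otimes>\<^bsub>YEnd M R\<^esub> g) (cls c) = cls (app \<phi> x)" if g: "g (cls c) = cls x" for g c x
      unfolding YEnd_app g by (rule assms(4))
  qed
qed

lemma lifts_lmul:
  assumes "rep (YEnd M R) (\<lambda>f c. f (cls c)) cls S \<iota>"
  shows "rep.lifts (YEnd M R) (\<lambda>f c. f (cls c)) cls (\<lambda>v\<in>carrier V. cls a \<otimes>\<^bsub>V\<^esub> v) (lmul a)"
  by (rule lifts_YEnd[OF assms]) (auto simp: cls_in V_simps(3))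

section \<open>Operators on the quotient and their lifts\<close>

definition lifted :: "'n Lop \<Rightarrow> 'n opmat \<Rightarrow> bool" where
  "lifted L T \<longleftrightarrow> (\<forall>i j r. linop (T i j r)) \<and> (\<forall>i j r a. L i j (cls a) r = cls (app (T i j r) a))"

lemma Lops_D:
  assumes "L \<in> Lops M R"
  shows "L i j (cls a) r \<in> carrier V" "L i j (cls (a + b)) r = L i j (cls a) r \<oplus>\<^bsub>V\<^esub> L i j (cls b) r"
    "L i j (cls (falg_const s * a)) r = s \<odot>\<^bsub>V\<^esub> L i j (cls a) r" "L i j \<in> extensional (carrier V)"
proof -
  have L: "L i j \<in> Hom V (xinv_h V)" using assms by (simp add: Lops_def)
  show "L i j (cls a) r \<in> carrier V" using L cls_in[of a] by (auto simp: Hom_def xinv_h_def)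
  have "L i j (cls a \<oplus>\<^bsub>V\<^esub> cls b) = L i j (cls a) \<oplus>\<^bsub>xinv_h V\<^esub> L i j (cls b)" using L cls_in by (auto simp: Hom_def)
  then show "L i j (cls (a + b)) r = L i j (cls a) r \<oplus>\<^bsub>V\<^esub> L i j (cls b) r"
    by (simp add: V_simps(2) xinv_h_def)
  have "L i j (s \<odot>\<^bsub>V\<^esub> cls a) = s \<odot>\<^bsub>xinv_h V\<^esub> L i j (cls a)" using L cls_in by (auto simp: Hom_def)
  then show "L i j (cls (falg_const s * a)) r = s \<odot>\<^bsub>V\<^esub> L i j (cls a) r"
    by (simp add: V_simps(6) xinv_h_def)
  show "L i j \<in> extensional (carrier V)" using L by (auto simp: Hom_def PiE_def)
qed

text \<open>Representatives chosen for all elements would not be linear. They are chosen on words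
  and extended linearly; the set where the extension is correct is closed because the ideal
  is.\<close>

lemma lifted_ex:
  assumes L: "L \<in> Lops M R"
  shows "\<exists>T. lifted L T"
proof -
  define Y where "Y i j r a = (SOME y. L i j (cls a) r = cls y)" for i j r a
  have Y: "L i j (cls a) r = cls (Y i j r a)" for i j r a
    unfolding Y_def by (rule someI_ex) (rule V_cases[OF Lops_D(1)[OF L]])
  define T where "T i j r = ext (\<lambda>w. Y i j r (fps_const (Poly_Mapping.single w 1)))" for i j r
  have lin: "linop (T i j r)" for i j r unfolding T_def by (rule linop_ext)
  have "L i j (cls a) r = cls (app (T i j r) a)" for i j r a
  proof -
    let ?K = "{a. L i j (cls a) r = cls (app (T i j r) a)}"
    have "csub ?K" unfolding csub_def submod_def
    proof (intro conjI ballI allI impI)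
      show "0 \<in> ?K" using Lops_D(3)[OF L, of i j 0 0 r] by (simp add: Y V_simps(6))
      show "a + b \<in> ?K" if "a \<in> ?K" "b \<in> ?K" for a b
        using that Lops_D(2)[OF L, of i j a b r] by (simp add: app_add V_simps(2))
      show "falg_const s * a \<in> ?K" if "a \<in> ?K" for s a
        using that Lops_D(3)[OF L, of i j s a r] by (simp add: linopD[OF lin] V_simps(6))
      fix b assume lim: "\<forall>m. \<exists>c. b - fps_X ^ m * c \<in> ?K"
      \<comment> \<open>Replacing b by an approximation modulo h^m changes the difference by a
        multiple of h^m, whichever representatives were chosen.\<close>
      have "Y i j r b - app (T i j r) b \<in> J"
      proof (rule csub_lim[OF J_props(2)])
        fix m
        obtain c where c: "b - fps_X ^ m * c \<in> ?K" using lim by blast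
        have "cls (Y i j r b) = L i j (cls ((b - fps_X ^ m * c) + falg_const (fps_X ^ m) * c)) r"
          by (simp add: Y falg_const_X_power)
        also have "\<dots> = cls (app (T i j r) (b - fps_X ^ m * c) + falg_const (fps_X ^ m) * Y i j r c)"
          unfolding Lops_D(2)[OF L] Lops_D(3)[OF L] using c by (simp add: Y[of _ _ c] V_simps(2,6))
        finally have "Y i j r b - (app (T i j r) (b - fps_X ^ m * c) + falg_const (fps_X ^ m) * Y i j r c) \<in> J"
          by (simp only: cls_eq_iff)
        then have "Y i j r b - app (T i j r) b - fps_X ^ m * (Y i j r c - app (T i j r) c) \<in> J"
          by (simp add: app_diff linop_X[OF lin] falg_const_X_power algebra_simps)
        then show "\<exists>d. Y i j r b - app (T i j r) b - fps_X ^ m * d \<in> J" by blast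
      qed
      then show "b \<in> ?K" by (simp add: Y cls_eq_iff)
    qed
    then have "a \<in> ?K"
      by (rule csub_eq_UNIV_word) (simp add: Y T_def ext_word)
    then show ?thesis by simp
  qed
  then show ?thesis unfolding lifted_def using lin by blast
qed

text \<open>Invariance of the ideal makes the operator well defined on classes, and decay puts its
  values into the series in 1/x with coefficients tending to 0.\<close>

lemma Lop_of_opmat:
  assumes lin: "\<And>i j r. linop (T i j r)" and dec: "decays T" and TJ: "\<And>i j r x. x \<in> J \<Longrightarrow> app (T i j r) x \<in> J"
  obtains L where "L \<in> Lops M R" "lifted L T"
proof -
  define L :: "'n Lop" where "L i j = (\<lambda>v\<in>carrier V. \<lambda>r. cls (app (T i j r) (SOME a. v = cls a)))" for i j
  have Lc: "L i j (cls a) r = cls (app (T i j r) a)" for i j a r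
  proof -
    have "cls a = cls (SOME a'. cls a = cls a')" by (rule someI) simp
    then have "a - (SOME a'. cls a = cls a') \<in> J" by (simp add: cls_eq_iff)
    then have "app (T i j r) (a - (SOME a'. cls a = cls a')) \<in> J" by (rule TJ)
    then have "cls (app (T i j r) a) = cls (app (T i j r) (SOME a'. cls a = cls a'))"
      by (simp only: cls_eq_iff app_diff)
    then show ?thesis by (simp only: L_def restrict_apply cls_in if_True)
  qed
  have lif: "lifted L T" unfolding lifted_def using lin Lc by blast
  have "L \<in> Lops M R"
    unfolding Lops_def Hom_def
  proof (intro CollectI allI conjI ballI)
    fix i j
    show "L i j \<in> carrier V \<rightarrow>\<^sub>E carrier (xinv_h V)"
    proof (rule PiE_I)
      fix v assume "v \<in> carrier V"
      then obtain a where v: "v = cls a" using V_cases by blast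
      have "\<exists>r0. \<forall>r\<ge>r0. \<exists>w\<in>carrier V. L i j v r = (fps_X ^ k) \<odot>\<^bsub>V\<^esub> w" for k
      proof -
        obtain r0 where r0: "\<And>r. r \<ge> r0 \<Longrightarrow> \<exists>c. app (T i j r) a = fps_X ^ k * c"
          using dec unfolding decays_def by blast
        have "\<exists>w\<in>carrier V. L i j v r = (fps_X ^ k) \<odot>\<^bsub>V\<^esub> w" if r: "r \<ge> r0" for r
        proof -
          obtain c where "app (T i j r) a = fps_X ^ k * c" using r0[OF r] by blast
          then have "L i j v r = (fps_X ^ k) \<odot>\<^bsub>V\<^esub> cls c"
            unfolding v Lc V_simps(6) falg_const_X_power by simp
          then show ?thesis using cls_in by blast
        qed
        then show ?thesis by blast
      qed
      moreover have "L i j v r \<in> carrier V" for r unfolding v Lc by (rule cls_in)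
      ultimately show "L i j v \<in> carrier (xinv_h V)" by (simp add: xinv_h_def)
    qed (simp add: L_def)
    show "L i j (v \<oplus>\<^bsub>V\<^esub> w) = L i j v \<oplus>\<^bsub>xinv_h V\<^esub> L i j w" if "v \<in> carrier V" "w \<in> carrier V" for v w
    proof -
      obtain a where "v = cls a" using V_cases \<open>v \<in> carrier V\<close> by blast
      moreover obtain b where "w = cls b" using V_cases \<open>w \<in> carrier V\<close> by blast
      ultimately show ?thesis by (simp add: fun_eq_iff xinv_h_def V_simps(2) Lc app_add)
    qed
    show "L i j (s \<odot>\<^bsub>V\<^esub> v) = s \<odot>\<^bsub>xinv_h V\<^esub> L i j v" if v: "v \<in> carrier V" for s v
    proof -
      obtain a where "v = cls a" using V_cases[OF v] by blast
      then show ?thesis by (simp add: fun_eq_iff xinv_h_def V_simps(6) Lc linopD[OF lin])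
    qed
  qed
  then show ?thesis using that lif by blast
qed

lemma lifted_eqI:
  assumes L: "L \<in> Lops M R" "L' \<in> Lops M R" and T: "lifted L T" "lifted L' T'"
    and eq: "\<And>i j r a. app (T i j r) a - app (T' i j r) a \<in> J"
  shows "L = L'"
proof (intro ext)
  fix i j v r
  show "L i j v r = L' i j v r"
  proof (cases "v \<in> carrier V")
    case True
    then obtain a where "v = cls a" using V_cases by blast
    then show ?thesis using T eq by (simp add: lifted_def cls_eq_iff)
  next
    case False
    then show ?thesis using Lops_D(4)[OF L(1), of i j] Lops_D(4)[OF L(2), of i j] by (simp add: extensional_def)
  qed
qed

lemma lifts_Lop:
  assumes r: "rep (YEnd M R) (\<lambda>f c. f (cls c)) cls S \<iota>" and T: "lifted L T"
  shows "rep.lifts (YEnd M R) (\<lambda>f c. f (cls c)) cls (\<lambda>v\<in>carrier V. L i j v k) (T i j k)"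
  by (rule lifts_YEnd[OF r]) (use T in \<open>auto simp: lifted_def cls_in\<close>)

end

declare One_nat_def [simp del]

section \<open>Hecke symmetries in coordinates\<close>

text \<open>Scalars act on the free algebra by multiplication, so the machinery made for the
  quotient also evaluates the matrix products in the hypotheses on R.\<close>

lemma rep_ch_alg:
  assumes "finite S" "\<And>e e' v. \<iota> (e + e') v = \<iota> e v + \<iota> e' v" "inj \<iota>"
  shows "rep ch_alg (\<lambda>s c. falg_const s * c :: 'n::finite falg) (\<lambda>x. x) S \<iota>"
proof (rule rep.intro)
  show "abelian_monoid ch_alg"
    by (rule abelian_monoidI) (simp_all add: ch_alg_def add_ac)
qed (use assms in \<open>simp_all add: ch_alg_def falg_const_add falg_const_mult distrib_right mult.assoc\<close>)

text \<open>Here an element acts by left multiplication, the form in which the relations are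
  compared with \<open>rho\<close>.\<close>

lemma rep_free_alg:
  assumes "finite S" "\<And>e e' v. \<iota> (e + e') v = \<iota> e v + \<iota> e' v" "inj \<iota>"
  shows "rep free_alg (*) (\<lambda>x. x :: 'n::finite falg) S \<iota>"
proof (rule rep.intro)
  show "abelian_monoid (free_alg :: (complex fps, 'n falg) module)"
    by (rule abelian_monoidI) (simp_all add: free_alg_def add_ac)
qed (use assms in \<open>simp_all add: free_alg_def distrib_right mult.assoc\<close>)

lemma inj_int_exp: "inj (\<lambda>(e :: nat \<Rightarrow> nat) v. int (e v))"
  by (rule injI) (auto simp: fun_eq_iff)

abbreviation tri :: "'n \<Rightarrow> 'n \<Rightarrow> 'n \<Rightarrow> nat \<Rightarrow> 'n" where
  "tri a b c \<equiv> (\<lambda>_. undefined)(1 := a, 2 := b, 3 := c)"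

lemma tri_idx: "tri a b c \<in> idx {1, 2, 3}"
  by (auto simp: idx_def PiE_def extensional_def)

lemma tri_upd: "(tri a b c)(1 := x, 2 := y, 3 := z) = tri x y z"
  by (auto simp: fun_eq_iff)

lemma tri_eq_iff: "tri a b c = tri a' b' c' \<longleftrightarrow> a = a' \<and> b = b' \<and> c = c'"
proof
  assume eq: "tri a b c = tri a' b' c'"
  show "a = a' \<and> b = b' \<and> c = c'"
    using fun_cong[OF eq, of 1] fun_cong[OF eq, of 2] fun_cong[OF eq, of 3] by simp
qed simp

lemma sum_delta3:
  fixes f :: "'n::finite \<Rightarrow> 'n \<Rightarrow> 'n \<Rightarrow> 'a::comm_monoid_add"
  shows "(\<Sum>x\<in>UNIV. \<Sum>y\<in>UNIV. \<Sum>z\<in>UNIV. if x = a \<and> y = b \<and> z = c then f x y z else 0) = f a b c"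
proof -
  have 1: "(\<Sum>z\<in>UNIV. if x = a \<and> y = b \<and> z = c then f x y z else 0) = (if x = a \<and> y = b then f x y c else 0)" for x y
    by (cases "x = a \<and> y = b") (auto intro!: sum.neutral)
  have 2: "(\<Sum>y\<in>UNIV. if x = a \<and> y = b then f x y c else 0) = (if x = a then f x b c else 0)" for x
    by (cases "x = a") simp_all
  show ?thesis by (simp add: 1 2)
qed

lemma spt_sg: "app (spt s) (sg (tri a' b' c') 1 (tri x y z)) 0
    = (if x = a' \<and> y = b' \<and> z = c' then falg_const s else (0 :: 'n falg))"
  by (simp add: app_spt sg_def tri_eq_iff sing_def zero_fun_def)

lemma finsum_ch_alg: "finite X \<Longrightarrow> finsum ch_alg f X = sum f X"
proof (induction X rule: finite_induct)
  case empty
  interpret abelian_monoid ch_alg by (rule abelian_monoidI) (simp_all add: ch_alg_def add_ac)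
  show ?case unfolding finsum_empty by (simp add: ch_alg_def)
next
  case (insert x X)
  interpret abelian_monoid ch_alg by (rule abelian_monoidI) (simp_all add: ch_alg_def add_ac)
  have "finsum ch_alg f (insert x X) = f x \<oplus>\<^bsub>ch_alg\<^esub> finsum ch_alg f X"
    using insert by (intro finsum_insert) (auto simp: ch_alg_def)
  then show ?case using insert by (simp add: ch_alg_def)
qed

lemma tprod_12_23:
  fixes X Y :: "complex fps ^ ('n::finite \<times> 'n) ^ ('n \<times> 'n)"
  shows "tprod ch_alg {1, 2, 3} [cleg ch_alg {1, 2, 3} 1 2 X, cleg ch_alg {1, 2, 3} 2 3 Y] (tri a b c) (tri a' b' c') (\<lambda>_. 0)
    = (\<Sum>y\<in>UNIV. X $ (a, b) $ (a', y) * Y $ (y, c) $ (b', c'))" (is "?l = ?r")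
proof -
  let ?\<iota> = "\<lambda>(e :: nat \<Rightarrow> nat) v. int (e v)"
  interpret rep ch_alg "\<lambda>s c. falg_const s * c :: 'n falg" "\<lambda>x. x" "{1, 2, 3}" ?\<iota>
    by (rule rep_ch_alg) (simp_all add: plus_fun_apply inj_int_exp)
  have "list_all2 oprep [cleg ch_alg {1, 2, 3} 1 2 X, cleg ch_alg {1, 2, 3} 2 3 Y] [cm 1 2 X, cm 2 3 Y]"
    by (simp add: oprep_cleg)
  from ev_tprod(1)[OF this tri_idx[of a b c] tri_idx[of a' b' c'], of 0 1]
  have "falg_const ?l = app (cm 1 2 X * cm 2 3 Y) (sg (tri a' b' c') 1) (tri a b c) 0"
    by simp
  also have "\<dots> = (\<Sum>x\<in>UNIV. \<Sum>y\<in>UNIV. \<Sum>y'\<in>UNIV. \<Sum>z\<in>UNIV.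
      if x = a' \<and> y' = b' \<and> z = c' then falg_const (X $ (a, b) $ (a', y) * Y $ (y, c) $ (b', c')) else 0)"
  proof -
    have 1: "(tri a b c)(1 := x, 2 := y, 2 := y', 3 := z) = tri x y' z" for x y y' z by (auto simp: fun_eq_iff)
    have "app (cm 1 2 X * cm 2 3 Y) (sg (tri a' b' c') 1) (tri a b c) 0 = (\<Sum>x\<in>UNIV. \<Sum>y\<in>UNIV. \<Sum>y'\<in>UNIV. \<Sum>z\<in>UNIV.
        app (spt (X $ (a, b) $ (x, y))) (app (spt (Y $ (y, c) $ (y', z))) (sg (tri a' b' c') 1 (tri x y' z))) 0)"
      by (simp add: app_cm app_sum sum_fun_apply 1 fun_upd_twist)
    also have "\<dots> = (\<Sum>x\<in>UNIV. \<Sum>y\<in>UNIV. \<Sum>y'\<in>UNIV. \<Sum>z\<in>UNIV.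
      if x = a' \<and> y' = b' \<and> z = c' then falg_const (X $ (a, b) $ (a', y) * Y $ (y, c) $ (b', c')) else 0)"
      unfolding app_spt[of "X $ _ $ _"] spt_sg by (intro sum.cong refl) (simp add: falg_const_mult)
    finally show ?thesis .
  qed
  also have "\<dots> = (\<Sum>y\<in>UNIV. \<Sum>x\<in>UNIV. \<Sum>y'\<in>UNIV. \<Sum>z\<in>UNIV.
      if x = a' \<and> y' = b' \<and> z = c' then falg_const (X $ (a, b) $ (a', y) * Y $ (y, c) $ (b', c')) else 0)"
    by (rule sum.swap)
  also have "\<dots> = (\<Sum>y\<in>UNIV. falg_const (X $ (a, b) $ (a', y) * Y $ (y, c) $ (b', c')))"
    unfolding sum_delta3 ..
  also have "\<dots> = falg_const ?r" by (simp add: falg_const_sum)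
  finally show ?thesis by (rule inj_falg_const)
qed

text \<open>On leg 2 the product joins the column index of X to the row index of Y (t), and the
  trace joins the two that remain (m).\<close>

lemma skew_entries:
  fixes X Y :: "complex fps ^ ('n::finite \<times> 'n) ^ ('n \<times> 'n)"
  assumes "teq {1, 3} (ptrace ch_alg 2 (tprod ch_alg {1, 2, 3} [cleg ch_alg {1, 2, 3} 1 2 X, cleg ch_alg {1, 2, 3} 2 3 Y]))
    (cleg ch_alg {1, 3} 1 3 Pmat)"
  shows "(\<Sum>m\<in>UNIV. \<Sum>t\<in>UNIV. X $ (i, m) $ (j, t) * Y $ (t, k) $ (m, l)) = (if i = l \<and> k = j then 1 else 0)"
proof -
  let ?d = "\<lambda>a c. (\<lambda>_. undefined)(1 := a, 3 := c) :: nat \<Rightarrow> 'n"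
  have I: "?d a c \<in> idx {1, 3}" for a c by (auto simp: idx_def PiE_def extensional_def)
  have t: "(?d a c)(2 := m) = tri a m c" for a c m by (auto simp: fun_eq_iff)
  have "ptrace ch_alg 2 (tprod ch_alg {1, 2, 3} [cleg ch_alg {1, 2, 3} 1 2 X, cleg ch_alg {1, 2, 3} 2 3 Y]) (?d i k) (?d j l) (\<lambda>_. 0)
    = cleg ch_alg {1, 3} 1 3 Pmat (?d i k) (?d j l) (\<lambda>_. 0)"
    using assms I by (simp add: teq_def)
  moreover have "cleg ch_alg {1, 3} 1 3 Pmat (?d i k) (?d j l) (\<lambda>_. 0) = (if i = l \<and> k = j then 1 else 0)"
    by (auto simp: cleg_def leg2_def ch_alg_def Pmat_nth)
  ultimately show ?thesis
    unfolding ptrace_def t tprod_12_23 by (simp add: finsum_ch_alg)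
qed

lemma braid_entries:
  fixes R :: "complex fps ^ ('n::finite \<times> 'n) ^ ('n \<times> 'n)"
  assumes "hecke_symmetry R"
  shows "(\<Sum>x\<in>UNIV. \<Sum>y\<in>UNIV. \<Sum>z\<in>UNIV. R $ (a, b) $ (x, y) * (R $ (y, c) $ (z, c') * R $ (x, z) $ (a', b'))) =
      (\<Sum>x\<in>UNIV. \<Sum>y\<in>UNIV. \<Sum>z\<in>UNIV. R $ (b, c) $ (y, z) * (R $ (a, y) $ (a', x) * R $ (x, z) $ (b', c')))"
    (is "?l = ?r")
proof -
  let ?\<iota> = "\<lambda>(e :: nat \<Rightarrow> nat) v. int (e v)"
  interpret rep ch_alg "\<lambda>s c. falg_const s * c :: 'n falg" "\<lambda>x. x" "{1, 2, 3}" ?\<iota>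
    by (rule rep_ch_alg) (simp_all add: plus_fun_apply inj_int_exp)
  let ?R12 = "cleg ch_alg {1, 2, 3} 1 2 R" and ?R23 = "cleg ch_alg {1, 2, 3} 2 3 R"
  have "list_all2 oprep [?R12, ?R23, ?R12] [cm 1 2 R, cm 2 3 R, cm 1 2 R]"
    "list_all2 oprep [?R23, ?R12, ?R23] [cm 2 3 R, cm 1 2 R, cm 2 3 R]"
    by (simp_all add: oprep_cleg)
  from this[THEN ev_tprod(1)[OF _ tri_idx[of a b c] tri_idx[of a' b' c'], of _ _ 0 1]]
  have "falg_const (tprod ch_alg {1, 2, 3} [?R12, ?R23, ?R12] (tri a b c) (tri a' b' c') (?\<iota> 0))
      = app (cm 1 2 R * (cm 2 3 R * cm 1 2 R)) (sg (tri a' b' c') 1) (tri a b c) 0"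
    "falg_const (tprod ch_alg {1, 2, 3} [?R23, ?R12, ?R23] (tri a b c) (tri a' b' c') (?\<iota> 0))
      = app (cm 2 3 R * (cm 1 2 R * cm 2 3 R)) (sg (tri a' b' c') 1) (tri a b c) 0"
    by (simp_all only: mult_1_right prod_list.Cons prod_list.Nil)
  moreover have "tprod ch_alg {1, 2, 3} [?R12, ?R23, ?R12] (tri a b c) (tri a' b' c') (?\<iota> 0)
      = tprod ch_alg {1, 2, 3} [?R23, ?R12, ?R23] (tri a b c) (tri a' b' c') (?\<iota> 0)"
  proof -
    have "teq {1, 2, 3} (tprod ch_alg {1, 2, 3} [?R12, ?R23, ?R12]) (tprod ch_alg {1, 2, 3} [?R23, ?R12, ?R23])"
      using assms unfolding hecke_symmetry_def Let_def by blast
    from bspec[OF bspec[OF this[unfolded teq_def] tri_idx[of a b c]] tri_idx[of a' b' c']] show ?thesis by (rule spec)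
  qed
  moreover have d: "1 \<noteq> (2 :: nat)" "2 \<noteq> (3 :: nat)" "1 \<noteq> (3 :: nat)" by simp_all
  moreover have "app (cm 1 2 R * (cm 2 3 R * cm 1 2 R)) (sg (tri a' b' c') 1) (tri a b c) 0 = falg_const ?l"
    unfolding app_cm_braid(1)[OF d] sum_fun_apply tri_upd spt_sg sum_delta3 by simp
  moreover have "app (cm 2 3 R * (cm 1 2 R * cm 2 3 R)) (sg (tri a' b' c') 1) (tri a b c) 0 = falg_const ?r"
    unfolding app_cm_braid(2)[OF d] sum_fun_apply tri_upd spt_sg sum_delta3 by simp
  ultimately have "falg_const ?l = (falg_const ?r :: 'n falg)" by simp
  then show ?thesis by (rule inj_falg_const)
qed

lemma hecke_data_ex:
  assumes "M > 0" "hecke_symmetry R" "skew_invertible R"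
  shows "\<exists>Psi. hecke_data R Psi M"
proof -
  obtain Psi where
    1: "teq {1, 3} (ptrace ch_alg 2 (tprod ch_alg {1, 2, 3} [cleg ch_alg {1, 2, 3} 1 2 R, cleg ch_alg {1, 2, 3} 2 3 Psi]))
      (cleg ch_alg {1, 3} 1 3 Pmat)" and
    2: "teq {1, 3} (ptrace ch_alg 2 (tprod ch_alg {1, 2, 3} [cleg ch_alg {1, 2, 3} 1 2 Psi, cleg ch_alg {1, 2, 3} 2 3 R]))
      (cleg ch_alg {1, 3} 1 3 Pmat)"
    using assms(3) unfolding skew_invertible_def Let_def by blast
  have "hecke_data R Psi M"
  proof
    show "M > 0" by fact
    show "R ** R = mat nu ** R + mat 1" using assms(2) hecke_square unfolding hecke_symmetry_def by blast
    show "(\<Sum>k\<in>UNIV. \<Sum>l\<in>UNIV. R $ (a, k) $ (b, l) * Psi $ (l, b') $ (k, a')) = (if a = a' \<and> b = b' then 1 else 0)" for a b a' b'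
      by (subst skew_entries[OF 1]) auto
    show "(\<Sum>a\<in>UNIV. \<Sum>b\<in>UNIV. Psi $ (l', b) $ (k', a) * R $ (a, k) $ (b, l)) = (if k = k' \<and> l = l' then 1 else 0)" for k l k' l'
      by (subst sum.swap, subst skew_entries[OF 2]) auto
  qed (rule braid_entries[OF assms(2)])
  then show ?thesis ..
qed

section \<open>The relations as values of an operator\<close>

text \<open>Operators on legs 1 and 2 that are known from their values at basis columns: their
  entries are local and commute with monomials.\<close>

definition gleg :: "'n::finite mvec addop \<Rightarrow> bool" where
  "gleg X \<longleftrightarrow> (\<exists>C. X = leg2m 1 2 C \<and> (\<forall>p q. loc (C p q) \<and> (\<forall>a. comm (mon a) (C p q))))"

lemma gleg_mult: "gleg X \<Longrightarrow> gleg Y \<Longrightarrow> gleg (X * Y)"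
proof -
  assume "gleg X" "gleg Y"
  then obtain C D where C: "X = leg2m 1 2 C" "\<And>p q. loc (C p q)" "\<And>p q a. comm (mon a) (C p q)"
    and D: "Y = leg2m 1 2 D" "\<And>p q. loc (D p q)" "\<And>p q a. comm (mon a) (D p q)" unfolding gleg_def by blast
  show ?thesis unfolding gleg_def C(1) D(1)
    by (intro exI[of _ "\<lambda>p q. \<Sum>t\<in>UNIV. C p t * D t q"] conjI allI leg2m_mult loc_sum loc_mult C D comm_sum comm_ring) simp
qed

lemma gleg_diff: "gleg X \<Longrightarrow> gleg Y \<Longrightarrow> gleg (X - Y)"
proof -
  assume "gleg X" "gleg Y"
  then obtain C D where C: "X = leg2m 1 2 C" "\<And>p q. loc (C p q)" "\<And>p q a. comm (mon a) (C p q)"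
    and D: "Y = leg2m 1 2 D" "\<And>p q. loc (D p q)" "\<And>p q a. comm (mon a) (D p q)" unfolding gleg_def by blast
  show ?thesis unfolding gleg_def C(1) D(1)
    by (intro exI[of _ "\<lambda>p q. C p q - D p q"] conjI allI leg2m_diff[symmetric] loc_diff C D comm_ring)
qed

lemma gleg_leg2m:
  assumes "\<And>p q. loc (C p q)" "\<And>p q a. comm (mon a) (C p q)"
  shows "gleg (leg2m 1 2 C)" "gleg (leg2m 2 1 C)"
proof -
  show "gleg (leg2m 1 2 C)" unfolding gleg_def using assms by blast
  have "leg2m 2 1 C = leg2m 1 2 (\<lambda>p q. C (prod.swap p) (prod.swap q))" by (rule leg2m_swap) simp
  then show "gleg (leg2m 2 1 C)" unfolding gleg_def using assms by blast
qed

lemma gleg_leg1m: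
  fixes C :: "'n::finite \<Rightarrow> 'n \<Rightarrow> 'n ser addop"
  assumes "\<And>p q. loc (C p q)" "\<And>p q a. comm (mon a) (C p q)"
  shows "gleg (leg1m 1 C)" "gleg (leg1m 2 C)"
proof -
  have "leg1m 1 C = leg2m 1 2 (\<lambda>p q. if snd p = snd q then C (fst p) (fst q) else 0)" by (rule leg1m_first) simp
  moreover have "leg1m 2 C = leg2m 1 2 (\<lambda>p q. if fst p = fst q then C (snd p) (snd q) else 0)" by (rule leg1m_second) simp
  ultimately show "gleg (leg1m 1 C)" "gleg (leg1m 2 C)"
    by (auto intro!: gleg_leg2m simp: assms loc_0 comm_ring(1))
qed

lemma gleg_cm: "gleg (cm 1 2 X)" "gleg (cm 2 1 X)"
  unfolding cm_def spt_def by (intro gleg_leg2m loc_gser comm_mon_gser fin_const)+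

lemma gleg_Lop: "\<delta> \<noteq> 0 \<Longrightarrow> gleg (Lop 1 \<delta>)" "\<delta> \<noteq> 0 \<Longrightarrow> gleg (Lop 2 \<delta>)"
  unfolding Lop_def by (intro gleg_leg1m loc_gser comm_mon_gser fin_mexp; assumption)+

text \<open>The relations only provide values at the columns \<open>sg\<close>; locality
  (\<open>loc_mem\<close>) extends membership from these to arbitrary vectors.\<close>

lemma gleg_mem:
  assumes "gleg X" "submod U"
    and mem: "\<And>I K v e. I \<in> idx {1, 2} \<Longrightarrow> K \<in> idx {1, 2} \<Longrightarrow> app X (sg K v) I e \<in> U"
  shows "app X \<Phi> \<in> pw U"
proof -
  obtain C where X: "X = leg2m 1 2 C" and C: "\<And>p q. loc (C p q)" "\<And>p q a. comm (mon a) (C p q)"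
    using assms(1) unfolding gleg_def by blast
  have CU: "app (C p q) \<phi> e \<in> U" for p q \<phi> e
  proof (rule loc_mem[OF C(1) assms(2) C(2)])
    fix v e
    \<comment> \<open>The multi-index with values p on legs 1 and 2, extended by
      \<open>undefined\<close> as \<open>idx\<close> requires.\<close>
    let ?d = "\<lambda>p. (\<lambda>_::nat. undefined)(1 := fst p, 2 := snd p)"
    have d: "?d p \<in> idx {1, 2}" for p by (auto simp: idx_def PiE_def extensional_def)
    have inj: "(?d p)(1 := fst t, 2 := snd t) = ?d q \<longleftrightarrow> t = q" for p q t :: "'a \<times> 'a"
    proof
      assume eq: "(?d p)(1 := fst t, 2 := snd t) = ?d q"
      show "t = q" using fun_cong[OF eq, of 1] fun_cong[OF eq, of 2] by (simp add: prod_eq_iff)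
    qed (auto simp: fun_eq_iff)
    have "app X (sg (?d q) v) (?d p) = (\<Sum>t\<in>UNIV. app (C p t) (sg (?d q) v ((?d p)(1 := fst t, 2 := snd t))))"
      unfolding X by (subst app_leg2m) simp_all
    also have "\<dots> = (\<Sum>t\<in>UNIV. if t = q then app (C p t) (sing 0 v) else 0)"
      unfolding sg_def inj by (intro sum.cong refl) simp
    also have "\<dots> = app (C p q) (sing 0 v)" by simp
    finally show "app (C p q) (sing 0 v) e \<in> U" using mem[OF d d, of q v p e] by simp
  qed
  show ?thesis unfolding pw_def X
    by (simp add: app_leg2m sum_fun_apply submod_sum[OF assms(2)] CU)
qed

context tdata
begin

text \<open>Exponents with respect to \<open>x\<^sub>1 / x\<^sub>2\<close> and \<open>x\<^sub>2\<close>.\<close>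

abbreviation rel_exp :: "(nat \<Rightarrow> nat) \<Rightarrow> nat \<Rightarrow> int" where
  "rel_exp e v \<equiv> if v = 1 then int (e 1) else if v = 2 then int (e 2) - int (e 1) else int (e v)"

lemma gleg_rho: "gleg rho"
  unfolding rho_def sm_def sser_def
  by (intro gleg_diff gleg_mult gleg_cm gleg_Lop gleg_leg2m loc_gser comm_mon_gser fin_mexp nz_add unit_exp_nz)

text \<open>Left multiplication by a generator of the ideal is a coefficient of \<open>rho\<close>.
  This connects the formal definition of the relations with operator algebra.\<close>

lemma relations_rho:
  defines "S \<equiv> {1, 2}" and "L \<equiv> Lp free_alg (\<lambda>a. a :: 'n falg) {1, 2}"
  defines "y \<equiv> (\<lambda>I K \<gamma>. tprod free_alg S [sleg free_alg S 1 2 (Rbar M R) 1 1 2, L 1, cleg free_alg S 1 2 (R ** Pmat), L 2] I K \<gamma>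
      - tprod free_alg S [L 2, cleg free_alg S 2 1 (R ** Pmat), L 1, sleg free_alg S 2 1 (Rbar M R) 1 1 2] I K \<gamma>)"
  assumes I: "I \<in> idx {1, 2}" and K: "K \<in> idx {1, 2}"
  shows "y I K (rel_exp e) * c = app rho (sg K c) I e" "\<gamma> \<notin> range rel_exp \<Longrightarrow> y I K \<gamma> = 0"
    "y I K \<gamma> \<in> Y_relations M R"
proof -
  have inj: "inj rel_exp"
  proof (rule injI, rule ext)
    fix e e' :: "nat \<Rightarrow> nat" and v assume eq: "rel_exp e = rel_exp e'"
    show "e v = e' v" using fun_cong[OF eq, of v] fun_cong[OF eq, of 1] by (simp split: if_splits)
  qed
  interpret rep free_alg "(*)" "\<lambda>x. x :: 'n falg" S rel_exp
    by (rule rep_free_alg) (use inj in \<open>auto simp: plus_fun_apply S_def\<close>)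
  have l: "lifts a (lmul a)" for a unfolding lifts_def by (simp add: free_alg_def mult.assoc)
  have L: "oprep (L 1) (Lop 1 (unit_exp 1 + unit_exp 2))" "oprep (L 2) (Lop 2 (unit_exp 2))"
    unfolding L_def S_def[symmetric] by (rule oprep_Lp[OF _ _ l]; auto simp: S_def fun_eq_iff plus_fun_apply)+
  have Rb: "oprep (sleg free_alg S 1 2 (Rbar M R) 1 1 2) (Rb 1 2 (unit_exp 1) 1)"
    "oprep (sleg free_alg S 2 1 (Rbar M R) 1 1 2) (Rb 2 1 (unit_exp 1) 1)"
    unfolding sm_def by (rule oprep_sleg; auto simp: S_def fun_eq_iff)+
  have A: "oprep (cleg free_alg S 1 2 (R ** Pmat)) (A 1 2)" "oprep (cleg free_alg S 2 1 (R ** Pmat)) (A 2 1)"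
    by (rule oprep_cleg; simp add: S_def)+
  have 1: "list_all2 oprep [sleg free_alg S 1 2 (Rbar M R) 1 1 2, L 1, cleg free_alg S 1 2 (R ** Pmat), L 2]
      [Rb 1 2 (unit_exp 1) 1, Lop 1 (unit_exp 1 + unit_exp 2), A 1 2, Lop 2 (unit_exp 2)]"
    using L Rb A by simp
  have 2: "list_all2 oprep [L 2, cleg free_alg S 2 1 (R ** Pmat), L 1, sleg free_alg S 2 1 (Rbar M R) 1 1 2]
      [Lop 2 (unit_exp 2), A 2 1, Lop 1 (unit_exp 1 + unit_exp 2), Rb 2 1 (unit_exp 1) 1]"
    using L Rb A by simp
  have I': "I \<in> idx S" and K': "K \<in> idx S" using I K by (simp_all add: S_def)
  show "y I K (rel_exp e) * c = app rho (sg K c) I e"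
    unfolding y_def left_diff_distrib ev_tprod(1)[OF 1 I' K'] ev_tprod(1)[OF 2 I' K'] rho_def
    by (simp add: fun_diff_def)
  show "y I K \<gamma> = 0" if "\<gamma> \<notin> range rel_exp"
    unfolding y_def ev_tprod(3)[OF 1 I' K' that] ev_tprod(3)[OF 2 I' K' that] by simp
  show "y I K \<gamma> \<in> Y_relations M R"
    unfolding Y_relations_def Let_def y_def L_def using I K unfolding S_def by blast
qed

lemma rho_mem: "app rho \<Phi> \<in> pw (Y_ideal M R)"
proof (rule gleg_mem[OF gleg_rho J_props(1)])
  fix I K :: "nat \<Rightarrow> 'n" and v e assume I: "I \<in> idx {1, 2}" and K: "K \<in> idx {1, 2}"
  show "app rho (sg K v) I e \<in> Y_ideal M R"
    unfolding relations_rho(1)[OF I K, symmetric]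
    by (rule J_props(4), rule subsetD[OF J_props(6)], rule relations_rho(3)[OF I K])
qed

lemma T_ideal: "x \<in> Y_ideal M R \<Longrightarrow> app (T i j r) x \<in> Y_ideal M R"
proof (rule T_preserves[where rels = "Y_relations M R"])
  show "Y_ideal M R \<subseteq> I" if "csub I" "\<And>a x. x \<in> I \<Longrightarrow> a * x \<in> I" "\<And>a x. x \<in> I \<Longrightarrow> x * a \<in> I"
    "\<And>x. fps_X * x \<in> I \<Longrightarrow> x \<in> I" "Y_relations M R \<subseteq> I" for I
    using that by (rule J_least)
  fix y assume "y \<in> Y_relations M R"
  then obtain I K \<gamma> where I: "I \<in> idx {1, 2}" and K: "K \<in> idx {1, 2}" and
    y: "y = tprod free_alg {1, 2} [sleg free_alg {1, 2} 1 2 (Rbar M R) 1 1 2, Lp free_alg (\<lambda>a. a) {1, 2} 1, cleg free_alg {1, 2} 1 2 (R ** Pmat), Lp free_alg (\<lambda>a. a) {1, 2} 2] I K \<gamma>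
      - tprod free_alg {1, 2} [Lp free_alg (\<lambda>a. a) {1, 2} 2, cleg free_alg {1, 2} 2 1 (R ** Pmat), Lp free_alg (\<lambda>a. a) {1, 2} 1, sleg free_alg {1, 2} 2 1 (Rbar M R) 1 1 2] I K \<gamma>"
    unfolding Y_relations_def Let_def by blast
  have IK: "I 0 = K 0" using I K by (simp add: idx_def PiE_def extensional_def)
  show "\<exists>I K e. I 0 = K 0 \<and> (\<forall>c. y * c = app rho (sg K c) I e)"
  proof (cases "\<gamma> \<in> range rel_exp")
    case True
    then obtain e where "\<gamma> = rel_exp e" by blast
    then show ?thesis using relations_rho(1)[OF I K, of e] IK unfolding y by blast
  next
    case False
    \<comment> \<open>Such an exponent gives the zero relation, which is matched by a coefficient of
      \<open>rho\<close> at a positive power of x_0, where \<open>rho\<close> vanishes.\<close>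
    have "y = 0" unfolding y by (rule relations_rho(2)[OF I K False])
    moreover have "app rho (sg K c) I (unit_exp 0) = 0" for c by (rule rho_supp) simp
    ultimately show ?thesis using IK by (intro exI[of _ I] exI[of _ K] exI[of _ "unit_exp 0"]) simp
  qed
qed (use J_props rho_mem in blast)+

end

section \<open>Products of operators on one leg\<close>

lemma leg1m_mult: "leg1m k C * leg1m k D = leg1m k (\<lambda>a b. \<Sum>t\<in>UNIV. C a t * D t b)"
proof (rule mvec_eqI)
  fix \<Phi> I
  have "app (leg1m k C * leg1m k D) \<Phi> I = (\<Sum>t\<in>UNIV. \<Sum>b\<in>UNIV. app (C (I k) t) (app (D t b) (\<Phi> (I(k := b)))))"
    by (simp add: app_leg1m app_sum)
  also have "\<dots> = (\<Sum>b\<in>UNIV. \<Sum>t\<in>UNIV. app (C (I k) t) (app (D t b) (\<Phi> (I(k := b)))))" by (rule sum.swap)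
  finally show "app (leg1m k C * leg1m k D) \<Phi> I = app (leg1m k (\<lambda>a b. \<Sum>t\<in>UNIV. C a t * D t b)) \<Phi> I"
    by (simp add: app_leg1m app_sum_left)
qed

lemma Top_conv:
  assumes "\<delta> \<noteq> 0"
  shows "Top a k \<delta> * Top b k \<delta> = Top (conv a b) k \<delta>"
  unfolding Top_def leg1m_mult conv_def gser_sum cser_mult[OF assms] ..

lemma Top_idm:
  assumes "\<delta> \<noteq> 0"
  shows "Top idm k \<delta> = (1 :: 'n::finite mvec addop)"
proof (rule mvec_eqI)
  fix \<Phi> :: "'n mvec" and I
  have c: "app (cser \<delta> (idm a b)) \<phi> = (if a = b then \<phi> else 0)" for a b :: 'n and \<phi>
  proof
    fix e
    have "app (cser \<delta> (idm a b)) \<phi> e = (\<Sum>r\<in>{0}. app (idm a b r) (\<phi> (e - mexp r \<delta>)))"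
      unfolding app_gser
    proof (rule sum.mono_neutral_right)
      show "finite {x. mexp x \<delta> \<le> e}" by (rule finD[OF fin_mexp[OF assms]])
    qed (auto simp: idm_def le_fun_def)
    then show "app (cser \<delta> (idm a b)) \<phi> e = (if a = b then \<phi> else 0) e"
      by (simp add: idm_def fun_diff_def)
  qed
  show "app (Top idm k \<delta>) \<Phi> I = app 1 \<Phi> I"
    unfolding Top_def app_leg1m c by simp
qed

lemma Top_diff: "Top (\<lambda>i j r. a i j r - b i j r) k \<delta> = Top a k \<delta> - Top b k \<delta>"
  unfolding Top_def leg1m_def gser_diff lift_ring(2) by (simp add: left_diff_distrib sum_subtractf)

lemma Lop_value:
  fixes \<Psi> :: "'n::finite mvec"
  assumes supp: "\<And>I e. I k \<noteq> K k \<or> e k \<noteq> 0 \<Longrightarrow> \<Psi> I e = 0"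
  shows "app (Lop k (unit_exp k)) \<Psi> I e = lplus (I k) (K k) (e k) * \<Psi> (I(k := K k)) (e(k := 0))"
proof -
  have "app (Lop k (unit_exp k)) \<Psi> I e
    = (\<Sum>b\<in>UNIV. \<Sum>r' | mexp r' (unit_exp k) \<le> e. lplus (I k) b r' * (\<Psi> (I(k := b)) (e - mexp r' (unit_exp k))))"
    by (simp add: Lop_def app_leg1m sum_fun_apply app_gser)
  also have "\<dots> = (\<Sum>b\<in>UNIV. if b = K k then lplus (I k) (K k) (e k) * \<Psi> (I(k := K k)) (e(k := 0)) else 0)"
  proof (intro sum.cong refl)
    fix b
    have er: "e - mexp (e k) (unit_exp k) = e(k := 0)" by (auto simp: fun_eq_iff unit_exp_def)
    have "(\<Sum>r' | mexp r' (unit_exp k) \<le> e. lplus (I k) b r' * (\<Psi> (I(k := b)) (e - mexp r' (unit_exp k))))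
      = (\<Sum>r'\<in>{e k}. lplus (I k) b r' * (\<Psi> (I(k := b)) (e - mexp r' (unit_exp k))))"
    proof (rule sum.mono_neutral_right)
      show "finite {r'. mexp r' (unit_exp k) \<le> e}" by (rule finD[OF fin_mexp]) simp
      show "{e k} \<subseteq> {r'. mexp r' (unit_exp k) \<le> e}" by (auto simp: le_fun_def unit_exp_def)
      show "\<forall>r'\<in>{r'. mexp r' (unit_exp k) \<le> e} - {e k}. lplus (I k) b r' * (\<Psi> (I(k := b)) (e - mexp r' (unit_exp k))) = 0"
      proof
        fix r' assume r': "r' \<in> {r'. mexp r' (unit_exp k) \<le> e} - {e k}"
        then have "r' * unit_exp k k \<le> e k" unfolding le_fun_def by blast
        then have "(e - mexp r' (unit_exp k)) k \<noteq> 0" using r' by simp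
        then show "lplus (I k) b r' * (\<Psi> (I(k := b)) (e - mexp r' (unit_exp k))) = 0" using supp by simp
      qed
    qed
    also have "\<dots> = lplus (I k) b (e k) * \<Psi> (I(k := b)) (e(k := 0))" by (simp only: er sum.empty sum.insert finite.emptyI empty_iff not_False_eq_True add_0_right)
    also have "\<dots> = (if b = K k then lplus (I k) (K k) (e k) * \<Psi> (I(k := K k)) (e(k := 0)) else 0)"
      using supp[of "I(k := b)" "e(k := 0)"] by auto
    finally show "(\<Sum>r' | mexp r' (unit_exp k) \<le> e. lplus (I k) b r' * (\<Psi> (I(k := b)) (e - mexp r' (unit_exp k))))
      = (if b = K k then lplus (I k) (K k) (e k) * \<Psi> (I(k := K k)) (e(k := 0)) else 0)" .
  qed
  finally show ?thesis by simp
qed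

text \<open>Without the matrices RP the bracket has single products of entries of L^+ as its
  coefficients.\<close>

lemma Lops_value:
  "distinct ks \<Longrightarrow> app (prod_list (map (\<lambda>k. Lop k (unit_exp k)) ks)) (sg K c) I e
    = (if \<forall>v. v \<notin> set ks \<longrightarrow> I v = K v \<and> e v = 0 then prod_list (map (\<lambda>k. lplus (I k) (K k) (e k)) ks) * c else 0)"
proof (induction ks arbitrary: I e)
  case Nil
  show ?case by (auto simp: sg_def sing_def fun_eq_iff)
next
  case (Cons k ks)
  let ?\<Psi> = "app (prod_list (map (\<lambda>k. Lop k (unit_exp k)) ks)) (sg K c)"
  have k: "k \<notin> set ks" "distinct ks" using Cons.prems by auto
  note IH = Cons.IH[OF k(2)]
  have "app (prod_list (map (\<lambda>k. Lop k (unit_exp k)) (k # ks))) (sg K c) I e = app (Lop k (unit_exp k)) ?\<Psi> I e"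
    by simp
  also have "\<dots> = lplus (I k) (K k) (e k) * ?\<Psi> (I(k := K k)) (e(k := 0))"
    by (rule Lop_value) (use k in \<open>auto simp: IH\<close>)
  also have "prod_list (map (\<lambda>l. lplus ((I(k := K k)) l) (K l) ((e(k := 0)) l)) ks) = prod_list (map (\<lambda>l. lplus (I l) (K l) (e l)) ks)"
    using k by (intro arg_cong[where f = prod_list] map_cong) auto
  then have "?\<Psi> (I(k := K k)) (e(k := 0)) = (if \<forall>v. v \<notin> set (k # ks) \<longrightarrow> I v = K v \<and> e v = 0
      then prod_list (map (\<lambda>k. lplus (I k) (K k) (e k)) ks) * c else 0)"
    unfolding IH by auto
  finally show ?case by (auto simp: mult.assoc)
qed

section \<open>Uniqueness\<close>

definition lword :: "'n gen list \<Rightarrow> 'n falg" where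
  "lword w = prod_list (map (\<lambda>(i, j, r). lplus i j r) w)"

text \<open>\<open>csub_eq_UNIV\<close> multiplies by new letters on the left, while membership is
  known for whole words. All left factors \<open>lword w\<close> are therefore carried along, and a
  new letter joins w at its right end.\<close>

lemma lword_mem_UNIV:
  fixes D :: "'n::finite opmat"
  assumes lin: "\<And>i j r. linop (D i j r)" and U: "csub U" and w: "\<And>i j r w. app (D i j r) (lword w) \<in> U"
  shows "app (D i j r) b \<in> U"
proof -
  let ?K = "{b. \<forall>x\<in>UNIV. b \<in> (case x of (w, i, j, r) \<Rightarrow> {b. app (D i j r * lmul (lword w)) b \<in> U})}"
  have "csub ?K"
    by (rule csub_Inter) (auto simp del: app_simps intro!: csub_vimage linop_ring(3) lin U linop_lmul split: prod.split)
  then have "b \<in> ?K"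
  proof (rule csub_eq_UNIV)
    show "1 \<in> ?K" using w by auto
    show "lplus i' j' r' * b \<in> ?K" if b: "b \<in> ?K" for i' j' r' b
    proof -
      have "app (D i j r) (lword w * (lplus i' j' r' * b)) \<in> U" for w i j r
      proof -
        have "app (D i j r) (lword (w @ [(i', j', r')]) * b) \<in> U" using b by auto
        then show ?thesis by (simp add: lword_def mult.assoc)
      qed
      then show ?thesis by auto
    qed
  qed
  then have "app (D i j r) (lword [] * b) \<in> U" by auto
  then show ?thesis by (simp add: lword_def)
qed

text \<open>The defining identity is known only at the unit and for multi-indices over S, so
  stripping is repeated for these smaller sets. A matrix unit moves a basis column or kills it;
  hence the added 0.\<close>

definition sgs :: "nat set \<Rightarrow> 'n mvec set" where
  "sgs S = insert 0 {sg J 1 | J. J \<in> idx S}"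

definition pwS :: "nat set \<Rightarrow> 'n falg set \<Rightarrow> 'n mvec set" where
  "pwS S U = {\<Phi>. \<forall>I\<in>idx S. \<forall>e. \<Phi> I e \<in> U}"

lemma sgs_E: "k \<in> S \<Longrightarrow> \<Phi> \<in> sgs S \<Longrightarrow> app (E k a b) \<Phi> \<in> sgs S"
proof -
  assume k: "k \<in> S" and "\<Phi> \<in> sgs S"
  then consider "\<Phi> = 0" | J where "\<Phi> = sg J 1" "J \<in> idx S" unfolding sgs_def by blast
  then show ?thesis
  proof cases
    case 2
    have "app (E k a b) (sg J 1) = (if J k = b then sg (J(k := a)) 1 else 0)"
      by (auto simp: app_E sg_def fun_eq_iff split: if_splits)
    then show ?thesis using 2 idx_update[OF 2(2) k, of a] unfolding sgs_def by auto
  qed (simp add: sgs_def)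
qed

lemma pwS_E: "k \<in> S \<Longrightarrow> submod U \<Longrightarrow> \<Phi> \<in> pwS S U \<Longrightarrow> app (E k a b) \<Phi> \<in> pwS S U"
  by (auto simp: pwS_def app_E idx_update submodD(1))

lemma pwS_spt: "submod U \<Longrightarrow> \<Phi> \<in> pwS S U \<Longrightarrow> app (lift (spt s)) \<Phi> \<in> pwS S U"
  by (auto simp: pwS_def app_lift app_spt submodD(3))

lemma pwS_sum: "submod U \<Longrightarrow> (\<And>i. i \<in> A \<Longrightarrow> f i \<in> pwS S U) \<Longrightarrow> sum f A \<in> pwS S U"
  by (auto simp: pwS_def sum_fun_apply intro: submod_sum)

context hecke_data
begin

abbreviation maps_sg :: "nat set \<Rightarrow> 'n falg set \<Rightarrow> 'n mvec addop \<Rightarrow> bool" where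
  "maps_sg S U X \<equiv> (\<forall>\<Phi>\<in>sgs S. app X \<Phi> \<in> pwS S U)"

lemma strip_sg:
  assumes "i \<noteq> j" "\<And>a b. comm (E j a b) D" "\<And>a b. comm (E i a b) G"
    "\<And>s. comm (lift (spt s)) D" "\<And>s. comm (lift (spt s)) G" "submod U" "i \<in> S" "j \<in> S"
    and mem: "maps_sg S U (D * (A i j * G))"
  shows "maps_sg S U (D * G)"
proof
  fix \<Phi> :: "'n mvec" assume \<Phi>: "\<Phi> \<in> sgs S"
  show "app (D * G) \<Phi> \<in> pwS S U"
    unfolding stripA[OF assms(1-5)] app_sum_left app_simps(4)[of "lift _"] app_simps(4)[of "E j _ _"] app_simps(4)[of _ "E i _ _"]
    by (intro pwS_sum assms(6) pwS_spt pwS_E assms(8) bspec[OF mem] sgs_E assms(7) \<Phi>)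
qed

text \<open>Only the last factor is adjacent to G, so the list is emptied from its right end, with
  the earlier factors counted as part of D.\<close>

lemma strip_list:
  assumes "\<And>k a b. k \<in> set ks \<Longrightarrow> comm (E k a b) D" "\<And>a b. comm (E i a b) G"
    "\<And>s. comm (lift (spt s)) D" "\<And>s. comm (lift (spt s)) G" "submod U" "i \<in> S" "set ks \<subseteq> S"
    "distinct ks" "i \<notin> set ks"
    and "maps_sg S U (D * (prod_list (map (A i) ks) * G))"
  shows "maps_sg S U (D * G)"
  using assms(1,7-10)
proof (induction ks rule: rev_induct)
  case (snoc k ks)
  have "maps_sg S U ((D * prod_list (map (A i) ks)) * G)"
  proof (rule strip_sg[of i k])
    show "i \<noteq> k" using snoc.prems by auto
    show "comm (E k a b) (D * prod_list (map (A i) ks))" for a b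
      using snoc.prems by (intro comm_ring comm_prod_list) (auto intro!: comm_E_cm)
    show "comm (lift (spt s)) (D * prod_list (map (A i) ks))" for s
      by (intro comm_ring comm_prod_list assms(3)) (auto intro!: comm_spt_cm)
    show "maps_sg S U (D * prod_list (map (A i) ks) * (A i k * G))"
      using snoc.prems(5) by (simp only: map_append prod_list.append list.map prod_list.Cons prod_list.Nil mult_1_right mult.assoc)
  qed (use snoc.prems assms in auto)
  then have "maps_sg S U (D * (prod_list (map (A i) ks) * G))" by (simp only: mult.assoc)
  then show ?case using snoc.prems by (intro snoc.IH) auto
qed simp

text \<open>Once the matrices RP behind L_k are gone, L_k joins D: it does not act on later legs, so
  the stripping can continue.\<close>

lemma strip_brk:
  assumes "\<And>k a b. k \<in> set ks \<Longrightarrow> comm (E k a b) D" "\<And>s. comm (lift (spt s)) D"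
    "submod U" "set ks \<subseteq> S" "distinct ks"
    and "maps_sg S U (D * brk (\<lambda>k. Lop k (unit_exp k)) A ks)"
  shows "maps_sg S U (D * prod_list (map (\<lambda>k. Lop k (unit_exp k)) ks))"
  using assms
proof (induction ks arbitrary: D)
  case (Cons k ks)
  let ?L = "\<lambda>k. Lop k (unit_exp k)"
  have E: "comm (E l a b) (brk ?L A ms)" if "l \<notin> set ms" for l a b ms
    using that by (induction ms) (auto intro!: comm_ring comm_prod_list comm_E_Lop comm_E_cm)
  have s: "comm (lift (spt s)) (brk ?L A ms)" for s ms
    by (induction ms) (auto intro!: comm_ring comm_prod_list comm_spt_Lop comm_spt_cm)
  have "maps_sg S U ((D * ?L k) * brk ?L A ks)"
  proof (rule strip_list[of ks _ k])
    show "comm (E l a b) (D * ?L k)" if "l \<in> set ks" for l a b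
      using Cons.prems that by (intro comm_ring comm_E_Lop) auto
    show "comm (lift (spt t)) (D * ?L k)" for t
      using Cons.prems by (intro comm_ring comm_spt_Lop) auto
    show "maps_sg S U (D * ?L k * (prod_list (map (A k) ks) * brk ?L A ks))"
      using Cons.prems(6) by (simp only: brk.simps mult.assoc)
  qed (use Cons.prems E s in auto)
  then have "maps_sg S U ((D * ?L k) * prod_list (map ?L ks))"
    using Cons.prems by (intro Cons.IH) (auto intro!: comm_ring comm_E_Lop comm_spt_Lop)
  then show ?case by (simp only: list.map prod_list.Cons mult.assoc)
qed simp

text \<open>After all RP have been removed, first between leg 0 and the bracket and then inside it,
  the coefficients are values of D at products of entries of L^+; every word occurs for n equal to
  its length.\<close>

lemma uniqueness_core:
  fixes D :: "'n opmat"
  assumes lin: "\<And>i j r. linop (D i j r)" and U: "csub U"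
    and one: "\<And>i j r. app (D i j r) 1 \<in> U"
    and mem: "\<And>n I J e. n \<ge> 1 \<Longrightarrow> I \<in> idx {0..n} \<Longrightarrow> J \<in> idx {0..n} \<Longrightarrow>
      app (Top D 0 (unit_exp 0) * (prod_list (map (A 0) [1..<Suc n]) * brk (\<lambda>k. Lop k (unit_exp k)) A [1..<Suc n])) (sg J 1) I e \<in> U"
  shows "app (D i j r) b \<in> U"
proof (rule lword_mem_UNIV[OF lin U])
  fix i j r and w :: "'n gen list"
  show "app (D i j r) (lword w) \<in> U"
  proof (cases "w = []")
    case True
    then show ?thesis using one by (simp add: lword_def)
  next
    case False
    define n where "n = length w"
    have n: "n \<ge> 1" using False by (cases w) (auto simp: n_def)
    let ?ks = "[1..<Suc n]" and ?S = "{0..n}" and ?L = "\<lambda>k. Lop k (unit_exp k)"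
    have sU: "submod U" by (rule csub_submod[OF U])
    have E: "comm (E 0 a b) (brk ?L A ms)" if "0 \<notin> set ms" for a b ms
      using that by (induction ms) (auto intro!: comm_ring comm_prod_list comm_E_Lop comm_E_cm)
    have s: "comm (lift (spt s)) (brk ?L A ms)" for s ms
      by (induction ms) (auto intro!: comm_ring comm_prod_list comm_spt_Lop comm_spt_cm)
    have "maps_sg ?S U (Top D 0 (unit_exp 0) * (prod_list (map (A 0) ?ks) * brk ?L A ?ks))"
    proof
      fix \<Phi> :: "'n mvec" assume "\<Phi> \<in> sgs ?S"
      then consider "\<Phi> = 0" | J where "\<Phi> = sg J 1" "J \<in> idx ?S" unfolding sgs_def by blast
      then show "app (Top D 0 (unit_exp 0) * (prod_list (map (A 0) ?ks) * brk ?L A ?ks)) \<Phi> \<in> pwS ?S U"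
      proof cases
        case 1
        then show ?thesis using submodD(1)[OF sU] by (simp only: app_0) (simp add: pwS_def)
      next
        case 2
        show ?thesis unfolding pwS_def 2(1) using mem[OF n _ 2(2)] by blast
      qed
    qed
    then have "maps_sg ?S U (Top D 0 (unit_exp 0) * brk ?L A ?ks)"
      by (rule strip_list[rotated -1]) (auto intro!: comm_E_Top comm_spt_Top lin E s sU simp del: upt_Suc)
    then have M: "maps_sg ?S U (Top D 0 (unit_exp 0) * prod_list (map ?L ?ks))"
      by (rule strip_brk[rotated -1]) (auto intro!: comm_E_Top comm_spt_Top lin sU)
    \<comment> \<open>The letter of w with number v, counted from 1, is placed on leg v: row, column
      and exponent select its \<open>lplus\<close>. Leg 0 carries the column index j of D.\<close>
    define I where "I v = (if v = 0 then j else if v \<le> n then fst (w ! (v - 1)) else undefined)" for v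
    define J where "J v = (if v = 0 then j else if v \<le> n then fst (snd (w ! (v - 1))) else undefined)" for v
    define e where "e v = (if v = 0 \<or> v > n then 0 else snd (snd (w ! (v - 1))))" for v
    have IJ: "I(0 := i) \<in> idx ?S" "J \<in> idx ?S" by (auto simp: idx_def PiE_def extensional_def I_def J_def)
    let ?\<Psi> = "app (prod_list (map ?L ?ks)) (sg J 1)"
    have V: "?\<Psi> I' e' = (if \<forall>v. v \<notin> set ?ks \<longrightarrow> I' v = J v \<and> e' v = 0 then prod_list (map (\<lambda>k. lplus (I' k) (J k) (e' k)) ?ks) * 1 else 0)" for I' e'
      by (rule Lops_value) simp
    have "app (Top D 0 (unit_exp 0)) ?\<Psi> (I(0 := i)) (e(0 := r)) = app (D i j r) (?\<Psi> I e)"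
    proof (rule Top_value)
      show "?\<Psi> I' e' = 0" if "I' 0 \<noteq> j \<or> e' 0 \<noteq> 0" for I' e'
      proof -
        have "\<not> (\<forall>v. v \<notin> set ?ks \<longrightarrow> I' v = J v \<and> e' v = 0)" using that by (auto simp: J_def intro!: exI[of _ 0])
        then show ?thesis unfolding V by (simp only: if_False)
      qed
    qed (simp_all add: I_def e_def)
    moreover have "?\<Psi> I e = lword w"
    proof -
      have "\<forall>v. v \<notin> set ?ks \<longrightarrow> I v = J v \<and> e v = 0" by (auto simp: I_def J_def e_def)
      moreover have "map (\<lambda>k. lplus (I k) (J k) (e k)) ?ks = map (\<lambda>(i, j, r). lplus i j r) w"
        by (rule nth_equalityI) (auto simp: n_def I_def J_def e_def split_def nth_append simp del: upt_Suc)
      ultimately show ?thesis unfolding V lword_def by simp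
    qed
    moreover have "app (Top D 0 (unit_exp 0) * prod_list (map ?L ?ks)) (sg J 1) \<in> pwS ?S U"
      using M IJ(2) by (auto simp: sgs_def simp del: app_simps)
    then have "app (Top D 0 (unit_exp 0)) ?\<Psi> (I(0 := i)) (e(0 := r)) \<in> U"
      unfolding app_simps(4)[of "Top D 0 (unit_exp 0)"] pwS_def using IJ(1) by blast
    ultimately show ?thesis by simp
  qed
qed

end

section \<open>Exponents with some variables inverted\<close>

text \<open>The variable x_k occurs through its inverse and the others through themselves, as suits
  L^-(x_k), L^+(y) and R-bar(y/x_k).\<close>

definition neg_exp :: "nat \<Rightarrow> (nat \<Rightarrow> nat) \<Rightarrow> nat \<Rightarrow> int" where
  "neg_exp k e v = (if v = k then - int (e v) else int (e v))"

lemma neg_exp_add: "neg_exp k (e + e') v = neg_exp k e v + neg_exp k e' v"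
  by (simp add: neg_exp_def plus_fun_apply)

lemma inj_neg_exp: "inj (neg_exp k)"
proof (rule injI, rule HOL.ext)
  fix e e' v assume eq: "neg_exp k e = neg_exp k e'"
  show "e v = e' v" using fun_cong[OF eq, of v] by (simp add: neg_exp_def split: if_splits)
qed

lemma neg_exp_unit:
  "neg_exp k (unit_exp k) = (\<lambda>_. 0)(k := - 1)" "l \<noteq> k \<Longrightarrow> neg_exp k (unit_exp l) = (\<lambda>_. 0)(l := 1)"
  "l \<noteq> k \<Longrightarrow> neg_exp k (unit_exp k + unit_exp l) = (\<lambda>_. 0)(l := 1, k := - 1)"
  by (auto simp: fun_eq_iff neg_exp_def plus_fun_apply unit_exp_def)

text \<open>Exponents with respect to \<open>1 / x\<^sub>1\<close> and \<open>x\<^sub>1 / x\<^sub>2\<close>.\<close>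

definition rtt_exp :: "(nat \<Rightarrow> nat) \<Rightarrow> nat \<Rightarrow> int" where
  "rtt_exp e v = (if v = 1 then int (e 2) - int (e 1) else if v = 2 then - int (e 2) else int (e v))"

lemma rtt_exp_add: "rtt_exp (e + e') v = rtt_exp e v + rtt_exp e' v"
  by (simp add: rtt_exp_def plus_fun_apply)

lemma inj_rtt_exp: "inj rtt_exp"
proof (rule injI, rule HOL.ext)
  fix e e' v assume eq: "rtt_exp e = rtt_exp e'"
  show "e v = e' v" using fun_cong[OF eq, of v] fun_cong[OF eq, of 2] by (simp add: rtt_exp_def split: if_splits)
qed

lemma rtt_exp_unit:
  "rtt_exp (unit_exp 1) = (\<lambda>_. 0)(1 := - 1)" "rtt_exp (unit_exp 2) = (\<lambda>_. 0)(1 := 1, 2 := - 1)"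
  "rtt_exp (unit_exp 1 + unit_exp 2) = (\<lambda>_. 0)(2 := - 1)"
  by (auto simp: fun_eq_iff rtt_exp_def plus_fun_apply unit_exp_def)

section \<open>The operator on the quotient\<close>

lemma oprep_LpY:
  assumes r: "rep (YEnd M R) (\<lambda>f c. f (Y_class M R c)) (Y_class M R) S \<iota>" and "k \<in> S" "\<iota> \<epsilon> = (\<lambda>_. 0)(k := 1)"
  shows "rep.oprep (YEnd M R) (\<lambda>f c. f (Y_class M R c)) (Y_class M R) S \<iota> (LpY M R S k) (Lop k \<epsilon>)"
  unfolding LpY_def by (rule rep.oprep_Lp[OF r assms(2,3) lifts_lmul[OF r]])

lemma oprep_LmY:
  assumes r: "rep (YEnd M R) (\<lambda>f c. f (Y_class M R c)) (Y_class M R) S \<iota>" and "k \<in> S" "\<iota> \<epsilon> = (\<lambda>_. 0)(k := - 1)"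
    and "lifted M R L T"
  shows "rep.oprep (YEnd M R) (\<lambda>f c. f (Y_class M R c)) (Y_class M R) S \<iota> (LmY M R L S k) (Top T k \<epsilon>)"
  unfolding LmY_def by (rule rep.oprep_Lm[OF r assms(2,3) lifts_Lop[OF r assms(4)]])

lemma list_all2_concat_map:
  "(\<And>x. x \<in> set xs \<Longrightarrow> list_all2 P (f x) (g x)) \<Longrightarrow> list_all2 P (concat (map f xs)) (concat (map g xs))"
  by (induction xs) (auto intro: list_all2_appendI)

lemma list_all2_map_same:
  "(\<And>x. x \<in> set xs \<Longrightarrow> P (f x) (g x)) \<Longrightarrow> list_all2 P (map f xs) (map g xs)"
  by (induction xs) auto

lemma prod_list_brk:
  "prod_list (concat (map (\<lambda>i. L i # map (A i) [Suc i..<n]) [m..<n])) = brk L A [m..<n]"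
proof (induction "n - m" arbitrary: m)
  case (Suc d)
  then have "[m..<n] = m # [Suc m..<n]" by (intro upt_conv_Cons) simp
  then show ?case using Suc.hyps(1)[of "Suc m"] Suc.hyps(2) by (simp add: mult.assoc)
qed simp

lemma sg_spn: "sg K c \<in> pw (spn c)"
proof -
  have "c \<in> spn c" unfolding spn_def by (intro CollectI exI[of _ 1]) simp
  then show ?thesis by (simp add: pw_def sg_def sing_def submodD(1)[OF submod_spn])
qed

lemma stab_prod_list: "(\<And>x. x \<in> set xs \<Longrightarrow> stab U x) \<Longrightarrow> stab U (prod_list xs)"
  by (induction xs) (auto simp: stab_def)

context tdata
begin

abbreviation "ev1 \<equiv> (\<lambda>f c. f (Y_class M R c))"

abbreviation "ks n \<equiv> [1..<Suc n]"

abbreviation "bracket n \<equiv> brk (\<lambda>k. Lop k (unit_exp k)) A (ks n)"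

lemma rep_neg: "rep (YEnd M R) ev1 (Y_class M R) {0..n} (neg_exp k)"
  by (rule rep_YEnd) (auto simp: neg_exp_add inj_neg_exp)

lemma oprep_A:
  assumes "rep (YEnd M R) ev1 (Y_class M R) S \<iota>" "i \<in> S" "j \<in> S" "i \<noteq> j"
  shows "rep.oprep (YEnd M R) ev1 (Y_class M R) S \<iota> (cleg (YEnd M R) S i j (R ** Pmat)) (A i j)"
  by (rule rep.oprep_cleg[OF assms])

lemma oprep_sm:
  assumes "rep (YEnd M R) ev1 (Y_class M R) S \<iota>" "i \<in> S" "j \<in> S" "i \<noteq> j" "u \<noteq> v" "\<iota> \<delta> = (\<lambda>_. 0)(u := 1, v := - 1)"
  shows "rep.oprep (YEnd M R) ev1 (Y_class M R) S \<iota> (sleg (YEnd M R) S i j X b u v) (sm i j \<delta> b X)"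
  unfolding sm_def by (rule rep.oprep_sleg[OF assms])

lemma oprep_bracket:
  "list_all2 (rep.oprep (YEnd M R) ev1 (Y_class M R) {0..n} (neg_exp 0)) (Lp_bracket M R {0..n} n)
    (concat (map (\<lambda>i. Lop i (unit_exp i) # map (A i) [Suc i..<Suc n]) (ks n)))"
  unfolding Lp_bracket_def
proof (rule list_all2_concat_map, rule list_all2_Cons[THEN iffD2], rule conjI)
  fix i assume "i \<in> set (ks n)"
  then have i: "1 \<le> i" "i \<le> n" by auto
  show "rep.oprep (YEnd M R) ev1 (Y_class M R) {0..n} (neg_exp 0) (LpY M R {0..n} i) (Lop i (unit_exp i))"
    using i by (intro oprep_LpY[OF rep_neg] neg_exp_unit) auto
  show "list_all2 (rep.oprep (YEnd M R) ev1 (Y_class M R) {0..n} (neg_exp 0))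
      (map (\<lambda>j. cleg (YEnd M R) {0..n} i j (R ** Pmat)) [Suc i..<Suc n]) (map (A i) [Suc i..<Suc n])"
    using i by (intro list_all2_map_same oprep_A[OF rep_neg]) auto
qed

lemma identity_lhs:
  assumes L: "lifted M R L T0" and I: "I \<in> idx {0..n}" and K: "K \<in> idx {0..n}"
  defines "t \<equiv> tprod (YEnd M R) {0..n} ([LmY M R L {0..n} 0] @ map (\<lambda>i. cleg (YEnd M R) {0..n} 0 i (R ** Pmat)) (ks n)
    @ Lp_bracket M R {0..n} n)"
  shows "t I K (neg_exp 0 e) (Y_class M R c)
      = Y_class M R (app (Top T0 0 (unit_exp 0) * (prod_list (map (A 0) (ks n)) * bracket n)) (sg K c) I e)"
    and "\<gamma> \<notin> range (neg_exp 0) \<Longrightarrow> t I K \<gamma> = \<zero>\<^bsub>YEnd M R\<^esub>"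
proof -
  let ?o = "rep.oprep (YEnd M R) ev1 (Y_class M R) {0..n} (neg_exp 0)"
  have "list_all2 ?o (map (\<lambda>i. cleg (YEnd M R) {0..n} 0 i (R ** Pmat)) (ks n)) (map (A 0) (ks n))"
    by (intro list_all2_map_same oprep_A[OF rep_neg]) auto
  moreover have "?o (LmY M R L {0..n} 0) (Top T0 0 (unit_exp 0))"
    by (intro oprep_LmY[OF rep_neg] neg_exp_unit L) simp
  ultimately have l: "list_all2 ?o ([LmY M R L {0..n} 0] @ map (\<lambda>i. cleg (YEnd M R) {0..n} 0 i (R ** Pmat)) (ks n) @ Lp_bracket M R {0..n} n)
      ([Top T0 0 (unit_exp 0)] @ map (A 0) (ks n) @ concat (map (\<lambda>i. Lop i (unit_exp i) # map (A i) [Suc i..<Suc n]) (ks n)))"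
    by (intro list_all2_appendI oprep_bracket) simp_all
  show "t I K (neg_exp 0 e) (Y_class M R c)
      = Y_class M R (app (Top T0 0 (unit_exp 0) * (prod_list (map (A 0) (ks n)) * bracket n)) (sg K c) I e)"
    unfolding t_def rep.ev_tprod(1)[OF rep_neg l I K]
    by (simp only: prod_list.append prod_list.Cons prod_list.Nil mult_1_right prod_list_brk)
  show "t I K \<gamma> = \<zero>\<^bsub>YEnd M R\<^esub>" if "\<gamma> \<notin> range (neg_exp 0)"
    unfolding t_def by (rule rep.ev_tprod(3)[OF rep_neg l I K that])
qed

lemma identity_rhs:
  assumes I: "I \<in> idx {0..n}" and K: "K \<in> idx {0..n}"
  defines "t \<equiv> tprod (YEnd M R) {0..n} (map (\<lambda>i. sleg (YEnd M R) {0..n} i 0 (Rbar M R) b1 i 0) (ks n) @ Lp_bracket M R {0..n} n @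
    map (\<lambda>i. cleg (YEnd M R) {0..n} i 0 (R ** Pmat)) (ks n) @
    map (\<lambda>i. sleg (YEnd M R) {0..n} 0 i (matrix_inv (Rbar M R)) b2 i 0) (rev (ks n)))"
  shows "t I K (neg_exp 0 e) (Y_class M R c)
      = Y_class M R (app (prod_list (map (\<lambda>k. Rb k 0 (unit_exp 0 + unit_exp k) b1) (ks n)) * (bracket n *
          (prod_list (map (\<lambda>k. A k 0) (ks n)) * prod_list (map (\<lambda>k. Ri 0 k (unit_exp 0 + unit_exp k) b2) (rev (ks n)))))) (sg K c) I e)"
    and "\<gamma> \<notin> range (neg_exp 0) \<Longrightarrow> t I K \<gamma> = \<zero>\<^bsub>YEnd M R\<^esub>"
proof -
  let ?o = "rep.oprep (YEnd M R) ev1 (Y_class M R) {0..n} (neg_exp 0)"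
  have "list_all2 ?o (map (\<lambda>i. sleg (YEnd M R) {0..n} i 0 (Rbar M R) b1 i 0) (ks n)) (map (\<lambda>k. Rb k 0 (unit_exp 0 + unit_exp k) b1) (ks n))"
    by (intro list_all2_map_same oprep_sm[OF rep_neg] neg_exp_unit) auto
  moreover have "list_all2 ?o (map (\<lambda>i. cleg (YEnd M R) {0..n} i 0 (R ** Pmat)) (ks n)) (map (\<lambda>k. A k 0) (ks n))"
    by (intro list_all2_map_same oprep_A[OF rep_neg]) auto
  moreover have "list_all2 ?o (map (\<lambda>i. sleg (YEnd M R) {0..n} 0 i (matrix_inv (Rbar M R)) b2 i 0) (rev (ks n)))
      (map (\<lambda>k. Ri 0 k (unit_exp 0 + unit_exp k) b2) (rev (ks n)))"
    by (intro list_all2_map_same oprep_sm[OF rep_neg] neg_exp_unit) auto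
  ultimately have l: "list_all2 ?o (map (\<lambda>i. sleg (YEnd M R) {0..n} i 0 (Rbar M R) b1 i 0) (ks n) @ Lp_bracket M R {0..n} n @
    map (\<lambda>i. cleg (YEnd M R) {0..n} i 0 (R ** Pmat)) (ks n) @
    map (\<lambda>i. sleg (YEnd M R) {0..n} 0 i (matrix_inv (Rbar M R)) b2 i 0) (rev (ks n)))
    (map (\<lambda>k. Rb k 0 (unit_exp 0 + unit_exp k) b1) (ks n) @ concat (map (\<lambda>i. Lop i (unit_exp i) # map (A i) [Suc i..<Suc n]) (ks n))
      @ map (\<lambda>k. A k 0) (ks n) @ map (\<lambda>k. Ri 0 k (unit_exp 0 + unit_exp k) b2) (rev (ks n)))"
    by (intro list_all2_appendI oprep_bracket)
  show "t I K (neg_exp 0 e) (Y_class M R c)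
      = Y_class M R (app (prod_list (map (\<lambda>k. Rb k 0 (unit_exp 0 + unit_exp k) b1) (ks n)) * (bracket n *
          (prod_list (map (\<lambda>k. A k 0) (ks n)) * prod_list (map (\<lambda>k. Ri 0 k (unit_exp 0 + unit_exp k) b2) (rev (ks n)))))) (sg K c) I e)"
    unfolding t_def rep.ev_tprod(1)[OF rep_neg l I K] by (simp only: prod_list.append prod_list_brk)
  show "t I K \<gamma> = \<zero>\<^bsub>YEnd M R\<^esub>" if "\<gamma> \<notin> range (neg_exp 0)"
    unfolding t_def by (rule rep.ev_tprod(3)[OF rep_neg l I K that])
qed

text \<open>After \<open>brk_exchange\<close> the operator T meets only the inverse R-matrices.
  Applied to a column with entry 1 these give scalar coefficients, on which T is the
  identity.\<close>

lemma T_bracket: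
  "app (Top T 0 (unit_exp 0) * (prod_list (map (A 0) (ks n)) * bracket n)) (sg K 1)
    = app (prod_list (map (\<lambda>k. Rb k 0 (unit_exp 0 + unit_exp k) b1) (ks n)) * (bracket n *
        (prod_list (map (\<lambda>k. A k 0) (ks n)) * prod_list (map (\<lambda>k. Ri 0 k (unit_exp 0 + unit_exp k) b2) (rev (ks n)))))) (sg K 1)"
proof -
  interpret exchange "Top T 0 (unit_exp 0)" A "\<lambda>k. Rb k 0 (unit_exp 0 + unit_exp k) b1"
    "\<lambda>k. Ri 0 k (unit_exp 0 + unit_exp k) b2" "\<lambda>k. Lop k (unit_exp k)" 0 "set (ks n)"
    by (rule exchange_Top) auto
  have "stab (spn 1) (prod_list (map (\<lambda>k. Ri 0 k (unit_exp 0 + unit_exp k) b2) (rev (ks n))))"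
    by (rule stab_prod_list) (auto intro!: stab_sm submod_spn)
  then have "app (prod_list (map (\<lambda>k. Ri 0 k (unit_exp 0 + unit_exp k) b2) (rev (ks n)))) (sg K 1) \<in> pw (spn 1)"
    by (rule stabD) (rule sg_spn)
  then have "app (Top T 0 (unit_exp 0)) (app (prod_list (map (\<lambda>k. Ri 0 k (unit_exp 0 + unit_exp k) b2) (rev (ks n)))) (sg K 1))
      = app (prod_list (map (\<lambda>k. Ri 0 k (unit_exp 0 + unit_exp k) b2) (rev (ks n)))) (sg K 1)"
    by (intro Top_one linop_tlin tlin_one) simp_all
  then show ?thesis
    unfolding brk_exchange[OF order_refl distinct_upt] by (simp only: app_simps(4))
qed

text \<open>The right-hand side of the defining identity does not contain L, so the lifts of two
  solutions agree on all brackets modulo the ideal.\<close>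

lemma uniqueness:
  assumes L: "is_Lminus M R \<kappa> L" "is_Lminus M R \<kappa> L'" and b: "b1 = fps_exp \<kappa>" "b2 = fps_exp (- \<kappa>)"
  shows "L = L'"
proof -
  have Lops: "L \<in> Lops M R" "L' \<in> Lops M R" using L by (auto simp: is_Lminus_def)
  obtain T1 T2 where T1: "lifted M R L T1" and T2: "lifted M R L' T2" using lifted_ex Lops by blast
  have lin: "linop (T1 i j r - T2 i j r)" for i j r
    using T1 T2 unfolding lifted_def by (intro linop_ring) auto
  have "app (T1 i j r - T2 i j r) b \<in> Y_ideal M R" for i j r b
  proof (rule uniqueness_core[where D = "\<lambda>i j r. T1 i j r - T2 i j r", OF lin J_props(2)])
    fix i j r
    have "L i j (Y_class M R 1) r = L' i j (Y_class M R 1) r"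
      using L unfolding is_Lminus_def V_simps(5) by simp
    then show "app (T1 i j r - T2 i j r) 1 \<in> Y_ideal M R"
      using T1 T2 unfolding lifted_def by (simp add: cls_eq_iff)
  next
    fix n :: nat and I K :: "nat \<Rightarrow> 'n" and e
    assume n: "n \<ge> 1" and I: "I \<in> idx {0..n}" and K: "K \<in> idx {0..n}"
    have "Lminus_identity M R \<kappa> L n" "Lminus_identity M R \<kappa> L' n" using L n by (auto simp: is_Lminus_def)
    note id = this[unfolded Lminus_identity_def Let_def, rule_format, OF I K, of "neg_exp 0 e", unfolded V_simps(5)]
    have "Y_class M R (app (Top T1 0 (unit_exp 0) * (prod_list (map (A 0) (ks n)) * bracket n)) (sg K 1) I e)
      = Y_class M R (app (Top T2 0 (unit_exp 0) * (prod_list (map (A 0) (ks n)) * bracket n)) (sg K 1) I e)"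
      unfolding identity_lhs(1)[OF T1 I K, symmetric] identity_lhs(1)[OF T2 I K, symmetric] id ..
    then have "app (Top T1 0 (unit_exp 0) * (prod_list (map (A 0) (ks n)) * bracket n)) (sg K 1) I e
        - app (Top T2 0 (unit_exp 0) * (prod_list (map (A 0) (ks n)) * bracket n)) (sg K 1) I e \<in> Y_ideal M R"
      by (simp only: cls_eq_iff)
    then show "app (Top (\<lambda>i j r. T1 i j r - T2 i j r) 0 (unit_exp 0) * (prod_list (map (A 0) (ks n)) * bracket n)) (sg K 1) I e \<in> Y_ideal M R"
      unfolding Top_diff left_diff_distrib by (simp only: app_simps(2) fun_diff_def)
  qed
  then show ?thesis by (intro lifted_eqI[OF Lops T1 T2]) simp
qed

lemma existence:
  assumes b: "b1 = fps_exp \<kappa>" "b2 = fps_exp (- \<kappa>)"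
  obtains L where "is_Lminus M R \<kappa> L" "lifted M R L T"
proof -
  obtain L where L: "L \<in> Lops M R" "lifted M R L T"
    using Lop_of_opmat[of T M R] linop_tlin T_decays T_ideal by blast
  have "Lminus_identity M R \<kappa> L n" for n
    unfolding Lminus_identity_def Let_def V_simps(5)
  proof (intro ballI allI)
    fix I K :: "nat \<Rightarrow> 'n" and \<gamma> assume I: "I \<in> idx {0..n}" and K: "K \<in> idx {0..n}"
    let ?l = "tprod (YEnd M R) {0..n} ([LmY M R L {0..n} 0] @ map (\<lambda>i. cleg (YEnd M R) {0..n} 0 i (R ** Pmat)) (ks n)
      @ Lp_bracket M R {0..n} n)"
    let ?r = "tprod (YEnd M R) {0..n} (map (\<lambda>i. sleg (YEnd M R) {0..n} i 0 (Rbar M R) (fps_exp \<kappa>) i 0) (ks n) @ Lp_bracket M R {0..n} n @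
      map (\<lambda>i. cleg (YEnd M R) {0..n} i 0 (R ** Pmat)) (ks n) @
      map (\<lambda>i. sleg (YEnd M R) {0..n} 0 i (matrix_inv (Rbar M R)) (fps_exp (- \<kappa>)) i 0) (rev (ks n)))"
    show "?l I K \<gamma> (Y_class M R 1) = ?r I K \<gamma> (Y_class M R 1)"
    proof (cases "\<gamma> \<in> range (neg_exp 0)")
      case True
      then obtain e where e: "\<gamma> = neg_exp 0 e" by blast
      show ?thesis unfolding e b[symmetric] identity_lhs(1)[OF L(2) I K] identity_rhs(1)[OF I K] T_bracket ..
    next
      case False
      show ?thesis unfolding b[symmetric] identity_lhs(2)[OF L(2) I K False] identity_rhs(2)[OF I K False] ..
    qed
  qed
  moreover have "L i j \<one>\<^bsub>Yplus M R\<^esub> r = (if i = j \<and> r = 0 then \<one>\<^bsub>Yplus M R\<^esub> else \<zero>\<^bsub>Yplus M R\<^esub>)" for i j r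
    using L(2) unfolding V_simps(4,5) lifted_def by (simp add: tlin_one)
  ultimately have "is_Lminus M R \<kappa> L" using L(1) by (simp add: is_Lminus_def)
  then show ?thesis using that L(2) by blast
qed

lemma YEnd_teq:
  assumes "rep (YEnd M R) ev1 (Y_class M R) S \<iota>"
    and "list_all2 (rep.oprep (YEnd M R) ev1 (Y_class M R) S \<iota>) As as" "list_all2 (rep.oprep (YEnd M R) ev1 (Y_class M R) S \<iota>) Bs bs"
    and "\<And>K c. app (prod_list as) (sg K c) = app (prod_list bs) (sg K c)"
  shows "teq S (tprod (YEnd M R) S As) (tprod (YEnd M R) S Bs)"
  by (rule rep.teq_tprod[OF assms(1) _ assms(2,3,4)]) (rule YEnd_ext)

lemma invertible:
  assumes L: "lifted M R L T"
  shows "Lop_invertible M R L"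
proof -
  obtain T' where T': "\<And>i j r. linop (T' i j r)" "decays T'" "conv T T' = idm" "conv T' T = idm"
    and U: "\<And>U i j r x. csub U \<Longrightarrow> (\<And>x. fps_X * x \<in> U \<Longrightarrow> x \<in> U) \<Longrightarrow> (\<And>i j r x. x \<in> U \<Longrightarrow> app (T i j r) x \<in> U) \<Longrightarrow>
      x \<in> U \<Longrightarrow> app (T' i j r) x \<in> U"
    using inverse_exists[OF linop_tlin T_decays T_idm_mod_h] by metis
  \<comment> \<open>This uses that the ideal is closed and saturated, and it lets the inverse
    descend to the quotient.\<close>
  have "app (T' i j r) x \<in> Y_ideal M R" if "x \<in> Y_ideal M R" for i j r x
    by (rule U[OF J_props(2) J_props(5) T_ideal that])
  then obtain L' where L': "L' \<in> Lops M R" "lifted M R L' T'"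
    using Lop_of_opmat[of T' M R] T'(1,2) by blast
  have r: "rep (YEnd M R) ev1 (Y_class M R) {0} (neg_exp 0)" using rep_neg[of 0 0] by simp
  have o: "rep.oprep (YEnd M R) ev1 (Y_class M R) {0} (neg_exp 0) (LmY M R L {0} 0) (Top T 0 (unit_exp 0))"
    "rep.oprep (YEnd M R) ev1 (Y_class M R) {0} (neg_exp 0) (LmY M R L' {0} 0) (Top T' 0 (unit_exp 0))"
    by (intro oprep_LmY[OF r] neg_exp_unit L L'; simp)+
  have t: "tone (YEnd M R) = tprod (YEnd M R) {0} []" by (simp add: tprod_def)
  have 1: "Top T 0 (unit_exp 0) * Top T' 0 (unit_exp 0) = 1" "Top T' 0 (unit_exp 0) * Top T 0 (unit_exp 0) = 1"
    by (simp_all only: Top_conv[OF unit_exp_nz] T'(3,4) Top_idm[OF unit_exp_nz])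
  have "teq {0} (tprod (YEnd M R) {0} [LmY M R L {0} 0, LmY M R L' {0} 0]) (tone (YEnd M R))"
    unfolding t by (rule YEnd_teq[OF r, where as = "[Top T 0 (unit_exp 0), Top T' 0 (unit_exp 0)]" and bs = "[]"])
      (simp_all add: o 1 del: app_simps(4))
  moreover have "teq {0} (tprod (YEnd M R) {0} [LmY M R L' {0} 0, LmY M R L {0} 0]) (tone (YEnd M R))"
    unfolding t by (rule YEnd_teq[OF r, where as = "[Top T' 0 (unit_exp 0), Top T 0 (unit_exp 0)]" and bs = "[]"])
      (simp_all add: o 1 del: app_simps(4))
  ultimately show ?thesis unfolding Lop_invertible_def using L'(1) by blast
qed

lemma minus_minus_relation:
  assumes L: "lifted M R L T"
  shows "teq {1, 2}
    (tprod (YEnd M R) {1, 2} [sleg (YEnd M R) {1, 2} 1 2 (Rbar M R) 1 1 2, LmY M R L {1, 2} 1,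
      cleg (YEnd M R) {1, 2} 1 2 (R ** Pmat), LmY M R L {1, 2} 2])
    (tprod (YEnd M R) {1, 2} [LmY M R L {1, 2} 2, cleg (YEnd M R) {1, 2} 2 1 (R ** Pmat), LmY M R L {1, 2} 1,
      sleg (YEnd M R) {1, 2} 2 1 (Rbar M R) 1 1 2])"
proof -
  let ?\<delta> = "unit_exp 1" and ?u = "unit_exp 2"
  let ?o = "rep.oprep (YEnd M R) ev1 (Y_class M R) {1, 2} rtt_exp"
  have r: "rep (YEnd M R) ev1 (Y_class M R) {1, 2} rtt_exp"
    by (rule rep_YEnd) (auto simp: rtt_exp_add inj_rtt_exp)
  have o: "?o (LmY M R L {1, 2} 1) (Top T 1 ?\<delta>)" "?o (LmY M R L {1, 2} 2) (Top T 2 (?\<delta> + ?u))"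
    by (intro oprep_LmY[OF r] rtt_exp_unit L; simp)+
  have oR: "?o (sleg (YEnd M R) {1, 2} 1 2 (Rbar M R) 1 1 2) (Rb 1 2 ?u 1)" "?o (sleg (YEnd M R) {1, 2} 2 1 (Rbar M R) 1 1 2) (Rb 2 1 ?u 1)"
    by (intro oprep_sm[OF r] rtt_exp_unit; simp)+
  have oA: "?o (cleg (YEnd M R) {1, 2} 1 2 (R ** Pmat)) (A 1 2)" "?o (cleg (YEnd M R) {1, 2} 2 1 (R ** Pmat)) (A 2 1)"
    by (intro oprep_A[OF r]; simp)+
  show ?thesis
  proof (rule YEnd_teq[OF r, where as = "[Rb 1 2 ?u 1, Top T 1 ?\<delta>, A 1 2, Top T 2 (?\<delta> + ?u)]"
        and bs = "[Top T 2 (?\<delta> + ?u), A 2 1, Top T 1 ?\<delta>, Rb 2 1 ?u 1]"])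
    show "app (prod_list [Rb 1 2 ?u 1, Top T 1 ?\<delta>, A 1 2, Top T 2 (?\<delta> + ?u)]) (sg K c)
        = app (prod_list [Top T 2 (?\<delta> + ?u), A 2 1, Top T 1 ?\<delta>, Rb 2 1 ?u 1]) (sg K c)" for K c
      unfolding prod_list.Cons prod_list.Nil mult_1_right by (rule T_RTT[OF sg_spn])
  qed (simp_all add: o oR oA)
qed

text \<open>The exchange relation for T contains the inverse R-matrix at its right end; multiplying
  by R-bar on the right removes it.\<close>

lemma minus_plus_relation:
  assumes L: "lifted M R L T"
  shows "teq {1, 2}
    (tprod (YEnd M R) {1, 2} [LmY M R L {1, 2} 1, cleg (YEnd M R) {1, 2} 1 2 (R ** Pmat), LpY M R {1, 2} 2,
      sleg (YEnd M R) {1, 2} 1 2 (Rbar M R) b2 2 1])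
    (tprod (YEnd M R) {1, 2} [sleg (YEnd M R) {1, 2} 2 1 (Rbar M R) b1 2 1, LpY M R {1, 2} 2,
      cleg (YEnd M R) {1, 2} 2 1 (R ** Pmat), LmY M R L {1, 2} 1])"
proof -
  let ?\<delta> = "unit_exp 1" and ?u = "unit_exp 2"
  let ?o = "rep.oprep (YEnd M R) ev1 (Y_class M R) {1, 2} (neg_exp 1)"
  have r: "rep (YEnd M R) ev1 (Y_class M R) {1, 2} (neg_exp 1)"
    by (rule rep_YEnd) (auto simp: neg_exp_add inj_neg_exp)
  have o: "?o (LmY M R L {1, 2} 1) (Top T 1 ?\<delta>)" "?o (LpY M R {1, 2} 2) (Lop 2 ?u)"
    by (intro oprep_LmY[OF r] neg_exp_unit L; simp) (intro oprep_LpY[OF r] neg_exp_unit; simp)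
  have oR: "?o (sleg (YEnd M R) {1, 2} 1 2 (Rbar M R) b2 2 1) (Rb 1 2 (?\<delta> + ?u) b2)"
    "?o (sleg (YEnd M R) {1, 2} 2 1 (Rbar M R) b1 2 1) (Rb 2 1 (?\<delta> + ?u) b1)"
    by (intro oprep_sm[OF r] neg_exp_unit; simp)+
  have oA: "?o (cleg (YEnd M R) {1, 2} 1 2 (R ** Pmat)) (A 1 2)" "?o (cleg (YEnd M R) {1, 2} 2 1 (R ** Pmat)) (A 2 1)"
    by (intro oprep_A[OF r]; simp)+
  have "Top T 1 ?\<delta> * (A 1 2 * (Lop 2 ?u * Rb 1 2 (?\<delta> + ?u) b2)) = (Top T 1 ?\<delta> * (A 1 2 * Lop 2 ?u)) * Rb 1 2 (?\<delta> + ?u) b2"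
    by (simp only: mult.assoc)
  also have "\<dots> = Rb 2 1 (?\<delta> + ?u) b1 * (Lop 2 ?u * (A 2 1 * (Top T 1 ?\<delta> * (Ri 1 2 (?\<delta> + ?u) b2 * Rb 1 2 (?\<delta> + ?u) b2))))"
    by (subst T_relation) (simp_all add: mult.assoc)
  also have "\<dots> = Rb 2 1 (?\<delta> + ?u) b1 * (Lop 2 ?u * (A 2 1 * Top T 1 ?\<delta>))"
    by (subst Rb_Ri(2)) (simp_all add: nz_add)
  finally have eq: "Top T 1 ?\<delta> * (A 1 2 * (Lop 2 ?u * Rb 1 2 (?\<delta> + ?u) b2)) = Rb 2 1 (?\<delta> + ?u) b1 * (Lop 2 ?u * (A 2 1 * Top T 1 ?\<delta>))" .
  show ?thesis
  proof (rule YEnd_teq[OF r, where as = "[Top T 1 ?\<delta>, A 1 2, Lop 2 ?u, Rb 1 2 (?\<delta> + ?u) b2]"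
        and bs = "[Rb 2 1 (?\<delta> + ?u) b1, Lop 2 ?u, A 2 1, Top T 1 ?\<delta>]"])
    show "app (prod_list [Top T 1 ?\<delta>, A 1 2, Lop 2 ?u, Rb 1 2 (?\<delta> + ?u) b2]) (sg K c)
        = app (prod_list [Rb 2 1 (?\<delta> + ?u) b1, Lop 2 ?u, A 2 1, Top T 1 ?\<delta>]) (sg K c)" for K c
      unfolding prod_list.Cons prod_list.Nil mult_1_right eq ..
  qed (simp_all add: o oR oA)
qed

end

theorem proposition5p2:
  fixes R :: "complex fps ^ ('n::finite \<times> 'n) ^ ('n \<times> 'n)"
    and M :: nat and a c :: complex
  assumes "CARD('n) \<ge> 2" and "M > 0" and "a \<noteq> 0"
    and "hecke_symmetry R" and "skew_invertible R"
  defines "S \<equiv> {1, 2}"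
    and "K \<equiv> YEnd M R"
    and "RP \<equiv> (\<lambda>r s. cleg (YEnd M R) {1, 2} r s (R ** Pmat))"
    and "Rb \<equiv> (\<lambda>r s b u v. sleg (YEnd M R) {1, 2} r s (Rbar M R) b u v)"
    and "Lplus \<equiv> LpY M R {1, 2}"
    and "Lminus \<equiv> (\<lambda>L. LmY M R L {1, 2})"
  shows "(\<exists>!L. is_Lminus M R (c / a) L) \<and>
    (\<forall>L. is_Lminus M R (c / a) L \<longrightarrow>
      Lop_invertible M R L \<and>
      teq S (tprod K S [Rb 1 2 1 1 2, Lminus L 1, RP 1 2, Lminus L 2])
            (tprod K S [Lminus L 2, RP 2 1, Lminus L 1, Rb 2 1 1 1 2]) \<and>
      teq S (tprod K S [Lminus L 1, RP 1 2, Lplus 2, Rb 1 2 (fps_exp (- (c / a))) 2 1])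
            (tprod K S [Rb 2 1 (fps_exp (c / a)) 2 1, Lplus 2, RP 2 1, Lminus L 1]))"
proof -
  obtain Psi where "hecke_data R Psi M" using hecke_data_ex assms(2,4,5) by blast
  then have "tdata R Psi M (fps_exp (c / a)) (fps_exp (- (c / a)))"
    by (intro tdata.intro tdata_axioms.intro) simp_all
  then interpret t: tdata R Psi M "fps_exp (c / a)" "fps_exp (- (c / a))" .
  obtain L0 where L0: "is_Lminus M R (c / a) L0" and lift: "lifted M R L0 t.T" using t.existence[OF refl refl] .
  have unique: "L = L0" if "is_Lminus M R (c / a) L" for L
    by (rule t.uniqueness[OF that L0 refl refl])
  have ex1: "\<exists>!L. is_Lminus M R (c / a) L" using L0 unique by blast
  \<comment> \<open>Every solution is \<open>L0\<close>, so the remaining claims are proved for it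
    alone, where T is available as a lift.\<close>
  have props: "Lop_invertible M R L0 \<and>
      teq S (tprod K S [Rb 1 2 1 1 2, Lminus L0 1, RP 1 2, Lminus L0 2])
            (tprod K S [Lminus L0 2, RP 2 1, Lminus L0 1, Rb 2 1 1 1 2]) \<and>
      teq S (tprod K S [Lminus L0 1, RP 1 2, Lplus 2, Rb 1 2 (fps_exp (- (c / a))) 2 1])
            (tprod K S [Rb 2 1 (fps_exp (c / a)) 2 1, Lplus 2, RP 2 1, Lminus L0 1])"
    unfolding S_def K_def RP_def Rb_def Lplus_def Lminus_def
    by (intro conjI t.invertible[OF lift] t.minus_minus_relation[OF lift] t.minus_plus_relation[OF lift])
  show ?thesis
  proof (intro conjI allI impI)
    show "\<exists>!L. is_Lminus M R (c / a) L" by (rule ex1)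
  qed (use unique props in blast)+
qed

end
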